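(* Let $k$ be a commutative ring with $2\in k^\times$, and let $A$ be a smooth commutative $k$-algebra with an involution $\theta$. Let $\mathbf{A}$ be the contraction algebra of $(A,\theta)$. Let $I\subset A$ be the ideal generated by $\{a\in A:\theta(a)=-a\}$. (1) There is a $k$-algebra isomorphism $\mathbf{A}/(t)\cong \mathrm{Sym}_{A/I}(I/I^2)$, where $\mathrm{Sym}_{A/I}(I/I^2)$ is the symmetric algebra over $A/I$ generated by $I/I^2$. (2) The structure homomorphism $k[t]\to\mathbf{A}$ is smooth. (3) If $A$ is a Hopf algebra over $k$ (and $\theta$ is an involution of the Hopf algebra $A$), then $\mathbf{A}$ is naturally equipped with the structure of a Hopf algebra over $k[t]$.
   Context: An involution of a commutative $k$-algebra (resp. commutative Hopf $k$-algebra) $A$ is a $k$-algebra (resp. Hopf $k$-algebra) automorphism $\theta$ with $\theta\circ\theta=\mathrm{id}_A$. Put $A^{\theta}=\{a\in A:\theta(a)=a\}$ and $A^{-\theta}=\{a\in A:\theta(a)=-a\}$. The contraction algebra $\mathbf{A}$ of $(A,\theta)$ is the $k[t]$-subalgebra of the Laurent polynomial ring $A[\sqrt{t}^{\pm1}]$ (in the variable $\sqrt t$, with $t=(\sqrt t)^2$) generated by $A^\theta$ and $\frac{1}{\sqrt t}A^{-\theta}$. The natural Hopf algebra structure in (3) is the one whose comultiplication, counit and antipode are the restrictions to $\mathbf{A}$ of those of the Hopf $k[\sqrt t^{\pm1}]$-algebra $A[\sqrt t^{\pm1}]=A\otimes_k k[\sqrt t^{\pm1}]$; here $\mathbf{A}\otimes_{k[t]}\mathbf{A}$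 is regarded as a subalgebra of $A[\sqrt t^{\pm1}]\otimes_{k[\sqrt t^{\pm1}]}A[\sqrt t^{\pm1}]$ via the canonical map. *)

theory Defs
  imports "HOL-Algebra.Algebra"
begin

section \<open>Algebras over a commutative ring\<close>

text \<open>
  A commutative \<open>R\<close>-algebra is a commutative ring \<open>A\<close> together with its structure homomorphism
  \<open>\<phi>: R \<rightarrow> A\<close>, that is, an instance of the locale \<^locale>\<open>ring_hom_cring\<close>.
\<close>

definition alg_hom ::
  "('r, 'm) ring_scheme \<Rightarrow> ('a, 'n) ring_scheme \<Rightarrow> ('r \<Rightarrow> 'a) \<Rightarrow>
   ('b, 'p) ring_scheme \<Rightarrow> ('r \<Rightarrow> 'b) \<Rightarrow> ('a \<Rightarrow> 'b) set"
  where "alg_hom R A \<phi> B \<psi> = {h \<in> ring_hom A B. \<forall>r \<in> carrier R. h (\<phi> r) = \<psi> r}"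

definition alg_iso ::
  "('r, 'm) ring_scheme \<Rightarrow> ('a, 'n) ring_scheme \<Rightarrow> ('r \<Rightarrow> 'a) \<Rightarrow>
   ('b, 'p) ring_scheme \<Rightarrow> ('r \<Rightarrow> 'b) \<Rightarrow> ('a \<Rightarrow> 'b) set"
  where "alg_iso R A \<phi> B \<psi> = alg_hom R A \<phi> B \<psi> \<inter> ring_iso A B"

definition alg_involution ::
  "('r, 'm) ring_scheme \<Rightarrow> ('a, 'n) ring_scheme \<Rightarrow> ('r \<Rightarrow> 'a) \<Rightarrow> ('a \<Rightarrow> 'a) \<Rightarrow> bool"
  where "alg_involution R A \<phi> \<theta> \<longleftrightarrow>
    \<theta> \<in> alg_iso R A \<phi> A \<phi> \<and> (\<forall>a \<in> carrier A. \<theta> (\<theta> a) = a)"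


section \<open>Monoid algebras\<close>

text \<open>
  The monoid algebra \<open>R[G]\<close>: finitely supported functions from \<open>G\<close> to \<open>R\<close> with convolution.
  Its instances below are Laurent polynomial rings (\<open>G = \<int>\<close>), polynomial rings (\<open>G\<close> a free
  commutative monoid), and the free \<open>R\<close>-module on \<open>B \<times> C\<close> that underlies \<open>B \<otimes>\<^sub>R C\<close>.
\<close>

definition monoid_algebra ::
  "('r, 'm) ring_scheme \<Rightarrow> ('g, 'n) monoid_scheme \<Rightarrow> ('g \<Rightarrow> 'r) ring"
  where "monoid_algebra R G =
    \<lparr>carrier = {f. (\<forall>x. f x \<in> carrier R) \<and> (\<forall>x. x \<notin> carrier G \<longrightarrow> f x = \<zero>\<^bsub>R\<^esub>) \<and>
                   finite {x. f x \<noteq> \<zero>\<^bsub>R\<^esub>}},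
     monoid.mult = (\<lambda>f g x. \<Oplus>\<^bsub>R\<^esub>z \<in> {(a, b). f a \<noteq> \<zero>\<^bsub>R\<^esub> \<and> g b \<noteq> \<zero>\<^bsub>R\<^esub> \<and> a \<otimes>\<^bsub>G\<^esub> b = x}.
                         f (fst z) \<otimes>\<^bsub>R\<^esub> g (snd z)),
     one = (\<lambda>x. if x = \<one>\<^bsub>G\<^esub> then \<one>\<^bsub>R\<^esub> else \<zero>\<^bsub>R\<^esub>),
     ring.zero = (\<lambda>x. \<zero>\<^bsub>R\<^esub>),
     add = (\<lambda>f g x. f x \<oplus>\<^bsub>R\<^esub> g x)\<rparr>"

definition single :: "('r, 'm) ring_scheme \<Rightarrow> 'r \<Rightarrow> 'g \<Rightarrow> 'g \<Rightarrow> 'r"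
  where "single R r g = (\<lambda>x. if x = g then r else \<zero>\<^bsub>R\<^esub>)"

definition free_cmonoid :: "'x set \<Rightarrow> 'x multiset monoid"
  where "free_cmonoid V = \<lparr>carrier = {M. set_mset M \<subseteq> V}, monoid.mult = (+), one = {#}\<rparr>"

text \<open>\<open>mpoly_ring R n\<close> is \<open>R[x\<^sub>0, \<dots>, x\<^sub>n\<^sub>-\<^sub>1]\<close>.\<close>

definition mpoly_ring :: "('r, 'm) ring_scheme \<Rightarrow> nat \<Rightarrow> (nat multiset \<Rightarrow> 'r) ring"
  where "mpoly_ring R n = monoid_algebra R (free_cmonoid {..<n})"


section \<open>Smoothness\<close>

definition finitely_presented ::
  "('r, 'm) ring_scheme \<Rightarrow> ('a, 'n) ring_scheme \<Rightarrow> ('r \<Rightarrow> 'a) \<Rightarrow> bool"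
  where "finitely_presented R A \<phi> \<longleftrightarrow>
    (\<exists>n F. \<exists>\<pi> \<in> alg_hom R (mpoly_ring R n) (\<lambda>r. single R r {#}) A \<phi>.
       \<pi> ` carrier (mpoly_ring R n) = carrier A \<and>
       finite F \<and> F \<subseteq> carrier (mpoly_ring R n) \<and>
       a_kernel (mpoly_ring R n) A \<pi> = Idl\<^bsub>mpoly_ring R n\<^esub> F)"

text \<open>
  The infinitesimal lifting property. HOL cannot quantify over all types, so the type \<open>'c\<close> carrying
  the test algebras \<open>C\<close> is a parameter. For a finitely presented algebra \<open>P / J\<close> with
  \<open>P = R[x\<^sub>0, \<dots>, x\<^sub>n\<^sub>-\<^sub>1]\<close>, the lifting property for all \<open>C\<close> already follows from the single test
  algebra \<open>P / J\<^sup>2\<close>, whose carrier lives in the type \<open>(nat multiset \<Rightarrow> 'r) set\<close>.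
\<close>

definition formally_smooth ::
  "'c itself \<Rightarrow> ('r, 'm) ring_scheme \<Rightarrow> ('a, 'n) ring_scheme \<Rightarrow> ('r \<Rightarrow> 'a) \<Rightarrow> bool"
  where "formally_smooth _ R A \<phi> \<longleftrightarrow>
    (\<forall>(C :: 'c ring) \<psi> J u.
       ring_hom_cring R C \<psi> \<and> ideal J C \<and> (\<forall>x \<in> J. \<forall>y \<in> J. x \<otimes>\<^bsub>C\<^esub> y = \<zero>\<^bsub>C\<^esub>) \<and>
       u \<in> alg_hom R A \<phi> (C Quot J) (\<lambda>r. J +>\<^bsub>C\<^esub> \<psi> r) \<longrightarrow>
       (\<exists>v \<in> alg_hom R A \<phi> C \<psi>. \<forall>a \<in> carrier A. J +>\<^bsub>C\<^esub> v a = u a))"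

definition smooth ::
  "'c itself \<Rightarrow> ('r, 'm) ring_scheme \<Rightarrow> ('a, 'n) ring_scheme \<Rightarrow> ('r \<Rightarrow> 'a) \<Rightarrow> bool"
  where "smooth T R A \<phi> \<longleftrightarrow>
    ring_hom_cring R A \<phi> \<and> finitely_presented R A \<phi> \<and> formally_smooth T R A \<phi>"


section \<open>Symmetric algebras and the conormal module\<close>

text \<open>
  \<open>Sym\<^sub>R(M)\<close> is the free commutative \<open>R\<close>-algebra on the set \<open>M\<close> modulo the ideal expressing that
  \<open>M \<rightarrow> Sym\<^sub>R(M)\<close> is \<open>R\<close>-linear.
\<close>

definition sym_free :: "('r, 'm) ring_scheme \<Rightarrow> ('r, 'x, 'n) module_scheme \<Rightarrow> ('x multiset \<Rightarrow> 'r) ring"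
  where "sym_free R M = monoid_algebra R (free_cmonoid (carrier M))"

definition sym_ideal :: "('r, 'm) ring_scheme \<Rightarrow> ('r, 'x, 'n) module_scheme \<Rightarrow> ('x multiset \<Rightarrow> 'r) set"
  where "sym_ideal R M = Idl\<^bsub>sym_free R M\<^esub>
    ({single R \<one>\<^bsub>R\<^esub> {#x \<oplus>\<^bsub>M\<^esub> y#} \<ominus>\<^bsub>sym_free R M\<^esub>
        (single R \<one>\<^bsub>R\<^esub> {#x#} \<oplus>\<^bsub>sym_free R M\<^esub> single R \<one>\<^bsub>R\<^esub> {#y#}) | x y.
        x \<in> carrier M \<and> y \<in> carrier M} \<union>
     {single R \<one>\<^bsub>R\<^esub> {#r \<odot>\<^bsub>M\<^esub> x#} \<ominus>\<^bsub>sym_free R M\<^esub> single R r {#x#} | r x.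
        r \<in> carrier R \<and> x \<in> carrier M})"

definition sym_alg ::
  "('r, 'm) ring_scheme \<Rightarrow> ('r, 'x, 'n) module_scheme \<Rightarrow> ('x multiset \<Rightarrow> 'r) set ring"
  where "sym_alg R M = sym_free R M Quot sym_ideal R M"

definition sym_str ::
  "('r, 'm) ring_scheme \<Rightarrow> ('r, 'x, 'n) module_scheme \<Rightarrow> 'r \<Rightarrow> ('x multiset \<Rightarrow> 'r) set"
  where "sym_str R M r = sym_ideal R M +>\<^bsub>sym_free R M\<^esub> single R r {#}"

text \<open>
  The \<open>A/I\<close>-module \<open>I/I\<^sup>2\<close>. The scalar product of \<open>a + I\<close> and \<open>x + I\<^sup>2\<close> (with \<open>x \<in> I\<close>) is the union
  of the cosets \<open>a'x' + I\<^sup>2\<close> over all representatives, which all coincide. The fields \<open>mult\<close> and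
  \<open>one\<close> are required by the record type and play no role for a module.
\<close>

definition conormal_module :: "('a, 'm) ring_scheme \<Rightarrow> 'a set \<Rightarrow> ('a set, 'a set) module"
  where "conormal_module A I =
    \<lparr>carrier = (\<lambda>x. (I \<cdot>\<^bsub>A\<^esub> I) +>\<^bsub>A\<^esub> x) ` I,
     monoid.mult = rcoset_mult A (I \<cdot>\<^bsub>A\<^esub> I),
     one = (I \<cdot>\<^bsub>A\<^esub> I) +>\<^bsub>A\<^esub> \<one>\<^bsub>A\<^esub>,
     ring.zero = I \<cdot>\<^bsub>A\<^esub> I,
     add = set_add A,
     smult = rcoset_mult A (I \<cdot>\<^bsub>A\<^esub> I)\<rparr>"


section \<open>Tensor products of commutative algebras\<close>

text \<open>
  \<open>B \<otimes>\<^sub>R C\<close> is the free \<open>R\<close>-module on \<open>B \<times> C\<close> modulo the bilinearity relations. With the product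
  \<open>(b, c)(b', c') = (bb', cc')\<close> on basis elements the free module is the monoid algebra of
  \<open>B \<times> C\<close>; the relations are stable under multiplication by basis elements, so the ideal they
  generate is the submodule they span.
\<close>

definition tensor_free ::
  "('r, 'm) ring_scheme \<Rightarrow> ('b, 'n) ring_scheme \<Rightarrow> ('c, 'p) ring_scheme \<Rightarrow> ('b \<times> 'c \<Rightarrow> 'r) ring"
  where "tensor_free R B C = monoid_algebra R (B \<times>\<times> C)"

definition tensor_ideal ::
  "('r, 'm) ring_scheme \<Rightarrow> ('b, 'n) ring_scheme \<Rightarrow> ('r \<Rightarrow> 'b) \<Rightarrow>
   ('c, 'p) ring_scheme \<Rightarrow> ('r \<Rightarrow> 'c) \<Rightarrow> ('b \<times> 'c \<Rightarrow> 'r) set"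
  where "tensor_ideal R B \<phi> C \<psi> = (let P = tensor_free R B C; e = single R \<one>\<^bsub>R\<^esub> in Idl\<^bsub>P\<^esub>
    ({e (b \<oplus>\<^bsub>B\<^esub> b', c) \<ominus>\<^bsub>P\<^esub> (e (b, c) \<oplus>\<^bsub>P\<^esub> e (b', c)) | b b' c.
        b \<in> carrier B \<and> b' \<in> carrier B \<and> c \<in> carrier C} \<union>
     {e (b, c \<oplus>\<^bsub>C\<^esub> c') \<ominus>\<^bsub>P\<^esub> (e (b, c) \<oplus>\<^bsub>P\<^esub> e (b, c')) | b c c'.
        b \<in> carrier B \<and> c \<in> carrier C \<and> c' \<in> carrier C} \<union>
     {e (\<phi> r \<otimes>\<^bsub>B\<^esub> b, c) \<ominus>\<^bsub>P\<^esub> single R r (b, c) | r b c.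
        r \<in> carrier R \<and> b \<in> carrier B \<and> c \<in> carrier C} \<union>
     {e (b, \<psi> r \<otimes>\<^bsub>C\<^esub> c) \<ominus>\<^bsub>P\<^esub> single R r (b, c) | r b c.
        r \<in> carrier R \<and> b \<in> carrier B \<and> c \<in> carrier C}))"

definition tensor ::
  "('r, 'm) ring_scheme \<Rightarrow> ('b, 'n) ring_scheme \<Rightarrow> ('r \<Rightarrow> 'b) \<Rightarrow>
   ('c, 'p) ring_scheme \<Rightarrow> ('r \<Rightarrow> 'c) \<Rightarrow> ('b \<times> 'c \<Rightarrow> 'r) set ring"
  where "tensor R B \<phi> C \<psi> = tensor_free R B C Quot tensor_ideal R B \<phi> C \<psi>"

definition tensor_str ::
  "('r, 'm) ring_scheme \<Rightarrow> ('b, 'n) ring_scheme \<Rightarrow> ('r \<Rightarrow> 'b) \<Rightarrow>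
   ('c, 'p) ring_scheme \<Rightarrow> ('r \<Rightarrow> 'c) \<Rightarrow> 'r \<Rightarrow> ('b \<times> 'c \<Rightarrow> 'r) set"
  where "tensor_str R B \<phi> C \<psi> r =
    tensor_ideal R B \<phi> C \<psi> +>\<^bsub>tensor_free R B C\<^esub> single R r (\<one>\<^bsub>B\<^esub>, \<one>\<^bsub>C\<^esub>)"

definition pure_tensor ::
  "('r, 'm) ring_scheme \<Rightarrow> ('b, 'n) ring_scheme \<Rightarrow> ('r \<Rightarrow> 'b) \<Rightarrow>
   ('c, 'p) ring_scheme \<Rightarrow> ('r \<Rightarrow> 'c) \<Rightarrow> 'b \<Rightarrow> 'c \<Rightarrow> ('b \<times> 'c \<Rightarrow> 'r) set"
  where "pure_tensor R B \<phi> C \<psi> b c =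
    tensor_ideal R B \<phi> C \<psi> +>\<^bsub>tensor_free R B C\<^esub> single R \<one>\<^bsub>R\<^esub> (b, c)"

text \<open>
  The map \<open>B \<otimes>\<^sub>R C \<rightarrow> D\<close>, \<open>b \<otimes> c \<mapsto> f(b) g(c)\<close>, where \<open>\<chi>\<close> is a homomorphism from \<open>R\<close> to \<open>D\<close>. It is given
  by a formula on the free module, whose value is the same on all representatives of a class when
  \<open>f\<close> and \<open>g\<close> are additive and \<open>\<chi>\<close>-linear.
\<close>

definition tensor_lift ::
  "('r, 'm) ring_scheme \<Rightarrow> ('d, 'n) ring_scheme \<Rightarrow> ('r \<Rightarrow> 'd) \<Rightarrow>
   ('b \<Rightarrow> 'd) \<Rightarrow> ('c \<Rightarrow> 'd) \<Rightarrow> ('b \<times> 'c \<Rightarrow> 'r) set \<Rightarrow> 'd"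
  where "tensor_lift R D \<chi> f g Z = the_elem
    ((\<lambda>p. \<Oplus>\<^bsub>D\<^esub>z \<in> {z. p z \<noteq> \<zero>\<^bsub>R\<^esub>}. \<chi> (p z) \<otimes>\<^bsub>D\<^esub> (f (fst z) \<otimes>\<^bsub>D\<^esub> g (snd z))) ` Z)"

text \<open>The map \<open>f \<otimes> g\<close> with values in \<open>B \<otimes>\<^sub>R C\<close>.\<close>

definition tensor_map ::
  "('r, 'm) ring_scheme \<Rightarrow> ('b, 'n) ring_scheme \<Rightarrow> ('r \<Rightarrow> 'b) \<Rightarrow>
   ('c, 'p) ring_scheme \<Rightarrow> ('r \<Rightarrow> 'c) \<Rightarrow> ('x \<Rightarrow> 'b) \<Rightarrow> ('y \<Rightarrow> 'c) \<Rightarrow>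
   ('x \<times> 'y \<Rightarrow> 'r) set \<Rightarrow> ('b \<times> 'c \<Rightarrow> 'r) set"
  where "tensor_map R B \<phi> C \<psi> f g =
    tensor_lift R (tensor R B \<phi> C \<psi>) (tensor_str R B \<phi> C \<psi>)
      (\<lambda>x. pure_tensor R B \<phi> C \<psi> (f x) \<one>\<^bsub>C\<^esub>) (\<lambda>y. pure_tensor R B \<phi> C \<psi> \<one>\<^bsub>B\<^esub> (g y))"

text \<open>The isomorphism \<open>(B \<otimes>\<^sub>R B) \<otimes>\<^sub>R B \<rightarrow> B \<otimes>\<^sub>R (B \<otimes>\<^sub>R B)\<close>, \<open>(b \<otimes> b') \<otimes> b'' \<mapsto> b \<otimes> (b' \<otimes> b'')\<close>.\<close>

definition tensor_assoc ::
  "('r, 'm) ring_scheme \<Rightarrow> ('b, 'n) ring_scheme \<Rightarrow> ('r \<Rightarrow> 'b) \<Rightarrow>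
   (('b \<times> 'b \<Rightarrow> 'r) set \<times> 'b \<Rightarrow> 'r) set \<Rightarrow> ('b \<times> ('b \<times> 'b \<Rightarrow> 'r) set \<Rightarrow> 'r) set"
  where "tensor_assoc R B \<phi> =
    (let T = tensor R B \<phi> B \<phi>; \<tau> = tensor_str R B \<phi> B \<phi>; p = pure_tensor R B \<phi> B \<phi>;
         T3 = tensor R B \<phi> T \<tau>; \<tau>3 = tensor_str R B \<phi> T \<tau>; p3 = pure_tensor R B \<phi> T \<tau>
     in tensor_lift R T3 \<tau>3
          (tensor_lift R T3 \<tau>3 (\<lambda>b. p3 b \<one>\<^bsub>T\<^esub>) (\<lambda>b. p3 \<one>\<^bsub>B\<^esub> (p b \<one>\<^bsub>B\<^esub>)))
          (\<lambda>b. p3 \<one>\<^bsub>B\<^esub> (p \<one>\<^bsub>B\<^esub> b)))"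


section \<open>Commutative Hopf algebras\<close>

text \<open>
  Comultiplication, counit and antipode of a commutative Hopf algebra are algebra homomorphisms.
  The counit and antipode axioms are stated after composing with multiplication
  \<open>B \<otimes>\<^sub>R B \<rightarrow> B\<close>: \<open>(\<eta>\<epsilon> \<cdot> id) \<circ> \<Delta> = id = (id \<cdot> \<eta>\<epsilon>) \<circ> \<Delta>\<close> and
  \<open>(S \<cdot> id) \<circ> \<Delta> = \<eta>\<epsilon> = (id \<cdot> S) \<circ> \<Delta>\<close>, with \<open>\<eta> = \<phi>\<close> the unit.
\<close>

definition hopf_algebra ::
  "('r, 'm) ring_scheme \<Rightarrow> ('b, 'n) ring_scheme \<Rightarrow> ('r \<Rightarrow> 'b) \<Rightarrow>
   ('b \<Rightarrow> ('b \<times> 'b \<Rightarrow> 'r) set) \<Rightarrow> ('b \<Rightarrow> 'r) \<Rightarrow> ('b \<Rightarrow> 'b) \<Rightarrow> bool"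
  where "hopf_algebra R B \<phi> \<Delta> \<epsilon> S \<longleftrightarrow>
    (let T = tensor R B \<phi> B \<phi>; \<tau> = tensor_str R B \<phi> B \<phi> in
       ring_hom_cring R B \<phi> \<and>
       \<Delta> \<in> alg_hom R B \<phi> T \<tau> \<and>
       \<epsilon> \<in> alg_hom R B \<phi> R id \<and>
       S \<in> alg_hom R B \<phi> B \<phi> \<and>
       (\<forall>b \<in> carrier B.
          tensor_assoc R B \<phi> (tensor_map R T \<tau> B \<phi> \<Delta> id (\<Delta> b)) =
            tensor_map R B \<phi> T \<tau> id \<Delta> (\<Delta> b) \<and>
          tensor_lift R B \<phi> (\<phi> \<circ> \<epsilon>) id (\<Delta> b) = b \<and>
          tensor_lift R B \<phi> id (\<phi> \<circ> \<epsilon>) (\<Delta> b) = b \<and>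
          tensor_lift R B \<phi> S id (\<Delta> b) = \<phi> (\<epsilon> b) \<and>
          tensor_lift R B \<phi> id S (\<Delta> b) = \<phi> (\<epsilon> b)))"

definition hopf_involution ::
  "('r, 'm) ring_scheme \<Rightarrow> ('b, 'n) ring_scheme \<Rightarrow> ('r \<Rightarrow> 'b) \<Rightarrow>
   ('b \<Rightarrow> ('b \<times> 'b \<Rightarrow> 'r) set) \<Rightarrow> ('b \<Rightarrow> 'r) \<Rightarrow> ('b \<Rightarrow> 'b) \<Rightarrow> ('b \<Rightarrow> 'b) \<Rightarrow> bool"
  where "hopf_involution R B \<phi> \<Delta> \<epsilon> S \<theta> \<longleftrightarrow>
    alg_involution R B \<phi> \<theta> \<and>
    (\<forall>b \<in> carrier B.
       \<Delta> (\<theta> b) = tensor_map R B \<phi> B \<phi> \<theta> \<theta> (\<Delta> b) \<and> \<epsilon> (\<theta> b) = \<epsilon> b \<and> S (\<theta> b) = \<theta> (S b))"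


section \<open>Laurent polynomials and the contraction algebra\<close>

text \<open>
  \<open>laurent A\<close> is \<open>A[\<surd>t\<^sup>\<plusminus>\<^sup>1]\<close>; the exponent \<open>n\<close> in \<^term>\<open>single A a (n :: int)\<close> is that of
  \<open>\<surd>t\<close>, so that \<open>t\<close> has exponent 2.
\<close>

definition laurent :: "('a, 'm) ring_scheme \<Rightarrow> (int \<Rightarrow> 'a) ring"
  where "laurent A = monoid_algebra A integer_group"

definition laurent_t :: "('a, 'm) ring_scheme \<Rightarrow> int \<Rightarrow> 'a"
  where "laurent_t A = single A \<one>\<^bsub>A\<^esub> 2"

text \<open>The structure homomorphism \<open>k[t] \<rightarrow> A[\<surd>t\<^sup>\<plusminus>\<^sup>1]\<close>.\<close>

definition laurent_str ::
  "('k, 'm) ring_scheme \<Rightarrow> ('a, 'n) ring_scheme \<Rightarrow> ('k \<Rightarrow> 'a) \<Rightarrow> (nat \<Rightarrow> 'k) \<Rightarrow> int \<Rightarrow> 'a"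
  where "laurent_str k A \<phi> = eval k (laurent A) (\<lambda>c. single A (\<phi> c) 0) (laurent_t A)"

definition fixed_part :: "('a, 'm) ring_scheme \<Rightarrow> ('a \<Rightarrow> 'a) \<Rightarrow> 'a set"
  where "fixed_part A \<theta> = {a \<in> carrier A. \<theta> a = a}"

definition anti_part :: "('a, 'm) ring_scheme \<Rightarrow> ('a \<Rightarrow> 'a) \<Rightarrow> 'a set"
  where "anti_part A \<theta> = {a \<in> carrier A. \<theta> a = \<ominus>\<^bsub>A\<^esub> a}"

definition contraction ::
  "('k, 'm) ring_scheme \<Rightarrow> ('a, 'n) ring_scheme \<Rightarrow> ('k \<Rightarrow> 'a) \<Rightarrow> ('a \<Rightarrow> 'a) \<Rightarrow> (int \<Rightarrow> 'a) ring"
  where "contraction k A \<phi> \<theta> = (laurent A)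
    \<lparr>carrier := generate_ring (laurent A)
       (laurent_str k A \<phi> ` carrier (UP k) \<union>
        (\<lambda>a. single A a 0) ` fixed_part A \<theta> \<union>
        (\<lambda>a. single A a (- 1)) ` anti_part A \<theta>)\<rparr>"


section \<open>The Hopf algebra of Laurent polynomials\<close>

text \<open>
  The base change \<open>A[\<surd>t\<^sup>\<plusminus>\<^sup>1] = A \<otimes>\<^sub>k k[\<surd>t\<^sup>\<plusminus>\<^sup>1]\<close> of a Hopf \<open>k\<close>-algebra \<open>A\<close>.
\<close>

definition laurent_map :: "('a \<Rightarrow> 'b) \<Rightarrow> (int \<Rightarrow> 'a) \<Rightarrow> int \<Rightarrow> 'b"
  where "laurent_map f x = (\<lambda>n. f (x n))"

text \<open>The \<open>k[\<surd>t\<^sup>\<plusminus>\<^sup>1]\<close>-algebra \<open>A[\<surd>t\<^sup>\<plusminus>\<^sup>1] \<otimes> A[\<surd>t\<^sup>\<plusminus>\<^sup>1]\<close>, the target of the comultiplication.\<close>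

definition laurent_tensor ::
  "('k, 'm) ring_scheme \<Rightarrow> ('a, 'n) ring_scheme \<Rightarrow> ('k \<Rightarrow> 'a) \<Rightarrow>
   ((int \<Rightarrow> 'a) \<times> (int \<Rightarrow> 'a) \<Rightarrow> int \<Rightarrow> 'k) set ring"
  where "laurent_tensor k A \<phi> =
    tensor (laurent k) (laurent A) (laurent_map \<phi>) (laurent A) (laurent_map \<phi>)"

definition laurent_tensor_str ::
  "('k, 'm) ring_scheme \<Rightarrow> ('a, 'n) ring_scheme \<Rightarrow> ('k \<Rightarrow> 'a) \<Rightarrow> (int \<Rightarrow> 'k) \<Rightarrow>
   ((int \<Rightarrow> 'a) \<times> (int \<Rightarrow> 'a) \<Rightarrow> int \<Rightarrow> 'k) set"
  where "laurent_tensor_str k A \<phi> =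
    tensor_str (laurent k) (laurent A) (laurent_map \<phi>) (laurent A) (laurent_map \<phi>)"

definition laurent_pure_tensor ::
  "('k, 'm) ring_scheme \<Rightarrow> ('a, 'n) ring_scheme \<Rightarrow> ('k \<Rightarrow> 'a) \<Rightarrow> (int \<Rightarrow> 'a) \<Rightarrow> (int \<Rightarrow> 'a) \<Rightarrow>
   ((int \<Rightarrow> 'a) \<times> (int \<Rightarrow> 'a) \<Rightarrow> int \<Rightarrow> 'k) set"
  where "laurent_pure_tensor k A \<phi> =
    pure_tensor (laurent k) (laurent A) (laurent_map \<phi>) (laurent A) (laurent_map \<phi>)"

text \<open>
  The \<open>k[\<surd>t\<^sup>\<plusminus>\<^sup>1]\<close>-linear extension of \<open>\<Delta>\<close>: \<open>\<Sum> a\<^sub>n \<surd>t\<^sup>n \<mapsto> \<Sum> \<surd>t\<^sup>n \<Delta>(a\<^sub>n)\<close>, where \<open>\<Delta>(a\<^sub>n)\<close> is mapped along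
  the canonical map \<open>A \<otimes>\<^sub>k A \<rightarrow> A[\<surd>t\<^sup>\<plusminus>\<^sup>1] \<otimes> A[\<surd>t\<^sup>\<plusminus>\<^sup>1]\<close>.
\<close>

definition laurent_comult ::
  "('k, 'm) ring_scheme \<Rightarrow> ('a, 'n) ring_scheme \<Rightarrow> ('k \<Rightarrow> 'a) \<Rightarrow> ('a \<Rightarrow> ('a \<times> 'a \<Rightarrow> 'k) set) \<Rightarrow>
   (int \<Rightarrow> 'a) \<Rightarrow> ((int \<Rightarrow> 'a) \<times> (int \<Rightarrow> 'a) \<Rightarrow> int \<Rightarrow> 'k) set"
  where "laurent_comult k A \<phi> \<Delta> x =
    (let T = laurent_tensor k A \<phi>; \<tau> = laurent_tensor_str k A \<phi>; p = laurent_pure_tensor k A \<phi>;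
         can = tensor_lift k T (\<lambda>c. \<tau> (single k c 0))
                 (\<lambda>a. p (single A a 0) \<one>\<^bsub>laurent A\<^esub>) (\<lambda>a. p \<one>\<^bsub>laurent A\<^esub> (single A a 0))
     in \<Oplus>\<^bsub>T\<^esub>n \<in> {n. x n \<noteq> \<zero>\<^bsub>A\<^esub>}. \<tau> (single k \<one>\<^bsub>k\<^esub> n) \<otimes>\<^bsub>T\<^esub> can (\<Delta> (x n)))"

text \<open>
  The canonical map \<open>\<^bold>A \<otimes>\<^bsub>k[t]\<^esub> \<^bold>A \<rightarrow> A[\<surd>t\<^sup>\<plusminus>\<^sup>1] \<otimes> A[\<surd>t\<^sup>\<plusminus>\<^sup>1]\<close> (over \<open>k[\<surd>t\<^sup>\<plusminus>\<^sup>1]\<close> on the right), \<open>x \<otimes> y \<mapsto> x \<otimes> y\<close>.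
  On scalars it is \<open>k[t] \<rightarrow> k[\<surd>t\<^sup>\<plusminus>\<^sup>1]\<close>, which is \<^term>\<open>laurent_str k k id\<close>.
\<close>

definition contraction_tensor_can ::
  "('k, 'm) ring_scheme \<Rightarrow> ('a, 'n) ring_scheme \<Rightarrow> ('k \<Rightarrow> 'a) \<Rightarrow>
   ((int \<Rightarrow> 'a) \<times> (int \<Rightarrow> 'a) \<Rightarrow> nat \<Rightarrow> 'k) set \<Rightarrow>
   ((int \<Rightarrow> 'a) \<times> (int \<Rightarrow> 'a) \<Rightarrow> int \<Rightarrow> 'k) set"
  where "contraction_tensor_can k A \<phi> =
    tensor_lift (UP k) (laurent_tensor k A \<phi>) (\<lambda>p. laurent_tensor_str k A \<phi> (laurent_str k k id p))
      (\<lambda>x. laurent_pure_tensor k A \<phi> x \<one>\<^bsub>laurent A\<^esub>)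
      (\<lambda>x. laurent_pure_tensor k A \<phi> \<one>\<^bsub>laurent A\<^esub> x)"

end

theory Submission
  imports Defs
begin

text \<open>
  Put \<open>C[\<surd>t] = C[s]/(s\<^sup>2 - t)\<close> for a \<open>k[t]\<close>-algebra \<open>C\<close>. The contraction represents the functor that sends \<open>C\<close>
  to the set of \<open>k\<close>-algebra homomorphisms \<open>A \<rightarrow> C[\<surd>t]\<close> equivariant for \<open>\<theta>\<close> and \<open>\<surd>t \<mapsto> -\<surd>t\<close>. That functor is
  represented by some finitely presented algebra \<open>B\<close>, and \<open>B\<close> is formally smooth: \<open>A\<close> is smooth, so a point
  lifts along a square-zero ideal to a homomorphism, and averaging with its conjugate makes the lift
  equivariant, as 2 is invertible. Smooth algebras preserve nonzerodivisors, so \<open>t\<close> is one on \<open>B\<close> and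
  \<open>B \<subseteq> B[1/\<surd>t]\<close>; there the universal point factors over \<open>A[\<surd>t\<^sup>\<plusminus>\<^sup>1]\<close>, and so the surjection from \<open>B\<close> to the
  contraction is injective. For \<open>t = 0\<close> a point is a homomorphism \<open>A/I \<rightarrow> C\<close> together with a linear map
  \<open>I/I\<^sup>2 \<rightarrow> C\<close>, hence (1). For a Hopf algebra \<open>A\<close> the points form a group under convolution, hence (3).
  Without noetherian hypotheses on \<open>k\<close>, preservation of nonzerodivisors is reduced to a finitely
  generated subring, where Hilbert's basis theorem and Krull's argument apply.
\<close>

section \<open>Homomorphisms, quotients and factorisations\<close>

text \<open>The contraction is given as a subring of \<open>laurent A\<close>, so homomorphisms into
  it are easy and homomorphisms out of it are not; all three claims ask for the latter. The
  presented algebra has the opposite nature: maps out of it are explicit, but nothing in its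
  relations excludes t-torsion. That t is a unit on one side and a nonzerodivisor on the other is
  what identifies the two. The usual reason for the latter is flatness of smooth algebras. Here,
  with A = P/J, a section of P/J^2 -> A yields an endomorphism \<open>N\<close> of P that is
  congruent to the identity modulo J and sends J into J^2. If t b lies in J, its iterates under
  \<open>N\<close> lie in ever higher powers of J, while b keeps its class modulo J. Finitely many
  constants express what \<open>N\<close> does to variables and relations, which permits the passage
  to a noetherian subring. The same \<open>N\<close> survives base change, so t is a nonzerodivisor
  on the tensor square of the contraction too; this makes the tensor square a subalgebra of its
  Laurent counterpart, as the Hopf statement requires.\<close>

lemma ring_hom_a_inv:
  assumes "h \<in> ring_hom R S" "ring R" "ring S" "x \<in> carrier R"
  shows "h (\<ominus>\<^bsub>R\<^esub> x) = \<ominus>\<^bsub>S\<^esub> h x"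
proof -
  interpret ring_hom_ring R S h
    using assms by (simp add: ring_hom_ring.intro ring_hom_ring_axioms.intro)
  show ?thesis using assms(4) by simp
qed

lemma ring_hom_minus:
  assumes "h \<in> ring_hom R S" "ring R" "ring S" "x \<in> carrier R" "y \<in> carrier R"
  shows "h (x \<ominus>\<^bsub>R\<^esub> y) = h x \<ominus>\<^bsub>S\<^esub> h y"
proof -
  interpret R: ring R by fact
  show ?thesis
    using assms by (simp add: a_minus_def ring_hom_add ring_hom_a_inv)
qed

lemma ring_hom_comp: "f \<in> ring_hom R S \<Longrightarrow> g \<in> ring_hom S T \<Longrightarrow> (\<lambda>x. g (f x)) \<in> ring_hom R T"
  by (auto simp: ring_hom_def Pi_def)

lemma ring_hom_cong:
  assumes "f \<in> ring_hom R S" "\<And>x. x \<in> carrier R \<Longrightarrow> g x = f x" "ring R"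
  shows "g \<in> ring_hom R S"
proof -
  interpret R: ring R by fact
  show ?thesis using assms(1,2) by (auto simp: ring_hom_def Pi_def)
qed

lemma ring_hom_eq_iff_minus:
  assumes "h \<in> ring_hom R S" "ring R" "ring S" "x \<in> carrier R" "y \<in> carrier R"
  shows "h x = h y \<longleftrightarrow> h (x \<ominus>\<^bsub>R\<^esub> y) = \<zero>\<^bsub>S\<^esub>"
proof -
  interpret S: ring S by fact
  have "h x \<in> carrier S" "h y \<in> carrier S"
    using assms by (auto simp: ring_hom_closed)
  then show ?thesis
    using assms by (simp add: ring_hom_minus)
qed

lemma subring_equalizer:
  assumes "f \<in> ring_hom R S" "g \<in> ring_hom R S" "ring R" "ring S"
  shows "subring {x \<in> carrier R. f x = g x} R"
proof -
  interpret R: ring R by fact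
  show ?thesis
    by (rule R.subringI)
      (use assms in \<open>auto simp: ring_hom_add ring_hom_mult ring_hom_one ring_hom_a_inv\<close>)
qed

lemma ring_hom_image_subring:
  assumes "h \<in> ring_hom R S" "ring R" "ring S"
  shows "subring (h ` carrier R) S"
proof -
  interpret ring_hom_ring R S h
    using assms by (simp add: ring_hom_ring.intro ring_hom_ring_axioms.intro)
  show ?thesis using img_is_subring[OF R.carrier_is_subring] .
qed

lemma ideal_kernel:
  assumes "h \<in> ring_hom R S" "ring R" "ring S"
  shows "ideal {x \<in> carrier R. h x = \<zero>\<^bsub>S\<^esub>} R"
proof -
  interpret ring_hom_ring R S h
    using assms by (simp add: ring_hom_ring.intro ring_hom_ring_axioms.intro)
  show ?thesis using kernel_is_ideal unfolding a_kernel_def' .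
qed

lemma genideal_kernel:
  assumes "h \<in> ring_hom R S" "ring R" "ring S" "F \<subseteq> carrier R"
    and "\<And>x. x \<in> F \<Longrightarrow> h x = \<zero>\<^bsub>S\<^esub>" and "x \<in> Idl\<^bsub>R\<^esub> F"
  shows "h x = \<zero>\<^bsub>S\<^esub>"
proof -
  interpret ring R by fact
  have "Idl\<^bsub>R\<^esub> F \<subseteq> {x \<in> carrier R. h x = \<zero>\<^bsub>S\<^esub>}"
    by (rule genideal_minimal[OF ideal_kernel[OF assms(1-3)]]) (use assms in auto)
  with assms show ?thesis by auto
qed

text \<open>This is the first isomorphism theorem for a surjection \<open>p\<close> onto a ring that
  need not be a literal quotient. It is applied to presentations \<open>\<pi>\<close> and to the
  surjection from the presented algebra onto the contraction.\<close>

lemma hom_factor: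
  assumes p: "p \<in> ring_hom P A" and surj: "p ` carrier P = carrier A"
    and f: "f \<in> ring_hom P S" and ker: "\<And>x. x \<in> carrier P \<Longrightarrow> p x = \<zero>\<^bsub>A\<^esub> \<Longrightarrow> f x = \<zero>\<^bsub>S\<^esub>"
    and rings: "ring P" "ring A" "ring S"
  obtains g where "g \<in> ring_hom A S" "\<And>x. x \<in> carrier P \<Longrightarrow> g (p x) = f x"
proof -
  interpret P: ring P by fact
  interpret A: ring A by fact
  define g where "g a = f (SOME x. x \<in> carrier P \<and> p x = a)" for a
  have eq: "f x = f y" if "x \<in> carrier P" "y \<in> carrier P" "p x = p y" for x y
    using that ker[of "x \<ominus>\<^bsub>P\<^esub> y"] ring_hom_eq_iff_minus[OF p rings(1,2)]
      ring_hom_eq_iff_minus[OF f rings(1,3)] by auto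
  have g: "g (p x) = f x" if "x \<in> carrier P" for x
  proof -
    have "(SOME y. y \<in> carrier P \<and> p y = p x) \<in> carrier P \<and> p (SOME y. y \<in> carrier P \<and> p y = p x) = p x"
      by (rule someI[of _ x]) (use that in auto)
    then show ?thesis unfolding g_def using eq that by blast
  qed
  have "g \<in> ring_hom A S"
  proof (rule ring_hom_memI)
    fix x assume "x \<in> carrier A"
    then obtain x' where "x' \<in> carrier P" "x = p x'" using surj by auto
    then show "g x \<in> carrier S" using g f by (simp add: ring_hom_closed)
  next
    fix x y assume "x \<in> carrier A" "y \<in> carrier A"
    then obtain x' y' where xy: "x' \<in> carrier P" "x = p x'" "y' \<in> carrier P" "y = p y'"
      using surj by (metis imageE)
    have "x \<otimes>\<^bsub>A\<^esub> y = p (x' \<otimes>\<^bsub>P\<^esub> y')" "x \<oplus>\<^bsub>A\<^esub> y = p (x' \<oplus>\<^bsub>P\<^esub> y')"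
      using xy p by (auto simp: ring_hom_mult ring_hom_add)
    then show "g (x \<otimes>\<^bsub>A\<^esub> y) = g x \<otimes>\<^bsub>S\<^esub> g y" "g (x \<oplus>\<^bsub>A\<^esub> y) = g x \<oplus>\<^bsub>S\<^esub> g y"
      using xy g f by (auto simp: ring_hom_mult ring_hom_add)
  next
    have "\<one>\<^bsub>A\<^esub> = p \<one>\<^bsub>P\<^esub>" using p by (simp add: ring_hom_one)
    then show "g \<one>\<^bsub>A\<^esub> = \<one>\<^bsub>S\<^esub>" using g f by (simp add: ring_hom_one)
  qed
  then show thesis using g that by blast
qed

lemma carrier_Quot: "carrier (R Quot I) = (\<lambda>r. I +>\<^bsub>R\<^esub> r) ` carrier R"
  by (auto simp: FactRing_def A_RCOSETS_def')

lemma zero_Quot: "\<zero>\<^bsub>R Quot I\<^esub> = I"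
  by (simp add: FactRing_def)

lemma coset_closed: "r \<in> carrier R \<Longrightarrow> I +>\<^bsub>R\<^esub> r \<in> carrier (R Quot I)"
  by (simp add: carrier_Quot)

lemma quot_hom: "ideal I R \<Longrightarrow> (\<lambda>r. I +>\<^bsub>R\<^esub> r) \<in> ring_hom R (R Quot I)"
  by (rule ideal.rcos_ring_hom)

lemma quot_cring: "ideal I R \<Longrightarrow> cring R \<Longrightarrow> cring (R Quot I)"
  by (rule ideal.quotient_is_cring)

lemma coset_eq_iff:
  assumes "ideal I R" "x \<in> carrier R" "y \<in> carrier R"
  shows "I +>\<^bsub>R\<^esub> x = I +>\<^bsub>R\<^esub> y \<longleftrightarrow> x \<ominus>\<^bsub>R\<^esub> y \<in> I"
proof -
  interpret ideal I R by fact
  show ?thesis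
    using quotient_eq_iff_same_a_r_cos[OF assms] assms by auto
qed

lemma coset_zero_iff:
  assumes "ideal I R" "x \<in> carrier R"
  shows "I +>\<^bsub>R\<^esub> x = I \<longleftrightarrow> x \<in> I"
proof -
  interpret ideal I R by fact
  have "I +>\<^bsub>R\<^esub> \<zero>\<^bsub>R\<^esub> = I"
    by (rule a_coset_join2) (simp_all add: a_subgroup)
  then show ?thesis
    using coset_eq_iff[OF assms(1), of x "\<zero>\<^bsub>R\<^esub>"] assms(2) by (simp add: a_minus_def)
qed

lemma mem_coset_iff:
  assumes "ideal I R" "x \<in> carrier R"
  shows "y \<in> I +>\<^bsub>R\<^esub> x \<longleftrightarrow> y \<in> carrier R \<and> y \<ominus>\<^bsub>R\<^esub> x \<in> I"
proof -
  interpret ideal I R by fact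
  have "I +>\<^bsub>R\<^esub> x \<subseteq> carrier R"
    using assms(2) a_subset a_r_coset_subset_G by blast
  then show ?thesis
    using a_rcos_module_minus[OF ring_axioms assms(2)] by blast
qed

lemma self_mem_coset:
  assumes "ideal I R" "x \<in> carrier R" shows "x \<in> I +>\<^bsub>R\<^esub> x"
proof -
  interpret ideal I R by fact
  show ?thesis using assms(2) by (rule a_rcos_self)
qed

text \<open>The homomorphism induced on a quotient, in the form in which \<^const>\<open>tensor_lift\<close> uses it.\<close>

lemma quot_lift_eq:
  assumes "ideal I R" "ring R" "ring S" "f \<in> ring_hom R S" "\<And>x. x \<in> I \<Longrightarrow> f x = \<zero>\<^bsub>S\<^esub>" "r \<in> carrier R"
  shows "the_elem (f ` (I +>\<^bsub>R\<^esub> r)) = f r"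
proof -
  interpret R: ring R by fact
  have "f y = f r" if "y \<in> I +>\<^bsub>R\<^esub> r" for y
    using that mem_coset_iff[OF assms(1,6)] ring_hom_eq_iff_minus[OF assms(4,2,3) _ assms(6)] assms(5) by blast
  moreover have "r \<in> I +>\<^bsub>R\<^esub> r" by (rule self_mem_coset[OF assms(1,6)])
  ultimately have "f ` (I +>\<^bsub>R\<^esub> r) = {f r}" by blast
  then show ?thesis by simp
qed

lemma quot_lift_hom:
  assumes "ideal I R" "ring R" "ring S" "f \<in> ring_hom R S" "\<And>x. x \<in> I \<Longrightarrow> f x = \<zero>\<^bsub>S\<^esub>"
  shows "(\<lambda>Z. the_elem (f ` Z)) \<in> ring_hom (R Quot I) S"
proof -
  interpret R: ring R by fact
  interpret I: ideal I R by fact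
  note eq = quot_lift_eq[OF assms]
  note q = quot_hom[OF assms(1)]
  show ?thesis
  proof (rule ring_hom_memI)
    fix x assume "x \<in> carrier (R Quot I)"
    then show "the_elem (f ` x) \<in> carrier S"
      using assms by (auto simp: carrier_Quot eq ring_hom_closed)
  next
    fix x y assume "x \<in> carrier (R Quot I)" "y \<in> carrier (R Quot I)"
    then obtain a b where ab: "a \<in> carrier R" "b \<in> carrier R" "x = I +>\<^bsub>R\<^esub> a" "y = I +>\<^bsub>R\<^esub> b"
      by (auto simp: carrier_Quot)
    have "x \<otimes>\<^bsub>R Quot I\<^esub> y = I +>\<^bsub>R\<^esub> (a \<otimes>\<^bsub>R\<^esub> b)" "x \<oplus>\<^bsub>R Quot I\<^esub> y = I +>\<^bsub>R\<^esub> (a \<oplus>\<^bsub>R\<^esub> b)"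
      using ab ring_hom_mult[OF q ab(1,2)] ring_hom_add[OF q ab(1,2)] by auto
    then show "the_elem (f ` (x \<otimes>\<^bsub>R Quot I\<^esub> y)) = the_elem (f ` x) \<otimes>\<^bsub>S\<^esub> the_elem (f ` y)"
      "the_elem (f ` (x \<oplus>\<^bsub>R Quot I\<^esub> y)) = the_elem (f ` x) \<oplus>\<^bsub>S\<^esub> the_elem (f ` y)"
      using ab assms(4) by (simp_all add: eq ring_hom_mult ring_hom_add)
  next
    have "\<one>\<^bsub>R Quot I\<^esub> = I +>\<^bsub>R\<^esub> \<one>\<^bsub>R\<^esub>" using ring_hom_one[OF q] by simp
    then show "the_elem (f ` \<one>\<^bsub>R Quot I\<^esub>) = \<one>\<^bsub>S\<^esub>"
      using assms(4) by (simp add: eq ring_hom_one)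
  qed
qed

section \<open>Monoid algebras\<close>

lemma comm_monoid_free_cmonoid: "comm_monoid (free_cmonoid V)"
  by (rule comm_monoidI) (auto simp: free_cmonoid_def add.assoc add.commute)

lemma comm_monoid_DirProd:
  assumes "comm_monoid G" "comm_monoid H"
  shows "comm_monoid (G \<times>\<times> H)"
proof -
  interpret G: comm_monoid G by fact
  interpret H: comm_monoid H by fact
  show ?thesis
    by (rule comm_monoidI) (auto simp: G.m_ac H.m_ac)
qed

lemma comm_monoid_integer_group: "comm_monoid integer_group"
  using abelian_integer_group by (rule comm_group.axioms)

lemma cring_comm_monoid: "cring R \<Longrightarrow> comm_monoid R"
  by (rule cring.axioms)

text \<open>Up to the order of factors this is the sum in \<open>laurent_comult\<close>, and
  \<open>tensor_lift\<close> applies it to the representatives of a class. One universal property of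
  monoid algebras thus serves polynomials, Laurent polynomials and tensor products.\<close>

definition ma_lift ::
  "('r, 'm) ring_scheme \<Rightarrow> ('d, 'n) ring_scheme \<Rightarrow> ('r \<Rightarrow> 'd) \<Rightarrow> ('g \<Rightarrow> 'd) \<Rightarrow> ('g \<Rightarrow> 'r) \<Rightarrow> 'd"
  where "ma_lift R D \<phi> \<chi> p = (\<Oplus>\<^bsub>D\<^esub>z \<in> {z. p z \<noteq> \<zero>\<^bsub>R\<^esub>}. \<phi> (p z) \<otimes>\<^bsub>D\<^esub> \<chi> z)"

locale mon_alg = R?: cring R + G: comm_monoid G
  for R (structure) and G
begin

abbreviation "P \<equiv> monoid_algebra R G"

lemma mem_carrier_iff: "p \<in> carrier P \<longleftrightarrow>
  (\<forall>x. p x \<in> carrier R) \<and> (\<forall>x. x \<notin> carrier G \<longrightarrow> p x = \<zero>) \<and> finite {x. p x \<noteq> \<zero>}"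
  by (simp add: monoid_algebra_def)

lemma coeff_closed: "p \<in> carrier P \<Longrightarrow> p x \<in> carrier R"
  by (simp add: mem_carrier_iff)

lemma coeff_outside: "p \<in> carrier P \<Longrightarrow> p x \<noteq> \<zero> \<Longrightarrow> x \<in> carrier G"
  by (auto simp: mem_carrier_iff)

lemma finite_supp: "p \<in> carrier P \<Longrightarrow> finite {x. p x \<noteq> \<zero>}"
  by (simp add: mem_carrier_iff)

lemma add_P: "p \<oplus>\<^bsub>P\<^esub> q = (\<lambda>x. p x \<oplus> q x)"
  and zero_P: "\<zero>\<^bsub>P\<^esub> = (\<lambda>x. \<zero>)"
  and one_P: "\<one>\<^bsub>P\<^esub> = single R \<one> \<one>\<^bsub>G\<^esub>"
  by (simp_all only: monoid_algebra_def single_def ring_record_simps)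

lemma add_apply: "(p \<oplus>\<^bsub>P\<^esub> q) x = p x \<oplus> q x"
  by (simp add: add_P)

lemma single_apply: "single R r g x = (if x = g then r else \<zero>)"
  by (simp add: single_def)

lemma single_closed [simp]: "r \<in> carrier R \<Longrightarrow> g \<in> carrier G \<Longrightarrow> single R r g \<in> carrier P"
  by (auto simp: mem_carrier_iff single_def)

lemma P_a_closed [simp]: "p \<in> carrier P \<Longrightarrow> q \<in> carrier P \<Longrightarrow> p \<oplus>\<^bsub>P\<^esub> q \<in> carrier P"
  unfolding mem_carrier_iff add_P
  by (auto intro!: finite_subset[of "{x. p x \<oplus> q x \<noteq> \<zero>}" "{x. p x \<noteq> \<zero>} \<union> {x. q x \<noteq> \<zero>}"])

lemma P_zero_closed [simp]: "\<zero>\<^bsub>P\<^esub> \<in> carrier P"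
  by (simp add: mem_carrier_iff zero_P)

lemma P_abelian: "abelian_group P"
proof (rule abelian_groupI)
  fix p assume p: "p \<in> carrier P"
  have "finite {x. \<ominus> p x \<noteq> \<zero>}"
    by (rule finite_subset[OF _ finite_supp[OF p]]) (use p in auto)
  then have "(\<lambda>x. \<ominus> p x) \<in> carrier P"
    using p by (simp add: mem_carrier_iff)
  note [simp] = coeff_closed[OF p]
  from \<open>(\<lambda>x. \<ominus> p x) \<in> carrier P\<close> show "\<exists>q\<in>carrier P. q \<oplus>\<^bsub>P\<^esub> p = \<zero>\<^bsub>P\<^esub>"
    by (intro bexI[of _ "\<lambda>x. \<ominus> p x"]) (auto simp: add_P zero_P l_neg)
qed (simp_all, auto simp: add_P zero_P a_ac coeff_closed fun_eq_iff)

text \<open>The defining sum runs over the exact supports, which change under addition. Over a fixed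
  box that contains all supports involved, distributivity and commutativity can be checked term by
  term.\<close>

lemma mult_P:
  assumes p: "p \<in> carrier P" and q: "q \<in> carrier P"
    and A: "finite A" "\<And>x. p x \<noteq> \<zero> \<Longrightarrow> x \<in> A" and B: "finite B" "\<And>x. q x \<noteq> \<zero> \<Longrightarrow> x \<in> B"
  shows "(p \<otimes>\<^bsub>P\<^esub> q) x = (\<Oplus>z \<in> {z \<in> A \<times> B. fst z \<otimes>\<^bsub>G\<^esub> snd z = x}. p (fst z) \<otimes> q (snd z))"
proof -
  note [simp] = coeff_closed[OF p] coeff_closed[OF q] finite_supp[OF p] finite_supp[OF q]
  have "(p \<otimes>\<^bsub>P\<^esub> q) x = (\<Oplus>z \<in> {(a, b). p a \<noteq> \<zero> \<and> q b \<noteq> \<zero> \<and> a \<otimes>\<^bsub>G\<^esub> b = x}. p (fst z) \<otimes> q (snd z))"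
    by (simp add: monoid_algebra_def)
  also have "\<dots> = (\<Oplus>z \<in> {z \<in> A \<times> B. fst z \<otimes>\<^bsub>G\<^esub> snd z = x}. p (fst z) \<otimes> q (snd z))"
    by (rule add.finprod_mono_neutral_cong_left) (use assms in \<open>auto\<close>)
  finally show ?thesis .
qed

lemma P_m_closed [simp]:
  assumes p: "p \<in> carrier P" and q: "q \<in> carrier P"
  shows "p \<otimes>\<^bsub>P\<^esub> q \<in> carrier P"
proof -
  note [simp] = coeff_closed[OF p] coeff_closed[OF q] finite_supp[OF p] finite_supp[OF q]
  define A where "A = {x. p x \<noteq> \<zero>}"
  define B where "B = {x. q x \<noteq> \<zero>}"
  have AB: "finite A" "finite B" "A \<subseteq> carrier G" "B \<subseteq> carrier G"
    using p q by (auto simp: A_def B_def dest: coeff_outside)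
  have eq: "(p \<otimes>\<^bsub>P\<^esub> q) x = (\<Oplus>z \<in> {z \<in> A \<times> B. fst z \<otimes>\<^bsub>G\<^esub> snd z = x}. p (fst z) \<otimes> q (snd z))" for x
    by (rule mult_P) (use p q AB in \<open>auto simp: A_def B_def\<close>)
  have "x \<in> (\<lambda>z. fst z \<otimes>\<^bsub>G\<^esub> snd z) ` (A \<times> B)" if "(p \<otimes>\<^bsub>P\<^esub> q) x \<noteq> \<zero>" for x
  proof (rule ccontr)
    assume "x \<notin> (\<lambda>z. fst z \<otimes>\<^bsub>G\<^esub> snd z) ` (A \<times> B)"
    then have "{z \<in> A \<times> B. fst z \<otimes>\<^bsub>G\<^esub> snd z = x} = {}" by blast
    then have "(p \<otimes>\<^bsub>P\<^esub> q) x = \<zero>" unfolding eq by (simp only: finsum_empty)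
    then show False using that by simp
  qed
  then have sub: "{x. (p \<otimes>\<^bsub>P\<^esub> q) x \<noteq> \<zero>} \<subseteq> (\<lambda>z. fst z \<otimes>\<^bsub>G\<^esub> snd z) ` (A \<times> B)" by auto
  then have "finite {x. (p \<otimes>\<^bsub>P\<^esub> q) x \<noteq> \<zero>}"
    using AB finite_subset[OF sub] by simp
  moreover have "(p \<otimes>\<^bsub>P\<^esub> q) x \<in> carrier R" for x
    unfolding eq using p q by (auto intro!: finsum_closed)
  moreover have "x \<in> carrier G" if nz: "(p \<otimes>\<^bsub>P\<^esub> q) x \<noteq> \<zero>" for x
  proof -
    obtain z where "z \<in> A \<times> B" "x = fst z \<otimes>\<^bsub>G\<^esub> snd z" using sub nz by blast
    then show ?thesis using AB(3,4) by (metis G.m_closed mem_Times_iff subsetD)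
  qed
  ultimately show ?thesis unfolding mem_carrier_iff by blast
qed

lemma P_l_distr:
  assumes p: "p \<in> carrier P" and p': "p' \<in> carrier P" and q: "q \<in> carrier P"
  shows "(p \<oplus>\<^bsub>P\<^esub> p') \<otimes>\<^bsub>P\<^esub> q = p \<otimes>\<^bsub>P\<^esub> q \<oplus>\<^bsub>P\<^esub> p' \<otimes>\<^bsub>P\<^esub> q"
proof
  note [simp] = coeff_closed[OF p] coeff_closed[OF q] finite_supp[OF p] finite_supp[OF q] coeff_closed[OF p'] finite_supp[OF p']
  fix x
  define A where "A = {x. p x \<noteq> \<zero>} \<union> {x. p' x \<noteq> \<zero>}"
  define B where "B = {x. q x \<noteq> \<zero>}"
  have AB: "finite A" "finite B"
    using p p' q by (auto simp: A_def B_def)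
  let ?Z = "{z \<in> A \<times> B. fst z \<otimes>\<^bsub>G\<^esub> snd z = x}"
  have "((p \<oplus>\<^bsub>P\<^esub> p') \<otimes>\<^bsub>P\<^esub> q) x = (\<Oplus>z \<in> ?Z. (p \<oplus>\<^bsub>P\<^esub> p') (fst z) \<otimes> q (snd z))"
    by (rule mult_P) (use p p' q AB in \<open>auto simp: A_def B_def add_apply\<close>)
  also have "\<dots> = (\<Oplus>z \<in> ?Z. p (fst z) \<otimes> q (snd z) \<oplus> p' (fst z) \<otimes> q (snd z))"
    by (rule finsum_cong) (use p p' q in \<open>auto simp: add_apply l_distr simp_implies_def\<close>)
  also have "\<dots> = (\<Oplus>z \<in> ?Z. p (fst z) \<otimes> q (snd z)) \<oplus> (\<Oplus>z \<in> ?Z. p' (fst z) \<otimes> q (snd z))"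
    by (rule finsum_addf) (use p p' q in auto)
  also have "(\<Oplus>z \<in> ?Z. p (fst z) \<otimes> q (snd z)) = (p \<otimes>\<^bsub>P\<^esub> q) x"
    by (rule mult_P[symmetric]) (use p p' q AB in \<open>auto simp: A_def B_def\<close>)
  also have "(\<Oplus>z \<in> ?Z. p' (fst z) \<otimes> q (snd z)) = (p' \<otimes>\<^bsub>P\<^esub> q) x"
    by (rule mult_P[symmetric]) (use p p' q AB in \<open>auto simp: A_def B_def\<close>)
  finally show "((p \<oplus>\<^bsub>P\<^esub> p') \<otimes>\<^bsub>P\<^esub> q) x = (p \<otimes>\<^bsub>P\<^esub> q \<oplus>\<^bsub>P\<^esub> p' \<otimes>\<^bsub>P\<^esub> q) x"
    by (simp only: add_apply[of _ _ x])
qed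

lemma P_m_comm:
  assumes p: "p \<in> carrier P" and q: "q \<in> carrier P"
  shows "p \<otimes>\<^bsub>P\<^esub> q = q \<otimes>\<^bsub>P\<^esub> p"
proof
  note [simp] = coeff_closed[OF p] coeff_closed[OF q] finite_supp[OF p] finite_supp[OF q]
  fix x
  define A where "A = {x. p x \<noteq> \<zero>}"
  define B where "B = {x. q x \<noteq> \<zero>}"
  have AB: "finite A" "finite B" "A \<subseteq> carrier G" "B \<subseteq> carrier G"
    using p q by (auto simp: A_def B_def dest: coeff_outside)
  let ?Z = "{z \<in> A \<times> B. fst z \<otimes>\<^bsub>G\<^esub> snd z = x}" and ?Z' = "{z \<in> B \<times> A. fst z \<otimes>\<^bsub>G\<^esub> snd z = x}"
  have "b \<otimes>\<^bsub>G\<^esub> a = a \<otimes>\<^bsub>G\<^esub> b" if "a \<in> A" "b \<in> B" for a b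
    using that AB G.m_comm by blast
  then have sw: "prod.swap z \<in> ?Z \<longleftrightarrow> z \<in> ?Z'" for z
    by (cases z) (simp, metis)
  have img: "?Z' = prod.swap ` ?Z"
  proof (intro equalityI subsetI)
    fix z assume "z \<in> ?Z'"
    then show "z \<in> prod.swap ` ?Z"
      using sw[of z] by (intro image_eqI[of _ _ "prod.swap z"]) auto
  next
    fix z assume "z \<in> prod.swap ` ?Z"
    then obtain w where "w \<in> ?Z" "z = prod.swap w" by blast
    then show "z \<in> ?Z'" using sw[of z] by simp
  qed
  have "(q \<otimes>\<^bsub>P\<^esub> p) x = (\<Oplus>z \<in> ?Z'. q (fst z) \<otimes> p (snd z))"
    by (rule mult_P) (use p q AB in \<open>auto simp: A_def B_def\<close>)
  also have "\<dots> = (\<Oplus>z \<in> ?Z. q (fst (prod.swap z)) \<otimes> p (snd (prod.swap z)))"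
    unfolding img by (rule finsum_reindex) (use p q in auto)
  also have "\<dots> = (\<Oplus>z \<in> ?Z. p (fst z) \<otimes> q (snd z))"
    by (rule finsum_cong) (use p q in \<open>auto simp: m_comm simp_implies_def\<close>)
  also have "\<dots> = (p \<otimes>\<^bsub>P\<^esub> q) x"
    by (rule mult_P[symmetric]) (use p q AB in \<open>auto simp: A_def B_def\<close>)
  finally show "(p \<otimes>\<^bsub>P\<^esub> q) x = (q \<otimes>\<^bsub>P\<^esub> p) x" by simp
qed

lemma P_r_distr:
  assumes "p \<in> carrier P" "p' \<in> carrier P" "q \<in> carrier P"
  shows "q \<otimes>\<^bsub>P\<^esub> (p \<oplus>\<^bsub>P\<^esub> p') = q \<otimes>\<^bsub>P\<^esub> p \<oplus>\<^bsub>P\<^esub> q \<otimes>\<^bsub>P\<^esub> p'"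
  using P_l_distr[OF assms] P_m_comm assms by simp

lemma single_mult:
  assumes "r \<in> carrier R" "s \<in> carrier R" "g \<in> carrier G" "h \<in> carrier G"
  shows "single R r g \<otimes>\<^bsub>P\<^esub> single R s h = single R (r \<otimes> s) (g \<otimes>\<^bsub>G\<^esub> h)"
proof
  fix x
  have "(single R r g \<otimes>\<^bsub>P\<^esub> single R s h) x =
    (\<Oplus>z \<in> {z \<in> {g} \<times> {h}. fst z \<otimes>\<^bsub>G\<^esub> snd z = x}. single R r g (fst z) \<otimes> single R s h (snd z))"
    by (rule mult_P) (use assms in \<open>auto simp: single_apply split: if_splits\<close>)
  also have "{z \<in> {g} \<times> {h}. fst z \<otimes>\<^bsub>G\<^esub> snd z = x} = (if x = g \<otimes>\<^bsub>G\<^esub> h then {(g, h)} else {})"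
    by auto
  finally show "(single R r g \<otimes>\<^bsub>P\<^esub> single R s h) x = single R (r \<otimes> s) (g \<otimes>\<^bsub>G\<^esub> h) x"
    using assms by (simp add: single_apply[of _ _ g] single_apply[of _ _ h] single_apply[of _ _ x] Pi_def)
qed

lemma single_add: "r \<in> carrier R \<Longrightarrow> s \<in> carrier R \<Longrightarrow> single R r g \<oplus>\<^bsub>P\<^esub> single R s g = single R (r \<oplus> s) g"
  by (auto simp: add_apply single_apply fun_eq_iff)

lemma single_zero: "single R \<zero> g = \<zero>\<^bsub>P\<^esub>"
  by (auto simp: zero_P single_apply fun_eq_iff)

text \<open>Associativity and the multiplicativity of lifts are additive in each argument, so this
  induction leaves only products of monomials. The zero function is itself a monomial, with
  coefficient zero, which starts the induction.\<close>

lemma P_induct [consumes 1, case_names single add]: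
  assumes p: "p \<in> carrier P"
    and single: "\<And>r g. r \<in> carrier R \<Longrightarrow> g \<in> carrier G \<Longrightarrow> Q (single R r g)"
    and add: "\<And>p q. p \<in> carrier P \<Longrightarrow> q \<in> carrier P \<Longrightarrow> Q p \<Longrightarrow> Q q \<Longrightarrow> Q (p \<oplus>\<^bsub>P\<^esub> q)"
  shows "Q p"
proof -
  have "finite F \<Longrightarrow> p \<in> carrier P \<Longrightarrow> {x. p x \<noteq> \<zero>} \<subseteq> F \<Longrightarrow> Q p" for F p
  proof (induction F arbitrary: p rule: finite_induct)
    case empty
    then have "p = single R \<zero> \<one>\<^bsub>G\<^esub>" by (auto simp: single_apply fun_eq_iff)
    then show ?case using single by simp
  next
    case (insert g F)
    show ?case
    proof (cases "p g = \<zero>")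
      case True
      then show ?thesis using insert by blast
    next
      case False
      define q where "q = p(g := \<zero>)"
      have g: "g \<in> carrier G" using False insert coeff_outside by blast
      have "finite {x. q x \<noteq> \<zero>}"
        by (rule finite_subset[OF _ finite_supp[OF insert(4)]]) (auto simp: q_def)
      then have q: "q \<in> carrier P"
        using insert(4) by (auto simp: mem_carrier_iff q_def)
      have "Q q" by (rule insert.IH[OF q]) (use insert(5) in \<open>auto simp: q_def\<close>)
      then have "Q (single R (p g) g \<oplus>\<^bsub>P\<^esub> q)"
        using coeff_closed[OF insert(4), of g] g q by (intro add single single_closed)
      also have "single R (p g) g \<oplus>\<^bsub>P\<^esub> q = p"
        using coeff_closed[OF insert(4)] by (intro ext) (auto simp: q_def add_P single_def)
      finally show ?thesis .
    qed
  qed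
  then show ?thesis using p finite_supp[OF p] by blast
qed

lemma P_cring: "cring P"
proof (rule cringI[OF P_abelian])
  interpret P: abelian_group P by (rule P_abelian)
  show "comm_monoid P"
  proof (rule comm_monoidI)
    fix p q r assume p: "p \<in> carrier P" and q: "q \<in> carrier P" and r: "r \<in> carrier P"
    show "p \<otimes>\<^bsub>P\<^esub> q \<otimes>\<^bsub>P\<^esub> r = p \<otimes>\<^bsub>P\<^esub> (q \<otimes>\<^bsub>P\<^esub> r)"
      using p
    proof (induction p rule: P_induct)
      case p: (single a g)
      show ?case using q
      proof (induction q rule: P_induct)
        case q: (single b h)
        show ?case using r
        proof (induction r rule: P_induct)
          case (single c k)
          then show ?case using p q by (simp add: single_mult m_assoc G.m_assoc)
        next
          case (add r r')
          then show ?case using p q by (simp add: P_r_distr)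
        qed
      next
        case (add q q')
        then show ?case using p r by (simp add: P_r_distr P_l_distr)
      qed
    next
      case (add p p')
      then show ?case using q r by (simp add: P_l_distr)
    qed
  next
    fix p assume "p \<in> carrier P"
    then show "\<one>\<^bsub>P\<^esub> \<otimes>\<^bsub>P\<^esub> p = p"
      by (induction p rule: P_induct) (simp_all add: one_P single_mult P_r_distr)
  qed (simp_all add: one_P P_m_comm)
qed (rule P_l_distr)

sublocale P: cring P by (rule P_cring)

lemma const_hom: "(\<lambda>r. single R r \<one>\<^bsub>G\<^esub>) \<in> ring_hom R P"
  by (rule ring_hom_memI) (simp_all add: single_mult single_add one_P)

lemma const_mult:
  assumes "r \<in> carrier R" "p \<in> carrier P"
  shows "single R r \<one>\<^bsub>G\<^esub> \<otimes>\<^bsub>P\<^esub> p = (\<lambda>x. r \<otimes> p x)"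
  using assms(2)
proof (induction p rule: P_induct)
  case (single s g)
  then show ?case using assms(1) by (simp add: single_mult) (auto simp: single_def)
next
  case (add p q)
  then show ?case using assms(1) by (simp add: P_r_distr) (auto simp: add_P r_distr coeff_closed)
qed

text \<open>A monomial is a constant times a basis element. Taking for \<open>S\<close> the
  equalizer of two homomorphisms turns generation into uniqueness; later uniqueness proofs follow
  the same pattern.\<close>

lemma generating_subring:
  assumes S: "subring S P" and c: "\<And>r. r \<in> carrier R \<Longrightarrow> single R r \<one>\<^bsub>G\<^esub> \<in> S"
    and g: "\<And>g. g \<in> carrier G \<Longrightarrow> single R \<one> g \<in> S"
  shows "carrier P \<subseteq> S"
proof
  fix p assume "p \<in> carrier P"
  then show "p \<in> S"
  proof (induction p rule: P_induct)
    case (single r h)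
    have "single R r h = single R r \<one>\<^bsub>G\<^esub> \<otimes>\<^bsub>P\<^esub> single R \<one> h" using single by (simp add: single_mult)
    then show ?case using subringE(6)[OF S] c g single by auto
  next
    case (add p q)
    then show ?case using subringE(7)[OF S] by auto
  qed
qed

lemma hom_eqI:
  assumes "f \<in> ring_hom P D" "g \<in> ring_hom P D" "ring D"
    and "\<And>r. r \<in> carrier R \<Longrightarrow> f (single R r \<one>\<^bsub>G\<^esub>) = g (single R r \<one>\<^bsub>G\<^esub>)"
    and "\<And>x. x \<in> carrier G \<Longrightarrow> f (single R \<one> x) = g (single R \<one> x)" and "p \<in> carrier P"
  shows "f p = g p"
  using generating_subring[OF subring_equalizer[OF assms(1,2) P.ring_axioms assms(3)]] assms by auto

context
  fixes D :: "('dd, 'nn) ring_scheme" and \<phi> \<chi>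
  assumes D: "cring D" and phi: "\<phi> \<in> ring_hom R D"
    and chi_closed: "\<And>x. x \<in> carrier G \<Longrightarrow> \<chi> x \<in> carrier D"
    and chi_mult: "\<And>x y. x \<in> carrier G \<Longrightarrow> y \<in> carrier G \<Longrightarrow> \<chi> (x \<otimes>\<^bsub>G\<^esub> y) = \<chi> x \<otimes>\<^bsub>D\<^esub> \<chi> y"
    and chi_one: "\<chi> \<one>\<^bsub>G\<^esub> = \<one>\<^bsub>D\<^esub>"
begin

interpretation D: cring D by (rule D)

lemma phi_zero: "\<phi> \<zero> = \<zero>\<^bsub>D\<^esub>"
  using ring_hom_zero[OF phi] R.ring_axioms D.ring_axioms by simp

lemma lift_term_closed: "p \<in> carrier P \<Longrightarrow> p z \<noteq> \<zero> \<Longrightarrow> \<phi> (p z) \<otimes>\<^bsub>D\<^esub> \<chi> z \<in> carrier D"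
  using ring_hom_closed[OF phi coeff_closed] chi_closed coeff_outside by auto

lemma lift_superset:
  assumes "p \<in> carrier P" "finite A" "{z. p z \<noteq> \<zero>} \<subseteq> A" "A \<subseteq> carrier G"
  shows "ma_lift R D \<phi> \<chi> p = (\<Oplus>\<^bsub>D\<^esub>z\<in>A. \<phi> (p z) \<otimes>\<^bsub>D\<^esub> \<chi> z)"
  unfolding ma_lift_def
  by (rule D.add.finprod_mono_neutral_cong_left)
    (use assms chi_closed phi in \<open>auto simp: phi_zero ring_hom_closed coeff_closed subset_iff\<close>)

lemma lift_single:
  assumes "r \<in> carrier R" "g \<in> carrier G"
  shows "ma_lift R D \<phi> \<chi> (single R r g) = \<phi> r \<otimes>\<^bsub>D\<^esub> \<chi> g"
proof -
  have "ma_lift R D \<phi> \<chi> (single R r g) = (\<Oplus>\<^bsub>D\<^esub>z\<in>{g}. \<phi> (single R r g z) \<otimes>\<^bsub>D\<^esub> \<chi> z)"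
    by (rule lift_superset) (use assms in \<open>auto simp: single_apply\<close>)
  also have "\<dots> = \<phi> r \<otimes>\<^bsub>D\<^esub> \<chi> g"
    using assms chi_closed phi
    by (simp add: single_apply[of _ _ g] ring_hom_closed Pi_def)
  finally show ?thesis .
qed

lemma lift_closed: "p \<in> carrier P \<Longrightarrow> ma_lift R D \<phi> \<chi> p \<in> carrier D"
  unfolding ma_lift_def using lift_term_closed by (auto intro!: D.finsum_closed)

lemma lift_add:
  assumes p: "p \<in> carrier P" and q: "q \<in> carrier P"
  shows "ma_lift R D \<phi> \<chi> (p \<oplus>\<^bsub>P\<^esub> q) = ma_lift R D \<phi> \<chi> p \<oplus>\<^bsub>D\<^esub> ma_lift R D \<phi> \<chi> q"
proof -
  note [simp] = coeff_closed[OF p] coeff_closed[OF q] finite_supp[OF p] finite_supp[OF q]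
  define A where "A = {z. p z \<noteq> \<zero>} \<union> {z. q z \<noteq> \<zero>}"
  have A: "finite A" "A \<subseteq> carrier G" using p q by (auto simp: A_def dest: coeff_outside)
  have "ma_lift R D \<phi> \<chi> (p \<oplus>\<^bsub>P\<^esub> q) = (\<Oplus>\<^bsub>D\<^esub>z\<in>A. \<phi> ((p \<oplus>\<^bsub>P\<^esub> q) z) \<otimes>\<^bsub>D\<^esub> \<chi> z)"
    by (rule lift_superset) (use p q A in \<open>auto simp: A_def add_apply\<close>)
  also have "\<dots> = (\<Oplus>\<^bsub>D\<^esub>z\<in>A. \<phi> (p z) \<otimes>\<^bsub>D\<^esub> \<chi> z \<oplus>\<^bsub>D\<^esub> \<phi> (q z) \<otimes>\<^bsub>D\<^esub> \<chi> z)"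
    by (rule D.finsum_cong)
      (use p q A chi_closed phi in
        \<open>auto simp: add_apply ring_hom_add ring_hom_closed D.l_distr simp_implies_def subset_iff\<close>)
  also have "\<dots> = (\<Oplus>\<^bsub>D\<^esub>z\<in>A. \<phi> (p z) \<otimes>\<^bsub>D\<^esub> \<chi> z) \<oplus>\<^bsub>D\<^esub> (\<Oplus>\<^bsub>D\<^esub>z\<in>A. \<phi> (q z) \<otimes>\<^bsub>D\<^esub> \<chi> z)"
    by (rule D.finsum_addf) (use p q A chi_closed phi in \<open>auto simp: ring_hom_closed subset_iff\<close>)
  also have "(\<Oplus>\<^bsub>D\<^esub>z\<in>A. \<phi> (p z) \<otimes>\<^bsub>D\<^esub> \<chi> z) = ma_lift R D \<phi> \<chi> p"
    by (rule lift_superset[symmetric]) (use p q A in \<open>auto simp: A_def\<close>)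
  also have "(\<Oplus>\<^bsub>D\<^esub>z\<in>A. \<phi> (q z) \<otimes>\<^bsub>D\<^esub> \<chi> z) = ma_lift R D \<phi> \<chi> q"
    by (rule lift_superset[symmetric]) (use p q A in \<open>auto simp: A_def\<close>)
  finally show ?thesis .
qed

lemma lift_hom: "ma_lift R D \<phi> \<chi> \<in> ring_hom P D"
proof (rule ring_hom_memI)
  fix p q assume p: "p \<in> carrier P" and q: "q \<in> carrier P"
  show "ma_lift R D \<phi> \<chi> (p \<otimes>\<^bsub>P\<^esub> q) = ma_lift R D \<phi> \<chi> p \<otimes>\<^bsub>D\<^esub> ma_lift R D \<phi> \<chi> q"
    using p
  proof (induction p rule: P_induct)
    case p: (single r g)
    show ?case using q
    proof (induction q rule: P_induct)
      case (single s h)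
      then show ?case
        using p ring_hom_closed[OF phi] chi_closed
        by (simp add: single_mult lift_single chi_mult ring_hom_mult[OF phi] D.m_ac)
    next
      case (add q q')
      then show ?case using p by (simp add: P_r_distr lift_add lift_closed D.r_distr)
    qed
  next
    case (add p p')
    then show ?case using q by (simp add: P_l_distr lift_add lift_closed D.l_distr)
  qed
next
  show "ma_lift R D \<phi> \<chi> \<one>\<^bsub>P\<^esub> = \<one>\<^bsub>D\<^esub>"
    by (simp add: one_P lift_single chi_one ring_hom_one[OF phi])
qed (simp_all add: lift_closed lift_add)

lemma lift_const: "r \<in> carrier R \<Longrightarrow> ma_lift R D \<phi> \<chi> (single R r \<one>\<^bsub>G\<^esub>) = \<phi> r"
  using ring_hom_closed[OF phi] by (simp add: lift_single chi_one)

lemma lift_basis: "g \<in> carrier G \<Longrightarrow> ma_lift R D \<phi> \<chi> (single R \<one> g) = \<chi> g"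
  using chi_closed by (simp add: lift_single ring_hom_one[OF phi])

end

end

section \<open>Algebra homomorphisms\<close>

lemma alg_homI:
  "h \<in> ring_hom A B \<Longrightarrow> (\<And>r. r \<in> carrier R \<Longrightarrow> h (\<phi> r) = \<psi> r) \<Longrightarrow> h \<in> alg_hom R A \<phi> B \<psi>"
  by (simp add: alg_hom_def)

lemma alg_hom_ring_hom: "h \<in> alg_hom R A \<phi> B \<psi> \<Longrightarrow> h \<in> ring_hom A B"
  by (simp add: alg_hom_def)

lemma alg_hom_str: "h \<in> alg_hom R A \<phi> B \<psi> \<Longrightarrow> r \<in> carrier R \<Longrightarrow> h (\<phi> r) = \<psi> r"
  by (simp add: alg_hom_def)

lemma alg_hom_closed: "h \<in> alg_hom R A \<phi> B \<psi> \<Longrightarrow> x \<in> carrier A \<Longrightarrow> h x \<in> carrier B"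
  by (auto simp: alg_hom_def ring_hom_closed)

lemma alg_hom_comp:
  "f \<in> alg_hom R A \<phi> B \<psi> \<Longrightarrow> g \<in> alg_hom R B \<psi> C \<chi> \<Longrightarrow> (\<lambda>x. g (f x)) \<in> alg_hom R A \<phi> C \<chi>"
  by (auto simp: alg_hom_def intro: ring_hom_comp)

lemma alg_hom_id: "id \<in> alg_hom R A \<phi> A \<phi>"
  by (auto simp: alg_hom_def ring_hom_def)

lemma ring_hom_cringD:
  assumes "ring_hom_cring R A \<phi>"
  shows "cring R" "cring A" "\<phi> \<in> ring_hom R A" "ring R" "ring A"
  using assms by (auto simp: ring_hom_cring_def ring_hom_cring_axioms_def cring.axioms)

section \<open>Polynomial rings\<close>

lemma free_cmonoid_simps [simp]:
  "carrier (free_cmonoid V) = {M. set_mset M \<subseteq> V}"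
  "M \<otimes>\<^bsub>free_cmonoid V\<^esub> N = M + N" "\<one>\<^bsub>free_cmonoid V\<^esub> = {#}"
  by (simp_all add: free_cmonoid_def)

lemma mon_alg_free: "cring R \<Longrightarrow> mon_alg R (free_cmonoid V)"
  by (intro mon_alg.intro comm_monoid_free_cmonoid)

text \<open>The set \<open>V\<close> may be infinite: the symmetric algebra takes all elements of a
  module as variables. The value of a monomial is a product over the finite support of a
  multiset.\<close>

lemma free_lift:
  fixes R (structure) and D :: "('d, 'n) ring_scheme"
  assumes "cring R" "cring D" "\<phi> \<in> ring_hom R D" "\<And>x. x \<in> V \<Longrightarrow> c x \<in> carrier D"
  obtains e where "e \<in> ring_hom (monoid_algebra R (free_cmonoid V)) D"
    "\<And>r. r \<in> carrier R \<Longrightarrow> e (single R r {#}) = \<phi> r"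
    "\<And>x. x \<in> V \<Longrightarrow> e (single R \<one> {#x#}) = c x"
proof -
  interpret mon_alg R "free_cmonoid V"
    by (rule mon_alg_free) fact
  interpret D: cring D by fact
  define \<chi> where "\<chi> M = (\<Otimes>\<^bsub>D\<^esub>x\<in>set_mset M. c x [^]\<^bsub>D\<^esub> count M x)" for M
  \<comment> \<open>The supports of \<open>M\<close>, \<open>N\<close> and \<open>M + N\<close>
    differ; over a common finite index set the exponents add factor by factor.\<close>
  have sup: "\<chi> M = (\<Otimes>\<^bsub>D\<^esub>x\<in>S. c x [^]\<^bsub>D\<^esub> count M x)" if "finite S" "set_mset M \<subseteq> S" "S \<subseteq> V" for M S
    unfolding \<chi>_def by (rule D.finprod_mono_neutral_cong_left)
      (use that assms(4) in \<open>auto simp: not_in_iff\<close>)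
  have 1: "\<chi> M \<in> carrier D" if "set_mset M \<subseteq> V" for M
    unfolding \<chi>_def by (rule D.finprod_closed) (use assms(4) that in auto)
  have 2: "\<chi> (M + N) = \<chi> M \<otimes>\<^bsub>D\<^esub> \<chi> N" if "set_mset M \<subseteq> V" "set_mset N \<subseteq> V" for M N
  proof -
    define S where "S = set_mset (M + N)"
    have S: "finite S" "S \<subseteq> V" using that by (auto simp: S_def)
    have "\<chi> (M + N) = (\<Otimes>\<^bsub>D\<^esub>x\<in>S. c x [^]\<^bsub>D\<^esub> count M x \<otimes>\<^bsub>D\<^esub> c x [^]\<^bsub>D\<^esub> count N x)"
      unfolding \<chi>_def S_def[symmetric]
      by (rule D.finprod_cong) (use S assms(4) in \<open>auto simp: D.nat_pow_mult subset_iff\<close>)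
    also have "\<dots> = (\<Otimes>\<^bsub>D\<^esub>x\<in>S. c x [^]\<^bsub>D\<^esub> count M x) \<otimes>\<^bsub>D\<^esub> (\<Otimes>\<^bsub>D\<^esub>x\<in>S. c x [^]\<^bsub>D\<^esub> count N x)"
      by (rule D.finprod_multf) (use S assms(4) in auto)
    also have "\<dots> = \<chi> M \<otimes>\<^bsub>D\<^esub> \<chi> N"
      using sup[OF S(1) _ S(2), of M] sup[OF S(1) _ S(2), of N] by (auto simp: S_def)
    finally show ?thesis .
  qed
  have 3: "\<chi> {#} = \<one>\<^bsub>D\<^esub>" by (simp add: \<chi>_def)
  have 4: "\<chi> {#x#} = c x" if "x \<in> V" for x
    using assms(4)[OF that] by (simp add: \<chi>_def Pi_def)
  have 5: "ma_lift R D \<phi> \<chi> \<in> ring_hom P D"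
    by (rule lift_hom) (use assms 1 2 3 in auto)
  have 6: "ma_lift R D \<phi> \<chi> (single R r {#}) = \<phi> r" if "r \<in> carrier R" for r
    using lift_const[OF assms(2,3), of \<chi> r] 1 2 3 that by auto
  have 7: "ma_lift R D \<phi> \<chi> (single R \<one> {#x#}) = c x" if "x \<in> V" for x
    using lift_basis[OF assms(2,3), of \<chi> "{#x#}"] 1 2 3 4 that by auto
  show thesis using that[OF 5 6 7] .
qed

lemma free_generating_subring:
  fixes R (structure)
  assumes "cring R" and S: "subring S (monoid_algebra R (free_cmonoid V))"
    and c: "\<And>r. r \<in> carrier R \<Longrightarrow> single R r {#} \<in> S"
    and x: "\<And>x. x \<in> V \<Longrightarrow> single R \<one> {#x#} \<in> S"
  shows "carrier (monoid_algebra R (free_cmonoid V)) \<subseteq> S"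
proof -
  interpret mon_alg R "free_cmonoid V"
    by (rule mon_alg_free) fact
  have "single R \<one> M \<in> S" if "set_mset M \<subseteq> V" for M
    using that
  proof (induction M)
    case empty
    then show ?case using c by simp
  next
    case (add y M)
    then have "single R \<one> {#y#} \<otimes>\<^bsub>P\<^esub> single R \<one> M \<in> S"
      using subringE(6)[OF S] x by auto
    then show ?case using add.prems by (simp add: single_mult)
  qed
  then show ?thesis by (intro generating_subring[OF S]) (use c in auto)
qed

lemma free_hom_eqI:
  fixes R (structure)
  assumes "cring R" "ring D" "f \<in> ring_hom (monoid_algebra R (free_cmonoid V)) D"
    "g \<in> ring_hom (monoid_algebra R (free_cmonoid V)) D"
    "\<And>r. r \<in> carrier R \<Longrightarrow> f (single R r {#}) = g (single R r {#})"
    "\<And>x. x \<in> V \<Longrightarrow> f (single R \<one> {#x#}) = g (single R \<one> {#x#})"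
    "p \<in> carrier (monoid_algebra R (free_cmonoid V))"
  shows "f p = g p"
proof -
  interpret mon_alg R "free_cmonoid V"
    by (rule mon_alg_free) fact
  have "single R r {#} \<in> carrier P" if "r \<in> carrier R" for r using that by simp
  moreover have "single R \<one> {#x#} \<in> carrier P" if "x \<in> V" for x using that by simp
  ultimately show ?thesis
    using free_generating_subring[OF assms(1) subring_equalizer[OF assms(3,4) P.ring_axioms assms(2)]]
      assms(5-7) by auto
qed

lemma mpoly_ring_cring: "cring R \<Longrightarrow> cring (mpoly_ring R n)"
  unfolding mpoly_ring_def
  by (intro mon_alg.P_cring mon_alg_free)

lemma mpoly_const_hom:
  assumes "cring R" shows "(\<lambda>r. single R r {#}) \<in> ring_hom R (mpoly_ring R n)"
  using mon_alg.const_hom[OF mon_alg_free[OF assms]] by (simp add: mpoly_ring_def)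

lemma mpoly_var_closed:
  assumes "cring R" "i < n" shows "single R \<one>\<^bsub>R\<^esub> {#i#} \<in> carrier (mpoly_ring R n)"
  using mon_alg.single_closed[OF mon_alg_free[OF assms(1)], of "\<one>\<^bsub>R\<^esub>" "{#i#}" "{..<n}"] assms
  by (simp add: mpoly_ring_def cring.cring_simprules)

lemma mpoly_lift:
  assumes "cring R" "cring D" "\<phi> \<in> ring_hom R D" "\<And>i. i < n \<Longrightarrow> c i \<in> carrier D"
  obtains e where "e \<in> alg_hom R (mpoly_ring R n) (\<lambda>r. single R r {#}) D \<phi>"
    "\<And>i. i < n \<Longrightarrow> e (single R \<one>\<^bsub>R\<^esub> {#i#}) = c i"
proof -
  obtain e where "e \<in> ring_hom (mpoly_ring R n) D"
    "\<And>r. r \<in> carrier R \<Longrightarrow> e (single R r {#}) = \<phi> r"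
    "\<And>x. x \<in> {..<n} \<Longrightarrow> e (single R \<one>\<^bsub>R\<^esub> {#x#}) = c x"
    unfolding mpoly_ring_def by (rule free_lift[OF assms(1-3), of "{..<n}" c]) (use assms(4) in auto)
  then show thesis using that[of e] by (auto simp: alg_hom_def)
qed

lemma mpoly_hom_eqI:
  assumes "cring R" "ring D" "f \<in> ring_hom (mpoly_ring R n) D" "g \<in> ring_hom (mpoly_ring R n) D"
    "\<And>r. r \<in> carrier R \<Longrightarrow> f (single R r {#}) = g (single R r {#})"
    "\<And>i. i < n \<Longrightarrow> f (single R \<one>\<^bsub>R\<^esub> {#i#}) = g (single R \<one>\<^bsub>R\<^esub> {#i#})"
    "p \<in> carrier (mpoly_ring R n)"
  shows "f p = g p"
  by (rule free_hom_eqI[OF assms(1,2) assms(3,4)[unfolded mpoly_ring_def]])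
    (use assms(5-7) in \<open>auto simp: mpoly_ring_def\<close>)

section \<open>Polynomials in one variable and the element t\<close>

definition tvar :: "('k, 'm) ring_scheme \<Rightarrow> nat \<Rightarrow> 'k"
  where "tvar k = up_ring.monom (UP k) \<one>\<^bsub>k\<^esub> 1"

lemma UP_cringI: "cring k \<Longrightarrow> UP_cring k"
  by (simp add: UP_cring_def)

lemma cring_UP: "cring k \<Longrightarrow> cring (UP k)"
  by (rule UP_cring.UP_cring) (rule UP_cringI)

lemma monom_UP_closed: "cring k \<Longrightarrow> c \<in> carrier k \<Longrightarrow> up_ring.monom (UP k) c n \<in> carrier (UP k)"
  by (rule UP_ring.monom_closed) (auto simp: UP_ring_def cring.axioms)

lemma tvar_closed: "cring k \<Longrightarrow> tvar k \<in> carrier (UP k)"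
  unfolding tvar_def by (rule monom_UP_closed) (auto simp: cring.cring_simprules)

lemma UP_const_hom: "cring k \<Longrightarrow> (\<lambda>c. up_ring.monom (UP k) c 0) \<in> ring_hom k (UP k)"
  using UP_ring.const_ring_hom[of k] by (simp add: UP_ring_def cring.axioms)

lemma UP_eval:
  assumes "cring k" "cring C" "h \<in> ring_hom k C" "s \<in> carrier C"
  shows "UnivPoly.eval k C h s \<in> ring_hom (UP k) C"
    and "\<And>c. c \<in> carrier k \<Longrightarrow>  UnivPoly.eval k C h s (up_ring.monom (UP k) c 0) = h c"
    and "UnivPoly.eval k C h s (tvar k) = s"
proof -
  interpret UP_pre_univ_prop k C h "UP k"
    using assms by (simp add: UP_pre_univ_prop_def UP_cring_def ring_hom_cringI)
  show "UnivPoly.eval k C h s \<in> ring_hom (UP k) C" using assms by (simp add: eval_ring_hom)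
  show "UnivPoly.eval k C h s (up_ring.monom (UP k) c 0) = h c" if "c \<in> carrier k" for c
    using assms that by (simp add: eval_const)
  show "UnivPoly.eval k C h s (tvar k) = s"
    unfolding tvar_def using assms(4) by (rule eval_monom1)
qed

lemma UP_hom_eqI:
  assumes k: "cring k" and C: "cring C" and f: "f \<in> ring_hom (UP k) C" and g: "g \<in> ring_hom (UP k) C"
    and c: "\<And>c. c \<in> carrier k \<Longrightarrow> f (up_ring.monom (UP k) c 0) = g (up_ring.monom (UP k) c 0)"
    and t: "f (tvar k) = g (tvar k)" and p: "p \<in> carrier (UP k)"
  shows "f p = g p"
proof -
  have h: "(\<lambda>c. f (up_ring.monom (UP k) c 0)) \<in> ring_hom k C"
    using ring_hom_comp[OF UP_const_hom[OF k] f] .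
  interpret UP_pre_univ_prop k C "\<lambda>c. f (up_ring.monom (UP k) c 0)" "UP k"
    using k C h by (simp add: UP_pre_univ_prop_def UP_cring_def ring_hom_cringI)
  have "cring (UP k)" using k by (rule cring_UP)
  show ?thesis
  proof (rule UP_hom_unique[where s = "f (tvar k)"])
    show "ring_hom_cring (UP k) C f" "ring_hom_cring (UP k) C g"
      using \<open>cring (UP k)\<close> C f g by (auto intro: ring_hom_cringI)
    show "f (tvar k) \<in> carrier C"
      using f tvar_closed[OF k] by (rule ring_hom_closed)
  qed (use c t p in \<open>simp_all add: tvar_def\<close>)
qed

text \<open>Multiplication by t shifts coefficients, so the coefficient of the product in degree
  \<open>Suc n\<close> is that of \<open>p\<close> in degree \<open>n\<close>.\<close>

lemma tvar_nonzerodivisor: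
  assumes k: "cring k" and p: "p \<in> carrier (UP k)" and z: "tvar k \<otimes>\<^bsub>UP k\<^esub> p = \<zero>\<^bsub>UP k\<^esub>"
  shows "p = \<zero>\<^bsub>UP k\<^esub>"
proof -
  interpret UP_cring k "UP k" using k by (simp add: UP_cring_def)
  have t: "tvar k \<in> carrier (UP k)" using k by (rule tvar_closed)
  have "up_ring.coeff (UP k) p n = \<zero>\<^bsub>k\<^esub>" for n
  proof -
    have c: "up_ring.coeff (UP k) p i \<in> carrier k" for i using p by (rule coeff_closed)
    have "\<zero>\<^bsub>k\<^esub> = up_ring.coeff (UP k) (p \<otimes>\<^bsub>UP k\<^esub> tvar k) (Suc n)"
      using z p t by (simp only: coeff_zero P.m_comm[OF p t])
    also have "\<dots> = (\<Oplus>\<^bsub>k\<^esub>i\<in>{..Suc n}. up_ring.coeff (UP k) p i \<otimes>\<^bsub>k\<^esub> up_ring.coeff (UP k) (tvar k) (Suc n - i))"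
      using p t by (rule coeff_mult)
    also have "\<dots> = (\<Oplus>\<^bsub>k\<^esub>i\<in>{..Suc n}. if n = i then up_ring.coeff (UP k) p i else \<zero>\<^bsub>k\<^esub>)"
      by (rule R.finsum_cong) (auto simp: tvar_def c simp_implies_def)
    also have "\<dots> = up_ring.coeff (UP k) p n"
      by (rule R.finsum_singleton) (auto simp: c)
    finally show ?thesis by simp
  qed
  then show ?thesis using p by (intro up_eqI) (auto simp: coeff_zero)
qed

section \<open>Tensor products\<close>

locale tensor_alg =
  fixes R :: "('r, 'm) ring_scheme" (structure) and B :: "('b, 'n) ring_scheme" and \<phi>
    and C :: "('c, 'p) ring_scheme" and \<psi>
  assumes B: "ring_hom_cring R B \<phi>" and C: "ring_hom_cring R C \<psi>"
begin

abbreviation "T \<equiv> tensor R B \<phi> C \<psi>"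
abbreviation "\<tau> \<equiv> tensor_str R B \<phi> C \<psi>"
abbreviation "pt \<equiv> pure_tensor R B \<phi> C \<psi>"
abbreviation "j1 b \<equiv> pt b \<one>\<^bsub>C\<^esub>"
abbreviation "j2 c \<equiv> pt \<one>\<^bsub>B\<^esub> c"
abbreviation "F \<equiv> tensor_free R B C"
abbreviation "J \<equiv> tensor_ideal R B \<phi> C \<psi>"

lemma crings: "cring R" "cring B" "cring C" "\<phi> \<in> ring_hom R B" "\<psi> \<in> ring_hom R C"
  using ring_hom_cringD[OF B] ring_hom_cringD[OF C] by auto

sublocale MA: mon_alg R "B \<times>\<times> C"
  using crings by (intro mon_alg.intro comm_monoid_DirProd cring_comm_monoid)

interpretation B: cring B by (rule crings)
interpretation C: cring C by (rule crings)

lemma F_eq: "F = MA.P" by (simp add: tensor_free_def)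

interpretation F: cring F unfolding F_eq by (rule MA.P_cring)

definition "rels = 
    ({single R \<one> (b \<oplus>\<^bsub>B\<^esub> b', c) \<ominus>\<^bsub>F\<^esub> (single R \<one> (b, c) \<oplus>\<^bsub>F\<^esub> single R \<one> (b', c)) | b b' c.
        b \<in> carrier B \<and> b' \<in> carrier B \<and> c \<in> carrier C} \<union>
     {single R \<one> (b, c \<oplus>\<^bsub>C\<^esub> c') \<ominus>\<^bsub>F\<^esub> (single R \<one> (b, c) \<oplus>\<^bsub>F\<^esub> single R \<one> (b, c')) | b c c'.
        b \<in> carrier B \<and> c \<in> carrier C \<and> c' \<in> carrier C} \<union>
     {single R \<one> (\<phi> r \<otimes>\<^bsub>B\<^esub> b, c) \<ominus>\<^bsub>F\<^esub> single R r (b, c) | r b c.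
        r \<in> carrier R \<and> b \<in> carrier B \<and> c \<in> carrier C} \<union>
     {single R \<one> (b, \<psi> r \<otimes>\<^bsub>C\<^esub> c) \<ominus>\<^bsub>F\<^esub> single R r (b, c) | r b c.
        r \<in> carrier R \<and> b \<in> carrier B \<and> c \<in> carrier C})"

lemma J_eq: "J = Idl\<^bsub>F\<^esub> rels"
  by (simp add: tensor_ideal_def rels_def Let_def)

lemma single_F [simp]: "r \<in> carrier R \<Longrightarrow> b \<in> carrier B \<Longrightarrow> c \<in> carrier C \<Longrightarrow> single R r (b, c) \<in> carrier F"
  unfolding F_eq by (rule MA.single_closed) auto

lemma phi_closed [simp]: "r \<in> carrier R \<Longrightarrow> \<phi> r \<in> carrier B"
  and psi_closed [simp]: "r \<in> carrier R \<Longrightarrow> \<psi> r \<in> carrier C"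
  using crings by (auto simp: ring_hom_closed)

lemma rels_closed: "rels \<subseteq> carrier F"
  unfolding rels_def by (auto intro!: F.minus_closed F.a_closed)

lemma J_ideal: "ideal J F"
  unfolding J_eq using rels_closed by (rule F.genideal_ideal)

lemma T_cring: "cring T"
  unfolding tensor_def by (rule quot_cring[OF J_ideal F.is_cring])

lemma q_hom: "(\<lambda>x. J +>\<^bsub>F\<^esub> x) \<in> ring_hom F T"
  unfolding tensor_def by (rule quot_hom[OF J_ideal])

lemma rel_eq: "x \<ominus>\<^bsub>F\<^esub> y \<in> rels \<Longrightarrow> x \<in> carrier F \<Longrightarrow> y \<in> carrier F \<Longrightarrow> J +>\<^bsub>F\<^esub> x = J +>\<^bsub>F\<^esub> y"
  using coset_eq_iff[OF J_ideal] F.genideal_self[OF rels_closed] unfolding J_eq by auto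

lemma pt_closed: "b \<in> carrier B \<Longrightarrow> c \<in> carrier C \<Longrightarrow> pt b c \<in> carrier T"
  unfolding pure_tensor_def using q_hom by (auto intro!: ring_hom_closed[OF q_hom])

lemma pt_mult:
  assumes "b \<in> carrier B" "c \<in> carrier C" "b' \<in> carrier B" "c' \<in> carrier C"
  shows "pt b c \<otimes>\<^bsub>T\<^esub> pt b' c' = pt (b \<otimes>\<^bsub>B\<^esub> b') (c \<otimes>\<^bsub>C\<^esub> c')"
  unfolding pure_tensor_def using assms
  by (subst ring_hom_mult[OF q_hom, symmetric]) (auto simp: F_eq MA.single_mult)

lemma pt_add1:
  assumes "b \<in> carrier B" "b' \<in> carrier B" "c \<in> carrier C"
  shows "pt (b \<oplus>\<^bsub>B\<^esub> b') c = pt b c \<oplus>\<^bsub>T\<^esub> pt b' c"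
proof -
  have "J +>\<^bsub>F\<^esub> single R \<one> (b \<oplus>\<^bsub>B\<^esub> b', c) = J +>\<^bsub>F\<^esub> (single R \<one> (b, c) \<oplus>\<^bsub>F\<^esub> single R \<one> (b', c))"
    by (rule rel_eq) (use assms in \<open>auto simp: rels_def intro!: F.a_closed\<close>)
  also have "\<dots> = pt b c \<oplus>\<^bsub>T\<^esub> pt b' c"
    unfolding pure_tensor_def by (rule ring_hom_add[OF q_hom]) (use assms in auto)
  finally show ?thesis unfolding pure_tensor_def .
qed

lemma pt_add2:
  assumes "b \<in> carrier B" "c \<in> carrier C" "c' \<in> carrier C"
  shows "pt b (c \<oplus>\<^bsub>C\<^esub> c') = pt b c \<oplus>\<^bsub>T\<^esub> pt b c'"
proof -
  have "J +>\<^bsub>F\<^esub> single R \<one> (b, c \<oplus>\<^bsub>C\<^esub> c') = J +>\<^bsub>F\<^esub> (single R \<one> (b, c) \<oplus>\<^bsub>F\<^esub> single R \<one> (b, c'))"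
    by (rule rel_eq) (use assms in \<open>auto simp: rels_def intro!: F.a_closed\<close>)
  also have "\<dots> = pt b c \<oplus>\<^bsub>T\<^esub> pt b c'"
    unfolding pure_tensor_def by (rule ring_hom_add[OF q_hom]) (use assms in auto)
  finally show ?thesis unfolding pure_tensor_def .
qed

lemma one_T: "\<one>\<^bsub>T\<^esub> = pt \<one>\<^bsub>B\<^esub> \<one>\<^bsub>C\<^esub>"
  unfolding pure_tensor_def ring_hom_one[OF q_hom, symmetric] by (simp add: F_eq MA.one_P)

lemma j1_hom: "j1 \<in> ring_hom B T"
  by (rule ring_hom_memI) (simp_all add: pt_closed pt_mult pt_add1 one_T)

lemma j2_hom: "j2 \<in> ring_hom C T"
  by (rule ring_hom_memI) (simp_all add: pt_closed pt_mult pt_add2 one_T)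

lemma j1_str: "r \<in> carrier R \<Longrightarrow> j1 (\<phi> r) = \<tau> r"
proof -
  assume r: "r \<in> carrier R"
  have "J +>\<^bsub>F\<^esub> single R \<one> (\<phi> r \<otimes>\<^bsub>B\<^esub> \<one>\<^bsub>B\<^esub>, \<one>\<^bsub>C\<^esub>) = J +>\<^bsub>F\<^esub> single R r (\<one>\<^bsub>B\<^esub>, \<one>\<^bsub>C\<^esub>)"
    by (rule rel_eq) (use r in \<open>unfold rels_def, blast, auto\<close>)
  then show ?thesis using r by (simp add: pure_tensor_def tensor_str_def)
qed

lemma j2_str: "r \<in> carrier R \<Longrightarrow> j2 (\<psi> r) = \<tau> r"
proof -
  assume r: "r \<in> carrier R"
  have "J +>\<^bsub>F\<^esub> single R \<one> (\<one>\<^bsub>B\<^esub>, \<psi> r \<otimes>\<^bsub>C\<^esub> \<one>\<^bsub>C\<^esub>) = J +>\<^bsub>F\<^esub> single R r (\<one>\<^bsub>B\<^esub>, \<one>\<^bsub>C\<^esub>)"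
    by (rule rel_eq) (use r in \<open>unfold rels_def, blast, auto\<close>)
  then show ?thesis using r by (simp add: pure_tensor_def tensor_str_def)
qed

lemma str_hom: "\<tau> \<in> ring_hom R T"
  using ring_hom_cong[OF ring_hom_comp[OF crings(4) j1_hom]] j1_str crings(1) by (simp add: cring.axioms)

lemma T_alg: "ring_hom_cring R T \<tau>"
  using crings(1) T_cring str_hom by (rule ring_hom_cringI)

lemma j1_alg: "j1 \<in> alg_hom R B \<phi> T \<tau>"
  using j1_hom j1_str by (rule alg_homI)

lemma j2_alg: "j2 \<in> alg_hom R C \<psi> T \<tau>"
  using j2_hom j2_str by (rule alg_homI)

lemma pt_eq: "b \<in> carrier B \<Longrightarrow> c \<in> carrier C \<Longrightarrow> pt b c = j1 b \<otimes>\<^bsub>T\<^esub> j2 c"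
  by (simp add: pt_mult)

text \<open>Scalars lie in the image of \<open>j1\<close>, and a pure tensor is the product of some
  \<open>j1 b\<close> and \<open>j2 c\<close>, so the two embeddings generate the tensor product as
  a ring. A homomorphism from it is determined by its two restrictions, the form in which tensor
  identities are checked below.\<close>

lemma T_generating_subring:
  assumes S: "subring S T" and 1: "\<And>b. b \<in> carrier B \<Longrightarrow> j1 b \<in> S"
    and 2: "\<And>c. c \<in> carrier C \<Longrightarrow> j2 c \<in> S"
  shows "carrier T \<subseteq> S"
proof -
  interpret T: cring T by (rule T_cring)
  let ?S = "{x \<in> carrier F. J +>\<^bsub>F\<^esub> x \<in> S}"
  have "subring ?S F"
    by (rule F.subringI)
      (use S subringE[OF S] q_hom in
        \<open>auto simp: ring_hom_add[OF q_hom] ring_hom_mult[OF q_hom] ring_hom_one[OF q_hom]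
          ring_hom_a_inv[OF q_hom F.ring_axioms T.ring_axioms]\<close>)
  moreover have "single R r \<one>\<^bsub>B \<times>\<times> C\<^esub> \<in> ?S" if "r \<in> carrier R" for r
    using that 1[of "\<phi> r"] by (simp add: j1_str tensor_str_def)
  moreover have "single R \<one> g \<in> ?S" if gBC: "g \<in> carrier (B \<times>\<times> C)" for g
  proof -
    obtain b c where g: "g = (b, c)" "b \<in> carrier B" "c \<in> carrier C" using gBC by (cases g) auto
    have "pt b c \<in> S" unfolding pt_eq[OF g(2,3)] by (intro subringE(6)[OF S] 1 2 g)
    then show ?thesis using g by (simp add: pure_tensor_def)
  qed
  ultimately have "carrier F \<subseteq> ?S"
    unfolding F_eq by (rule MA.generating_subring)
  then show ?thesis unfolding tensor_def by (auto simp: carrier_Quot)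
qed

lemma T_hom_eqI:
  assumes "f \<in> ring_hom T D" "g \<in> ring_hom T D" "ring D"
    "\<And>b. b \<in> carrier B \<Longrightarrow> f (j1 b) = g (j1 b)" "\<And>c. c \<in> carrier C \<Longrightarrow> f (j2 c) = g (j2 c)"
    "x \<in> carrier T"
  shows "f x = g x"
proof -
  interpret T: cring T by (rule T_cring)
  have "carrier T \<subseteq> {x \<in> carrier T. f x = g x}"
    by (rule T_generating_subring[OF subring_equalizer[OF assms(1,2) T.ring_axioms assms(3)]])
      (use assms pt_closed in auto)
  then show ?thesis using assms by auto
qed

context
  fixes D :: "('d, 'q) ring_scheme" and \<chi> f g
  assumes D: "cring D" and chi: "\<chi> \<in> ring_hom R D"
    and f: "f \<in> alg_hom R B \<phi> D \<chi>" and g: "g \<in> alg_hom R C \<psi> D \<chi>"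
begin

interpretation D: cring D by (rule D)

abbreviation "lf \<equiv> ma_lift R D \<chi> (\<lambda>z. f (fst z) \<otimes>\<^bsub>D\<^esub> g (snd z))"

lemma tensor_lift_eq: "tensor_lift R D \<chi> f g = (\<lambda>Z. the_elem (lf ` Z))"
  by (simp add: tensor_lift_def ma_lift_def fun_eq_iff)

lemma fr: "f \<in> ring_hom B D" and gr: "g \<in> ring_hom C D"
  using f g by (auto intro: alg_hom_ring_hom)

lemma lf_hom: "lf \<in> ring_hom F D"
  unfolding F_eq
  by (rule MA.lift_hom[OF D chi])
    (auto simp: ring_hom_closed[OF fr] ring_hom_closed[OF gr] ring_hom_mult[OF fr] ring_hom_mult[OF gr]
      D.m_ac ring_hom_one[OF fr] ring_hom_one[OF gr])

lemma lf_single: "r \<in> carrier R \<Longrightarrow> b \<in> carrier B \<Longrightarrow> c \<in> carrier C \<Longrightarrow>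
    lf (single R r (b, c)) = \<chi> r \<otimes>\<^bsub>D\<^esub> (f b \<otimes>\<^bsub>D\<^esub> g c)"
  by (subst MA.lift_single[OF D chi])
    (auto simp: ring_hom_closed[OF fr] ring_hom_closed[OF gr] ring_hom_mult[OF fr] ring_hom_mult[OF gr]
      D.m_ac ring_hom_one[OF fr] ring_hom_one[OF gr])

lemma lf_rels: "x \<in> rels \<Longrightarrow> lf x = \<zero>\<^bsub>D\<^esub>"
proof -
  \<comment> \<open>Every generator of the ideal is a difference, so it dies once both terms have
    the same image. The four cases are additivity and linearity of \<open>f\<close> and of
    \<open>g\<close>.\<close>
  have *: "lf (x \<ominus>\<^bsub>F\<^esub> y) = \<zero>\<^bsub>D\<^esub>" if "lf x = lf y" "x \<in> carrier F" "y \<in> carrier F" for x y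
    using that ring_hom_eq_iff_minus[OF lf_hom F.ring_axioms D.ring_axioms] by blast
  note c = ring_hom_closed[OF fr] ring_hom_closed[OF gr] ring_hom_closed[OF chi]
  note one = ring_hom_one[OF chi]
  note s = alg_hom_str[OF f] alg_hom_str[OF g]
  note m = ring_hom_mult[OF fr] ring_hom_mult[OF gr] ring_hom_add[OF fr] ring_hom_add[OF gr]
  note simps = lf_single c one s m ring_hom_add[OF lf_hom]
  assume "x \<in> rels"
  then show ?thesis unfolding rels_def
    by (elim UnE CollectE exE conjE; hypsubst; intro *;
        simp add: simps D.l_distr D.r_distr D.m_assoc D.m_lcomm)
qed

lemma lf_J: "x \<in> J \<Longrightarrow> lf x = \<zero>\<^bsub>D\<^esub>"
  using genideal_kernel[OF lf_hom F.ring_axioms D.ring_axioms rels_closed lf_rels] unfolding J_eq by blast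

lemma tensor_lift_hom: "tensor_lift R D \<chi> f g \<in> ring_hom T D"
  unfolding tensor_lift_eq tensor_def
  by (rule quot_lift_hom[OF J_ideal F.ring_axioms D.ring_axioms lf_hom lf_J])

lemma tensor_lift_pt:
  "b \<in> carrier B \<Longrightarrow> c \<in> carrier C \<Longrightarrow> tensor_lift R D \<chi> f g (pt b c) = f b \<otimes>\<^bsub>D\<^esub> g c"
  unfolding tensor_lift_eq pure_tensor_def
  by (subst quot_lift_eq[OF J_ideal F.ring_axioms D.ring_axioms lf_hom lf_J])
    (auto simp: lf_single ring_hom_one[OF chi] ring_hom_closed[OF fr] ring_hom_closed[OF gr])

lemma tensor_lift_j1: "b \<in> carrier B \<Longrightarrow> tensor_lift R D \<chi> f g (j1 b) = f b"
  by (simp add: tensor_lift_pt ring_hom_one[OF gr] ring_hom_closed[OF fr])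

lemma tensor_lift_j2: "c \<in> carrier C \<Longrightarrow> tensor_lift R D \<chi> f g (j2 c) = g c"
  by (simp add: tensor_lift_pt ring_hom_one[OF fr] ring_hom_closed[OF gr])

lemma tensor_lift_alg: "tensor_lift R D \<chi> f g \<in> alg_hom R T \<tau> D \<chi>"
  using tensor_lift_hom
  by (rule alg_homI) (simp add: j1_str[symmetric] tensor_lift_j1 alg_hom_str[OF f])

end

end

section \<open>Smooth algebras\<close>

lemma ideal_prod_le:
  assumes "ideal K R" "\<And>i j. i \<in> I \<Longrightarrow> j \<in> J \<Longrightarrow> i \<otimes>\<^bsub>R\<^esub> j \<in> K" "x \<in> I \<cdot>\<^bsub>R\<^esub> J"
  shows "x \<in> K"
  using assms(3)
proof (induction x rule: ideal_prod.induct)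
  case (prod i j)
  then show ?case using assms(2) by blast
next
  case (sum s1 s2)
  show ?case
    using sum.IH by (rule additive_subgroup.a_closed[OF ideal.axioms(1)[OF assms(1)]])
qed

locale alg_presentation =
  fixes R :: "('r, 'm) ring_scheme" and A :: "('a, 'n) ring_scheme" and \<phi> n F \<pi>
  assumes alg: "ring_hom_cring R A \<phi>"
    and pi: "\<pi> \<in> alg_hom R (mpoly_ring R n) (\<lambda>r. single R r {#}) A \<phi>"
    and surj: "\<pi> ` carrier (mpoly_ring R n) = carrier A"
    and fin: "finite F" and F: "F \<subseteq> carrier (mpoly_ring R n)"
    and ker: "a_kernel (mpoly_ring R n) A \<pi> = Idl\<^bsub>mpoly_ring R n\<^esub> F"
begin

abbreviation "Pn \<equiv> mpoly_ring R n"
abbreviation "cst r \<equiv> single R r {#}"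
abbreviation "vr i \<equiv> single R \<one>\<^bsub>R\<^esub> {#i::nat#}"

definition "J = Idl\<^bsub>Pn\<^esub> F"
definition "J2 = J \<cdot>\<^bsub>Pn\<^esub> J"

lemmas algD = ring_hom_cringD[OF alg]

lemma Pn_cring: "cring Pn" and Pn_ring: "ring Pn"
  using mpoly_ring_cring[OF algD(1)] by (auto simp: cring.axioms)

lemma J_ideal: "ideal J Pn"
  unfolding J_def using F by (rule ring.genideal_ideal[OF Pn_ring])

lemma J2_ideal: "ideal J2 Pn"
  unfolding J2_def using J_ideal by (intro ring.ideal_prod_is_ideal[OF Pn_ring])

lemma J2_sub: "J2 \<subseteq> J"
  unfolding J2_def using ring.ideal_prod_inter[OF Pn_ring J_ideal J_ideal] by blast

lemma J_closed: "x \<in> J \<Longrightarrow> x \<in> carrier Pn"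
  using J_ideal by (meson additive_subgroup.a_Hcarr ideal.axioms(1))

lemma mem_J_iff: "x \<in> J \<longleftrightarrow> x \<in> carrier Pn \<and> \<pi> x = \<zero>\<^bsub>A\<^esub>"
  unfolding J_def ker[symmetric] a_kernel_def' by blast

lemma pi_hom: "\<pi> \<in> ring_hom Pn A"
  using pi by (rule alg_hom_ring_hom)

lemma cst_closed: "r \<in> carrier R \<Longrightarrow> cst r \<in> carrier Pn"
  using mpoly_const_hom[OF algD(1)] by (rule ring_hom_closed)

lemma var_closed: "i < n \<Longrightarrow> vr i \<in> carrier Pn"
  using algD(1) by (rule mpoly_var_closed)

lemma mem_J_minus:
  assumes "p \<in> carrier Pn" "q \<in> carrier Pn"
  shows "p \<ominus>\<^bsub>Pn\<^esub> q \<in> J \<longleftrightarrow> \<pi> p = \<pi> q"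
  using assms ring_hom_eq_iff_minus[OF pi_hom Pn_ring algD(5) assms] ring.ring_simprules(4)[OF Pn_ring]
  unfolding mem_J_iff by blast

lemma preimage: assumes "a \<in> carrier A" obtains p where "p \<in> carrier Pn" "\<pi> p = a"
proof -
  have "a \<in> \<pi> ` carrier Pn" using assms surj by simp
  with that show thesis by blast
qed

end

lemma finitely_presentedE:
  assumes "ring_hom_cring R A \<phi>" "finitely_presented R A \<phi>"
  obtains n F \<pi> where "alg_presentation R A \<phi> n F \<pi>"
  using assms unfolding finitely_presented_def alg_presentation_def by blast

lemma (in alg_presentation) finitely_presented: "finitely_presented R A \<phi>"
  unfolding finitely_presented_def using pi surj fin F ker by blast

text \<open>Smoothness enters through \<open>\<sigma>\<close>, a section of the projection from
  P/J^2 to A. The section property speaks of representatives in P, which avoids the double quotient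
  of P/J^2 by J/J^2.\<close>

locale smooth_presentation = alg_presentation +
  fixes \<sigma>
  assumes sigma: "\<sigma> \<in> alg_hom R A \<phi> (Pn Quot J2) (\<lambda>r. J2 +>\<^bsub>Pn\<^esub> cst r)"
    and section_sigma: "\<And>p q. p \<in> carrier Pn \<Longrightarrow> q \<in> carrier Pn \<Longrightarrow> \<sigma> (\<pi> p) = J2 +>\<^bsub>Pn\<^esub> q \<Longrightarrow> \<pi> q = \<pi> p"

lemma formally_smoothD:
  fixes C :: "'c ring"
  assumes "formally_smooth TYPE('c) R A \<phi>" "ring_hom_cring R C \<psi>" "ideal J C"
    "\<forall>x\<in>J. \<forall>y\<in>J. x \<otimes>\<^bsub>C\<^esub> y = \<zero>\<^bsub>C\<^esub>"
    "u \<in> alg_hom R A \<phi> (C Quot J) (\<lambda>r. J +>\<^bsub>C\<^esub> \<psi> r)"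
  shows "\<exists>v\<in>alg_hom R A \<phi> C \<psi>. \<forall>a\<in>carrier A. J +>\<^bsub>C\<^esub> v a = u a"
  using assms(1) unfolding formally_smooth_def
  by (elim allE[of _ C] allE[of _ \<psi>] allE[of _ J] allE[of _ u] impE) (intro conjI assms(2-5))

text \<open>The lifting property is applied to C = P/J^2, its ideal J/J^2 and the canonical map
  \<open>u\<close> from A to the double quotient. Every application of smoothness passes through
  this one test algebra, which fixes the type in the hypothesis.\<close>

lemma smoothE:
  fixes R :: "('r, 'm) ring_scheme"
  assumes "smooth TYPE((nat multiset \<Rightarrow> 'r) set) R A \<phi>"
  obtains n F \<pi> \<sigma> where "smooth_presentation R A \<phi> n F \<pi> \<sigma>"
proof -
  obtain n F \<pi> where "alg_presentation R A \<phi> n F \<pi>"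
    using assms finitely_presentedE unfolding smooth_def by blast
  then interpret alg_presentation R A \<phi> n F \<pi> .
  let ?C = "Pn Quot J2" and ?J = "(\<lambda>x. J2 +>\<^bsub>Pn\<^esub> x) ` J"
  have C: "cring ?C" by (rule quot_cring[OF J2_ideal Pn_cring])
  have q: "(\<lambda>x. J2 +>\<^bsub>Pn\<^esub> x) \<in> ring_hom Pn ?C" by (rule quot_hom[OF J2_ideal])
  have strC: "ring_hom_cring R ?C (\<lambda>r. J2 +>\<^bsub>Pn\<^esub> cst r)"
    using algD(1) C ring_hom_comp[OF mpoly_const_hom[OF algD(1)] q] by (rule ring_hom_cringI)
  have J: "ideal ?J ?C"
    using ring.ring_ideal_imp_quot_ideal[OF Pn_ring J2_ideal J_ideal] .
  have q': "(\<lambda>x. ?J +>\<^bsub>?C\<^esub> x) \<in> ring_hom ?C (?C Quot ?J)" by (rule quot_hom[OF J])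
  have C': "cring (?C Quot ?J)" by (rule quot_cring[OF J C])
  have ker0: "?J +>\<^bsub>?C\<^esub> (J2 +>\<^bsub>Pn\<^esub> x) = \<zero>\<^bsub>?C Quot ?J\<^esub>" if "x \<in> carrier Pn" "\<pi> x = \<zero>\<^bsub>A\<^esub>" for x
  proof -
    have "J2 +>\<^bsub>Pn\<^esub> x \<in> ?J" using that mem_J_iff by blast
    then show ?thesis
      using coset_zero_iff[OF J ring_hom_closed[OF q that(1)]] by (simp add: zero_Quot)
  qed
  obtain u where u: "u \<in> ring_hom A (?C Quot ?J)"
    and u_eq: "\<And>x. x \<in> carrier Pn \<Longrightarrow> u (\<pi> x) = ?J +>\<^bsub>?C\<^esub> (J2 +>\<^bsub>Pn\<^esub> x)"
    by (rule hom_factor[OF pi_hom surj ring_hom_comp[OF q q'] ker0 Pn_ring algD(5)])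
      (use C' in \<open>auto simp: cring.axioms\<close>)
  have u_alg: "u \<in> alg_hom R A \<phi> (?C Quot ?J) (\<lambda>r. ?J +>\<^bsub>?C\<^esub> (J2 +>\<^bsub>Pn\<^esub> cst r))"
    using u by (rule alg_homI) (simp add: alg_hom_str[OF pi, symmetric] u_eq cst_closed)
  have sq: "\<forall>x\<in>?J. \<forall>y\<in>?J. x \<otimes>\<^bsub>?C\<^esub> y = \<zero>\<^bsub>?C\<^esub>"
  proof (intro ballI)
    fix x y assume "x \<in> ?J" "y \<in> ?J"
    then obtain a b where ab: "a \<in> J" "b \<in> J" "x = J2 +>\<^bsub>Pn\<^esub> a" "y = J2 +>\<^bsub>Pn\<^esub> b" by blast
    have "a \<otimes>\<^bsub>Pn\<^esub> b \<in> J2" unfolding J2_def using ab by (intro ideal_prod.prod)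
    moreover have "a \<otimes>\<^bsub>Pn\<^esub> b \<in> carrier Pn"
      using ab J_closed by (intro ring.ring_simprules(5)[OF Pn_ring])
    moreover have "x \<otimes>\<^bsub>?C\<^esub> y = J2 +>\<^bsub>Pn\<^esub> (a \<otimes>\<^bsub>Pn\<^esub> b)"
      unfolding ab by (rule ring_hom_mult[OF q, symmetric]) (use ab J_closed in auto)
    ultimately show "x \<otimes>\<^bsub>?C\<^esub> y = \<zero>\<^bsub>?C\<^esub>"
      using coset_zero_iff[OF J2_ideal] by (simp add: zero_Quot)
  qed
  have "formally_smooth TYPE((nat multiset \<Rightarrow> 'r) set) R A \<phi>"
    using assms by (simp add: smooth_def)
  then obtain \<sigma> where s: "\<sigma> \<in> alg_hom R A \<phi> ?C (\<lambda>r. J2 +>\<^bsub>Pn\<^esub> cst r)"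
    and s_eq: "\<And>a. a \<in> carrier A \<Longrightarrow> ?J +>\<^bsub>?C\<^esub> \<sigma> a = u a"
    using formally_smoothD[OF _ strC J sq u_alg] by blast
  have "smooth_presentation R A \<phi> n F \<pi> \<sigma>"
  proof (unfold_locales, rule s)
    fix p q assume p: "p \<in> carrier Pn" and qq: "q \<in> carrier Pn" and e: "\<sigma> (\<pi> p) = J2 +>\<^bsub>Pn\<^esub> q"
    have cl: "J2 +>\<^bsub>Pn\<^esub> q \<in> carrier ?C" "J2 +>\<^bsub>Pn\<^esub> p \<in> carrier ?C"
      using p qq by (auto intro: coset_closed)
    have "?J +>\<^bsub>?C\<^esub> (J2 +>\<^bsub>Pn\<^esub> q) = ?J +>\<^bsub>?C\<^esub> (J2 +>\<^bsub>Pn\<^esub> p)"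
      using s_eq[OF ring_hom_closed[OF pi_hom p]] u_eq[OF p] e by simp
    then have "(J2 +>\<^bsub>Pn\<^esub> q) \<ominus>\<^bsub>?C\<^esub> (J2 +>\<^bsub>Pn\<^esub> p) \<in> ?J"
      using coset_eq_iff[OF J cl] by blast
    moreover have "(J2 +>\<^bsub>Pn\<^esub> q) \<ominus>\<^bsub>?C\<^esub> (J2 +>\<^bsub>Pn\<^esub> p) = J2 +>\<^bsub>Pn\<^esub> (q \<ominus>\<^bsub>Pn\<^esub> p)"
      using ring_hom_minus[OF q Pn_ring _ qq p] C by (simp add: cring.axioms)
    \<comment> \<open>Agreement in the double quotient puts q - p, modulo J^2, into the image of J;
      as J^2 is contained in J, the difference q - p itself lies in J.\<close>
    ultimately obtain x where x: "x \<in> J" "J2 +>\<^bsub>Pn\<^esub> (q \<ominus>\<^bsub>Pn\<^esub> p) = J2 +>\<^bsub>Pn\<^esub> x" by auto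
    have qp: "q \<ominus>\<^bsub>Pn\<^esub> p \<in> carrier Pn" using p qq by (intro ring.ring_simprules(4)[OF Pn_ring])
    then have "(q \<ominus>\<^bsub>Pn\<^esub> p) \<ominus>\<^bsub>Pn\<^esub> x \<in> J"
      using coset_eq_iff[OF J2_ideal qp J_closed[OF x(1)]] x J2_sub by blast
    then show "\<pi> q = \<pi> p"
      using mem_J_minus[OF qp J_closed[OF x(1)]] x(1) mem_J_minus[OF qq p] mem_J_iff qp by auto
  qed
  then show thesis by (rule that)
qed

context smooth_presentation
begin

lemma sigma_rep:
  assumes "a \<in> carrier A" obtains q where "q \<in> carrier Pn" "\<sigma> a = J2 +>\<^bsub>Pn\<^esub> q" "\<pi> q = a"
proof -
  obtain p where p: "p \<in> carrier Pn" "\<pi> p = a" using assms by (rule preimage)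
  have "\<sigma> a \<in> carrier (Pn Quot J2)" using sigma assms by (rule alg_hom_closed)
  then obtain q where "q \<in> carrier Pn" "\<sigma> a = J2 +>\<^bsub>Pn\<^esub> q" by (auto simp: carrier_Quot)
  then show thesis using that section_sigma p by blast
qed

text \<open>The images of the variables are lifted along \<open>q\<close> arbitrarily, which gives
  \<open>\<rho>\<close> on P. It sends J into the kernel of \<open>q\<close>, whose square is zero,
  so it kills J^2 and descends to P/J^2; composition with \<open>\<sigma>\<close> corrects the
  arbitrary choice. A surjection \<open>q\<close> takes the place of a quotient because the lemma is
  later applied to \<open>map_prod q q\<close>.\<close>

lemma lifting:
  assumes C: "cring C" and D: "cring D" and chi: "\<chi> \<in> ring_hom R C"
    and q: "q \<in> ring_hom C D" and q_surj: "q ` carrier C = carrier D"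
    and sq: "\<And>x y. x \<in> carrier C \<Longrightarrow> y \<in> carrier C \<Longrightarrow> q x = \<zero>\<^bsub>D\<^esub> \<Longrightarrow> q y = \<zero>\<^bsub>D\<^esub> \<Longrightarrow> x \<otimes>\<^bsub>C\<^esub> y = \<zero>\<^bsub>C\<^esub>"
    and u: "u \<in> alg_hom R A \<phi> D (\<lambda>r. q (\<chi> r))"
  obtains v where "v \<in> alg_hom R A \<phi> C \<chi>" "\<And>a. a \<in> carrier A \<Longrightarrow> q (v a) = u a"
proof -
  have rC: "ring C" and rD: "ring D" using C D by (auto simp: cring.axioms)
  note ur = alg_hom_ring_hom[OF u]
  define c where "c i = (SOME x. x \<in> carrier C \<and> q x = u (\<pi> (vr i)))" for i
  have c: "c i \<in> carrier C \<and> q (c i) = u (\<pi> (vr i))" if "i < n" for i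
  proof -
    have "u (\<pi> (vr i)) \<in> carrier D"
      using var_closed[OF that] by (intro ring_hom_closed[OF ur] ring_hom_closed[OF pi_hom])
    then obtain x where "x \<in> carrier C \<and> q x = u (\<pi> (vr i))" using q_surj by force
    then show ?thesis unfolding c_def by (rule someI)
  qed
  obtain \<rho> where rho: "\<rho> \<in> alg_hom R Pn cst C \<chi>" and rho_var: "\<And>i. i < n \<Longrightarrow> \<rho> (vr i) = c i"
    by (rule mpoly_lift[OF algD(1) C chi, of n c]) (use c in auto)
  note rr = alg_hom_ring_hom[OF rho]
  have q_rho: "q (\<rho> p) = u (\<pi> p)" if "p \<in> carrier Pn" for p
    by (rule mpoly_hom_eqI[OF algD(1) rD ring_hom_comp[OF rr q] ring_hom_comp[OF pi_hom ur] _ _ that])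
      (simp_all add: alg_hom_str[OF rho] alg_hom_str[OF pi] alg_hom_str[OF u] rho_var c)
  have rho_J: "q (\<rho> x) = \<zero>\<^bsub>D\<^esub>" if "x \<in> J" for x
    using that q_rho mem_J_iff ring_hom_zero[OF ur algD(5) rD] by simp
  have K: "ideal {x \<in> carrier Pn. \<rho> x = \<zero>\<^bsub>C\<^esub>} Pn" by (rule ideal_kernel[OF rr Pn_ring rC])
  have rho_J2: "\<rho> x = \<zero>\<^bsub>C\<^esub>" if "x \<in> J2" for x
  proof -
    have "x \<in> {x \<in> carrier Pn. \<rho> x = \<zero>\<^bsub>C\<^esub>}"
    proof (rule ideal_prod_le[OF K _ that[unfolded J2_def]])
      fix i j assume ij: "i \<in> J" "j \<in> J"
      then have cl: "i \<in> carrier Pn" "j \<in> carrier Pn" using J_closed by auto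
      then have "\<rho> i \<otimes>\<^bsub>C\<^esub> \<rho> j = \<zero>\<^bsub>C\<^esub>"
        using ij by (intro sq rho_J) (auto intro: ring_hom_closed[OF rr])
      then show "i \<otimes>\<^bsub>Pn\<^esub> j \<in> {x \<in> carrier Pn. \<rho> x = \<zero>\<^bsub>C\<^esub>}"
        using cl by (simp add: ring_hom_mult[OF rr] ring.ring_simprules(5)[OF Pn_ring])
    qed
    then show ?thesis by simp
  qed
  define \<rho>' where "\<rho>' = (\<lambda>Z. the_elem (\<rho> ` Z))"
  have rho': "\<rho>' \<in> ring_hom (Pn Quot J2) C"
    unfolding \<rho>'_def by (rule quot_lift_hom[OF J2_ideal Pn_ring rC rr rho_J2])
  have rho'_eq: "\<rho>' (J2 +>\<^bsub>Pn\<^esub> p) = \<rho> p" if "p \<in> carrier Pn" for p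
    unfolding \<rho>'_def by (rule quot_lift_eq[OF J2_ideal Pn_ring rC rr rho_J2 that])
  have "(\<lambda>a. \<rho>' (\<sigma> a)) \<in> alg_hom R A \<phi> C \<chi>"
    using ring_hom_comp[OF alg_hom_ring_hom[OF sigma] rho']
    by (rule alg_homI) (simp add: alg_hom_str[OF sigma] rho'_eq cst_closed alg_hom_str[OF rho])
  moreover have "q (\<rho>' (\<sigma> a)) = u a" if a: "a \<in> carrier A" for a
  proof -
    obtain p where "p \<in> carrier Pn" "\<sigma> a = J2 +>\<^bsub>Pn\<^esub> p" "\<pi> p = a" using a by (rule sigma_rep)
    then show ?thesis by (simp add: rho'_eq q_rho)
  qed
  ultimately show thesis by (rule that)
qed

text \<open>Newton's method: modifying the variables by elements of the ideal moves the ideal into its square.\<close>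

lemma newton:
  obtains N where "N \<in> alg_hom R Pn cst Pn cst" "\<And>p. p \<in> carrier Pn \<Longrightarrow> N p \<ominus>\<^bsub>Pn\<^esub> p \<in> J"
    "\<And>x. x \<in> J \<Longrightarrow> N x \<in> J2"
proof -
  define c where "c i = (SOME q. q \<in> carrier Pn \<and> \<sigma> (\<pi> (vr i)) = J2 +>\<^bsub>Pn\<^esub> q)" for i
  have c: "c i \<in> carrier Pn \<and> \<sigma> (\<pi> (vr i)) = J2 +>\<^bsub>Pn\<^esub> c i" if i: "i < n" for i
  proof -
    have "\<exists>q. q \<in> carrier Pn \<and> \<sigma> (\<pi> (vr i)) = J2 +>\<^bsub>Pn\<^esub> q"
      using sigma_rep[OF ring_hom_closed[OF pi_hom var_closed[OF i]]] by blast
    then show ?thesis unfolding c_def by (rule someI_ex)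
  qed
  obtain N where N: "N \<in> alg_hom R Pn cst Pn cst" and N_var: "\<And>i. i < n \<Longrightarrow> N (vr i) = c i"
    by (rule mpoly_lift[OF algD(1) Pn_cring mpoly_const_hom[OF algD(1)], of n c]) (use c in auto)
  note Nr = alg_hom_ring_hom[OF N]
  have rQ: "ring (Pn Quot J2)" using quot_cring[OF J2_ideal Pn_cring] by (simp add: cring.axioms)
  \<comment> \<open>Thus \<open>N\<close> represents \<open>\<sigma>\<close> after
    \<open>\<pi>\<close>. It is congruent to the identity modulo J because \<open>\<sigma>\<close>
    is a section, and it sends J into J^2 because \<open>\<pi>\<close> kills J.\<close>
  have eq: "\<sigma> (\<pi> p) = J2 +>\<^bsub>Pn\<^esub> N p" if "p \<in> carrier Pn" for p
    by (rule mpoly_hom_eqI[OF algD(1) rQ ring_hom_comp[OF pi_hom alg_hom_ring_hom[OF sigma]]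
          ring_hom_comp[OF Nr quot_hom[OF J2_ideal]] _ _ that])
      (simp_all add: alg_hom_str[OF N] alg_hom_str[OF pi] alg_hom_str[OF sigma] N_var c)
  have cl: "N p \<in> carrier Pn" if "p \<in> carrier Pn" for p using Nr that by (rule ring_hom_closed)
  show thesis
  proof (rule that[OF N])
    fix p assume p: "p \<in> carrier Pn"
    show "N p \<ominus>\<^bsub>Pn\<^esub> p \<in> J"
      using section_sigma[OF p cl[OF p] eq[OF p]] mem_J_minus[OF cl[OF p] p] by simp
  next
    fix x assume x: "x \<in> J"
    then have "J2 +>\<^bsub>Pn\<^esub> N x = \<sigma> \<zero>\<^bsub>A\<^esub>" using eq[of x] unfolding mem_J_iff by simp
    also have "\<dots> = J2" using ring_hom_zero[OF alg_hom_ring_hom[OF sigma] algD(5) rQ] by (simp add: zero_Quot)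
    finally show "N x \<in> J2" using coset_zero_iff[OF J2_ideal cl[OF J_closed[OF x]]] by simp
  qed
qed

end

text \<open>Quotients by square-zero ideals are replaced by surjections with square-zero kernel, the
  form in which \<open>universal_lifting\<close> is stated. The type of \<open>D\<close> is that of
  cosets in \<open>C\<close>.\<close>

lemma formally_smoothI:
  fixes A :: "('a, 'n) ring_scheme"
  assumes "\<And>(C :: 'c ring) (D :: 'c set ring) \<chi> q u. cring C \<Longrightarrow> cring D \<Longrightarrow> \<chi> \<in> ring_hom R C \<Longrightarrow>
      q \<in> ring_hom C D \<Longrightarrow> q ` carrier C = carrier D \<Longrightarrow>
      (\<And>x y. x \<in> carrier C \<Longrightarrow> y \<in> carrier C \<Longrightarrow> q x = \<zero>\<^bsub>D\<^esub> \<Longrightarrow> q y = \<zero>\<^bsub>D\<^esub> \<Longrightarrow> x \<otimes>\<^bsub>C\<^esub> y = \<zero>\<^bsub>C\<^esub>) \<Longrightarrow>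
      u \<in> alg_hom R A \<phi> D (\<lambda>r. q (\<chi> r)) \<Longrightarrow> \<exists>v\<in>alg_hom R A \<phi> C \<chi>. \<forall>a\<in>carrier A. q (v a) = u a"
  shows "formally_smooth TYPE('c) R A \<phi>"
  unfolding formally_smooth_def
proof (intro allI impI, elim conjE)
  fix C :: "'c ring" and \<psi> J u
  assume C: "ring_hom_cring R C \<psi>" and J: "ideal J C"
    and sq: "\<forall>x\<in>J. \<forall>y\<in>J. x \<otimes>\<^bsub>C\<^esub> y = \<zero>\<^bsub>C\<^esub>" and u: "u \<in> alg_hom R A \<phi> (C Quot J) (\<lambda>r. J +>\<^bsub>C\<^esub> \<psi> r)"
  note C' = ring_hom_cringD[OF C]
  show "\<exists>v\<in>alg_hom R A \<phi> C \<psi>. \<forall>a\<in>carrier A. J +>\<^bsub>C\<^esub> v a = u a"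
  proof (rule assms[OF C'(2) quot_cring[OF J C'(2)] C'(3) quot_hom[OF J] _ _ u])
    fix x y assume "x \<in> carrier C" "y \<in> carrier C" "J +>\<^bsub>C\<^esub> x = \<zero>\<^bsub>C Quot J\<^esub>" "J +>\<^bsub>C\<^esub> y = \<zero>\<^bsub>C Quot J\<^esub>"
    then show "x \<otimes>\<^bsub>C\<^esub> y = \<zero>\<^bsub>C\<^esub>"
      using sq coset_zero_iff[OF J] by (simp add: zero_Quot)
  qed (simp add: carrier_Quot)
qed

section \<open>Noetherian subrings\<close>

text \<open>An ideal of the subring \<open>S\<close>, written with the operations of the ambient
  ring \<open>P\<close>, so that enlarging \<open>S\<close> leaves the ring fixed. Closure under
  negation follows, since a subring contains -1.\<close>

definition sub_ideal :: "('a, 'm) ring_scheme \<Rightarrow> 'a set \<Rightarrow> 'a set \<Rightarrow> bool"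
  where "sub_ideal P S D \<longleftrightarrow> D \<subseteq> S \<and> \<zero>\<^bsub>P\<^esub> \<in> D \<and> (\<forall>a\<in>D. \<forall>b\<in>D. a \<oplus>\<^bsub>P\<^esub> b \<in> D) \<and>
    (\<forall>s\<in>S. \<forall>a\<in>D. s \<otimes>\<^bsub>P\<^esub> a \<in> D)"

definition ideal_acc :: "('a, 'm) ring_scheme \<Rightarrow> 'a set \<Rightarrow> bool"
  where "ideal_acc P S \<longleftrightarrow> (\<forall>D :: nat \<Rightarrow> 'a set. (\<forall>n. sub_ideal P S (D n)) \<and> (\<forall>n. D n \<subseteq> D (Suc n)) \<longrightarrow>
    (\<exists>n. \<forall>m\<ge>n. D m = D n))"

lemma sub_idealD:
  assumes "sub_ideal P S D"
  shows "D \<subseteq> S" "\<zero>\<^bsub>P\<^esub> \<in> D" "\<And>a b. a \<in> D \<Longrightarrow> b \<in> D \<Longrightarrow> a \<oplus>\<^bsub>P\<^esub> b \<in> D"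
    "\<And>s a. s \<in> S \<Longrightarrow> a \<in> D \<Longrightarrow> s \<otimes>\<^bsub>P\<^esub> a \<in> D"
  using assms by (auto simp: sub_ideal_def)

lemma ideal_accD:
  assumes "ideal_acc P S" "\<And>n. sub_ideal P S (D n)" "\<And>n. D n \<subseteq> D (Suc n)"
  obtains n where "\<And>m. n \<le> m \<Longrightarrow> D m = D n"
  using assms unfolding ideal_acc_def by meson

lemma ideal_sub_ideal: "ideal D Q \<Longrightarrow> sub_ideal Q (carrier Q) D"
  unfolding sub_ideal_def
  by (meson additive_subgroup.a_closed additive_subgroup.a_subset additive_subgroup.zero_closed
      ideal.I_l_closed ideal.axioms(1))

lemma ideal_acc_maximal:
  assumes acc: "ideal_acc P S" and id: "\<And>D. D \<in> M \<Longrightarrow> sub_ideal P S D" and "D0 \<in> M"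
  obtains D where "D \<in> M" "\<And>E. E \<in> M \<Longrightarrow> D \<subseteq> E \<Longrightarrow> E = D"
proof (rule ccontr)
  assume "\<not> thesis"
  with that have ex: "\<exists>E. E \<in> M \<and> D \<subset> E" if D: "D \<in> M" for D using D by blast
  have "\<exists>f. \<forall>n. f n \<in> M \<and> f n \<subset> f (Suc n)"
    by (rule dependent_nat_choice) (use assms(3) ex in blast)+
  then obtain f where f: "\<And>n. f n \<in> M" "\<And>n. f n \<subset> f (Suc n)" by blast
  obtain n where "\<And>m. n \<le> m \<Longrightarrow> f m = f n"
    by (rule ideal_accD[OF acc, of f]) (use f id in auto)
  then show False using f(2)[of n] by (metis le_Suc_eq order_refl psubset_eq)
qed

context cring
begin

lemma sub_ideal_minus:
  assumes S: "subring S R" and D: "sub_ideal R S D" and a: "a \<in> D" and b: "b \<in> D"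
  shows "a \<ominus> b \<in> D"
proof -
  have SC: "S \<subseteq> carrier R" using S by (rule subringE(1))
  have "b \<in> carrier R" using sub_idealD(1)[OF D] SC b by blast
  then have "\<ominus> b = (\<ominus> \<one>) \<otimes> b" by (simp add: l_minus)
  also have "\<dots> \<in> D" using b by (intro sub_idealD(4)[OF D] subringE(5)[OF S] subringE(3)[OF S])
  finally show ?thesis unfolding a_minus_def using a by (intro sub_idealD(3)[OF D])
qed

text \<open>The values at \<open>x\<close> of polynomials of degree less than \<open>n\<close> with
  coefficients in \<open>S\<close>. An element may have many such expressions; the last step of the
  recursion isolates the leading term of one of them.\<close>

primrec expr :: "'a set \<Rightarrow> 'a \<Rightarrow> nat \<Rightarrow> 'a set" where
  "expr S x 0 = {\<zero>}"
| "expr S x (Suc n) = {e \<oplus> s \<otimes> x [^] n | e s. e \<in> expr S x n \<and> s \<in> S}"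

context
  fixes S x assumes S: "subring S R" and x: "x \<in> carrier R"
begin

lemma S_carrier: "s \<in> S \<Longrightarrow> s \<in> carrier R"
  using subringE(1)[OF S] by blast

lemma expr_closed: "e \<in> expr S x n \<Longrightarrow> e \<in> carrier R"
  by (induction n arbitrary: e) (auto simp: x S_carrier)

lemma expr_Suc: "e \<in> expr S x n \<Longrightarrow> e \<in> expr S x (Suc n)"
proof -
  assume e: "e \<in> expr S x n"
  have "e = e \<oplus> \<zero> \<otimes> x [^] n" using expr_closed[OF e] x by simp
  then show ?thesis using e subringE(2)[OF S] by (simp only: expr.simps) blast
qed

lemma expr_mono: "n \<le> m \<Longrightarrow> e \<in> expr S x n \<Longrightarrow> e \<in> expr S x m"
  by (induction m rule: dec_induct) (auto simp del: expr.simps intro: expr_Suc)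

lemma expr_add: "e \<in> expr S x n \<Longrightarrow> f \<in> expr S x n \<Longrightarrow> e \<oplus> f \<in> expr S x n"
proof (induction n arbitrary: e f)
  case (Suc n)
  obtain e' s where e: "e = e' \<oplus> s \<otimes> x [^] n" "e' \<in> expr S x n" "s \<in> S" using Suc.prems(1) by auto
  obtain f' r where f: "f = f' \<oplus> r \<otimes> x [^] n" "f' \<in> expr S x n" "r \<in> S" using Suc.prems(2) by auto
  have "e \<oplus> f = (e' \<oplus> f') \<oplus> (s \<oplus> r) \<otimes> x [^] n"
    unfolding e(1) f(1) using expr_closed[OF e(2)] expr_closed[OF f(2)] S_carrier[OF e(3)] S_carrier[OF f(3)] x
    by (simp add: l_distr a_ac)
  moreover have "e' \<oplus> f' \<in> expr S x n" using Suc.IH e f by blast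
  moreover have "s \<oplus> r \<in> S" using e f by (intro subringE(7)[OF S])
  ultimately show ?case by (simp only: expr.simps) blast
qed simp

lemma expr_smult: "r \<in> S \<Longrightarrow> e \<in> expr S x n \<Longrightarrow> r \<otimes> e \<in> expr S x n"
proof (induction n arbitrary: e)
  case 0
  then show ?case by (simp add: S_carrier)
next
  case (Suc n)
  obtain e' s where e: "e = e' \<oplus> s \<otimes> x [^] n" "e' \<in> expr S x n" "s \<in> S" using Suc.prems(2) by auto
  have "r \<otimes> e = r \<otimes> e' \<oplus> (r \<otimes> s) \<otimes> x [^] n"
    unfolding e(1) using expr_closed[OF e(2)] S_carrier[OF e(3)] S_carrier[OF Suc.prems(1)] x
    by (simp add: r_distr m_assoc)
  moreover have "r \<otimes> e' \<in> expr S x n" using Suc.IH Suc.prems e by blast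
  moreover have "r \<otimes> s \<in> S" using e Suc.prems by (intro subringE(6)[OF S])
  ultimately show ?case by (simp only: expr.simps) blast
qed

lemma expr_shift: "e \<in> expr S x n \<Longrightarrow> x \<otimes> e \<in> expr S x (Suc n)"
proof (induction n arbitrary: e)
  case 0
  then show ?case using expr_Suc[of \<zero> 0] x by simp
next
  case (Suc n)
  obtain e' s where e: "e = e' \<oplus> s \<otimes> x [^] n" "e' \<in> expr S x n" "s \<in> S" using Suc.prems by auto
  have "x \<otimes> e = x \<otimes> e' \<oplus> s \<otimes> x [^] (Suc n)"
    unfolding e(1) using expr_closed[OF e(2)] S_carrier[OF e(3)] x
    by (simp add: r_distr m_ac)
  moreover have "x \<otimes> e' \<in> expr S x (Suc n)" using Suc.IH e by blast
  ultimately show ?case using e(3) by (simp only: expr.simps(2)[of _ _ "Suc n"]) blast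
qed

lemma expr_pow_shift: "e \<in> expr S x n \<Longrightarrow> x [^] (m::nat) \<otimes> e \<in> expr S x (n + m)"
proof (induction m)
  case 0
  then show ?case using expr_closed by simp
next
  case (Suc m)
  have "x [^] Suc m \<otimes> e = x \<otimes> (x [^] m \<otimes> e)"
    using expr_closed[OF Suc.prems] x by (simp add: m_ac)
  then show ?case using expr_shift[OF Suc.IH[OF Suc.prems]] by simp
qed

lemma expr_mult: "e \<in> expr S x n \<Longrightarrow> f \<in> expr S x m \<Longrightarrow> \<exists>l. e \<otimes> f \<in> expr S x l"
proof (induction n arbitrary: e)
  case 0
  then have "e \<otimes> f \<in> expr S x 0" using expr_closed by simp
  then show ?case by blast
next
  case (Suc n)
  obtain e' s where e: "e = e' \<oplus> s \<otimes> x [^] n" "e' \<in> expr S x n" "s \<in> S" using Suc.prems by auto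
  obtain l where l: "e' \<otimes> f \<in> expr S x l" using Suc e by blast
  have "e \<otimes> f = e' \<otimes> f \<oplus> s \<otimes> (x [^] n \<otimes> f)"
    unfolding e(1) using expr_closed[OF e(2)] expr_closed[OF Suc.prems(2)] S_carrier[OF e(3)] x
    by (simp add: l_distr m_assoc)
  moreover have "s \<otimes> (x [^] n \<otimes> f) \<in> expr S x (m + n)"
    using expr_smult expr_pow_shift e Suc.prems by blast
  ultimately have "e \<otimes> f \<in> expr S x (max l (m + n))"
    using l expr_add[of "e' \<otimes> f" "max l (m + n)" "s \<otimes> (x [^] n \<otimes> f)"] expr_mono
    by (metis max.cobounded1 max.cobounded2)
  then show ?case by blast
qed

lemma expr_const: "s \<in> S \<Longrightarrow> s \<in> expr S x (Suc 0)"
proof -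
  assume s: "s \<in> S"
  then have "s = \<zero> \<oplus> s \<otimes> x [^] (0::nat)" using S_carrier by simp
  then show ?thesis using s by auto
qed

lemma generate_insert_expr: "generate_ring R (insert x S) \<subseteq> (\<Union>n. expr S x n)"
proof (rule generate_ring_min_subring1)
  show "insert x S \<subseteq> carrier R" using x S_carrier by blast
  have 1: "\<one> \<in> S" by (rule subringE(3)[OF S])
  have "x \<otimes> \<one> \<in> expr S x (Suc (Suc 0))" using expr_shift[OF expr_const[OF 1]] .
  then have "x \<in> expr S x (Suc (Suc 0))" using x by simp
  moreover have "s \<in> (\<Union>n. expr S x n)" if "s \<in> S" for s using expr_const[OF that] by blast
  ultimately show "insert x S \<subseteq> (\<Union>n. expr S x n)" by blast
  show "subring (\<Union>n. expr S x n) R"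
  proof (rule subringI)
    show "(\<Union>n. expr S x n) \<subseteq> carrier R" using expr_closed by blast
    show "\<one> \<in> (\<Union>n. expr S x n)" using expr_const[OF 1] by blast
    fix e assume "e \<in> (\<Union>n. expr S x n)"
    then obtain n where e: "e \<in> expr S x n" by blast
    have "\<ominus> e = (\<ominus> \<one>) \<otimes> e" using expr_closed[OF e] by (simp add: l_minus)
    also have "\<dots> \<in> expr S x n" using e by (intro expr_smult subringE(5)[OF S] 1)
    finally show "\<ominus> e \<in> (\<Union>n. expr S x n)" by blast
    fix f assume "f \<in> (\<Union>n. expr S x n)"
    then obtain m where f: "f \<in> expr S x m" by blast
    show "e \<otimes> f \<in> (\<Union>n. expr S x n)" using expr_mult[OF e f] by blast
    have "e \<oplus> f \<in> expr S x (max n m)"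
      using expr_mono[OF _ e, of "max n m"] expr_mono[OF _ f, of "max n m"] by (intro expr_add) auto
    then show "e \<oplus> f \<in> (\<Union>n. expr S x n)" by blast
  qed
qed

text \<open>Hilbert's basis theorem. The powers of \<open>x\<close> may satisfy relations, so leading coefficients belong to
  expressions, not to elements.\<close>

theorem ideal_acc_adjoin:
  assumes acc: "ideal_acc R S"
  shows "ideal_acc R (generate_ring R (insert x S))"
  unfolding ideal_acc_def
proof (intro allI impI, elim conjE)
  let ?G = "generate_ring R (insert x S)"
  have ins: "insert x S \<subseteq> carrier R" using x S_carrier by blast
  have G: "subring ?G R" by (rule generate_ring_is_subring[OF ins])
  have SG: "s \<in> ?G" if "s \<in> S" for s using that by (auto intro: generate_ring.incl)
  have xG: "x \<in> ?G" by (auto intro: generate_ring.incl)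
  have GC: "g \<in> carrier R" if "g \<in> ?G" for g using that by (rule generate_ring_in_carrier[OF ins])
  fix D :: "nat \<Rightarrow> 'a set"
  assume "\<forall>n. sub_ideal R ?G (D n)" and "\<forall>n. D n \<subseteq> D (Suc n)"
  then have D: "sub_ideal R ?G (D n)" and D_Suc: "D n \<subseteq> D (Suc n)" for n by auto
  have D_mono: "D n \<subseteq> D m" if "n \<le> m" for n m using lift_Suc_mono_le[of D, OF D_Suc that] .
  \<comment> \<open>The coefficients of \<open>x [^] n\<close> in expressions of degree at most
    \<open>n\<close> for elements of \<open>D i\<close>; zero counts as such a coefficient.
    \<open>L\<close> increases in both arguments, in \<open>n\<close> because \<open>D i\<close> is
    closed under multiplication by \<open>x\<close>.\<close>
  define L where "L i n = {s \<in> S. \<exists>e \<in> expr S x n. e \<oplus> s \<otimes> x [^] n \<in> D i}" for i n :: nat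
  have L_ideal: "sub_ideal R S (L i n)" for i n
    unfolding sub_ideal_def
  proof (intro conjI ballI)
    show "L i n \<subseteq> S" by (auto simp: L_def)
    have "\<zero> \<in> expr S x n" using expr_mono[of 0 n \<zero>] by simp
    moreover have "\<zero> \<oplus> \<zero> \<otimes> x [^] n \<in> D i" using sub_idealD(2)[OF D] x by simp
    ultimately show "\<zero> \<in> L i n" using subringE(2)[OF S] by (auto simp: L_def)
    fix a assume a: "a \<in> L i n"
    then obtain e where e: "e \<in> expr S x n" "e \<oplus> a \<otimes> x [^] n \<in> D i" "a \<in> S" by (auto simp: L_def)
    note cl = expr_closed[OF e(1)] S_carrier[OF e(3)]
    { fix b assume "b \<in> L i n"
      then obtain f where f: "f \<in> expr S x n" "f \<oplus> b \<otimes> x [^] n \<in> D i" "b \<in> S" by (auto simp: L_def)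
      have "(e \<oplus> f) \<oplus> (a \<oplus> b) \<otimes> x [^] n = (e \<oplus> a \<otimes> x [^] n) \<oplus> (f \<oplus> b \<otimes> x [^] n)"
        using cl expr_closed[OF f(1)] S_carrier[OF f(3)] x by (simp add: l_distr a_ac)
      then have "(e \<oplus> f) \<oplus> (a \<oplus> b) \<otimes> x [^] n \<in> D i" using sub_idealD(3)[OF D e(2) f(2)] by simp
      moreover have "e \<oplus> f \<in> expr S x n" using e f by (intro expr_add)
      ultimately show "a \<oplus> b \<in> L i n" using subringE(7)[OF S e(3) f(3)] by (auto simp: L_def) }
    { fix s assume s: "s \<in> S"
      have "s \<otimes> e \<oplus> (s \<otimes> a) \<otimes> x [^] n = s \<otimes> (e \<oplus> a \<otimes> x [^] n)"
        using cl S_carrier[OF s] x by (simp add: r_distr m_assoc)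
      then have "s \<otimes> e \<oplus> (s \<otimes> a) \<otimes> x [^] n \<in> D i" using sub_idealD(4)[OF D SG[OF s] e(2)] by simp
      moreover have "s \<otimes> e \<in> expr S x n" using s e by (intro expr_smult)
      ultimately show "s \<otimes> a \<in> L i n" using subringE(6)[OF S s e(3)] by (auto simp: L_def) }
  qed
  have L_Suc: "L i n \<subseteq> L i (Suc n)" for i n
  proof
    fix a assume "a \<in> L i n"
    then obtain e where e: "e \<in> expr S x n" "e \<oplus> a \<otimes> x [^] n \<in> D i" "a \<in> S" by (auto simp: L_def)
    have "x \<otimes> e \<oplus> a \<otimes> x [^] Suc n = x \<otimes> (e \<oplus> a \<otimes> x [^] n)"
      using expr_closed[OF e(1)] S_carrier[OF e(3)] x by (simp add: r_distr m_ac)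
    then have "x \<otimes> e \<oplus> a \<otimes> x [^] Suc n \<in> D i" using sub_idealD(4)[OF D xG e(2)] by simp
    then show "a \<in> L i (Suc n)" using expr_shift[OF e(1)] e(3) unfolding L_def by blast
  qed
  have L_mono1: "L i n \<subseteq> L j n" if "i \<le> j" for i j n using D_mono[OF that] by (auto simp: L_def)
  have L_mono2: "L i n \<subseteq> L i m" if "n \<le> m" for i n m using lift_Suc_mono_le[of "L i", OF L_Suc that] .
  have L_mono: "L i n \<subseteq> L j m" if "i \<le> j" "n \<le> m" for i j n m
    using L_mono1[OF that(1), of n] L_mono2[OF that(2), of j] by blast
  \<comment> \<open>A double sequence that increases in both directions stabilises uniformly: the
    diagonal settles all \<open>n\<close> from \<open>N\<close> on, and each of the finitely many
    smaller \<open>n\<close> has its own bound \<open>M n\<close>.\<close>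
  obtain N where N: "\<And>m. N \<le> m \<Longrightarrow> L m m = L N N"
    by (rule ideal_accD[OF acc, of "\<lambda>i. L i i"]) (use L_ideal L_mono in auto)
  have "\<exists>M. \<forall>i\<ge>M. L i n = L M n" for n
    using ideal_accD[OF acc, of "\<lambda>i. L i n"] L_ideal L_mono1[OF le_SucI[OF order_refl]] by metis
  then obtain M where M: "\<And>n i. M n \<le> i \<Longrightarrow> L i n = L (M n) n" by metis
  define K where "K = Max (insert N (M ` {..<N}))"
  have KN: "N \<le> K" and KM: "\<And>n. n < N \<Longrightarrow> M n \<le> K" by (auto simp: K_def)
  have L_eq: "L i n = L K n" if "K \<le> i" for i n
  proof (cases "n < N")
    case True
    then show ?thesis using M[of n i] M[of n K] KM[of n] that by auto
  next
    case False
    \<comment> \<open>For \<open>n\<close> at least \<open>N\<close> the comparison passes through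
      the diagonal: L i n \<subseteq> L m m = L N N \<subseteq> L K n.\<close>
    define m where "m = max i n"
    have "L i n \<subseteq> L m m" by (rule L_mono) (simp_all add: m_def)
    moreover have "L m m = L N N" by (rule N) (use False in \<open>simp add: m_def\<close>)
    moreover have "L N N \<subseteq> L K n" by (rule L_mono) (use False KN in simp_all)
    ultimately show ?thesis using L_mono1[OF that, of n] by blast
  qed
  have "D m = D K" if Km: "K \<le> m" for m
  proof
    show "D K \<subseteq> D m" by (rule D_mono[OF Km])
    \<comment> \<open>Subtracting an element of \<open>D K\<close> with the same leading coefficient
      shortens the expression of \<open>e\<close>, so the length of the expression carries the
      induction.\<close>
    have "e \<in> D m \<Longrightarrow> e \<in> expr S x n \<Longrightarrow> e \<in> D K" for n e
    proof (induction n arbitrary: e)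
      case 0
      then show ?case using sub_idealD(2)[OF D] by simp
    next
      case (Suc n)
      obtain e' s where e: "e = e' \<oplus> s \<otimes> x [^] n" "e' \<in> expr S x n" "s \<in> S" using Suc.prems(2) by auto
      have "s \<in> L m n" using e Suc.prems(1) unfolding L_def by blast
      then have "s \<in> L K n" using L_eq[OF Km] by blast
      then obtain f where f: "f \<in> expr S x n" "f \<oplus> s \<otimes> x [^] n \<in> D K" by (auto simp: L_def)
      note cl = expr_closed[OF e(2)] expr_closed[OF f(1)] S_carrier[OF e(3)]
      have d: "e \<ominus> (f \<oplus> s \<otimes> x [^] n) \<in> D m"
        by (rule sub_ideal_minus[OF G D Suc.prems(1)]) (use f(2) D_mono[OF Km] in blast)
      have eq: "e \<ominus> (f \<oplus> s \<otimes> x [^] n) = e' \<oplus> (\<ominus> \<one>) \<otimes> f"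
        unfolding e(1) using cl x by (simp add: a_minus_def minus_add l_minus a_ac r_neg r_neg1 r_neg2)
      have "e' \<oplus> (\<ominus> \<one>) \<otimes> f \<in> expr S x n"
        using e f by (intro expr_add expr_smult subringE(5)[OF S] subringE(3)[OF S])
      then have "e \<ominus> (f \<oplus> s \<otimes> x [^] n) \<in> D K" using Suc.IH d eq by simp
      then have "(e \<ominus> (f \<oplus> s \<otimes> x [^] n)) \<oplus> (f \<oplus> s \<otimes> x [^] n) \<in> D K"
        using f(2) by (rule sub_idealD(3)[OF D])
      moreover have "(e \<ominus> (f \<oplus> s \<otimes> x [^] n)) \<oplus> (f \<oplus> s \<otimes> x [^] n) = e"
        unfolding e(1) using cl x by (simp add: a_minus_def a_assoc l_neg)
      ultimately show ?case by simp
    qed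
    then show "D m \<subseteq> D K"
      using sub_idealD(1)[OF D, of m] generate_insert_expr by blast
  qed
  then show "\<exists>n. \<forall>m\<ge>n. D m = D n" by blast
qed

end

text \<open>The subring generated by the empty set is the image of the integers. Let
  \<open>d\<close> be the least positive integer whose image lies in some member of the chain; by
  division with remainder it generates every later member. If there is no such \<open>d\<close>,
  every member is zero.\<close>

lemma ideal_acc_prime_ring: "ideal_acc R (generate_ring R {})"
  unfolding ideal_acc_def
proof (intro allI impI, elim conjE)
  let ?G = "generate_ring R {}" and ?z = "\<lambda>z::int. [z] \<cdot> \<one>"
  have z_add: "?z (a + b) = ?z a \<oplus> ?z b" for a b by (simp add: add.int_pow_mult)
  have z_mult: "?z (a * b) = ?z a \<otimes> ?z b" for a b
    by (simp add: add_pow_ldistr_int add.int_pow_pow mult.commute)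
  have z_neg: "?z (- a) = \<ominus> ?z a" for a by (simp add: add.int_pow_neg)
  have z_cl: "?z a \<in> carrier R" for a by simp
  have G: "subring ?G R" by (rule generate_ring_is_subring) simp
  have zG_nat: "?z (int n) \<in> ?G" for n
  proof (induction n)
    case 0 then show ?case using subringE(2)[OF G] by (simp add: add_pow_def)
  next
    case (Suc n)
    then show ?case using subringE(7)[OF G Suc subringE(3)[OF G]] z_add[of "int n" 1] by (simp add: add.commute)
  qed
  have zG: "?z a \<in> ?G" for a
    by (cases a rule: int_cases2) (use zG_nat subringE(5)[OF G] in \<open>auto simp: z_neg simp del: add.int_pow_neg\<close>)
  have Gz: "\<exists>a. y = ?z a" if "y \<in> ?G" for y
    using that
  proof induction
    case one then show ?case by (intro exI[of _ 1]) simp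
  next
    case (a_inv h) then show ?case by (metis z_neg)
  next
    case (eng_add h1 h2) then show ?case by (metis z_add)
  next
    case (eng_mult h1 h2) then show ?case by (metis z_mult)
  qed simp
  fix D :: "nat \<Rightarrow> 'a set"
  assume "\<forall>n. sub_ideal R ?G (D n)" and "\<forall>n. D n \<subseteq> D (Suc n)"
  then have D: "sub_ideal R ?G (D n)" and D_Suc: "D n \<subseteq> D (Suc n)" for n by auto
  have D_mono: "D n \<subseteq> D m" if "n \<le> m" for n m using lift_Suc_mono_le[of D, OF D_Suc that] .
  show "\<exists>n. \<forall>m\<ge>n. D m = D n"
  proof (cases "\<exists>d::nat. 0 < d \<and> (\<exists>i. ?z (int d) \<in> D i)")
    case True
    define d where "d = (LEAST d::nat. 0 < d \<and> (\<exists>i. ?z (int d) \<in> D i))"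
    have d: "0 < d" "\<exists>i. ?z (int d) \<in> D i" using LeastI_ex[OF True] unfolding d_def by auto
    have d_min: "d \<le> e" if "0 < e" "?z (int e) \<in> D i" for e i
      unfolding d_def by (rule Least_le) (use that in blast)
    obtain i where i: "?z (int d) \<in> D i" using d by blast
    have "D m = D i" if im: "i \<le> m" for m
    proof
      show "D i \<subseteq> D m" by (rule D_mono[OF im])
      show "D m \<subseteq> D i"
      proof
        fix y assume y: "y \<in> D m"
        then obtain a where a: "y = ?z a" using Gz sub_idealD(1)[OF D] by blast
        define q r where "q = a div int d" and "r = a mod int d"
        have qd: "?z (q * int d) \<in> D i" unfolding z_mult by (rule sub_idealD(4)[OF D zG i])
        have "?z a \<ominus> ?z (q * int d) \<in> D m"
          by (rule sub_ideal_minus[OF G D]) (use y a qd D_mono[OF im] in auto)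
        moreover have "?z a \<ominus> ?z (q * int d) = ?z r"
        proof -
          have "a = r + q * int d" by (simp add: q_def r_def)
          then have "?z a = ?z r \<oplus> ?z (q * int d)" using z_add by metis
          then show ?thesis by (simp add: a_minus_def a_assoc r_neg del: add.int_pow_mult)
        qed
        ultimately have "?z (int (nat r)) \<in> D m" using d(1) by (simp add: r_def)
        moreover have "nat r < d" using d(1) by (simp add: r_def nat_less_iff)
        ultimately have "nat r = 0" using d_min[of "nat r" m] by linarith
        then have "r = 0" using d(1) by (simp add: r_def pos_mod_sign order_antisym)
        moreover have "a = q * int d + r" by (simp add: q_def r_def)
        ultimately have "a = q * int d" by simp
        then show "y \<in> D i" using qd a by simp
      qed
    qed
    then show ?thesis by blast
  next
    case False
    have "y = \<zero>" if y: "y \<in> D i" for y i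
    proof -
      obtain a where a: "y = ?z a" using y Gz sub_idealD(1)[OF D] by blast
      have "\<zero> \<ominus> y \<in> D i" by (rule sub_ideal_minus[OF G D sub_idealD(2)[OF D] y])
      then have "?z (- a) \<in> D i" unfolding a by (simp add: a_minus_def z_neg del: add.int_pow_neg)
      then have "\<not> 0 < - a" using False by (metis zero_less_imp_eq_int of_nat_0_less_iff)
      moreover have "\<not> 0 < a" using False y a by (metis zero_less_imp_eq_int of_nat_0_less_iff)
      ultimately have "a = 0" by simp
      then show ?thesis using a by (simp add: add_pow_def)
    qed
    then have "D i = {\<zero>}" for i using sub_idealD(2)[OF D] by blast
    then show ?thesis by simp
  qed
qed

lemma generate_ring_insert:
  assumes "insert x G \<subseteq> carrier R"
  shows "generate_ring R (insert x G) = generate_ring R (insert x (generate_ring R G))"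
proof
  have G: "generate_ring R G \<subseteq> carrier R" using assms generate_ring_incl by simp
  have sub: "G \<subseteq> generate_ring R G" by (auto intro: generate_ring.incl)
  show "generate_ring R (insert x G) \<subseteq> generate_ring R (insert x (generate_ring R G))"
    by (rule mono_generate_ring) (use assms G sub in auto)
  have S: "subring (generate_ring R (insert x G)) R" by (rule generate_ring_is_subring[OF assms])
  show "generate_ring R (insert x (generate_ring R G)) \<subseteq> generate_ring R (insert x G)"
    by (rule generate_ring_min_subring1[OF _ S])
      (use assms G mono_generate_ring[of G "insert x G"] in \<open>auto intro: generate_ring.incl\<close>)
qed

theorem ideal_acc_finitely_generated:
  assumes "finite G" "G \<subseteq> carrier R"
  shows "ideal_acc R (generate_ring R G)"
  using assms
proof (induction G)
  case empty
  show ?case by (rule ideal_acc_prime_ring)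
next
  case (insert x G)
  then have G: "G \<subseteq> carrier R" "x \<in> carrier R" by auto
  show ?case
    unfolding generate_ring_insert[OF insert.prems]
    by (rule ideal_acc_adjoin[OF generate_ring_is_subring[OF G(1)] G(2) insert.IH[OF G(1)]])
qed

end

section \<open>Smooth algebras preserve nonzerodivisors\<close>

lemma genideal_image:
  assumes "h \<in> ring_hom R S" "ring R" "ring S" "F \<subseteq> carrier R" "ideal I S"
    and "\<And>x. x \<in> F \<Longrightarrow> h x \<in> I" and "x \<in> Idl\<^bsub>R\<^esub> F"
  shows "h x \<in> I"
proof -
  interpret I: ideal I S by fact
  have "ring (S Quot I)" by (rule I.quotient_is_ring)
  have cl: "h x \<in> carrier S" if "x \<in> carrier R" for x using assms(1) that by (rule ring_hom_closed)
  have "x \<in> carrier R"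
    using assms(7) ideal.Icarr[OF ring.genideal_ideal[OF assms(2,4)]] by blast
  have "I +>\<^bsub>S\<^esub> h x = \<zero>\<^bsub>S Quot I\<^esub>"
    by (rule genideal_kernel[OF ring_hom_comp[OF assms(1) quot_hom[OF assms(5)]] assms(2)
          \<open>ring (S Quot I)\<close> assms(4) _ assms(7)])
      (use assms(4,6) cl coset_zero_iff[OF assms(5)] in \<open>auto simp: zero_Quot\<close>)
  then show ?thesis using coset_zero_iff[OF assms(5) cl[OF \<open>x \<in> carrier R\<close>]] by (simp add: zero_Quot)
qed

context cring
begin

lemma sub_ideal_ideal:
  assumes D: "sub_ideal R (carrier R) D" shows "ideal D R"
proof (rule idealI)
  note d = sub_idealD[OF D]
  have neg: "\<ominus> a \<in> D" if "a \<in> D" for a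
    using sub_ideal_minus[OF carrier_is_subring D d(2) that] d(1) that by (auto simp: a_minus_def)
  show "subgroup D (add_monoid R)"
    by (rule add.subgroupI) (use d neg in \<open>auto simp: a_inv_def\<close>)
  fix a x assume ax: "a \<in> D" "x \<in> carrier R"
  then show "x \<otimes> a \<in> D" using d by blast
  then show "a \<otimes> x \<in> D" using ax d(1) m_comm by (metis subsetD)
qed (rule ring_axioms)

lemma subring_cring: "subring S R \<Longrightarrow> cring (R\<lparr>carrier := S\<rparr>)"
  using subcringI' subcring_iff subringE(1) by blast

lemma adjoin_mem:
  assumes "ideal D R" "z \<in> carrier R"
  shows "y \<in> D <+>\<^bsub>R\<^esub> PIdl z \<longleftrightarrow> (\<exists>d\<in>D. \<exists>q\<in>carrier R. y = d \<oplus> z \<otimes> q)"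
proof -
  have "y \<in> D <+>\<^bsub>R\<^esub> PIdl z \<longleftrightarrow> (\<exists>d\<in>D. \<exists>q\<in>carrier R. y = d \<oplus> q \<otimes> z)"
    unfolding set_add_def' cgenideal_def by blast
  then show ?thesis using m_comm assms(2) by metis
qed

lemma adjoin_ideal: "ideal D R \<Longrightarrow> z \<in> carrier R \<Longrightarrow> ideal (D <+>\<^bsub>R\<^esub> PIdl z) R"
  by (intro add_ideals cgenideal_ideal)

section \<open>Powers of ideals and nilpotence modulo an ideal\<close>

primrec ideal_pow :: "'a set \<Rightarrow> nat \<Rightarrow> 'a set" where
  "ideal_pow J 0 = J"
| "ideal_pow J (Suc n) = ideal_pow J n \<cdot> J"

text \<open>Note the shift: \<^term>\<open>ideal_pow J n\<close> is the power with exponent \<open>n + 1\<close>.\<close>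

lemma ideal_pow_ideal: "ideal J R \<Longrightarrow> ideal (ideal_pow J n) R"
  by (induction n) (simp_all add: ideal_prod_is_ideal)

lemma ideal_pow_split: "ideal J R \<Longrightarrow> ideal_pow J (Suc (k + n)) = ideal_pow J k \<cdot> ideal_pow J n"
  by (induction n) (simp_all add: ideal_prod_assoc ideal_pow_ideal)

text \<open>In the expansion of a power of E + (x), every term except the power of E contains a
  factor \<open>x\<close>.\<close>

lemma ideal_pow_adjoin:
  assumes E: "ideal E R" and x: "x \<in> carrier R" and I: "ideal I R" and sub: "I \<subseteq> E <+>\<^bsub>R\<^esub> PIdl x"
  shows "ideal_pow I n \<subseteq> ideal_pow E n <+>\<^bsub>R\<^esub> PIdl x"
proof (induction n)
  case 0 then show ?case using sub by simp
next
  case (Suc n)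
  have K: "ideal (ideal_pow E (Suc n) <+>\<^bsub>R\<^esub> PIdl x) R"
    by (intro adjoin_ideal ideal_pow_ideal E x)
  have prods: "i \<otimes> j \<in> ideal_pow E (Suc n) <+>\<^bsub>R\<^esub> PIdl x" if ij: "i \<in> ideal_pow I n" "j \<in> I" for i j
  proof -
    obtain d q where d: "d \<in> ideal_pow E n" "q \<in> carrier R" "i = d \<oplus> x \<otimes> q"
      using ij(1) Suc adjoin_mem[OF ideal_pow_ideal[OF E] x] by blast
    obtain e r where e: "e \<in> E" "r \<in> carrier R" "j = e \<oplus> x \<otimes> r"
      using ij(2) sub adjoin_mem[OF E x] by blast
    have cl: "d \<in> carrier R" "e \<in> carrier R"
      using d e ideal.Icarr[OF ideal_pow_ideal[OF E]] ideal.Icarr[OF E] by auto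
    have "i \<otimes> j = d \<otimes> e \<oplus> x \<otimes> (d \<otimes> r \<oplus> q \<otimes> e \<oplus> x \<otimes> (q \<otimes> r))"
      unfolding d(3) e(3) using cl d(2) e(2) x by (simp add: l_distr r_distr m_ac a_ac)
    moreover have "d \<otimes> e \<in> ideal_pow E (Suc n)" using d e by (auto intro: ideal_prod.prod)
    ultimately show ?thesis
      using adjoin_mem[OF ideal_pow_ideal[OF E, of "Suc n"] x] cl d(2) e(2) x by blast
  qed
  show ?case
  proof
    fix y assume "y \<in> ideal_pow I (Suc n)"
    then have y: "y \<in> ideal_pow I n \<cdot> I" by simp
    show "y \<in> ideal_pow E (Suc n) <+>\<^bsub>R\<^esub> PIdl x" by (rule ideal_prod_le[OF K _ y]) (rule prods)
  qed
qed

text \<open>By induction on i, some power of I lies in D + (x^i): the product of an element of D +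
  (x^i) and an element of E^(n+1) + (x), hence of D + (x), lies in D + (x^(i+1)). For i = 0 the
  ideal is the whole ring, and for i = m it is D.\<close>

lemma ideal_pow_nilpotent_step:
  assumes E: "ideal E R" and x: "x \<in> carrier R" and I: "ideal I R" and sub: "I \<subseteq> E <+>\<^bsub>R\<^esub> PIdl x"
    and D: "ideal D R" and n: "ideal_pow E n \<subseteq> D" and m: "x [^] (m::nat) \<in> D"
  shows "\<exists>l. ideal_pow I l \<subseteq> D"
proof -
  have "\<exists>l. ideal_pow I l \<subseteq> D <+>\<^bsub>R\<^esub> PIdl (x [^] i)" for i :: nat
  proof (induction i)
    case 0
    have "y \<in> D <+>\<^bsub>R\<^esub> PIdl (x [^] (0::nat))" if "y \<in> carrier R" for y
    proof -
      have "y = \<zero> \<oplus> x [^] (0::nat) \<otimes> y" using that by simp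
      moreover have "\<zero> \<in> D" using D by (simp add: additive_subgroup.zero_closed ideal.axioms(1))
      ultimately show ?thesis using adjoin_mem[OF D nat_pow_closed[OF x], of y 0] that by blast
    qed
    then show ?case using ideal.Icarr[OF I] by (intro exI[of _ 0]) auto
  next
    case (Suc i)
    then obtain l where l: "ideal_pow I l \<subseteq> D <+>\<^bsub>R\<^esub> PIdl (x [^] i)" by blast
    have K: "ideal (D <+>\<^bsub>R\<^esub> PIdl (x [^] Suc i)) R" by (intro adjoin_ideal D nat_pow_closed x)
    have "a \<otimes> b \<in> D <+>\<^bsub>R\<^esub> PIdl (x [^] Suc i)" if ab: "a \<in> ideal_pow I l" "b \<in> ideal_pow I n" for a b
    proof -
      obtain d q where d: "d \<in> D" "q \<in> carrier R" "a = d \<oplus> x [^] i \<otimes> q"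
        using ab(1) l adjoin_mem[OF D] x by blast
      obtain e r where e: "e \<in> ideal_pow E n" "r \<in> carrier R" "b = e \<oplus> x \<otimes> r"
        using ab(2) ideal_pow_adjoin[OF E x I sub, of n] adjoin_mem[OF ideal_pow_ideal[OF E] x] by blast
      have eD: "e \<in> D" using e n by blast
      have cl: "d \<in> carrier R" "e \<in> carrier R" using d eD ideal.Icarr[OF D] by auto
      have "a \<otimes> b = (d \<otimes> (e \<oplus> x \<otimes> r) \<oplus> (x [^] i \<otimes> q) \<otimes> e) \<oplus> x [^] Suc i \<otimes> (q \<otimes> r)"
        unfolding d(3) e(3) using cl d(2) e(2) x by (simp add: l_distr r_distr m_ac a_ac)
      moreover have "d \<otimes> (e \<oplus> x \<otimes> r) \<oplus> (x [^] i \<otimes> q) \<otimes> e \<in> D"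
        using d eD e(2) cl x
        by (intro additive_subgroup.a_closed[OF ideal.axioms(1)[OF D]] ideal.I_l_closed[OF D] ideal.I_r_closed[OF D]) auto
      ultimately show ?thesis using adjoin_mem[OF D, of "x [^] Suc i"] d(2) e(2) x by blast
    qed
    then have "ideal_pow I (Suc (l + n)) \<subseteq> D <+>\<^bsub>R\<^esub> PIdl (x [^] Suc i)"
      unfolding ideal_pow_split[OF I] using ideal_prod_le[OF K] by blast
    then show ?case by blast
  qed
  then obtain l where "ideal_pow I l \<subseteq> D <+>\<^bsub>R\<^esub> PIdl (x [^] m)" by blast
  moreover have "y \<in> D" if y: "y \<in> D <+>\<^bsub>R\<^esub> PIdl (x [^] m)" for y
  proof -
    obtain d q where d: "d \<in> D" "q \<in> carrier R" "y = d \<oplus> x [^] m \<otimes> q"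
      using y adjoin_mem[OF D] x by blast
    then show ?thesis
      using m by (auto intro!: additive_subgroup.a_closed[OF ideal.axioms(1)[OF D]] ideal.I_r_closed[OF D])
  qed
  ultimately show ?thesis by blast
qed

text \<open>Generators are added one at a time, which avoids multinomial expansions.\<close>

lemma ideal_pow_nilpotent:
  assumes "finite F" "F \<subseteq> carrier R" and D: "ideal D R" and "\<And>f. f \<in> F \<Longrightarrow> \<exists>m::nat. f [^] m \<in> D"
  shows "\<exists>l. ideal_pow (Idl\<^bsub>R\<^esub> F) l \<subseteq> D"
  using assms(1,2,4)
proof (induction F)
  case empty
  have "ideal_pow (Idl\<^bsub>R\<^esub> {}) 0 \<subseteq> D" using genideal_minimal[OF D, of "{}"] by simp
  then show ?case by blast
next
  case (insert f F)
  then have F: "F \<subseteq> carrier R" "f \<in> carrier R" by auto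
  obtain n where n: "ideal_pow (Idl\<^bsub>R\<^esub> F) n \<subseteq> D" using insert F by blast
  obtain m :: nat where m: "f [^] m \<in> D" using insert by blast
  have E: "ideal (Idl\<^bsub>R\<^esub> F) R" using F by (intro genideal_ideal)
  have "Idl\<^bsub>R\<^esub> (insert f F) \<subseteq> Idl\<^bsub>R\<^esub> F <+>\<^bsub>R\<^esub> PIdl f"
  proof (rule genideal_minimal[OF adjoin_ideal[OF E F(2)]])
    have "g = g \<oplus> f \<otimes> \<zero>" if "g \<in> F" for g using that F by auto
    then have 1: "g \<in> Idl\<^bsub>R\<^esub> F <+>\<^bsub>R\<^esub> PIdl f" if "g \<in> F" for g
      using that adjoin_mem[OF E F(2)] genideal_self[OF F(1)] by blast
    have "f = \<zero> \<oplus> f \<otimes> \<one>" using F by simp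
    moreover have "\<zero> \<in> Idl\<^bsub>R\<^esub> F" using E by (simp add: additive_subgroup.zero_closed ideal.axioms(1))
    ultimately have "f \<in> Idl\<^bsub>R\<^esub> F <+>\<^bsub>R\<^esub> PIdl f" using adjoin_mem[OF E F(2)] by blast
    then show "insert f F \<subseteq> Idl\<^bsub>R\<^esub> F <+>\<^bsub>R\<^esub> PIdl f" using 1 by blast
  qed
  then show ?case
    using ideal_pow_nilpotent_step[OF E F(2) _ _ D n m] genideal_ideal[OF insert.prems(1)] by blast
qed

text \<open>Krull's argument: for an ideal \<open>D\<close> maximal among those meeting \<open>(t)\<close> in \<open>t J\<close>, some power of \<open>J\<close> is
  contained in \<open>D\<close>. Iterating the contraction \<open>N\<close> moves \<open>t b\<close> into \<open>D\<close>.\<close>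

lemma noetherian_descent:
  assumes acc: "ideal_acc R (carrier R)" and t: "t \<in> carrier R"
    and nzd: "\<And>b. b \<in> carrier R \<Longrightarrow> t \<otimes> b = \<zero> \<Longrightarrow> b = \<zero>"
    and F: "finite F" "F \<subseteq> carrier R" and N: "N \<in> ring_hom R R" and Nt: "N t = t"
    and N_id: "\<And>q. q \<in> carrier R \<Longrightarrow> \<exists>j\<in>Idl\<^bsub>R\<^esub> F. N q = q \<oplus> j"
    and N_F: "\<And>f. f \<in> F \<Longrightarrow> N f \<in> (Idl\<^bsub>R\<^esub> F) \<cdot> (Idl\<^bsub>R\<^esub> F)"
    and b: "b \<in> carrier R" and tb: "t \<otimes> b \<in> Idl\<^bsub>R\<^esub> F"
  shows "b \<in> Idl\<^bsub>R\<^esub> F"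
proof -
  let ?J = "Idl\<^bsub>R\<^esub> F"
  have J: "ideal ?J R" using F by (intro genideal_ideal)
  note Jcl = ideal.Icarr[OF J]
  note Jadd = additive_subgroup.a_closed[OF ideal.axioms(1)[OF J]]
  define tJ where "tJ = {t \<otimes> j | j. j \<in> ?J}"
  have tJ: "sub_ideal R (carrier R) tJ"
    unfolding sub_ideal_def
  proof (intro conjI ballI)
    show "tJ \<subseteq> carrier R" using t Jcl by (auto simp: tJ_def)
    have "\<zero> = t \<otimes> \<zero>" using t by simp
    then show "\<zero> \<in> tJ" unfolding tJ_def using additive_subgroup.zero_closed[OF ideal.axioms(1)[OF J]] by blast
  next
    fix x y assume "x \<in> tJ" "y \<in> tJ"
    then obtain i j where ij: "i \<in> ?J" "j \<in> ?J" "x = t \<otimes> i" "y = t \<otimes> j" by (auto simp: tJ_def)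
    then have "x \<oplus> y = t \<otimes> (i \<oplus> j)" using t Jcl by (simp add: r_distr)
    then show "x \<oplus> y \<in> tJ" unfolding tJ_def using Jadd ij by blast
  next
    fix s x assume s: "s \<in> carrier R" and "x \<in> tJ"
    then obtain i where i: "i \<in> ?J" "x = t \<otimes> i" by (auto simp: tJ_def)
    then have "s \<otimes> x = t \<otimes> (s \<otimes> i)" using t Jcl s by (simp add: m_lcomm)
    then show "s \<otimes> x \<in> tJ" unfolding tJ_def using ideal.I_l_closed[OF J] i s by blast
  qed
  \<comment> \<open>Since \<open>tJ\<close> lies in the ideal (t), these are the ideals that contain
    t J and meet (t) in exactly t J. The chain condition gives a maximal one.\<close>
  define M where "M = {D. sub_ideal R (carrier R) D \<and> tJ \<subseteq> D \<and> (\<forall>q\<in>carrier R. t \<otimes> q \<in> D \<longrightarrow> t \<otimes> q \<in> tJ)}"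
  obtain D where D: "D \<in> M" and D_max: "\<And>E. E \<in> M \<Longrightarrow> D \<subseteq> E \<Longrightarrow> E = D"
    by (rule ideal_acc_maximal[OF acc, of M tJ]) (use tJ in \<open>auto simp: M_def\<close>)
  have Dsub: "sub_ideal R (carrier R) D" and tJ_D: "tJ \<subseteq> D"
    and D_t: "\<And>q. q \<in> carrier R \<Longrightarrow> t \<otimes> q \<in> D \<Longrightarrow> t \<otimes> q \<in> tJ"
    using D by (auto simp: M_def)
  have DI: "ideal D R" using Dsub by (rule sub_ideal_ideal)
  note Dcl = ideal.Icarr[OF DI]
  have nil: "\<exists>m::nat. x [^] m \<in> D" if x: "x \<in> ?J" for x
  proof -
    have xc: "x \<in> carrier R" using Jcl x .
    \<comment> \<open>The ideals (D : x^m) increase with m and become constant. From there on D +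
      (x^m) still meets (t) in t J, so maximality forces x^m into D.\<close>
    define K where "K m = {q \<in> carrier R. x [^] m \<otimes> q \<in> D}" for m :: nat
    have "sub_ideal R (carrier R) (K m)" for m
      unfolding sub_ideal_def
    proof (intro conjI ballI)
      show "K m \<subseteq> carrier R" by (auto simp: K_def)
      show "\<zero> \<in> K m" using xc sub_idealD(2)[OF Dsub] by (simp add: K_def)
    next
      fix p q assume "p \<in> K m" "q \<in> K m"
      then show "p \<oplus> q \<in> K m" using xc sub_idealD(3)[OF Dsub] by (simp add: K_def r_distr)
    next
      fix s p assume s: "s \<in> carrier R" and p: "p \<in> K m"
      then have "x [^] m \<otimes> (s \<otimes> p) = s \<otimes> (x [^] m \<otimes> p)" using xc by (simp add: K_def m_lcomm)
      then show "s \<otimes> p \<in> K m" using s p sub_idealD(4)[OF Dsub] by (simp add: K_def)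
    qed
    moreover have "K m \<subseteq> K (Suc m)" for m
    proof
      fix q assume q: "q \<in> K m"
      then have "x [^] Suc m \<otimes> q = x \<otimes> (x [^] m \<otimes> q)" using xc by (simp add: K_def m_ac)
      then show "q \<in> K (Suc m)" using q xc sub_idealD(4)[OF Dsub] by (simp add: K_def)
    qed
    ultimately obtain m where m: "\<And>l. m \<le> l \<Longrightarrow> K l = K m" using ideal_accD[OF acc, of K] by metis
    have Km: "K (Suc m) = K m" by (rule m) simp
    let ?E = "D <+>\<^bsub>R\<^esub> PIdl (x [^] m)"
    have xm: "x [^] m \<in> carrier R" using xc by simp
    have DE: "D \<subseteq> ?E"
    proof
      fix d assume d: "d \<in> D"
      have "d = d \<oplus> x [^] m \<otimes> \<zero>" using Dcl[OF d] xc by simp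
      then show "d \<in> ?E" using adjoin_mem[OF DI xm] d by blast
    qed
    have "?E \<in> M"
      unfolding M_def
    proof (intro CollectI conjI ballI impI)
      show "sub_ideal R (carrier R) ?E" using adjoin_ideal[OF DI xm] by (rule ideal_sub_ideal)
      show "tJ \<subseteq> ?E" using tJ_D DE by blast
      fix q assume q: "q \<in> carrier R" and "t \<otimes> q \<in> ?E"
      then obtain d p where d: "d \<in> D" "p \<in> carrier R" "t \<otimes> q = d \<oplus> x [^] m \<otimes> p"
        using adjoin_mem[OF DI xm] by blast
      \<comment> \<open>Multiplication by \<open>x\<close>, an element of J, sends t q into t J and
        hence into D. So x^(m+1) p lies in D, and stability of \<open>K\<close> removes one factor
        \<open>x\<close>.\<close>
      have "x \<otimes> (t \<otimes> q) = t \<otimes> (q \<otimes> x)" using t q xc by (simp add: m_ac)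
      also have "\<dots> \<in> tJ" unfolding tJ_def using ideal.I_l_closed[OF J x q] by blast
      finally have 1: "x \<otimes> (t \<otimes> q) \<in> D" using tJ_D by blast
      have "x \<otimes> d \<in> D" using sub_idealD(4)[OF Dsub xc d(1)] .
      then have "x \<otimes> (t \<otimes> q) \<ominus> x \<otimes> d \<in> D" by (rule sub_ideal_minus[OF carrier_is_subring Dsub 1])
      also have "x \<otimes> (t \<otimes> q) \<ominus> x \<otimes> d = x [^] Suc m \<otimes> p"
        unfolding d(3) using Dcl[OF d(1)] d(2) xc by (simp add: r_distr a_minus_def a_ac r_neg2 r_neg1 r_neg m_ac)
      finally have "p \<in> K (Suc m)" using d(2) by (simp add: K_def)
      then have "x [^] m \<otimes> p \<in> D" unfolding Km by (simp add: K_def)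
      then have "t \<otimes> q \<in> D" unfolding d(3) using d(1) by (intro sub_idealD(3)[OF Dsub])
      then show "t \<otimes> q \<in> tJ" using D_t q by blast
    qed
    then have "?E = D" using DE by (rule D_max)
    moreover have "x [^] m \<in> ?E"
    proof -
      have "x [^] m = \<zero> \<oplus> x [^] m \<otimes> \<one>" using xm by simp
      then show ?thesis using adjoin_mem[OF DI xm] sub_idealD(2)[OF Dsub] by blast
    qed
    ultimately show ?thesis by blast
  qed
  obtain l where l: "ideal_pow ?J l \<subseteq> D"
    using ideal_pow_nilpotent[OF F DI] nil genideal_self[OF F(2)] by blast
  have NJ: "N x \<in> ?J \<cdot> ?J" if "x \<in> ?J" for x
    by (rule genideal_image[OF N ring_axioms ring_axioms F(2) ideal_prod_is_ideal[OF J J] N_F that])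
  have NJ': "N x \<in> ?J" if "x \<in> ?J" for x
    using NJ[OF that] ideal_prod_inter[OF J J] by blast
  \<comment> \<open>Each application of \<open>N\<close> raises the order by one: in a product, the
    first factor gains one power by induction and the other stays in J.\<close>
  have N_pow: "N x \<in> ideal_pow ?J (Suc n)" if "x \<in> ideal_pow ?J n" for n x
    using that
  proof (induction n arbitrary: x)
    case 0 then show ?case using NJ by simp
  next
    case (Suc n)
    note I = ideal_pow_ideal[OF J, of "Suc (Suc n)"]
    have "x \<in> ideal_pow ?J n \<cdot> ?J" using Suc.prems by simp
    then show ?case
    proof (induction x rule: ideal_prod.induct)
      case (prod i j)
      have "N (i \<otimes> j) = N i \<otimes> N j"
        using prod Jcl ideal.Icarr[OF ideal_pow_ideal[OF J]] by (intro ring_hom_mult[OF N]) auto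
      then show ?case using Suc.IH[OF prod(1)] NJ'[OF prod(2)] by (auto intro: ideal_prod.prod)
    next
      case (sum s1 s2)
      have "s1 \<in> carrier R" "s2 \<in> carrier R"
        using sum(1,2) ideal.Icarr[OF ideal_pow_ideal[OF J, of "Suc n"]] by auto
      then have "N (s1 \<oplus> s2) = N s1 \<oplus> N s2" by (rule ring_hom_add[OF N])
      then show ?case using sum.IH by (auto intro: ideal_prod.sum)
    qed
  qed
  \<comment> \<open>Along the iteration t b sinks into higher powers of J, while b keeps its class
    modulo J and t is fixed.\<close>
  have iter: "(N ^^ n) (t \<otimes> b) \<in> ideal_pow ?J n \<and> (\<exists>j\<in>?J. (N ^^ n) b = b \<oplus> j) \<and> (N ^^ n) (t \<otimes> b) = t \<otimes> (N ^^ n) b" for n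
  proof (induction n)
    case 0
    have "b = b \<oplus> \<zero>" using b by simp
    moreover have "\<zero> \<in> ?J" using additive_subgroup.zero_closed[OF ideal.axioms(1)[OF J]] .
    ultimately show ?case using tb by auto
  next
    case (Suc n)
    then obtain j where j: "j \<in> ?J" "(N ^^ n) b = b \<oplus> j" by blast
    have c: "(N ^^ n) b \<in> carrier R" using j b Jcl by simp
    obtain i where i: "i \<in> ?J" "N ((N ^^ n) b) = (N ^^ n) b \<oplus> i" using N_id[OF c] by blast
    have "(N ^^ Suc n) b = b \<oplus> (j \<oplus> i)" using i j b Jcl by (simp add: a_assoc)
    moreover have "(N ^^ Suc n) (t \<otimes> b) = t \<otimes> (N ^^ Suc n) b"
      using Suc c t by (simp add: ring_hom_mult[OF N] Nt)
    moreover have "(N ^^ Suc n) (t \<otimes> b) \<in> ideal_pow ?J (Suc n)"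
      using N_pow[OF conjunct1[OF Suc]] by simp
    ultimately show ?case using Jadd[OF j(1) i(1)] by blast
  qed
  obtain j where j: "j \<in> ?J" "(N ^^ l) b = b \<oplus> j" using iter by blast
  have c: "(N ^^ l) b \<in> carrier R" using j b Jcl by simp
  \<comment> \<open>The element t N^l(b) lies both in D and in (t), hence in t J. Cancelling t puts
    N^l(b), and therefore b, into J.\<close>
  have "t \<otimes> (N ^^ l) b \<in> D" using iter[of l] l by auto
  then have "t \<otimes> (N ^^ l) b \<in> tJ" using D_t c by blast
  then obtain i where i: "i \<in> ?J" "t \<otimes> (N ^^ l) b = t \<otimes> i" by (auto simp: tJ_def)
  have "t \<otimes> ((N ^^ l) b \<ominus> i) = \<zero>"
    using i(2) c t Jcl[OF i(1)] by (simp add: a_minus_def r_distr r_minus r_neg)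
  then have "(N ^^ l) b \<ominus> i = \<zero>" using nzd c Jcl[OF i(1)] by simp
  then have "(N ^^ l) b = i" using c Jcl[OF i(1)] by simp
  then have "b \<oplus> j \<in> ?J" using j i by simp
  then have "(b \<oplus> j) \<ominus> j \<in> ?J"
    using j(1) by (rule sub_ideal_minus[OF carrier_is_subring ideal_sub_ideal[OF J]])
  then show ?thesis using b Jcl[OF j(1)] by (simp add: a_minus_def a_assoc r_neg)
qed

section \<open>Ideal membership that persists in subrings\<close>

lemma subring_genideal_closure:
  assumes "subring S R" "F \<subseteq> S"
  shows "sub_ideal R S (Idl\<^bsub>R\<lparr>carrier := S\<rparr>\<^esub> F)" "F \<subseteq> Idl\<^bsub>R\<lparr>carrier := S\<rparr>\<^esub> F"
proof -
  interpret Q: cring "R\<lparr>carrier := S\<rparr>" using assms(1) by (rule subring_cring)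
  have "ideal (Idl\<^bsub>R\<lparr>carrier := S\<rparr>\<^esub> F) (R\<lparr>carrier := S\<rparr>)" using assms by (intro Q.genideal_ideal) simp
  from ideal_sub_ideal[OF this] show "sub_ideal R S (Idl\<^bsub>R\<lparr>carrier := S\<rparr>\<^esub> F)" by (simp add: sub_ideal_def)
  show "F \<subseteq> Idl\<^bsub>R\<lparr>carrier := S\<rparr>\<^esub> F" using assms by (intro Q.genideal_self) simp
qed

text \<open>A certificate of membership involves a finite set \<open>W\<close> and stays valid in
  every subring that contains \<open>W\<close> and \<open>F\<close>. The elements with a certificate
  form an ideal, where unions of certificates serve for sums, and this ideal contains
  \<open>F\<close>.\<close>

lemma genideal_witness:
  assumes F: "F \<subseteq> carrier R" and x: "x \<in> Idl\<^bsub>R\<^esub> F"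
  shows "\<exists>W. finite W \<and> W \<subseteq> carrier R \<and> (\<forall>S. subring S R \<and> W \<union> F \<subseteq> S \<longrightarrow> x \<in> Idl\<^bsub>R\<lparr>carrier := S\<rparr>\<^esub> F)"
proof -
  let ?P = "\<lambda>W x. finite W \<and> W \<subseteq> carrier R \<and> (\<forall>S. subring S R \<and> W \<union> F \<subseteq> S \<longrightarrow> x \<in> Idl\<^bsub>R\<lparr>carrier := S\<rparr>\<^esub> F)"
  define G where "G = {x \<in> carrier R. \<exists>W. ?P W x}"
  have "sub_ideal R (carrier R) G"
    unfolding sub_ideal_def
  proof (intro conjI ballI)
    show "G \<subseteq> carrier R" by (auto simp: G_def)
    have "?P {} \<zero>" using subring_genideal_closure(1) by (auto simp: sub_ideal_def)
    then show "\<zero> \<in> G" unfolding G_def by blast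
  next
    fix a b assume "a \<in> G" "b \<in> G"
    then obtain V W where VW: "?P V a" "?P W b" "a \<in> carrier R" "b \<in> carrier R" unfolding G_def by blast
    have "?P (V \<union> W) (a \<oplus> b)"
    proof (intro conjI allI impI)
      fix S assume S: "subring S R \<and> V \<union> W \<union> F \<subseteq> S"
      then have "a \<in> Idl\<^bsub>R\<lparr>carrier := S\<rparr>\<^esub> F" "b \<in> Idl\<^bsub>R\<lparr>carrier := S\<rparr>\<^esub> F" using VW by auto
      then show "a \<oplus> b \<in> Idl\<^bsub>R\<lparr>carrier := S\<rparr>\<^esub> F"
        using sub_idealD(3)[OF subring_genideal_closure(1)] S by blast
    qed (use VW in auto)
    then show "a \<oplus> b \<in> G" unfolding G_def using VW a_closed by blast
  next
    fix s a assume s: "s \<in> carrier R" and "a \<in> G"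
    then obtain V where V: "?P V a" "a \<in> carrier R" unfolding G_def by blast
    have "?P (insert s V) (s \<otimes> a)"
    proof (intro conjI allI impI)
      fix S assume S: "subring S R \<and> insert s V \<union> F \<subseteq> S"
      then have "a \<in> Idl\<^bsub>R\<lparr>carrier := S\<rparr>\<^esub> F" using V by auto
      then show "s \<otimes> a \<in> Idl\<^bsub>R\<lparr>carrier := S\<rparr>\<^esub> F"
        using sub_idealD(4)[OF subring_genideal_closure(1)] S by blast
    qed (use V s in auto)
    then show "s \<otimes> a \<in> G" unfolding G_def using V s m_closed by blast
  qed
  then have "ideal G R" by (rule sub_ideal_ideal)
  moreover have "F \<subseteq> G"
  proof
    fix f assume f: "f \<in> F"
    then have "?P {} f" using subring_genideal_closure(2) by blast
    then show "f \<in> G" unfolding G_def using f F by blast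
  qed
  ultimately have "Idl\<^bsub>R\<^esub> F \<subseteq> G" by (rule genideal_minimal)
  then show ?thesis using x unfolding G_def by blast
qed

lemma genideal_square_witness:
  assumes F: "F \<subseteq> carrier R" and x: "x \<in> (Idl\<^bsub>R\<^esub> F) \<cdot> (Idl\<^bsub>R\<^esub> F)"
  shows "\<exists>W. finite W \<and> W \<subseteq> carrier R \<and> (\<forall>S. subring S R \<and> W \<union> F \<subseteq> S \<longrightarrow>
    x \<in> (Idl\<^bsub>R\<lparr>carrier := S\<rparr>\<^esub> F) \<cdot>\<^bsub>R\<lparr>carrier := S\<rparr>\<^esub> (Idl\<^bsub>R\<lparr>carrier := S\<rparr>\<^esub> F))"
  using x
proof (induction x rule: ideal_prod.induct)
  case (prod i j)
  obtain V W where V: "finite V" "V \<subseteq> carrier R" "\<And>S. subring S R \<and> V \<union> F \<subseteq> S \<longrightarrow> i \<in> Idl\<^bsub>R\<lparr>carrier := S\<rparr>\<^esub> F"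
    and W: "finite W" "W \<subseteq> carrier R" "\<And>S. subring S R \<and> W \<union> F \<subseteq> S \<longrightarrow> j \<in> Idl\<^bsub>R\<lparr>carrier := S\<rparr>\<^esub> F"
    using genideal_witness[OF F prod(1)] genideal_witness[OF F prod(2)] by blast
  have "i \<otimes> j \<in> (Idl\<^bsub>R\<lparr>carrier := S\<rparr>\<^esub> F) \<cdot>\<^bsub>R\<lparr>carrier := S\<rparr>\<^esub> (Idl\<^bsub>R\<lparr>carrier := S\<rparr>\<^esub> F)"
    if "subring S R" "V \<union> W \<union> F \<subseteq> S" for S
    using ideal_prod.prod[of i "Idl\<^bsub>R\<lparr>carrier := S\<rparr>\<^esub> F" j _ "R\<lparr>carrier := S\<rparr>"] V(3)[of S] W(3)[of S] that by auto
  then show ?case using V(1,2) W(1,2) by (intro exI[of _ "V \<union> W"]) auto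
next
  case (sum s1 s2)
  let ?Q = "\<lambda>S. (Idl\<^bsub>R\<lparr>carrier := S\<rparr>\<^esub> F) \<cdot>\<^bsub>R\<lparr>carrier := S\<rparr>\<^esub> (Idl\<^bsub>R\<lparr>carrier := S\<rparr>\<^esub> F)"
  obtain V W where V: "finite V" "V \<subseteq> carrier R" "\<And>S. subring S R \<and> V \<union> F \<subseteq> S \<longrightarrow> s1 \<in> ?Q S"
    and W: "finite W" "W \<subseteq> carrier R" "\<And>S. subring S R \<and> W \<union> F \<subseteq> S \<longrightarrow> s2 \<in> ?Q S"
    using sum.IH by blast
  have "s1 \<oplus> s2 \<in> ?Q S" if "subring S R" "V \<union> W \<union> F \<subseteq> S" for S
    using ideal_prod.sum[of s1 "R\<lparr>carrier := S\<rparr>" "Idl\<^bsub>R\<lparr>carrier := S\<rparr>\<^esub> F" "Idl\<^bsub>R\<lparr>carrier := S\<rparr>\<^esub> F" s2]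
      V(3)[of S] W(3)[of S] that by auto
  then show ?case using V(1,2) W(1,2) by (intro exI[of _ "V \<union> W"]) auto
qed

end

lemma (in ring) add_minus_cancel: "x \<in> carrier R \<Longrightarrow> y \<in> carrier R \<Longrightarrow> y \<oplus> (x \<ominus> y) = x"
  by (simp add: a_minus_def a_lcomm[of y] r_neg)

section \<open>Reduction of polynomial rings to finitely generated subrings\<close>

context
  fixes Y :: "('x, 'm) ring_scheme" and n :: nat
  assumes Y: "cring Y"
begin

abbreviation (input) "PX \<equiv> mpoly_ring Y n"
abbreviation (input) "vars \<equiv> (\<lambda>i. single Y \<one>\<^bsub>Y\<^esub> {#i#}) ` {..<n}"
abbreviation (input) "consts \<equiv> (\<lambda>r. single Y r {#}) ` carrier Y"

interpretation PX: cring PX using Y by (rule mpoly_ring_cring)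

lemma vars_closed: "vars \<subseteq> carrier PX"
  using mpoly_var_closed[OF Y] by auto

lemma consts_closed: "consts \<subseteq> carrier PX"
  using ring_hom_closed[OF mpoly_const_hom[OF Y]] by blast

text \<open>All variables are kept, and only the constants are cut down to a finite set; the union
  of two such sets serves for sums and products.\<close>

lemma mpoly_support:
  assumes "p \<in> carrier PX"
  shows "\<exists>C. finite C \<and> C \<subseteq> consts \<and> p \<in> generate_ring PX (vars \<union> C)"
proof -
  let ?G = "\<lambda>C. generate_ring PX (vars \<union> C)"
  have mono: "?G C \<subseteq> ?G D" if "C \<subseteq> D" "D \<subseteq> consts" for C D
    by (rule PX.mono_generate_ring) (use that vars_closed consts_closed in auto)
  define S where "S = {p \<in> carrier PX. \<exists>C. finite C \<and> C \<subseteq> consts \<and> p \<in> ?G C}"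
  have mem: "p \<in> S" if "finite C" "C \<subseteq> consts" "p \<in> ?G C" for p C
    using that PX.generate_ring_in_carrier[of "vars \<union> C" p] vars_closed consts_closed unfolding S_def by auto
  have "subring S PX"
  proof (rule PX.subringI)
    show "S \<subseteq> carrier PX" by (auto simp: S_def)
    show "\<one>\<^bsub>PX\<^esub> \<in> S" by (rule mem[of "{}"]) (auto intro: generate_ring.one)
    fix p assume "p \<in> S"
    then obtain C where C: "finite C" "C \<subseteq> consts" "p \<in> ?G C" unfolding S_def by blast
    show "\<ominus>\<^bsub>PX\<^esub> p \<in> S" by (rule mem[OF C(1,2)]) (rule generate_ring.a_inv[OF C(3)])
    fix q assume "q \<in> S"
    then obtain D where D: "finite D" "D \<subseteq> consts" "q \<in> ?G D" unfolding S_def by blast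
    have CD: "finite (C \<union> D)" "C \<union> D \<subseteq> consts" "p \<in> ?G (C \<union> D)" "q \<in> ?G (C \<union> D)"
      using C D mono[of C "C \<union> D"] mono[of D "C \<union> D"] by auto
    show "p \<otimes>\<^bsub>PX\<^esub> q \<in> S" by (rule mem[OF CD(1,2)]) (rule generate_ring.eng_mult[OF CD(3,4)])
    show "p \<oplus>\<^bsub>PX\<^esub> q \<in> S" by (rule mem[OF CD(1,2)]) (rule generate_ring.eng_add[OF CD(3,4)])
  qed
  moreover have "single Y r {#} \<in> S" if "r \<in> carrier Y" for r
    by (rule mem[of "{single Y r {#}}"]) (use that in \<open>auto intro: generate_ring.incl\<close>)
  moreover have "single Y \<one>\<^bsub>Y\<^esub> {#i#} \<in> S" if "i \<in> {..<n}" for i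
    by (rule mem[of "{}"]) (use that in \<open>auto intro: generate_ring.incl\<close>)
  ultimately have "carrier PX \<subseteq> S"
    unfolding mpoly_ring_def by (rule free_generating_subring[OF Y])
  then show ?thesis using assms unfolding S_def by blast
qed

lemma mpoly_support_finite:
  assumes "finite E" "E \<subseteq> carrier PX"
  shows "\<exists>C. finite C \<and> C \<subseteq> consts \<and> E \<subseteq> generate_ring PX (vars \<union> C)"
  using assms
proof (induction E)
  case (insert e E)
  obtain C D where C: "finite C" "C \<subseteq> consts" "E \<subseteq> generate_ring PX (vars \<union> C)"
    and D: "finite D" "D \<subseteq> consts" "e \<in> generate_ring PX (vars \<union> D)"
    using insert mpoly_support[of e] by auto
  have "vars \<union> (C \<union> D) \<subseteq> carrier PX" using C D vars_closed consts_closed by blast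
  then have "generate_ring PX (vars \<union> C) \<subseteq> generate_ring PX (vars \<union> (C \<union> D))"
    "generate_ring PX (vars \<union> D) \<subseteq> generate_ring PX (vars \<union> (C \<union> D))"
    by (intro PX.mono_generate_ring; blast)+
  then have "insert e E \<subseteq> generate_ring PX (vars \<union> (C \<union> D))" using C D by blast
  then show ?case using C D by (intro exI[of _ "C \<union> D"]) auto
qed (auto intro: exI[of _ "{}"])

lemma mpoly_const_nonzerodivisor:
  assumes t: "t \<in> carrier Y" and nzd: "\<And>b. b \<in> carrier Y \<Longrightarrow> t \<otimes>\<^bsub>Y\<^esub> b = \<zero>\<^bsub>Y\<^esub> \<Longrightarrow> b = \<zero>\<^bsub>Y\<^esub>"
    and p: "p \<in> carrier PX" and z: "single Y t {#} \<otimes>\<^bsub>PX\<^esub> p = \<zero>\<^bsub>PX\<^esub>"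
  shows "p = \<zero>\<^bsub>PX\<^esub>"
proof -
  interpret mon_alg Y "free_cmonoid {..<n}" using Y by (rule mon_alg_free)
  have p': "p \<in> carrier P" using p by (simp add: mpoly_ring_def)
  have "(\<lambda>x. t \<otimes>\<^bsub>Y\<^esub> p x) = (\<lambda>x. \<zero>\<^bsub>Y\<^esub>)"
    using z const_mult[OF t p'] by (simp add: mpoly_ring_def zero_P)
  then have "t \<otimes>\<^bsub>Y\<^esub> p x = \<zero>\<^bsub>Y\<^esub>" for x by (rule fun_cong)
  then have "p x = \<zero>\<^bsub>Y\<^esub>" for x using nzd coeff_closed[OF p'] by blast
  then show ?thesis by (simp add: mpoly_ring_def zero_P fun_eq_iff)
qed

text \<open>The ring \<open>Y\<close> is arbitrary, but the hypotheses on \<open>N\<close> and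
  \<open>b\<close> are certified by finitely many polynomials, which involve finitely many
  constants. The subring generated by these constants and the variables satisfies the chain
  condition, and \<open>noetherian_descent\<close> applies there.\<close>

lemma mpoly_descent:
  assumes t: "t \<in> carrier Y" and nzd: "\<And>b. b \<in> carrier Y \<Longrightarrow> t \<otimes>\<^bsub>Y\<^esub> b = \<zero>\<^bsub>Y\<^esub> \<Longrightarrow> b = \<zero>\<^bsub>Y\<^esub>"
    and F: "finite F" "F \<subseteq> carrier PX"
    and N: "N \<in> alg_hom Y PX (\<lambda>r. single Y r {#}) PX (\<lambda>r. single Y r {#})"
    and N_var: "\<And>i. i < n \<Longrightarrow> N (single Y \<one>\<^bsub>Y\<^esub> {#i#}) \<ominus>\<^bsub>PX\<^esub> single Y \<one>\<^bsub>Y\<^esub> {#i#} \<in> Idl\<^bsub>PX\<^esub> F"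
    and N_F: "\<And>f. f \<in> F \<Longrightarrow> N f \<in> (Idl\<^bsub>PX\<^esub> F) \<cdot>\<^bsub>PX\<^esub> (Idl\<^bsub>PX\<^esub> F)"
    and b: "b \<in> carrier PX" and tb: "single Y t {#} \<otimes>\<^bsub>PX\<^esub> b \<in> Idl\<^bsub>PX\<^esub> F"
  shows "b \<in> Idl\<^bsub>PX\<^esub> F"
proof -
  note Nr = alg_hom_ring_hom[OF N]
  let ?v = "\<lambda>i. single Y \<one>\<^bsub>Y\<^esub> {#i#}" and ?t = "single Y t {#}"
  let ?Q = "\<lambda>S. PX\<lparr>carrier := S\<rparr>"
  have vc: "?v i \<in> carrier PX" if "i < n" for i using mpoly_var_closed[OF Y that] .
  have tc: "?t \<in> carrier PX" using consts_closed t by blast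
  have "\<forall>i. \<exists>W. i < n \<longrightarrow> finite W \<and> W \<subseteq> carrier PX \<and> (\<forall>S. subring S PX \<and> W \<union> F \<subseteq> S \<longrightarrow>
      N (?v i) \<ominus>\<^bsub>PX\<^esub> ?v i \<in> Idl\<^bsub>?Q S\<^esub> F)"
    using PX.genideal_witness[OF F(2) N_var] by meson
  then obtain W1 where W1: "\<And>i. i < n \<Longrightarrow> finite (W1 i) \<and> W1 i \<subseteq> carrier PX \<and> (\<forall>S. subring S PX \<and> W1 i \<union> F \<subseteq> S \<longrightarrow>
      N (?v i) \<ominus>\<^bsub>PX\<^esub> ?v i \<in> Idl\<^bsub>?Q S\<^esub> F)" by metis
  have "\<forall>f. \<exists>W. f \<in> F \<longrightarrow> finite W \<and> W \<subseteq> carrier PX \<and> (\<forall>S. subring S PX \<and> W \<union> F \<subseteq> S \<longrightarrow>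
      N f \<in> (Idl\<^bsub>?Q S\<^esub> F) \<cdot>\<^bsub>?Q S\<^esub> (Idl\<^bsub>?Q S\<^esub> F))"
    using PX.genideal_square_witness[OF F(2) N_F] by meson
  then obtain W2 where W2: "\<And>f. f \<in> F \<Longrightarrow> finite (W2 f) \<and> W2 f \<subseteq> carrier PX \<and> (\<forall>S. subring S PX \<and> W2 f \<union> F \<subseteq> S \<longrightarrow>
      N f \<in> (Idl\<^bsub>?Q S\<^esub> F) \<cdot>\<^bsub>?Q S\<^esub> (Idl\<^bsub>?Q S\<^esub> F))" by metis
  obtain W3 where W3: "finite W3" "W3 \<subseteq> carrier PX"
    "\<And>S. subring S PX \<and> W3 \<union> F \<subseteq> S \<longrightarrow> ?t \<otimes>\<^bsub>PX\<^esub> b \<in> Idl\<^bsub>?Q S\<^esub> F"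
    using PX.genideal_witness[OF F(2) tb] by blast
  \<comment> \<open>The finite set of everything the argument mentions: the relations,
    \<open>b\<close>, t, and the certificates for the variables, for the relations and for t
    b.\<close>
  define E where "E = F \<union> {b, ?t} \<union> (\<Union>i<n. W1 i) \<union> (\<Union>f\<in>F. W2 f) \<union> W3"
  have c1: "finite (W1 i)" "W1 i \<subseteq> carrier PX" if "i < n" for i using W1[OF that] by auto
  have c2: "finite (W2 f)" "W2 f \<subseteq> carrier PX" if "f \<in> F" for f using W2[OF that] by auto
  have E: "finite E" unfolding E_def using F(1) c1(1) c2(1) W3(1) by simp
  have E': "E \<subseteq> carrier PX" unfolding E_def using F(2) b tc c1(2) c2(2) W3(2) by blast
  obtain C where C: "finite C" "C \<subseteq> consts" "E \<subseteq> generate_ring PX (vars \<union> C)"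
    using mpoly_support_finite[OF E E'] by blast
  define S where "S = generate_ring PX (vars \<union> C)"
  have gens: "finite (vars \<union> C)" "vars \<union> C \<subseteq> carrier PX"
    using C vars_closed consts_closed by blast+
  have S: "subring S PX" unfolding S_def by (rule PX.generate_ring_is_subring[OF gens(2)])
  have SP: "x \<in> carrier PX" if "x \<in> S" for x using subringE(1)[OF S] that by blast
  have ES: "F \<subseteq> S" "b \<in> S" "?t \<in> S" "\<And>i. i < n \<Longrightarrow> W1 i \<subseteq> S" "\<And>f. f \<in> F \<Longrightarrow> W2 f \<subseteq> S" "W3 \<subseteq> S"
    using C(3) unfolding E_def S_def by auto
  interpret Q: cring "?Q S" using S by (rule PX.subring_cring)
  let ?J = "Idl\<^bsub>?Q S\<^esub> F"
  have J: "sub_ideal PX S ?J" "F \<subseteq> ?J" using PX.subring_genideal_closure[OF S ES(1)] by auto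
  note JS = sub_idealD[OF J(1)]
  have neg: "\<ominus>\<^bsub>PX\<^esub> j \<in> ?J" if "j \<in> ?J" for j
    using PX.sub_ideal_minus[OF S J(1) JS(2) that] JS(1) that SP by (auto simp: a_minus_def)
  \<comment> \<open>The elements that \<open>N\<close> moves only within \<open>?J\<close> are
    closed under the ring operations, so generators suffice: constants are fixed, and variables move
    by certified elements. In particular \<open>N\<close> maps \<open>S\<close> to itself.\<close>
  have N_id: "\<exists>j\<in>?J. N q = q \<oplus>\<^bsub>PX\<^esub> j" if "q \<in> S" for q
    using that unfolding S_def
  proof (induction q rule: generate_ring.induct)
    case one
    have "N \<one>\<^bsub>PX\<^esub> = \<one>\<^bsub>PX\<^esub> \<oplus>\<^bsub>PX\<^esub> \<zero>\<^bsub>PX\<^esub>" using ring_hom_one[OF Nr] by simp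
    then show ?case using JS(2) unfolding S_def by blast
  next
    case (incl h)
    then consider i where "i < n" "h = ?v i" | r where "r \<in> carrier Y" "h = single Y r {#}" using C(2) by blast
    then show ?case
    proof cases
      case 1
      have "N (?v i) \<ominus>\<^bsub>PX\<^esub> ?v i \<in> ?J" using W1[OF 1(1)] S ES(1) ES(4)[OF 1(1)] by auto
      moreover have "N (?v i) = ?v i \<oplus>\<^bsub>PX\<^esub> (N (?v i) \<ominus>\<^bsub>PX\<^esub> ?v i)"
        using vc[OF 1(1)] ring_hom_closed[OF Nr vc[OF 1(1)]]
        by (simp add: PX.add_minus_cancel)
      ultimately show ?thesis unfolding 1 S_def by blast
    next
      case 2
      have "h \<in> carrier PX" using 2 consts_closed by blast
      then have "N h = h \<oplus>\<^bsub>PX\<^esub> \<zero>\<^bsub>PX\<^esub>" using alg_hom_str[OF N 2(1)] 2(2) by simp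
      then show ?thesis using JS(2) unfolding S_def by blast
    qed
  next
    case (a_inv h)
    then obtain j where j: "j \<in> ?J" "N h = h \<oplus>\<^bsub>PX\<^esub> j" unfolding S_def by blast
    have h: "h \<in> carrier PX" "j \<in> carrier PX" using a_inv SP JS(1) j unfolding S_def by blast+
    have "N (\<ominus>\<^bsub>PX\<^esub> h) = \<ominus>\<^bsub>PX\<^esub> h \<oplus>\<^bsub>PX\<^esub> \<ominus>\<^bsub>PX\<^esub> j"
      using h j(2) ring_hom_a_inv[OF Nr PX.ring_axioms PX.ring_axioms h(1)] by (simp add: PX.minus_add)
    then show ?case using neg[OF j(1)] unfolding S_def by blast
  next
    case (eng_add h1 h2)
    then obtain j1 j2 where j: "j1 \<in> ?J" "N h1 = h1 \<oplus>\<^bsub>PX\<^esub> j1" "j2 \<in> ?J" "N h2 = h2 \<oplus>\<^bsub>PX\<^esub> j2" unfolding S_def by blast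
    have h: "h1 \<in> carrier PX" "h2 \<in> carrier PX" "j1 \<in> carrier PX" "j2 \<in> carrier PX"
      using eng_add SP JS(1) j unfolding S_def by blast+
    have "N (h1 \<oplus>\<^bsub>PX\<^esub> h2) = (h1 \<oplus>\<^bsub>PX\<^esub> h2) \<oplus>\<^bsub>PX\<^esub> (j1 \<oplus>\<^bsub>PX\<^esub> j2)"
      using h j ring_hom_add[OF Nr h(1,2)] by (simp add: PX.a_ac)
    then show ?case using JS(3)[OF j(1,3)] unfolding S_def by blast
  next
    case (eng_mult h1 h2)
    then obtain j1 j2 where j: "j1 \<in> ?J" "N h1 = h1 \<oplus>\<^bsub>PX\<^esub> j1" "j2 \<in> ?J" "N h2 = h2 \<oplus>\<^bsub>PX\<^esub> j2" unfolding S_def by blast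
    have hS: "h1 \<in> S" "h2 \<in> S" "j1 \<in> S" using eng_mult JS(1) j unfolding S_def by blast+
    have h: "h1 \<in> carrier PX" "h2 \<in> carrier PX" "j1 \<in> carrier PX" "j2 \<in> carrier PX"
      using hS SP JS(1) j by blast+
    have "N (h1 \<otimes>\<^bsub>PX\<^esub> h2) = h1 \<otimes>\<^bsub>PX\<^esub> h2 \<oplus>\<^bsub>PX\<^esub> (h1 \<otimes>\<^bsub>PX\<^esub> j2 \<oplus>\<^bsub>PX\<^esub> h2 \<otimes>\<^bsub>PX\<^esub> j1 \<oplus>\<^bsub>PX\<^esub> j1 \<otimes>\<^bsub>PX\<^esub> j2)"
      using h j ring_hom_mult[OF Nr h(1,2)] by (simp add: PX.l_distr PX.r_distr PX.a_ac PX.m_ac)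
    moreover have "h1 \<otimes>\<^bsub>PX\<^esub> j2 \<oplus>\<^bsub>PX\<^esub> h2 \<otimes>\<^bsub>PX\<^esub> j1 \<oplus>\<^bsub>PX\<^esub> j1 \<otimes>\<^bsub>PX\<^esub> j2 \<in> ?J"
      by (intro JS(3) JS(4) hS j)
    ultimately show ?case unfolding S_def by blast
  qed
  have "b \<in> ?J"
  proof (rule Q.noetherian_descent)
    have acc: "ideal_acc PX S" unfolding S_def by (rule PX.ideal_acc_finitely_generated[OF gens])
    then show "ideal_acc (?Q S) (carrier (?Q S))"
      by (simp add: ideal_acc_def sub_ideal_def)
    have "N q \<in> S" if "q \<in> S" for q
      using N_id[OF that] JS(1) subringE(7)[OF S that] by auto
    then show "N \<in> ring_hom (?Q S) (?Q S)"
      using Nr SP by (auto simp: ring_hom_def Pi_def)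
    show "N ?t = ?t" using alg_hom_str[OF N t] .
    show "c = \<zero>\<^bsub>?Q S\<^esub>" if "c \<in> carrier (?Q S)" "?t \<otimes>\<^bsub>?Q S\<^esub> c = \<zero>\<^bsub>?Q S\<^esub>" for c
      using mpoly_const_nonzerodivisor[OF t nzd] that SP by simp
    show "\<exists>j\<in>?J. N q = q \<oplus>\<^bsub>?Q S\<^esub> j" if "q \<in> carrier (?Q S)" for q using N_id that by simp
    show "N f \<in> ?J \<cdot>\<^bsub>?Q S\<^esub> ?J" if "f \<in> F" for f using W2[OF that] S ES(1) ES(5)[OF that] by auto
    show "?t \<otimes>\<^bsub>?Q S\<^esub> b \<in> ?J" using W3(3)[of S] S ES by simp
  qed (use F ES in auto)
  moreover have "?J \<subseteq> Idl\<^bsub>PX\<^esub> F"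
  proof -
    have I: "ideal (Idl\<^bsub>PX\<^esub> F) PX" using F(2) by (rule PX.genideal_ideal)
    have "ideal (S \<inter> Idl\<^bsub>PX\<^esub> F) (?Q S)"
    proof (rule Q.sub_ideal_ideal)
      show "sub_ideal (?Q S) (carrier (?Q S)) (S \<inter> Idl\<^bsub>PX\<^esub> F)"
        using sub_idealD[OF ideal_sub_ideal[OF I]] subringE[OF S] SP unfolding sub_ideal_def by simp
    qed
    then have "?J \<subseteq> S \<inter> Idl\<^bsub>PX\<^esub> F"
      by (rule Q.genideal_minimal) (use ES(1) PX.genideal_self[OF F(2)] in auto)
    then show ?thesis by blast
  qed
  ultimately show ?thesis by blast
qed

end

section \<open>Base change of the Newton endomorphism\<close>

context smooth_presentation
begin

interpretation Pn: cring Pn by (rule Pn_cring)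

lemma ideal_base_change:
  assumes Y: "cring Y" and c: "c \<in> ring_hom Pn D" and D: "cring D" and x: "x \<in> J2"
  shows "c x \<in> (Idl\<^bsub>D\<^esub> (c ` F)) \<cdot>\<^bsub>D\<^esub> (Idl\<^bsub>D\<^esub> (c ` F))"
proof -
  interpret D: cring D by fact
  have sub: "c ` F \<subseteq> carrier D" using F ring_hom_closed[OF c] by blast
  have J': "c y \<in> Idl\<^bsub>D\<^esub> (c ` F)" if "y \<in> J" for y
    by (rule genideal_image[OF c Pn_ring D.ring_axioms F D.genideal_ideal[OF sub] _ that[unfolded J_def]])
      (use D.genideal_self[OF sub] in blast)
  from x show ?thesis unfolding J2_def
  proof (induction x rule: ideal_prod.induct)
    case (prod i j)
    have "c (i \<otimes>\<^bsub>Pn\<^esub> j) = c i \<otimes>\<^bsub>D\<^esub> c j"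
      using prod J_closed by (intro ring_hom_mult[OF c]) auto
    then show ?case using J' prod by (auto intro: ideal_prod.prod)
  next
    case (sum s1 s2)
    have "s1 \<in> carrier Pn" "s2 \<in> carrier Pn"
      using sum(1,2) J2_sub J_closed unfolding J2_def by auto
    then have "c (s1 \<oplus>\<^bsub>Pn\<^esub> s2) = c s1 \<oplus>\<^bsub>D\<^esub> c s2" by (rule ring_hom_add[OF c])
    then show ?case using sum.IH by (auto intro: ideal_prod.sum)
  qed
qed

text \<open>The polynomial ring over \<open>Y\<close> modulo the images of \<open>F\<close> is the
  base change of A. Its endomorphism \<open>N'\<close> sends a variable to the image of
  \<open>N\<close> of that variable, so it inherits both congruences and
  \<open>mpoly_descent\<close> applies. A proof that smoothness itself is stable under base change
  is thereby bypassed.\<close>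

lemma base_change_descent:
  assumes Y: "cring Y" and rho: "\<rho> \<in> ring_hom R Y" and t: "t \<in> carrier Y"
    and nzd: "\<And>b. b \<in> carrier Y \<Longrightarrow> t \<otimes>\<^bsub>Y\<^esub> b = \<zero>\<^bsub>Y\<^esub> \<Longrightarrow> b = \<zero>\<^bsub>Y\<^esub>"
    and c: "c \<in> alg_hom R Pn cst (mpoly_ring Y n) (\<lambda>r. single Y (\<rho> r) {#})"
    and c_var: "\<And>i. i < n \<Longrightarrow> c (vr i) = single Y \<one>\<^bsub>Y\<^esub> {#i#}"
    and b: "b \<in> carrier (mpoly_ring Y n)"
    and tb: "single Y t {#} \<otimes>\<^bsub>mpoly_ring Y n\<^esub> b \<in> Idl\<^bsub>mpoly_ring Y n\<^esub> (c ` F)"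
  shows "b \<in> Idl\<^bsub>mpoly_ring Y n\<^esub> (c ` F)"
proof -
  let ?P = "mpoly_ring Y n"
  interpret PX: cring ?P using Y by (rule mpoly_ring_cring)
  note cr = alg_hom_ring_hom[OF c]
  obtain N where N: "N \<in> alg_hom R Pn cst Pn cst" and N_id: "\<And>p. p \<in> carrier Pn \<Longrightarrow> N p \<ominus>\<^bsub>Pn\<^esub> p \<in> J"
    and N_J: "\<And>x. x \<in> J \<Longrightarrow> N x \<in> J2" by (rule newton) blast
  note Nr = alg_hom_ring_hom[OF N]
  have Nc: "N p \<in> carrier Pn" if "p \<in> carrier Pn" for p using Nr that by (rule ring_hom_closed)
  obtain N' where N': "N' \<in> alg_hom Y ?P (\<lambda>r. single Y r {#}) ?P (\<lambda>r. single Y r {#})"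
    and N'_var: "\<And>i. i < n \<Longrightarrow> N' (single Y \<one>\<^bsub>Y\<^esub> {#i#}) = c (N (vr i))"
    by (rule mpoly_lift[OF Y PX.is_cring mpoly_const_hom[OF Y], of n "\<lambda>i. c (N (vr i))"])
      (use ring_hom_closed[OF cr Nc[OF var_closed]] in auto)
  have N'c: "N' (c p) = c (N p)" if "p \<in> carrier Pn" for p
    by (rule mpoly_hom_eqI[OF algD(1) PX.ring_axioms ring_hom_comp[OF cr alg_hom_ring_hom[OF N']] ring_hom_comp[OF Nr cr] _ _ that])
      (simp_all add: alg_hom_str[OF N] alg_hom_str[OF c] alg_hom_str[OF N'] ring_hom_closed[OF rho] c_var N'_var)
  have sub: "c ` F \<subseteq> carrier ?P" using F ring_hom_closed[OF cr] by blast
  have J': "c y \<in> Idl\<^bsub>?P\<^esub> (c ` F)" if "y \<in> J" for y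
    by (rule genideal_image[OF cr Pn_ring PX.ring_axioms F PX.genideal_ideal[OF sub] _ that[unfolded J_def]])
      (use PX.genideal_self[OF sub] in blast)
  have FJ: "f \<in> J" if "f \<in> F" for f using that Pn.genideal_self[OF F] unfolding J_def by blast
  show ?thesis
  proof (rule mpoly_descent[OF Y t nzd _ sub N' _ _ b tb])
    show "finite (c ` F)" using fin by simp
    show "N' (single Y \<one>\<^bsub>Y\<^esub> {#i#}) \<ominus>\<^bsub>?P\<^esub> single Y \<one>\<^bsub>Y\<^esub> {#i#} \<in> Idl\<^bsub>?P\<^esub> (c ` F)" if "i < n" for i
      using J'[OF N_id[OF var_closed[OF that]]]
        ring_hom_minus[OF cr Pn_ring PX.ring_axioms Nc[OF var_closed[OF that]] var_closed[OF that]]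
      by (simp add: N'_var[OF that] c_var[OF that])
    show "N' g \<in> (Idl\<^bsub>?P\<^esub> (c ` F)) \<cdot>\<^bsub>?P\<^esub> (Idl\<^bsub>?P\<^esub> (c ` F))" if g: "g \<in> c ` F" for g
    proof -
      obtain f where f: "f \<in> F" "g = c f" using g by blast
      then have "N' g = c (N f)" using N'c F by auto
      then show ?thesis using ideal_base_change[OF Y cr PX.is_cring N_J[OF FJ[OF f(1)]]] by simp
    qed
  qed
qed

lemma nonzerodivisor:
  assumes t: "t \<in> carrier R" and nzd: "\<And>b. b \<in> carrier R \<Longrightarrow> t \<otimes>\<^bsub>R\<^esub> b = \<zero>\<^bsub>R\<^esub> \<Longrightarrow> b = \<zero>\<^bsub>R\<^esub>"
    and a: "a \<in> carrier A" and ta: "\<phi> t \<otimes>\<^bsub>A\<^esub> a = \<zero>\<^bsub>A\<^esub>"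
  shows "a = \<zero>\<^bsub>A\<^esub>"
proof -
  obtain p where p: "p \<in> carrier Pn" "\<pi> p = a" using a by (rule preimage)
  have id: "id \<in> alg_hom R Pn cst (mpoly_ring R n) (\<lambda>r. single R (id r) {#})"
    using alg_hom_id[of R Pn cst] by simp
  have idR: "id \<in> ring_hom R R" by (auto simp: ring_hom_def)
  have "\<pi> (cst t \<otimes>\<^bsub>Pn\<^esub> p) = \<zero>\<^bsub>A\<^esub>"
    using ring_hom_mult[OF pi_hom cst_closed[OF t] p(1)] alg_hom_str[OF pi t] p ta by simp
  then have "cst t \<otimes>\<^bsub>Pn\<^esub> p \<in> Idl\<^bsub>Pn\<^esub> (id ` F)"
    using mem_J_iff p cst_closed[OF t] unfolding J_def by simp
  then have "p \<in> J"
    using base_change_descent[OF algD(1) idR t nzd id _ p(1)] unfolding J_def by simp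
  then show ?thesis using mem_J_iff p by simp
qed

text \<open>The tensor product is identified with the polynomial ring over \<open>Y\<close> modulo
  \<open>I\<close>: \<open>G\<close> presents it, and \<open>?L\<close> is the map in the opposite
  direction.\<close>

lemma nonzerodivisor_tensor:
  assumes xi: "ring_hom_cring R Y \<xi>" and t: "t \<in> carrier Y"
    and nzd: "\<And>b. b \<in> carrier Y \<Longrightarrow> t \<otimes>\<^bsub>Y\<^esub> b = \<zero>\<^bsub>Y\<^esub> \<Longrightarrow> b = \<zero>\<^bsub>Y\<^esub>"
    and w: "w \<in> carrier (tensor R A \<phi> Y \<xi>)"
    and tw: "pure_tensor R A \<phi> Y \<xi> \<one>\<^bsub>A\<^esub> t \<otimes>\<^bsub>tensor R A \<phi> Y \<xi>\<^esub> w = \<zero>\<^bsub>tensor R A \<phi> Y \<xi>\<^esub>"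
  shows "w = \<zero>\<^bsub>tensor R A \<phi> Y \<xi>\<^esub>"
proof -
  interpret TT: tensor_alg R A \<phi> Y \<xi> using alg xi by (rule tensor_alg.intro)
  interpret T: cring TT.T by (rule TT.T_cring)
  note Y = ring_hom_cringD[OF xi]
  let ?P = "mpoly_ring Y n" and ?c = "\<lambda>r. single Y r {#}"
  interpret PX: cring ?P using Y(2) by (rule mpoly_ring_cring)
  have cc: "?c r \<in> carrier ?P" if "r \<in> carrier Y" for r
    using ring_hom_closed[OF mpoly_const_hom[OF Y(2)] that] .
  obtain c where c: "c \<in> alg_hom R Pn cst ?P (\<lambda>r. ?c (\<xi> r))"
    and c_var: "\<And>i. i < n \<Longrightarrow> c (vr i) = single Y \<one>\<^bsub>Y\<^esub> {#i#}"
    by (rule mpoly_lift[OF algD(1) PX.is_cring ring_hom_comp[OF Y(3) mpoly_const_hom[OF Y(2)]], of n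
          "\<lambda>i. single Y \<one>\<^bsub>Y\<^esub> {#i#}"]) (use mpoly_var_closed[OF Y(2)] in auto)
  note cr = alg_hom_ring_hom[OF c]
  have sub: "c ` F \<subseteq> carrier ?P" using F ring_hom_closed[OF cr] by blast
  define I where "I = Idl\<^bsub>?P\<^esub> (c ` F)"
  have I: "ideal I ?P" unfolding I_def using sub by (rule PX.genideal_ideal)
  have J': "c y \<in> I" if "y \<in> J" for y unfolding I_def
    by (rule genideal_image[OF cr Pn_ring PX.ring_axioms F PX.genideal_ideal[OF sub] _ that[unfolded J_def]])
      (use PX.genideal_self[OF sub] in blast)
  have FJ: "f \<in> J" if "f \<in> F" for f using that Pn.genideal_self[OF F] unfolding J_def by blast
  obtain G where G: "G \<in> alg_hom Y ?P ?c TT.T TT.j2"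
    and G_var: "\<And>i. i < n \<Longrightarrow> G (single Y \<one>\<^bsub>Y\<^esub> {#i#}) = TT.j1 (\<pi> (vr i))"
    by (rule mpoly_lift[OF Y(2) T.is_cring TT.j2_hom, of n "\<lambda>i. TT.j1 (\<pi> (vr i))"])
      (use ring_hom_closed[OF TT.j1_hom ring_hom_closed[OF pi_hom var_closed]] in auto)
  note Gr = alg_hom_ring_hom[OF G]
  have Gc: "G (c p) = TT.j1 (\<pi> p)" if "p \<in> carrier Pn" for p
    by (rule mpoly_hom_eqI[OF algD(1) T.ring_axioms ring_hom_comp[OF cr Gr] ring_hom_comp[OF pi_hom TT.j1_hom] _ _ that])
      (simp_all add: alg_hom_str[OF c] alg_hom_str[OF G] alg_hom_str[OF pi] ring_hom_closed[OF Y(3)]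
        TT.j1_str TT.j2_str c_var G_var)
  have G_I: "G x = \<zero>\<^bsub>TT.T\<^esub>" if "x \<in> I" for x
  proof (rule genideal_kernel[OF Gr PX.ring_axioms T.ring_axioms sub _ that[unfolded I_def]])
    fix g assume "g \<in> c ` F"
    then obtain f where f: "f \<in> F" "g = c f" by blast
    then have "f \<in> carrier Pn" "\<pi> f = \<zero>\<^bsub>A\<^esub>" using FJ mem_J_iff by auto
    then show "G g = \<zero>\<^bsub>TT.T\<^esub>"
      using f Gc ring_hom_zero[OF TT.j1_hom algD(5) T.ring_axioms] by simp
  qed
  have G_surj: "carrier TT.T \<subseteq> G ` carrier ?P"
  proof (rule TT.T_generating_subring[OF ring_hom_image_subring[OF Gr PX.ring_axioms T.ring_axioms]])
    fix a assume "a \<in> carrier A"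
    then obtain p where "p \<in> carrier Pn" "\<pi> p = a" by (rule preimage)
    then show "TT.j1 a \<in> G ` carrier ?P"
      using Gc ring_hom_closed[OF cr] by (intro image_eqI[of _ _ "c p"]) auto
  next
    fix x assume "x \<in> carrier Y"
    then show "TT.j2 x \<in> G ` carrier ?P"
      using alg_hom_str[OF G] cc by (intro image_eqI[of _ _ "?c x"]) auto
  qed
  let ?q = "\<lambda>x. I +>\<^bsub>?P\<^esub> x"
  have Q: "cring (?P Quot I)" by (rule quot_cring[OF I PX.is_cring])
  then have rQ: "ring (?P Quot I)" by (rule cring.axioms)
  note q = quot_hom[OF I]
  have ker_q: "?q (c x) = \<zero>\<^bsub>?P Quot I\<^esub>" if "x \<in> carrier Pn" "\<pi> x = \<zero>\<^bsub>A\<^esub>" for x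
    using J'[of x] that coset_zero_iff[OF I ring_hom_closed[OF cr]] mem_J_iff by (simp add: zero_Quot)
  obtain f where f: "f \<in> ring_hom A (?P Quot I)" and f_eq: "\<And>p. p \<in> carrier Pn \<Longrightarrow> f (\<pi> p) = ?q (c p)"
    using hom_factor[OF pi_hom surj ring_hom_comp[OF cr q] ker_q Pn_ring algD(5) rQ] by metis
  have fA: "f \<in> alg_hom R A \<phi> (?P Quot I) (\<lambda>r. ?q (?c (\<xi> r)))"
    using f by (rule alg_homI)
      (simp add: alg_hom_str[OF pi, symmetric] f_eq cst_closed alg_hom_str[OF c])
  have gX: "(\<lambda>x. ?q (?c x)) \<in> alg_hom R Y \<xi> (?P Quot I) (\<lambda>r. ?q (?c (\<xi> r)))"
    by (rule alg_homI[OF ring_hom_comp[OF mpoly_const_hom[OF Y(2)] q]]) simp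
  have chi: "(\<lambda>r. ?q (?c (\<xi> r))) \<in> ring_hom R (?P Quot I)"
    by (rule ring_hom_comp[OF ring_hom_comp[OF Y(3) mpoly_const_hom[OF Y(2)]] q])
  let ?L = "tensor_lift R (?P Quot I) (\<lambda>r. ?q (?c (\<xi> r))) f (\<lambda>x. ?q (?c x))"
  note L = TT.tensor_lift_hom[OF Q chi fA gX]
  \<comment> \<open>Hence the kernel of \<open>G\<close> lies in \<open>I\<close>, and the relation
    t w = 0 can be read as membership in \<open>I\<close>.\<close>
  have LG: "?L (G p) = ?q p" if "p \<in> carrier ?P" for p
    by (rule mpoly_hom_eqI[OF Y(2) rQ ring_hom_comp[OF Gr L] q _ _ that])
      (simp_all add: alg_hom_str[OF G] TT.tensor_lift_j2[OF Q chi fA gX] G_var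
        TT.tensor_lift_j1[OF Q chi fA gX] ring_hom_closed[OF pi_hom var_closed] f_eq var_closed c_var)
  obtain p where p: "p \<in> carrier ?P" "w = G p" using w G_surj by blast
  have "G (?c t \<otimes>\<^bsub>?P\<^esub> p) = \<zero>\<^bsub>TT.T\<^esub>"
    using ring_hom_mult[OF Gr cc[OF t] p(1)] alg_hom_str[OF G t] tw p(2) by simp
  then have "?q (?c t \<otimes>\<^bsub>?P\<^esub> p) = ?L \<zero>\<^bsub>TT.T\<^esub>" using LG[of "?c t \<otimes>\<^bsub>?P\<^esub> p"] p(1) cc[OF t] by simp
  also have "\<dots> = I" using ring_hom_zero[OF L T.ring_axioms rQ] by (simp add: zero_Quot)
  finally have "?c t \<otimes>\<^bsub>?P\<^esub> p \<in> I" using coset_zero_iff[OF I] p(1) cc[OF t] by simp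
  then have "p \<in> I"
    using base_change_descent[OF Y(2,3) t nzd c c_var p(1)] unfolding I_def by simp
  then show ?thesis using G_I p(2) by simp
qed

end

section \<open>Adjoining a square root\<close>

text \<open>\<open>dbl C t\<close> is \<open>C[s]/(s\<^sup>2 - t)\<close>; the pair \<open>(a, b)\<close> stands for \<open>a + b s\<close>.\<close>

definition dbl :: "('c, 'm) ring_scheme \<Rightarrow> 'c \<Rightarrow> ('c \<times> 'c) ring"
  where "dbl C t = \<lparr>carrier = carrier C \<times> carrier C,
    monoid.mult = (\<lambda>x y. (fst x \<otimes>\<^bsub>C\<^esub> fst y \<oplus>\<^bsub>C\<^esub> t \<otimes>\<^bsub>C\<^esub> (snd x \<otimes>\<^bsub>C\<^esub> snd y), fst x \<otimes>\<^bsub>C\<^esub> snd y \<oplus>\<^bsub>C\<^esub> snd x \<otimes>\<^bsub>C\<^esub> fst y)),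
    one = (\<one>\<^bsub>C\<^esub>, \<zero>\<^bsub>C\<^esub>), ring.zero = (\<zero>\<^bsub>C\<^esub>, \<zero>\<^bsub>C\<^esub>),
    add = (\<lambda>x y. (fst x \<oplus>\<^bsub>C\<^esub> fst y, snd x \<oplus>\<^bsub>C\<^esub> snd y))\<rparr>"

lemma dbl_simps [simp]:
  "carrier (dbl C t) = carrier C \<times> carrier C"
  "(a, b) \<otimes>\<^bsub>dbl C t\<^esub> (c, d) = (a \<otimes>\<^bsub>C\<^esub> c \<oplus>\<^bsub>C\<^esub> t \<otimes>\<^bsub>C\<^esub> (b \<otimes>\<^bsub>C\<^esub> d), a \<otimes>\<^bsub>C\<^esub> d \<oplus>\<^bsub>C\<^esub> b \<otimes>\<^bsub>C\<^esub> c)"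
  "(a, b) \<oplus>\<^bsub>dbl C t\<^esub> (c, d) = (a \<oplus>\<^bsub>C\<^esub> c, b \<oplus>\<^bsub>C\<^esub> d)"
  "\<one>\<^bsub>dbl C t\<^esub> = (\<one>\<^bsub>C\<^esub>, \<zero>\<^bsub>C\<^esub>)" "\<zero>\<^bsub>dbl C t\<^esub> = (\<zero>\<^bsub>C\<^esub>, \<zero>\<^bsub>C\<^esub>)"
  by (simp_all add: dbl_def)

lemma dbl_cring:
  assumes "cring C" "t \<in> carrier C"
  shows "cring (dbl C t)"
proof -
  interpret C: cring C by fact
  note [simp] = assms(2)
  show ?thesis
  proof (rule cringI)
    show "abelian_group (dbl C t)"
    proof (rule abelian_groupI)
      fix x assume "x \<in> carrier (dbl C t)"
      then show "\<exists>y\<in>carrier (dbl C t). y \<oplus>\<^bsub>dbl C t\<^esub> x = \<zero>\<^bsub>dbl C t\<^esub>"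
        by (intro bexI[of _ "(\<ominus>\<^bsub>C\<^esub> fst x, \<ominus>\<^bsub>C\<^esub> snd x)"]) (auto simp: C.l_neg)
    qed (auto simp: C.a_ac)
    show "comm_monoid (dbl C t)"
    proof (rule comm_monoidI)
      fix x y z assume "x \<in> carrier (dbl C t)" "y \<in> carrier (dbl C t)" "z \<in> carrier (dbl C t)"
      then obtain a b c d e f where xyz: "x = (a, b)" "y = (c, d)" "z = (e, f)"
        and cl: "a \<in> carrier C" "b \<in> carrier C" "c \<in> carrier C" "d \<in> carrier C" "e \<in> carrier C" "f \<in> carrier C"
        by (cases x; cases y; cases z) auto
      show "x \<otimes>\<^bsub>dbl C t\<^esub> y \<otimes>\<^bsub>dbl C t\<^esub> z = x \<otimes>\<^bsub>dbl C t\<^esub> (y \<otimes>\<^bsub>dbl C t\<^esub> z)"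
        unfolding xyz using cl by (simp add: C.l_distr C.r_distr C.m_ac C.a_ac)
    next
      fix x y assume "x \<in> carrier (dbl C t)" "y \<in> carrier (dbl C t)"
      then show "x \<otimes>\<^bsub>dbl C t\<^esub> y = y \<otimes>\<^bsub>dbl C t\<^esub> x"
        by (cases x; cases y) (simp add: C.m_ac C.a_ac)
    qed auto
    fix x y z assume "x \<in> carrier (dbl C t)" "y \<in> carrier (dbl C t)" "z \<in> carrier (dbl C t)"
    then show "(x \<oplus>\<^bsub>dbl C t\<^esub> y) \<otimes>\<^bsub>dbl C t\<^esub> z = x \<otimes>\<^bsub>dbl C t\<^esub> z \<oplus>\<^bsub>dbl C t\<^esub> y \<otimes>\<^bsub>dbl C t\<^esub> z"
      by (cases x; cases y; cases z) (simp add: C.l_distr C.r_distr C.a_ac)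
  qed
qed

lemma dbl_a_inv:
  assumes "cring C" "t \<in> carrier C" "a \<in> carrier C" "b \<in> carrier C"
  shows "\<ominus>\<^bsub>dbl C t\<^esub> (a, b) = (\<ominus>\<^bsub>C\<^esub> a, \<ominus>\<^bsub>C\<^esub> b)"
proof -
  interpret C: cring C by fact
  interpret D: cring "dbl C t" using assms(1,2) by (rule dbl_cring)
  show ?thesis
    by (rule D.minus_equality) (use assms in \<open>auto simp: C.l_neg\<close>)
qed

lemma dbl_map_hom:
  assumes "h \<in> ring_hom C D" "h t = t'" "ring C" "ring D" "t \<in> carrier C"
  shows "map_prod h h \<in> ring_hom (dbl C t) (dbl D t')"
proof -
  interpret C: ring C by fact
  show ?thesis
    by (rule ring_hom_memI)
      (use assms in \<open>auto simp: ring_hom_closed ring_hom_mult[OF assms(1)] ring_hom_add[OF assms(1)]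
        ring_hom_one[OF assms(1)] ring_hom_zero[OF assms(1)]\<close>)
qed

lemma dbl_const_hom:
  assumes "cring C" "t \<in> carrier C"
  shows "(\<lambda>c. (c, \<zero>\<^bsub>C\<^esub>)) \<in> ring_hom C (dbl C t)"
proof -
  interpret C: cring C by fact
  show ?thesis by (rule ring_hom_memI) (use assms(2) in auto)
qed

lemma dbl_conj_hom:
  assumes "cring C" "t \<in> carrier C"
  shows "(\<lambda>x. (fst x, \<ominus>\<^bsub>C\<^esub> snd x)) \<in> ring_hom (dbl C t) (dbl C t)"
proof -
  interpret C: cring C by fact
  show ?thesis
    by (rule ring_hom_memI) (use assms(2) in \<open>auto simp: C.l_minus C.r_minus C.minus_add\<close>)
qed

text \<open>The universal property of C[s]/(s^2 - t): a square root of the image of t extends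
  \<open>e\<close>.\<close>

lemma dbl_eval_hom:
  assumes "cring C" "t \<in> carrier C" "cring E" "e \<in> ring_hom C E" "s \<in> carrier E" "s \<otimes>\<^bsub>E\<^esub> s = e t"
  shows "(\<lambda>x. e (fst x) \<oplus>\<^bsub>E\<^esub> s \<otimes>\<^bsub>E\<^esub> e (snd x)) \<in> ring_hom (dbl C t) E"
proof -
  interpret C: cring C by fact
  interpret E: cring E by fact
  note e = ring_hom_closed[OF assms(4)] ring_hom_mult[OF assms(4)] ring_hom_add[OF assms(4)]
    ring_hom_one[OF assms(4)] ring_hom_zero[OF assms(4) C.ring_axioms E.ring_axioms]
  note [simp] = assms(2,5)
  show ?thesis
  proof (rule ring_hom_memI)
    fix x y assume "x \<in> carrier (dbl C t)" "y \<in> carrier (dbl C t)"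
    then obtain a b c d where xy: "x = (a, b)" "y = (c, d)"
      and cl: "a \<in> carrier C" "b \<in> carrier C" "c \<in> carrier C" "d \<in> carrier C"
      by (cases x; cases y) auto
    then have cl': "e a \<in> carrier E" "e b \<in> carrier E" "e c \<in> carrier E" "e d \<in> carrier E"
      by (auto simp: e)
    have "(e a \<oplus>\<^bsub>E\<^esub> s \<otimes>\<^bsub>E\<^esub> e b) \<otimes>\<^bsub>E\<^esub> (e c \<oplus>\<^bsub>E\<^esub> s \<otimes>\<^bsub>E\<^esub> e d)
      = e a \<otimes>\<^bsub>E\<^esub> e c \<oplus>\<^bsub>E\<^esub> (s \<otimes>\<^bsub>E\<^esub> s) \<otimes>\<^bsub>E\<^esub> (e b \<otimes>\<^bsub>E\<^esub> e d) \<oplus>\<^bsub>E\<^esub> s \<otimes>\<^bsub>E\<^esub> (e a \<otimes>\<^bsub>E\<^esub> e d \<oplus>\<^bsub>E\<^esub> e b \<otimes>\<^bsub>E\<^esub> e c)"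
      using cl' by (simp add: E.l_distr E.r_distr E.m_ac E.a_ac)
    then show "e (fst (x \<otimes>\<^bsub>dbl C t\<^esub> y)) \<oplus>\<^bsub>E\<^esub> s \<otimes>\<^bsub>E\<^esub> e (snd (x \<otimes>\<^bsub>dbl C t\<^esub> y)) =
        (e (fst x) \<oplus>\<^bsub>E\<^esub> s \<otimes>\<^bsub>E\<^esub> e (snd x)) \<otimes>\<^bsub>E\<^esub> (e (fst y) \<oplus>\<^bsub>E\<^esub> s \<otimes>\<^bsub>E\<^esub> e (snd y))"
      unfolding xy assms(6) using cl by (simp add: e)
    show "e (fst (x \<oplus>\<^bsub>dbl C t\<^esub> y)) \<oplus>\<^bsub>E\<^esub> s \<otimes>\<^bsub>E\<^esub> e (snd (x \<oplus>\<^bsub>dbl C t\<^esub> y)) =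
        (e (fst x) \<oplus>\<^bsub>E\<^esub> s \<otimes>\<^bsub>E\<^esub> e (snd x)) \<oplus>\<^bsub>E\<^esub> (e (fst y) \<oplus>\<^bsub>E\<^esub> s \<otimes>\<^bsub>E\<^esub> e (snd y))"
      unfolding xy using cl cl' by (simp add: e E.r_distr E.a_ac)
  qed (auto simp: e)
qed

text \<open>The vanishing product says that f(a) f(b) + g(a) g(b) = f(a) g(b) + g(a) f(b). So (f(a)
  + g(a)) (f(b) + g(b)) is twice f(ab) + g(ab), and the factor \<open>h\<close>, one half, makes the
  average multiplicative.\<close>

lemma average_hom:
  assumes A: "ring A" and E: "cring E" and f: "f \<in> ring_hom A E" and g: "g \<in> ring_hom A E"
    and h: "h \<in> carrier E" "h \<oplus>\<^bsub>E\<^esub> h = \<one>\<^bsub>E\<^esub>"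
    and sq: "\<And>a b. a \<in> carrier A \<Longrightarrow> b \<in> carrier A \<Longrightarrow> (f a \<ominus>\<^bsub>E\<^esub> g a) \<otimes>\<^bsub>E\<^esub> (f b \<ominus>\<^bsub>E\<^esub> g b) = \<zero>\<^bsub>E\<^esub>"
  shows "(\<lambda>a. h \<otimes>\<^bsub>E\<^esub> (f a \<oplus>\<^bsub>E\<^esub> g a)) \<in> ring_hom A E"
proof -
  interpret A: ring A by fact
  interpret E: cring E by fact
  note F = ring_hom_closed[OF f] ring_hom_mult[OF f] ring_hom_add[OF f] ring_hom_one[OF f]
  note G = ring_hom_closed[OF g] ring_hom_mult[OF g] ring_hom_add[OF g] ring_hom_one[OF g]
  have half: "h \<otimes>\<^bsub>E\<^esub> (x \<oplus>\<^bsub>E\<^esub> x) = x" if "x \<in> carrier E" for x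
    using that h E.l_distr[of h h x] by (simp add: E.r_distr)
  show ?thesis
  proof (rule ring_hom_memI)
    fix a b assume ab: "a \<in> carrier A" "b \<in> carrier A"
    define x y z w where "x = f a" and "y = g a" and "z = f b" and "w = g b"
    have cl: "x \<in> carrier E" "y \<in> carrier E" "z \<in> carrier E" "w \<in> carrier E"
      using ab F(1) G(1) by (auto simp: x_def y_def z_def w_def)
    have "(x \<ominus>\<^bsub>E\<^esub> y) \<otimes>\<^bsub>E\<^esub> (z \<ominus>\<^bsub>E\<^esub> w) = \<zero>\<^bsub>E\<^esub>"
      using sq[OF ab] by (simp add: x_def y_def z_def w_def)
    then have "x \<otimes>\<^bsub>E\<^esub> z \<oplus>\<^bsub>E\<^esub> y \<otimes>\<^bsub>E\<^esub> w \<ominus>\<^bsub>E\<^esub> (x \<otimes>\<^bsub>E\<^esub> w \<oplus>\<^bsub>E\<^esub> y \<otimes>\<^bsub>E\<^esub> z) = \<zero>\<^bsub>E\<^esub>"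
      using cl by (simp add: a_minus_def E.l_distr E.r_distr E.l_minus E.r_minus E.minus_add E.a_ac)
    then have e: "x \<otimes>\<^bsub>E\<^esub> z \<oplus>\<^bsub>E\<^esub> y \<otimes>\<^bsub>E\<^esub> w = x \<otimes>\<^bsub>E\<^esub> w \<oplus>\<^bsub>E\<^esub> y \<otimes>\<^bsub>E\<^esub> z"
      using cl by simp
    have "(x \<oplus>\<^bsub>E\<^esub> y) \<otimes>\<^bsub>E\<^esub> (z \<oplus>\<^bsub>E\<^esub> w) = (x \<otimes>\<^bsub>E\<^esub> z \<oplus>\<^bsub>E\<^esub> y \<otimes>\<^bsub>E\<^esub> w) \<oplus>\<^bsub>E\<^esub> (x \<otimes>\<^bsub>E\<^esub> w \<oplus>\<^bsub>E\<^esub> y \<otimes>\<^bsub>E\<^esub> z)"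
      using cl by (simp add: E.l_distr E.r_distr E.a_ac)
    then have "h \<otimes>\<^bsub>E\<^esub> ((x \<oplus>\<^bsub>E\<^esub> y) \<otimes>\<^bsub>E\<^esub> (z \<oplus>\<^bsub>E\<^esub> w)) = x \<otimes>\<^bsub>E\<^esub> z \<oplus>\<^bsub>E\<^esub> y \<otimes>\<^bsub>E\<^esub> w"
      using half[of "x \<otimes>\<^bsub>E\<^esub> z \<oplus>\<^bsub>E\<^esub> y \<otimes>\<^bsub>E\<^esub> w"] cl by (simp add: e)
    then have "h \<otimes>\<^bsub>E\<^esub> (x \<otimes>\<^bsub>E\<^esub> z \<oplus>\<^bsub>E\<^esub> y \<otimes>\<^bsub>E\<^esub> w) = (h \<otimes>\<^bsub>E\<^esub> (x \<oplus>\<^bsub>E\<^esub> y)) \<otimes>\<^bsub>E\<^esub> (h \<otimes>\<^bsub>E\<^esub> (z \<oplus>\<^bsub>E\<^esub> w))"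
      using cl h(1) by (simp add: E.m_ac)
    then show "h \<otimes>\<^bsub>E\<^esub> (f (a \<otimes>\<^bsub>A\<^esub> b) \<oplus>\<^bsub>E\<^esub> g (a \<otimes>\<^bsub>A\<^esub> b)) = (h \<otimes>\<^bsub>E\<^esub> (f a \<oplus>\<^bsub>E\<^esub> g a)) \<otimes>\<^bsub>E\<^esub> (h \<otimes>\<^bsub>E\<^esub> (f b \<oplus>\<^bsub>E\<^esub> g b))"
      using ab by (simp add: F G x_def y_def z_def w_def)
    show "h \<otimes>\<^bsub>E\<^esub> (f (a \<oplus>\<^bsub>A\<^esub> b) \<oplus>\<^bsub>E\<^esub> g (a \<oplus>\<^bsub>A\<^esub> b)) = h \<otimes>\<^bsub>E\<^esub> (f a \<oplus>\<^bsub>E\<^esub> g a) \<oplus>\<^bsub>E\<^esub> h \<otimes>\<^bsub>E\<^esub> (f b \<oplus>\<^bsub>E\<^esub> g b)"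
      using ab h(1) cl by (simp add: F G E.r_distr E.a_ac x_def y_def z_def w_def)
  qed (use h(1) half in \<open>auto simp: F G\<close>)
qed

text \<open>The ring \<open>L\<close> is the Laurent polynomial ring over C modulo s^2 - t.
  Injectivity is the point: comparison of the highest and the lowest exponent shows that no nonzero
  constant is a multiple of s^2 - t when t is a nonzerodivisor. The invertible root of t makes
  homomorphisms from \<open>laurent A\<close> into \<open>L\<close> available.\<close>

lemma invert_square_root:
  fixes C :: "('c, 'm) ring_scheme"
  assumes C: "cring C" and t: "t \<in> carrier C"
    and nzd: "\<And>b. b \<in> carrier C \<Longrightarrow> t \<otimes>\<^bsub>C\<^esub> b = \<zero>\<^bsub>C\<^esub> \<Longrightarrow> b = \<zero>\<^bsub>C\<^esub>"
  obtains L :: "(int \<Rightarrow> 'c) set ring" and \<iota> s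
  where "cring L" "\<iota> \<in> ring_hom C L" "\<And>c. c \<in> carrier C \<Longrightarrow> \<iota> c = \<zero>\<^bsub>L\<^esub> \<Longrightarrow> c = \<zero>\<^bsub>C\<^esub>"
    "s \<in> Units L" "s \<otimes>\<^bsub>L\<^esub> s = \<iota> t"
proof -
  interpret C: cring C by fact
  interpret M: mon_alg C integer_group
    using C comm_monoid_integer_group by (rule mon_alg.intro)
  let ?P = "M.P"
  let ?r = "single C \<one>\<^bsub>C\<^esub> 2 \<ominus>\<^bsub>?P\<^esub> single C t (0::int)"
  define I where "I = PIdl\<^bsub>?P\<^esub> ?r"
  have cl: "single C c n \<in> carrier ?P" if "c \<in> carrier C" for c n using that by simp
  have rc: "?r \<in> carrier ?P" using t by (intro M.P.minus_closed cl) auto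
  have I: "ideal I ?P" unfolding I_def using rc by (rule M.P.cgenideal_ideal)
  define L where "L = ?P Quot I"
  define q where "q = (\<lambda>x. I +>\<^bsub>?P\<^esub> x)"
  have q: "q \<in> ring_hom ?P L" unfolding q_def L_def by (rule quot_hom[OF I])
  have L: "cring L" unfolding L_def by (rule quot_cring[OF I M.P.is_cring])
  interpret L: cring L by (rule L)
  have q0: "q x = \<zero>\<^bsub>L\<^esub> \<longleftrightarrow> x \<in> I" if "x \<in> carrier ?P" for x
    unfolding q_def L_def zero_Quot by (rule coset_zero_iff[OF I that])
  have c0: "(\<lambda>c. single C c 0) \<in> ring_hom C ?P" using M.const_hom by simp
  define s where "s = q (single C \<one>\<^bsub>C\<^esub> 1)"
  define s' where "s' = q (single C \<one>\<^bsub>C\<^esub> (-1))"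
  have sc: "s \<in> carrier L" "s' \<in> carrier L"
    unfolding s_def s'_def by (intro ring_hom_closed[OF q] cl C.one_closed)+
  have ss': "s \<otimes>\<^bsub>L\<^esub> s' = \<one>\<^bsub>L\<^esub>"
  proof -
    have "s \<otimes>\<^bsub>L\<^esub> s' = q (single C \<one>\<^bsub>C\<^esub> 1 \<otimes>\<^bsub>?P\<^esub> single C \<one>\<^bsub>C\<^esub> (-1))"
      unfolding s_def s'_def by (intro ring_hom_mult[OF q, symmetric] cl C.one_closed)
    also have "single C \<one>\<^bsub>C\<^esub> 1 \<otimes>\<^bsub>?P\<^esub> single C \<one>\<^bsub>C\<^esub> (-1) = \<one>\<^bsub>?P\<^esub>"
      by (subst M.single_mult) (auto simp: M.one_P)
    finally show ?thesis using ring_hom_one[OF q] by simp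
  qed
  have "s \<in> Units L" unfolding Units_def using sc ss' L.m_comm by blast
  moreover have "s \<otimes>\<^bsub>L\<^esub> s = q (single C t 0)"
  proof -
    have "s \<otimes>\<^bsub>L\<^esub> s = q (single C \<one>\<^bsub>C\<^esub> 1 \<otimes>\<^bsub>?P\<^esub> single C \<one>\<^bsub>C\<^esub> 1)"
      unfolding s_def by (intro ring_hom_mult[OF q, symmetric] cl C.one_closed)
    also have "single C \<one>\<^bsub>C\<^esub> 1 \<otimes>\<^bsub>?P\<^esub> single C \<one>\<^bsub>C\<^esub> 1 = single C \<one>\<^bsub>C\<^esub> 2"
      by (subst M.single_mult) auto
    also have "q (single C \<one>\<^bsub>C\<^esub> 2) = q (single C t 0)"
    proof -
      have "?r \<in> I" unfolding I_def using rc by (rule M.P.cgenideal_self)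
      then show ?thesis
        using ring_hom_eq_iff_minus[OF q M.P.ring_axioms L.ring_axioms, of "single C \<one>\<^bsub>C\<^esub> 2" "single C t 0"]
          q0[OF rc] cl t by simp
    qed
    finally show ?thesis .
  qed
  moreover have "c = \<zero>\<^bsub>C\<^esub>" if c: "c \<in> carrier C" and z: "q (single C c 0) = \<zero>\<^bsub>L\<^esub>" for c
  proof (rule ccontr)
    assume nz: "c \<noteq> \<zero>\<^bsub>C\<^esub>"
    have "single C c 0 \<in> I" using z q0 cl[OF c] by blast
    then obtain p where p: "p \<in> carrier ?P" "single C c 0 = p \<otimes>\<^bsub>?P\<^esub> ?r"
      unfolding I_def cgenideal_def by blast
    have pc: "p n \<in> carrier C" for n using M.coeff_closed[OF p(1)] .
    define A where "A = {n. p n \<noteq> \<zero>\<^bsub>C\<^esub>}"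
    have A: "finite A" unfolding A_def by (rule M.finite_supp[OF p(1)])
    have shift: "(p \<otimes>\<^bsub>?P\<^esub> single C r m) n = p (n - m) \<otimes>\<^bsub>C\<^esub> r" if r: "r \<in> carrier C" for r m n
      using p(1)
    proof (induction p rule: M.P_induct)
      case (single a g)
      have "(single C a g \<otimes>\<^bsub>?P\<^esub> single C r m) n = single C (a \<otimes>\<^bsub>C\<^esub> r) (g + m) n"
        using single r by (subst M.single_mult) auto
      then show ?case using r by (auto simp: single_def)
    next
      case (add p p')
      have "((p \<oplus>\<^bsub>?P\<^esub> p') \<otimes>\<^bsub>?P\<^esub> single C r m) n = (p \<otimes>\<^bsub>?P\<^esub> single C r m \<oplus>\<^bsub>?P\<^esub> p' \<otimes>\<^bsub>?P\<^esub> single C r m) n"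
        using add r by (subst M.P_l_distr) auto
      also have "\<dots> = (p (n - m) \<oplus>\<^bsub>C\<^esub> p' (n - m)) \<otimes>\<^bsub>C\<^esub> r"
        using add r M.coeff_closed[OF add(1)] M.coeff_closed[OF add(2)] by (simp only: M.add_P C.l_distr)
      finally show ?case by (simp only: M.add_P)
    qed
    have eq: "single C c 0 n = p (n - 2) \<ominus>\<^bsub>C\<^esub> p n \<otimes>\<^bsub>C\<^esub> t" for n
    proof -
      have "single C c 0 \<oplus>\<^bsub>?P\<^esub> p \<otimes>\<^bsub>?P\<^esub> single C t 0 = p \<otimes>\<^bsub>?P\<^esub> single C \<one>\<^bsub>C\<^esub> 2"
        unfolding p(2) using p(1) t cl
        by (simp add: a_minus_def M.P.r_distr M.P.r_minus M.P.a_assoc M.P.l_neg)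
      then have "single C c 0 n \<oplus>\<^bsub>C\<^esub> (p \<otimes>\<^bsub>?P\<^esub> single C t 0) n = (p \<otimes>\<^bsub>?P\<^esub> single C \<one>\<^bsub>C\<^esub> 2) n"
        by (metis M.add_apply)
      then have "single C c 0 n \<oplus>\<^bsub>C\<^esub> p n \<otimes>\<^bsub>C\<^esub> t = p (n - 2)" using shift t pc by simp
      moreover have "single C c 0 n \<in> carrier C" using c by (simp add: single_def)
      ultimately show ?thesis using pc t by (metis C.add.inv_solve_right' C.m_closed a_minus_def)
    qed
    have "A \<noteq> {}"
    proof
      assume "A = {}"
      then have "p n = \<zero>\<^bsub>C\<^esub>" for n by (auto simp: A_def)
      then have "single C c (0::int) 0 = \<zero>\<^bsub>C\<^esub>" using eq[of 0] t by (simp add: a_minus_def)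
      then show False using nz by (simp add: single_def)
    qed
    then have Max: "p (Max A) \<noteq> \<zero>\<^bsub>C\<^esub>" and Min: "p (Min A) \<noteq> \<zero>\<^bsub>C\<^esub>" and le: "Min A \<le> Max A"
      using Max_in[OF A] Min_in[OF A] A by (auto simp: A_def)
    have above: "p n = \<zero>\<^bsub>C\<^esub>" if "Max A < n" for n
      using that Max_ge[OF A, of n] unfolding A_def by fastforce
    have below: "p n = \<zero>\<^bsub>C\<^esub>" if "n < Min A" for n
      using that Min_le[OF A, of n] unfolding A_def by fastforce
    \<comment> \<open>The top coefficient of p (s^2 - t) is that of p, at exponent Max + 2, and it
      can only survive at exponent 0. The lowest exponent of p is then negative, and the coefficient
      -p(Min) t there has to vanish.\<close>
    have "Max A + 2 = 0"
    proof (rule ccontr)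
      assume "Max A + 2 \<noteq> 0"
      then have "single C c 0 (Max A + 2) = \<zero>\<^bsub>C\<^esub>" by (simp add: single_def)
      then show False using eq[of "Max A + 2"] above[of "Max A + 2"] Max t pc[of "Max A"] by (simp add: a_minus_def)
    qed
    then have "Min A \<noteq> 0" using le by simp
    then have "single C c 0 (Min A) = \<zero>\<^bsub>C\<^esub>" by (simp add: single_def)
    then have "\<ominus>\<^bsub>C\<^esub> (p (Min A) \<otimes>\<^bsub>C\<^esub> t) = \<zero>\<^bsub>C\<^esub>"
      using eq[of "Min A"] below[of "Min A - 2"] pc t by (simp add: a_minus_def)
    then have "t \<otimes>\<^bsub>C\<^esub> p (Min A) = \<zero>\<^bsub>C\<^esub>" using pc t C.m_comm by (simp add: C.m_comm)
    then show False using nzd pc Min by blast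
  qed
  ultimately show thesis
    using that[OF L ring_hom_comp[OF c0 q], of s] by blast
qed

section \<open>Involutions and equivariant homomorphisms\<close>

locale inv_alg =
  fixes k :: "('k, 'm) ring_scheme" and A :: "('a, 'n) ring_scheme" and \<phi> \<theta>
  assumes alg: "ring_hom_cring k A \<phi>" and two: "\<one>\<^bsub>k\<^esub> \<oplus>\<^bsub>k\<^esub> \<one>\<^bsub>k\<^esub> \<in> Units k"
    and inv: "alg_involution k A \<phi> \<theta>"
begin

lemmas algD = ring_hom_cringD[OF alg]

sublocale k: cring k by (rule algD)
sublocale A: cring A by (rule algD)

definition "half = inv\<^bsub>k\<^esub> (\<one>\<^bsub>k\<^esub> \<oplus>\<^bsub>k\<^esub> \<one>\<^bsub>k\<^esub>)"

lemma half_closed [simp]: "half \<in> carrier k"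
  unfolding half_def using two by (rule k.Units_inv_closed)

lemma half_double: "half \<oplus>\<^bsub>k\<^esub> half = \<one>\<^bsub>k\<^esub>"
proof -
  have "half \<otimes>\<^bsub>k\<^esub> (\<one>\<^bsub>k\<^esub> \<oplus>\<^bsub>k\<^esub> \<one>\<^bsub>k\<^esub>) = \<one>\<^bsub>k\<^esub>" unfolding half_def using two by (rule k.Units_l_inv)
  then show ?thesis by (simp add: k.r_distr)
qed

lemma half_image:
  assumes "\<gamma> \<in> ring_hom k E"
  shows "\<gamma> half \<in> carrier E" "\<gamma> half \<oplus>\<^bsub>E\<^esub> \<gamma> half = \<one>\<^bsub>E\<^esub>"
  using ring_hom_closed[OF assms half_closed] ring_hom_add[OF assms half_closed half_closed] ring_hom_one[OF assms]
  by (simp_all add: half_double)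

lemma theta_alg: "\<theta> \<in> alg_hom k A \<phi> A \<phi>"
  using inv by (simp add: alg_involution_def alg_iso_def)

lemma theta_hom: "\<theta> \<in> ring_hom A A"
  using theta_alg by (rule alg_hom_ring_hom)

lemma theta_closed [simp]: "a \<in> carrier A \<Longrightarrow> \<theta> a \<in> carrier A"
  using theta_hom by (rule ring_hom_closed)

lemma theta_theta [simp]: "a \<in> carrier A \<Longrightarrow> \<theta> (\<theta> a) = a"
  using inv by (simp add: alg_involution_def)

lemma theta_phi [simp]: "c \<in> carrier k \<Longrightarrow> \<theta> (\<phi> c) = \<phi> c"
  using theta_alg by (rule alg_hom_str)

lemma phi_closed [simp]: "c \<in> carrier k \<Longrightarrow> \<phi> c \<in> carrier A"
  using algD(3) by (rule ring_hom_closed)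

lemmas theta_simps = ring_hom_add[OF theta_hom] ring_hom_mult[OF theta_hom] ring_hom_one[OF theta_hom]
  ring_hom_a_inv[OF theta_hom A.ring_axioms A.ring_axioms] ring_hom_minus[OF theta_hom A.ring_axioms A.ring_axioms]
  ring_hom_zero[OF theta_hom A.ring_axioms A.ring_axioms]

definition "ev a = \<phi> half \<otimes>\<^bsub>A\<^esub> (a \<oplus>\<^bsub>A\<^esub> \<theta> a)"
definition "od a = \<phi> half \<otimes>\<^bsub>A\<^esub> (a \<ominus>\<^bsub>A\<^esub> \<theta> a)"

lemma ev_closed [simp]: "a \<in> carrier A \<Longrightarrow> ev a \<in> carrier A"
  and od_closed [simp]: "a \<in> carrier A \<Longrightarrow> od a \<in> carrier A"
  by (simp_all add: ev_def od_def)

lemma half_A: "a \<in> carrier A \<Longrightarrow> \<phi> half \<otimes>\<^bsub>A\<^esub> (a \<oplus>\<^bsub>A\<^esub> a) = a"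
  using half_image[OF algD(3)] A.l_distr[of "\<phi> half" "\<phi> half" a] by (simp add: A.r_distr)

lemma ev_add_od: "a \<in> carrier A \<Longrightarrow> ev a \<oplus>\<^bsub>A\<^esub> od a = a"
proof -
  assume a: "a \<in> carrier A"
  have "ev a \<oplus>\<^bsub>A\<^esub> od a = \<phi> half \<otimes>\<^bsub>A\<^esub> (a \<oplus>\<^bsub>A\<^esub> a)"
    unfolding ev_def od_def using a by (simp add: A.r_distr[symmetric] a_minus_def A.a_ac A.r_neg1 A.r_neg2 A.r_neg)
  then show ?thesis using half_A a by simp
qed

lemma theta_ev [simp]: "a \<in> carrier A \<Longrightarrow> \<theta> (ev a) = ev a"
  by (simp add: ev_def theta_simps A.a_comm)

lemma theta_od [simp]: "a \<in> carrier A \<Longrightarrow> \<theta> (od a) = \<ominus>\<^bsub>A\<^esub> od a"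
  by (simp add: od_def theta_simps a_minus_def A.r_minus[symmetric] A.minus_add A.a_comm)

text \<open>The splitting into an even and an odd part is unique because 2 is invertible. The
  product rules \<open>ev_od_mult\<close> are read off from this uniqueness.\<close>

lemma decomp:
  assumes "x \<in> carrier A" "y \<in> carrier A" "\<theta> x = x" "\<theta> y = \<ominus>\<^bsub>A\<^esub> y"
  shows "ev (x \<oplus>\<^bsub>A\<^esub> y) = x" "od (x \<oplus>\<^bsub>A\<^esub> y) = y"
proof -
  have "x \<oplus>\<^bsub>A\<^esub> y \<oplus>\<^bsub>A\<^esub> \<theta> (x \<oplus>\<^bsub>A\<^esub> y) = x \<oplus>\<^bsub>A\<^esub> x"
    using assms by (simp add: theta_simps A.a_ac A.r_neg A.r_neg1 A.r_neg2)
  then show "ev (x \<oplus>\<^bsub>A\<^esub> y) = x" unfolding ev_def using half_A assms by simp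
  have "x \<oplus>\<^bsub>A\<^esub> y \<ominus>\<^bsub>A\<^esub> \<theta> (x \<oplus>\<^bsub>A\<^esub> y) = (y \<oplus>\<^bsub>A\<^esub> y) \<oplus>\<^bsub>A\<^esub> (x \<oplus>\<^bsub>A\<^esub> \<ominus>\<^bsub>A\<^esub> x)"
    using assms by (simp add: theta_simps a_minus_def A.minus_add A.a_ac)
  also have "\<dots> = y \<oplus>\<^bsub>A\<^esub> y" using assms by (simp add: A.r_neg)
  finally have "x \<oplus>\<^bsub>A\<^esub> y \<ominus>\<^bsub>A\<^esub> \<theta> (x \<oplus>\<^bsub>A\<^esub> y) = y \<oplus>\<^bsub>A\<^esub> y" .
  then show "od (x \<oplus>\<^bsub>A\<^esub> y) = y" unfolding od_def using half_A assms by simp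
qed

lemma ev_fixed: "a \<in> carrier A \<Longrightarrow> \<theta> a = a \<Longrightarrow> ev a = a \<and> od a = \<zero>\<^bsub>A\<^esub>"
  using decomp[of a "\<zero>\<^bsub>A\<^esub>"] by (simp add: theta_simps)

lemma od_anti: "a \<in> carrier A \<Longrightarrow> \<theta> a = \<ominus>\<^bsub>A\<^esub> a \<Longrightarrow> ev a = \<zero>\<^bsub>A\<^esub> \<and> od a = a"
  using decomp[of "\<zero>\<^bsub>A\<^esub>" a] by (simp add: theta_simps)

lemma ev_add: "a \<in> carrier A \<Longrightarrow> b \<in> carrier A \<Longrightarrow> ev (a \<oplus>\<^bsub>A\<^esub> b) = ev a \<oplus>\<^bsub>A\<^esub> ev b"
  and od_add: "a \<in> carrier A \<Longrightarrow> b \<in> carrier A \<Longrightarrow> od (a \<oplus>\<^bsub>A\<^esub> b) = od a \<oplus>\<^bsub>A\<^esub> od b"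
  by (simp_all add: ev_def od_def theta_simps a_minus_def A.r_distr A.r_minus A.minus_add A.a_ac)

lemma ev_od_mult:
  assumes "a \<in> carrier A" "b \<in> carrier A"
  shows "ev (a \<otimes>\<^bsub>A\<^esub> b) = ev a \<otimes>\<^bsub>A\<^esub> ev b \<oplus>\<^bsub>A\<^esub> od a \<otimes>\<^bsub>A\<^esub> od b"
    and "od (a \<otimes>\<^bsub>A\<^esub> b) = ev a \<otimes>\<^bsub>A\<^esub> od b \<oplus>\<^bsub>A\<^esub> od a \<otimes>\<^bsub>A\<^esub> ev b"
proof -
  let ?x = "ev a \<otimes>\<^bsub>A\<^esub> ev b \<oplus>\<^bsub>A\<^esub> od a \<otimes>\<^bsub>A\<^esub> od b" and ?y = "ev a \<otimes>\<^bsub>A\<^esub> od b \<oplus>\<^bsub>A\<^esub> od a \<otimes>\<^bsub>A\<^esub> ev b"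
  have "a \<otimes>\<^bsub>A\<^esub> b = (ev a \<oplus>\<^bsub>A\<^esub> od a) \<otimes>\<^bsub>A\<^esub> (ev b \<oplus>\<^bsub>A\<^esub> od b)" using assms by (simp add: ev_add_od)
  also have "\<dots> = ?x \<oplus>\<^bsub>A\<^esub> ?y" using assms by (simp add: A.l_distr A.r_distr A.a_ac)
  finally have e: "a \<otimes>\<^bsub>A\<^esub> b = ?x \<oplus>\<^bsub>A\<^esub> ?y" .
  have "\<theta> ?x = ?x" "\<theta> ?y = \<ominus>\<^bsub>A\<^esub> ?y"
    using assms by (simp_all add: theta_simps A.l_minus A.r_minus A.minus_add)
  then show "ev (a \<otimes>\<^bsub>A\<^esub> b) = ?x" "od (a \<otimes>\<^bsub>A\<^esub> b) = ?y"
    unfolding e using assms decomp[of ?x ?y] by auto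
qed

lemma theta_ev_od: "a \<in> carrier A \<Longrightarrow> ev (\<theta> a) = ev a \<and> od (\<theta> a) = \<ominus>\<^bsub>A\<^esub> od a"
  by (simp add: ev_def od_def a_minus_def A.r_minus[symmetric] A.minus_add A.a_comm)

section \<open>Equivariant homomorphisms to C[\<surd>t]\<close>

abbreviation "R \<equiv> UP k"
abbreviation "cn c \<equiv> up_ring.monom R c 0"
abbreviation "t \<equiv> tvar k"

lemma R_cring: "cring R" by (rule cring_UP[OF k.is_cring])
sublocale R: cring R by (rule R_cring)

lemma t_closed [simp]: "t \<in> carrier R" by (rule tvar_closed[OF k.is_cring])
lemma cn_hom: "cn \<in> ring_hom k R" by (rule UP_const_hom[OF k.is_cring])
lemma cn_closed [simp]: "c \<in> carrier k \<Longrightarrow> cn c \<in> carrier R" using cn_hom by (rule ring_hom_closed)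

text \<open>Homomorphisms from \<open>A\<close> to \<open>C[\<surd>t]\<close> that are equivariant for \<open>\<theta>\<close> and the conjugation \<open>\<surd>t \<mapsto> -\<surd>t\<close>.\<close>

definition ehom :: "('c, 'p) ring_scheme \<Rightarrow> ((nat \<Rightarrow> 'k) \<Rightarrow> 'c) \<Rightarrow> ('a \<Rightarrow> 'c \<times> 'c) set"
  where "ehom C \<psi> = {w \<in> alg_hom k A \<phi> (dbl C (\<psi> t)) (\<lambda>c. (\<psi> (cn c), \<zero>\<^bsub>C\<^esub>)).
    \<forall>a\<in>carrier A. w (\<theta> a) = (fst (w a), \<ominus>\<^bsub>C\<^esub> snd (w a))}"

lemma ehom_alg: "w \<in> ehom C \<psi> \<Longrightarrow> w \<in> alg_hom k A \<phi> (dbl C (\<psi> t)) (\<lambda>c. (\<psi> (cn c), \<zero>\<^bsub>C\<^esub>))"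
  and ehom_hom: "w \<in> ehom C \<psi> \<Longrightarrow> w \<in> ring_hom A (dbl C (\<psi> t))"
  and ehom_theta: "w \<in> ehom C \<psi> \<Longrightarrow> a \<in> carrier A \<Longrightarrow> w (\<theta> a) = (fst (w a), \<ominus>\<^bsub>C\<^esub> snd (w a))"
  by (auto simp: ehom_def alg_hom_ring_hom)

lemma ehom_closed: "w \<in> ehom C \<psi> \<Longrightarrow> a \<in> carrier A \<Longrightarrow> fst (w a) \<in> carrier C \<and> snd (w a) \<in> carrier C"
  using ring_hom_closed[OF ehom_hom, of w C \<psi> a] by auto

lemma ehom_phi: "w \<in> ehom C \<psi> \<Longrightarrow> c \<in> carrier k \<Longrightarrow> w (\<phi> c) = (\<psi> (cn c), \<zero>\<^bsub>C\<^esub>)"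
  using ehom_alg alg_hom_str by metis

text \<open>Conjugation on \<open>dbl\<close> fixes the pairs (x, 0) and negates the pairs (0, y).
  With 2 invertible, equivariance sends even elements to the first kind and odd elements to the
  second.\<close>

lemma ehom_ev_od:
  assumes C: "ring_hom_cring R C \<psi>" and w: "w \<in> ehom C \<psi>" and a: "a \<in> carrier A"
  shows "w (ev a) = (fst (w a), \<zero>\<^bsub>C\<^esub>)" "w (od a) = (\<zero>\<^bsub>C\<^esub>, snd (w a))"
proof -
  note C' = ring_hom_cringD[OF C]
  interpret C: cring C by (rule C')
  interpret D: cring "dbl C (\<psi> t)" by (rule dbl_cring[OF C'(2) ring_hom_closed[OF C'(3) t_closed]])
  note wh = ehom_hom[OF w]
  obtain x y where xy: "w a = (x, y)" "x \<in> carrier C" "y \<in> carrier C" using ehom_closed[OF w a] by (metis prod.collapse)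
  let ?h = "\<psi> (cn half)"
  have h: "?h \<in> carrier C" "?h \<oplus>\<^bsub>C\<^esub> ?h = \<one>\<^bsub>C\<^esub>"
    using half_image[OF ring_hom_comp[OF cn_hom C'(3)]] by auto
  have half: "?h \<otimes>\<^bsub>C\<^esub> (z \<oplus>\<^bsub>C\<^esub> z) = z" if "z \<in> carrier C" for z
    using that h C.l_distr[of ?h ?h z] by (simp add: C.r_distr)
  have th: "w (\<theta> a) = (x, \<ominus>\<^bsub>C\<^esub> y)" using ehom_theta[OF w a] xy by simp
  have tC: "\<psi> t \<in> carrier C" by (rule ring_hom_closed[OF C'(3) t_closed])
  have "w (ev a) = (?h, \<zero>\<^bsub>C\<^esub>) \<otimes>\<^bsub>dbl C (\<psi> t)\<^esub> ((x, y) \<oplus>\<^bsub>dbl C (\<psi> t)\<^esub> (x, \<ominus>\<^bsub>C\<^esub> y))"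
    unfolding ev_def using a by (simp only: ring_hom_mult[OF wh] ring_hom_add[OF wh] A.a_closed theta_closed
        phi_closed half_closed ehom_phi[OF w] xy(1) th)
  then show "w (ev a) = (fst (w a), \<zero>\<^bsub>C\<^esub>)" using xy h half tC by (simp add: C.r_neg)
  have m: "\<ominus>\<^bsub>dbl C (\<psi> t)\<^esub> (x, \<ominus>\<^bsub>C\<^esub> y) = (\<ominus>\<^bsub>C\<^esub> x, y)" using xy tC C'(2) by (simp add: dbl_a_inv)
  have "w (od a) = (?h, \<zero>\<^bsub>C\<^esub>) \<otimes>\<^bsub>dbl C (\<psi> t)\<^esub> ((x, y) \<oplus>\<^bsub>dbl C (\<psi> t)\<^esub> (\<ominus>\<^bsub>C\<^esub> x, y))"
    unfolding od_def a_minus_def using a m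
    by (simp only: ring_hom_mult[OF wh] ring_hom_add[OF wh] A.a_closed A.a_inv_closed theta_closed
        phi_closed half_closed ehom_phi[OF w] xy(1) th ring_hom_a_inv[OF wh A.ring_axioms D.ring_axioms])
  then show "w (od a) = (\<zero>\<^bsub>C\<^esub>, snd (w a))" using xy h half tC by (simp add: C.r_neg)
qed

lemma ehom_comp:
  assumes C: "ring_hom_cring R C \<psi>" and D: "ring_hom_cring R D \<chi>" and w: "w \<in> ehom C \<psi>"
    and h: "h \<in> alg_hom R C \<psi> D \<chi>"
  shows "(\<lambda>a. map_prod h h (w a)) \<in> ehom D \<chi>"
proof -
  note C' = ring_hom_cringD[OF C] and D' = ring_hom_cringD[OF D]
  note hr = alg_hom_ring_hom[OF h]
  have "map_prod h h \<in> ring_hom (dbl C (\<psi> t)) (dbl D (\<chi> t))"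
    by (rule dbl_map_hom[OF hr alg_hom_str[OF h t_closed] C'(5) D'(5) ring_hom_closed[OF C'(3) t_closed]])
  then have "(\<lambda>a. map_prod h h (w a)) \<in> ring_hom A (dbl D (\<chi> t))"
    by (rule ring_hom_comp[OF ehom_hom[OF w]])
  then show ?thesis
    unfolding ehom_def using w ehom_closed[OF w]
    by (auto intro!: alg_homI simp: ehom_phi[OF w] ehom_theta[OF w] alg_hom_str[OF h]
        ring_hom_zero[OF hr C'(5) D'(5)] ring_hom_a_inv[OF hr C'(5) D'(5)] map_prod_def split_beta)
qed

text \<open>The conjugate \<open>v'\<close> of \<open>v\<close> is another lift of the same
  equivariant map, so the two differ by elements of the square-zero kernel and their average is a
  homomorphism. Conjugation exchanges \<open>v\<close> and \<open>v'\<close> up to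
  \<open>\<theta>\<close>, which makes the average equivariant.\<close>

lemma ehom_average:
  assumes C: "ring_hom_cring R C \<psi>" and v: "v \<in> alg_hom k A \<phi> (dbl C (\<psi> t)) (\<lambda>c. (\<psi> (cn c), \<zero>\<^bsub>C\<^esub>))"
    and D: "cring D" and q: "q \<in> ring_hom C D"
    and sq: "\<And>x y. x \<in> carrier C \<Longrightarrow> y \<in> carrier C \<Longrightarrow> q x = \<zero>\<^bsub>D\<^esub> \<Longrightarrow> q y = \<zero>\<^bsub>D\<^esub> \<Longrightarrow> x \<otimes>\<^bsub>C\<^esub> y = \<zero>\<^bsub>C\<^esub>"
    and eq: "\<And>a. a \<in> carrier A \<Longrightarrow> map_prod q q (v (\<theta> a)) = (q (fst (v a)), \<ominus>\<^bsub>D\<^esub> q (snd (v a)))"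
  obtains w where "w \<in> ehom C \<psi>" "\<And>a. a \<in> carrier A \<Longrightarrow> map_prod q q (w a) = map_prod q q (v a)"
proof -
  note C' = ring_hom_cringD[OF C]
  interpret C: cring C by (rule C')
  interpret D: cring D by fact
  have tC: "\<psi> t \<in> carrier C" by (rule ring_hom_closed[OF C'(3) t_closed])
  let ?E = "dbl C (\<psi> t)" and ?F = "dbl D (q (\<psi> t))"
  interpret E: cring ?E by (rule dbl_cring[OF C'(2) tC])
  interpret F: cring ?F by (rule dbl_cring[OF D ring_hom_closed[OF q tC]])
  let ?c = "\<lambda>x. (fst x, \<ominus>\<^bsub>C\<^esub> snd x)"
  note vr = alg_hom_ring_hom[OF v]
  have c: "?c \<in> ring_hom ?E ?E" by (rule dbl_conj_hom[OF C'(2) tC])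
  define v' where "v' a = ?c (v (\<theta> a))" for a
  have v': "v' \<in> ring_hom A ?E" unfolding v'_def by (rule ring_hom_comp[OF ring_hom_comp[OF theta_hom vr] c])
  have vcl: "fst (v a) \<in> carrier C" "snd (v a) \<in> carrier C" if "a \<in> carrier A" for a
    using ring_hom_closed[OF vr that] by auto
  have Q: "map_prod q q \<in> ring_hom ?E ?F"
    by (rule dbl_map_hom[OF q refl C'(5) D.ring_axioms tC])
  have qv': "map_prod q q (v' a) = map_prod q q (v a)" if a: "a \<in> carrier A" for a
  proof -
    have "q (fst (v (\<theta> a))) = q (fst (v a))" "q (snd (v (\<theta> a))) = \<ominus>\<^bsub>D\<^esub> q (snd (v a))"
      using eq[OF a] by (auto simp: map_prod_def split_beta)
    then show ?thesis
      using vcl[OF a] vcl[OF theta_closed[OF a]] ring_hom_closed[OF q]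
      by (simp add: v'_def map_prod_def split_beta ring_hom_a_inv[OF q C'(5) D.ring_axioms])
  qed
  let ?h = "(\<psi> (cn half), \<zero>\<^bsub>C\<^esub>)"
  have g: "(\<lambda>c. (\<psi> (cn c), \<zero>\<^bsub>C\<^esub>)) \<in> ring_hom k ?E"
    by (rule ring_hom_comp[OF ring_hom_comp[OF cn_hom C'(3)] dbl_const_hom[OF C'(2) tC]])
  note h = half_image[OF g]
  have sqE: "x \<otimes>\<^bsub>?E\<^esub> y = \<zero>\<^bsub>?E\<^esub>" if "x \<in> carrier ?E" "y \<in> carrier ?E" "map_prod q q x = \<zero>\<^bsub>?F\<^esub>" "map_prod q q y = \<zero>\<^bsub>?F\<^esub>" for x y
    using that sq tC by (cases x; cases y) simp
  have d: "v a \<ominus>\<^bsub>?E\<^esub> v' a \<in> carrier ?E" "map_prod q q (v a \<ominus>\<^bsub>?E\<^esub> v' a) = \<zero>\<^bsub>?F\<^esub>" if a: "a \<in> carrier A" for a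
    using E.minus_closed[OF ring_hom_closed[OF vr a] ring_hom_closed[OF v' a]]
      ring_hom_eq_iff_minus[OF Q E.ring_axioms F.ring_axioms ring_hom_closed[OF vr a] ring_hom_closed[OF v' a]] qv'[OF a]
    by auto
  define w where "w a = ?h \<otimes>\<^bsub>?E\<^esub> (v a \<oplus>\<^bsub>?E\<^esub> v' a)" for a
  have wh: "w \<in> ring_hom A ?E"
    unfolding w_def by (rule average_hom[OF A.ring_axioms E.is_cring vr v' h]) (rule sqE, simp_all add: d del: dbl_simps)
  have halfE: "?h \<otimes>\<^bsub>?E\<^esub> (x \<oplus>\<^bsub>?E\<^esub> x) = x" if "x \<in> carrier ?E" for x
    using that h E.l_distr[OF h(1) h(1) that] by (simp add: E.r_distr[OF that that h(1)] del: dbl_simps)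
  have "w \<in> alg_hom k A \<phi> ?E (\<lambda>c. (\<psi> (cn c), \<zero>\<^bsub>C\<^esub>))"
  proof (rule alg_homI[OF wh])
    fix c assume c: "c \<in> carrier k"
    have "v (\<phi> c) = (\<psi> (cn c), \<zero>\<^bsub>C\<^esub>)" "v' (\<phi> c) = (\<psi> (cn c), \<zero>\<^bsub>C\<^esub>)"
      using alg_hom_str[OF v c] c by (auto simp: v'_def)
    then show "w (\<phi> c) = (\<psi> (cn c), \<zero>\<^bsub>C\<^esub>)" unfolding w_def using halfE[OF ring_hom_closed[OF g c]] by (simp del: dbl_simps)
  qed
  moreover have "w (\<theta> a) = ?c (w a)" if a: "a \<in> carrier A" for a
  proof -
    have cc: "?c (?c x) = x" if "x \<in> carrier ?E" for x using that by auto
    have ch: "?c ?h = ?h" by simp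
    have "?c (w a) = ?c ?h \<otimes>\<^bsub>?E\<^esub> (?c (v a) \<oplus>\<^bsub>?E\<^esub> ?c (v' a))"
      unfolding w_def using ring_hom_closed[OF vr a] ring_hom_closed[OF v' a] h(1)
      by (subst ring_hom_mult[OF c]; (subst ring_hom_add[OF c])?) (auto simp del: dbl_simps)
    also have "?c (v' a) = v (\<theta> a)" unfolding v'_def using cc[OF ring_hom_closed[OF vr theta_closed[OF a]]] .
    also have "?c (v a) = v' (\<theta> a)" unfolding v'_def using a by simp
    also have "v' (\<theta> a) \<oplus>\<^bsub>?E\<^esub> v (\<theta> a) = v (\<theta> a) \<oplus>\<^bsub>?E\<^esub> v' (\<theta> a)"
      by (intro E.a_comm ring_hom_closed[OF vr] ring_hom_closed[OF v'] theta_closed a)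
    finally show ?thesis unfolding w_def ch by simp
  qed
  ultimately have "w \<in> ehom C \<psi>" unfolding ehom_def by blast
  moreover have "map_prod q q (w a) = map_prod q q (v a)" if a: "a \<in> carrier A" for a
  proof -
    have va: "v a \<in> carrier ?E" "v' a \<in> carrier ?E" using ring_hom_closed[OF vr a] ring_hom_closed[OF v' a] by auto
    have "map_prod q q (w a) = map_prod q q ?h \<otimes>\<^bsub>?F\<^esub> (map_prod q q (v a) \<oplus>\<^bsub>?F\<^esub> map_prod q q (v' a))"
      unfolding w_def ring_hom_mult[OF Q h(1) E.a_closed[OF va]] ring_hom_add[OF Q va] ..
    also have "\<dots> = map_prod q q (?h \<otimes>\<^bsub>?E\<^esub> (v a \<oplus>\<^bsub>?E\<^esub> v a))"
      unfolding ring_hom_mult[OF Q h(1) E.a_closed[OF va(1,1)]] ring_hom_add[OF Q va(1,1)] qv'[OF a] ..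
    finally show ?thesis unfolding halfE[OF va(1)] .
  qed
  ultimately show thesis by (rule that)
qed

end

section \<open>Laurent polynomials\<close>

lemma mon_alg_laurent: "cring A \<Longrightarrow> mon_alg A integer_group"
  by (intro mon_alg.intro comm_monoid_integer_group)

lemma laurent_cring: "cring A \<Longrightarrow> cring (laurent A)"
  unfolding laurent_def by (intro mon_alg.P_cring mon_alg_laurent)

lemma laurent_single_closed: "cring A \<Longrightarrow> a \<in> carrier A \<Longrightarrow> single A a n \<in> carrier (laurent A)"
  unfolding laurent_def by (rule mon_alg.single_closed[OF mon_alg_laurent]) auto

lemma laurent_single_mult:
  "cring A \<Longrightarrow> a \<in> carrier A \<Longrightarrow> b \<in> carrier A \<Longrightarrow>
    single A a m \<otimes>\<^bsub>laurent A\<^esub> single A b n = single A (a \<otimes>\<^bsub>A\<^esub> b) (m + n)"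
  unfolding laurent_def by (subst mon_alg.single_mult[OF mon_alg_laurent]) auto

lemma laurent_single_add:
  "cring A \<Longrightarrow> a \<in> carrier A \<Longrightarrow> b \<in> carrier A \<Longrightarrow>
    single A a n \<oplus>\<^bsub>laurent A\<^esub> single A b n = single A (a \<oplus>\<^bsub>A\<^esub> b) (n::int)"
  unfolding laurent_def by (rule mon_alg.single_add[OF mon_alg_laurent])

lemma laurent_one: "cring A \<Longrightarrow> \<one>\<^bsub>laurent A\<^esub> = single A \<one>\<^bsub>A\<^esub> 0"
  unfolding laurent_def by (subst mon_alg.one_P[OF mon_alg_laurent]) auto

lemma laurent_zero: "cring A \<Longrightarrow> single A \<zero>\<^bsub>A\<^esub> (n::int) = \<zero>\<^bsub>laurent A\<^esub>"
  unfolding laurent_def by (rule mon_alg.single_zero[OF mon_alg_laurent])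

lemma laurent_const_hom: "cring A \<Longrightarrow> (\<lambda>a. single A a 0) \<in> ring_hom A (laurent A)"
  unfolding laurent_def using mon_alg.const_hom[OF mon_alg_laurent] by simp

lemma laurent_minus_single:
  assumes "cring A" "a \<in> carrier A"
  shows "\<ominus>\<^bsub>laurent A\<^esub> single A a (n::int) = single A (\<ominus>\<^bsub>A\<^esub> a) n"
proof -
  interpret A: cring A by fact
  interpret L: cring "laurent A" using assms(1) by (rule laurent_cring)
  show ?thesis
    by (rule L.minus_equality)
      (use assms in \<open>simp_all add: laurent_single_closed laurent_single_add A.l_neg laurent_zero\<close>)
qed

lemma laurent_hom_eqI:
  assumes A: "cring A" and D: "ring D" and f: "f \<in> ring_hom (laurent A) D" and g: "g \<in> ring_hom (laurent A) D"
    and c: "\<And>a. a \<in> carrier A \<Longrightarrow> f (single A a 0) = g (single A a 0)"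
    and x: "\<And>n. f (single A \<one>\<^bsub>A\<^esub> n) = g (single A \<one>\<^bsub>A\<^esub> n)"
    and p: "p \<in> carrier (laurent A)"
  shows "f p = g p"
  using mon_alg.hom_eqI[OF mon_alg_laurent[OF A] f[unfolded laurent_def] g[unfolded laurent_def] D] c x p
  by (simp add: laurent_def)

text \<open>Integer powers are taken in the group of units, where exponents of either sign
  add.\<close>

definition unit_pow :: "('l, 'm) ring_scheme \<Rightarrow> 'l \<Rightarrow> int \<Rightarrow> 'l"
  where "unit_pow L s n = s [^]\<^bsub>units_of L\<^esub> n"

lemma unit_pow:
  assumes "cring L" "s \<in> Units L"
  shows "unit_pow L s n \<in> carrier L" "unit_pow L s (m + n) = unit_pow L s m \<otimes>\<^bsub>L\<^esub> unit_pow L s n"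
    "unit_pow L s 0 = \<one>\<^bsub>L\<^esub>" "unit_pow L s 1 = s" "unit_pow L s 2 = s \<otimes>\<^bsub>L\<^esub> s"
    "s \<otimes>\<^bsub>L\<^esub> unit_pow L s (-1) = \<one>\<^bsub>L\<^esub>"
proof -
  interpret L: cring L by fact
  interpret U: group "units_of L" by (rule L.units_group)
  have s: "s \<in> carrier (units_of L)" using assms(2) by (simp add: units_of_carrier)
  show "unit_pow L s n \<in> carrier L"
    using U.int_pow_closed[OF s, of n] L.Units_closed by (simp add: unit_pow_def units_of_carrier)
  show add: "unit_pow L s (m + n) = unit_pow L s m \<otimes>\<^bsub>L\<^esub> unit_pow L s n" for m n
    using U.int_pow_mult[OF s, of m n] by (simp add: unit_pow_def units_of_mult)
  show zero: "unit_pow L s 0 = \<one>\<^bsub>L\<^esub>" by (simp add: unit_pow_def units_of_one)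
  show one: "unit_pow L s 1 = s" using U.int_pow_1[OF s] by (simp add: unit_pow_def)
  show "unit_pow L s 2 = s \<otimes>\<^bsub>L\<^esub> s" using add[of 1 1] one by simp
  show "s \<otimes>\<^bsub>L\<^esub> unit_pow L s (-1) = \<one>\<^bsub>L\<^esub>" using add[of 1 "-1"] one zero by simp
qed

lemma laurent_lift:
  assumes A: "cring A" and L: "cring L" and f: "f \<in> ring_hom A L" and s: "s \<in> Units L"
  obtains \<Lambda> where "\<Lambda> \<in> ring_hom (laurent A) L"
    "\<And>a n. a \<in> carrier A \<Longrightarrow> \<Lambda> (single A a n) = f a \<otimes>\<^bsub>L\<^esub> unit_pow L s n"
proof -
  interpret mon_alg A integer_group using A by (rule mon_alg_laurent)
  show thesis
  proof (rule that[of "ma_lift A L f (unit_pow L s)"])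
    show "ma_lift A L f (unit_pow L s) \<in> ring_hom (laurent A) L"
      unfolding laurent_def by (rule lift_hom[OF L f]) (simp_all add: unit_pow[OF L s])
    show "ma_lift A L f (unit_pow L s) (single A a n) = f a \<otimes>\<^bsub>L\<^esub> unit_pow L s n" if "a \<in> carrier A" for a n
      by (rule lift_single[OF L f]) (use that in \<open>simp_all add: unit_pow[OF L s]\<close>)
  qed
qed

lemma laurent_str_hom:
  assumes k: "cring k" and A: "cring A" and \<phi>: "\<phi> \<in> ring_hom k A"
  shows "laurent_str k A \<phi> \<in> ring_hom (UP k) (laurent A)"
    and "c \<in> carrier k \<Longrightarrow> laurent_str k A \<phi> (up_ring.monom (UP k) c 0) = single A (\<phi> c) 0"
    and "laurent_str k A \<phi> (tvar k) = single A \<one>\<^bsub>A\<^esub> 2"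
proof -
  interpret A: cring A by fact
  have s: "laurent_t A \<in> carrier (laurent A)"
    unfolding laurent_t_def by (rule laurent_single_closed[OF A A.one_closed])
  note e = UP_eval[OF k laurent_cring[OF A] ring_hom_comp[OF \<phi> laurent_const_hom[OF A]] s, folded laurent_str_def]
  show "laurent_str k A \<phi> \<in> ring_hom (UP k) (laurent A)" by (rule e)
  show "laurent_str k A \<phi> (up_ring.monom (UP k) c 0) = single A (\<phi> c) 0" if "c \<in> carrier k" by (rule e(2)[OF that])
  show "laurent_str k A \<phi> (tvar k) = single A \<one>\<^bsub>A\<^esub> 2" using e(3) by (simp add: laurent_t_def)
qed

section \<open>The universal equivariant homomorphism\<close>

context inv_alg
begin

text \<open>The uniqueness half of representability: the components of \<open>\<delta>\<close>
  generate B over the base ring, so homomorphisms from B are determined by the points they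
  induce.\<close>

definition egen :: "('b, 'p) ring_scheme \<Rightarrow> ((nat \<Rightarrow> 'k) \<Rightarrow> 'b) \<Rightarrow> ('a \<Rightarrow> 'b \<times> 'b) \<Rightarrow> bool"
  where "egen B \<beta> \<delta> \<longleftrightarrow> (\<forall>S. subring S B \<and> \<beta> ` carrier R \<subseteq> S \<and>
    (\<forall>a\<in>carrier A. fst (\<delta> a) \<in> S \<and> snd (\<delta> a) \<in> S) \<longrightarrow> carrier B \<subseteq> S)"

lemma egenD:
  assumes "egen B \<beta> \<delta>" "subring S B" "\<And>r. r \<in> carrier R \<Longrightarrow> \<beta> r \<in> S"
    "\<And>a. a \<in> carrier A \<Longrightarrow> fst (\<delta> a) \<in> S" "\<And>a. a \<in> carrier A \<Longrightarrow> snd (\<delta> a) \<in> S"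
  shows "carrier B \<subseteq> S"
  using assms unfolding egen_def by blast

lemma egen_eqI:
  assumes gen: "egen B \<beta> \<delta>" and B: "ring_hom_cring R B \<beta>" and d: "\<delta> \<in> ehom B \<beta>" and C: "ring C"
    and f: "f \<in> ring_hom B C" and g: "g \<in> ring_hom B C"
    and str: "\<And>r. r \<in> carrier R \<Longrightarrow> f (\<beta> r) = g (\<beta> r)"
    and comp: "\<And>a. a \<in> carrier A \<Longrightarrow> f (fst (\<delta> a)) = g (fst (\<delta> a))"
      "\<And>a. a \<in> carrier A \<Longrightarrow> f (snd (\<delta> a)) = g (snd (\<delta> a))"
    and b: "b \<in> carrier B"
  shows "f b = g b"
proof -
  note B' = ring_hom_cringD[OF B]
  have "carrier B \<subseteq> {b \<in> carrier B. f b = g b}"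
    by (rule egenD[OF gen subring_equalizer[OF f g B'(5) C]])
      (use str comp ehom_closed[OF d] ring_hom_closed[OF B'(3)] in auto)
  then show ?thesis using b by blast
qed

lemma egen_hom_eqI:
  assumes gen: "egen B \<beta> \<delta>" and B: "ring_hom_cring R B \<beta>" and d: "\<delta> \<in> ehom B \<beta>" and C: "ring C"
    and f: "f \<in> alg_hom R B \<beta> C \<psi>" and g: "g \<in> alg_hom R B \<beta> C \<psi>"
    and comp: "\<And>a. a \<in> carrier A \<Longrightarrow> map_prod f f (\<delta> a) = map_prod g g (\<delta> a)"
    and b: "b \<in> carrier B"
  shows "f b = g b"
  by (rule egen_eqI[OF gen B d C alg_hom_ring_hom[OF f] alg_hom_ring_hom[OF g] _ _ _ b])
    (use comp in \<open>auto simp: alg_hom_str[OF f] alg_hom_str[OF g] map_prod_def split_beta\<close>)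

section \<open>The contraction algebra and its tautological point\<close>

abbreviation "CA \<equiv> contraction k A \<phi> \<theta>"
abbreviation "str \<equiv> laurent_str k A \<phi>"
abbreviation "LA \<equiv> laurent A"

sublocale LA: cring LA by (rule laurent_cring[OF A.is_cring])

lemmas str_LA = laurent_str_hom(1)[OF k.is_cring A.is_cring algD(3)]
  and str_cn = laurent_str_hom(2)[OF k.is_cring A.is_cring algD(3)]
  and str_t = laurent_str_hom(3)[OF k.is_cring A.is_cring algD(3)]

definition "cgens = str ` carrier R \<union> (\<lambda>a. single A a 0) ` fixed_part A \<theta> \<union> (\<lambda>a. single A a (- 1)) ` anti_part A \<theta>"

lemma cgens_closed: "cgens \<subseteq> carrier LA"
  unfolding cgens_def fixed_part_def anti_part_def
  using ring_hom_closed[OF str_LA] laurent_single_closed[OF A.is_cring] by auto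

lemma CA_eq: "CA = LA\<lparr>carrier := generate_ring LA cgens\<rparr>"
  by (simp add: contraction_def cgens_def)

lemma CA_simps [simp]: "x \<otimes>\<^bsub>CA\<^esub> y = x \<otimes>\<^bsub>LA\<^esub> y" "x \<oplus>\<^bsub>CA\<^esub> y = x \<oplus>\<^bsub>LA\<^esub> y" "\<one>\<^bsub>CA\<^esub> = \<one>\<^bsub>LA\<^esub>" "\<zero>\<^bsub>CA\<^esub> = \<zero>\<^bsub>LA\<^esub>"
  by (simp_all add: CA_eq)

lemma carrier_CA: "carrier CA = generate_ring LA cgens"
  by (simp add: CA_eq)

lemma CA_subring: "subring (carrier CA) LA"
  unfolding carrier_CA by (rule LA.generate_ring_is_subring[OF cgens_closed])

lemma CA_cring: "cring CA"
  unfolding CA_eq by (rule LA.subring_cring[OF CA_subring[unfolded carrier_CA]])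

lemma CA_LA: "x \<in> carrier CA \<Longrightarrow> x \<in> carrier LA"
  using subringE(1)[OF CA_subring] by blast

lemma CA_incl: "x \<in> cgens \<Longrightarrow> x \<in> carrier CA"
  unfolding carrier_CA by (rule generate_ring.incl)

lemma id_CA_LA: "(\<lambda>x. x) \<in> ring_hom CA LA"
  by (rule ring_hom_memI) (simp_all add: CA_LA)

lemma CA_a_inv: "x \<in> carrier CA \<Longrightarrow> \<ominus>\<^bsub>CA\<^esub> x = \<ominus>\<^bsub>LA\<^esub> x"
  using ring_hom_a_inv[OF id_CA_LA] CA_cring by (simp add: cring.axioms LA.ring_axioms)

lemma str_CA: "str \<in> ring_hom R CA"
  using str_LA CA_incl by (auto simp: ring_hom_def Pi_def cgens_def)

lemma CA_alg: "ring_hom_cring R CA str"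
  by (rule ring_hom_cringI[OF R_cring CA_cring str_CA])

text \<open>With s read as \<surd>t, the pair stands for ev a + \<surd>t (od a / \<surd>t), which is
  \<open>a\<close>. It is the inclusion of A into the Laurent ring, written as a point of the
  contraction.\<close>

definition dC :: "'a \<Rightarrow> (int \<Rightarrow> 'a) \<times> (int \<Rightarrow> 'a)"
  where "dC a = (single A (ev a) 0, single A (od a) (-1))"

lemma ev_fixed_part: "a \<in> carrier A \<Longrightarrow> ev a \<in> fixed_part A \<theta>"
  and od_anti_part: "a \<in> carrier A \<Longrightarrow> od a \<in> anti_part A \<theta>"
  by (simp_all add: fixed_part_def anti_part_def)

lemma dC_closed: "a \<in> carrier A \<Longrightarrow> fst (dC a) \<in> carrier CA \<and> snd (dC a) \<in> carrier CA"
  using ev_fixed_part od_anti_part by (auto simp: dC_def cgens_def intro!: CA_incl)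

lemma dC_ehom: "dC \<in> ehom CA str"
proof -
  note sc = laurent_single_closed[OF A.is_cring] and sm = laurent_single_mult[OF A.is_cring]
    and sa = laurent_single_add[OF A.is_cring]
  have "dC \<in> ring_hom A (dbl CA (str t))"
  proof (rule ring_hom_memI)
    fix a assume "a \<in> carrier A"
    then show "dC a \<in> carrier (dbl CA (str t))" using dC_closed[of a] by (simp add: mem_Times_iff)
  next
    fix a b assume ab: "a \<in> carrier A" "b \<in> carrier A"
    then show "dC (a \<otimes>\<^bsub>A\<^esub> b) = dC a \<otimes>\<^bsub>dbl CA (str t)\<^esub> dC b"
      by (simp add: dC_def str_t sm sa ev_od_mult)
    show "dC (a \<oplus>\<^bsub>A\<^esub> b) = dC a \<oplus>\<^bsub>dbl CA (str t)\<^esub> dC b"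
      using ab by (simp add: dC_def sa ev_add od_add)
  next
    show "dC \<one>\<^bsub>A\<^esub> = \<one>\<^bsub>dbl CA (str t)\<^esub>"
      using ev_fixed[of "\<one>\<^bsub>A\<^esub>"] by (simp add: dC_def theta_simps laurent_one[OF A.is_cring] laurent_zero[OF A.is_cring])
  qed
  moreover have "dC (\<phi> c) = (str (cn c), \<zero>\<^bsub>CA\<^esub>)" if "c \<in> carrier k" for c
    using ev_fixed[of "\<phi> c"] that by (simp add: dC_def str_cn laurent_zero[OF A.is_cring])
  moreover have "dC (\<theta> a) = (fst (dC a), \<ominus>\<^bsub>CA\<^esub> snd (dC a))" if a: "a \<in> carrier A" for a
  proof -
    have "\<ominus>\<^bsub>CA\<^esub> snd (dC a) = single A (\<ominus>\<^bsub>A\<^esub> od a) (-1)"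
      using CA_a_inv[of "snd (dC a)"] dC_closed[OF a] laurent_minus_single[OF A.is_cring od_closed[OF a]]
      by (simp add: dC_def)
    then show ?thesis using theta_ev_od[OF a] by (simp add: dC_def)
  qed
  ultimately show ?thesis unfolding ehom_def alg_hom_def by blast
qed

lemma CA_egen: "egen CA str dC"
  unfolding egen_def
proof (intro allI impI, elim conjE)
  fix S assume S: "subring S CA" and str: "str ` carrier R \<subseteq> S"
    and d: "\<forall>a\<in>carrier A. fst (dC a) \<in> S \<and> snd (dC a) \<in> S"
  have S': "subring S LA"
  proof (rule LA.subringI)
    show "S \<subseteq> carrier LA" using subringE(1)[OF S] CA_LA by blast
    show "\<ominus>\<^bsub>LA\<^esub> x \<in> S" if "x \<in> S" for x
      using subringE(5)[OF S that] CA_a_inv[of x] subringE(1)[OF S] that by auto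
  qed (use subringE[OF S] in auto)
  have "cgens \<subseteq> S"
  proof
    fix x assume "x \<in> cgens"
    then consider "x \<in> str ` carrier R" | a where "a \<in> fixed_part A \<theta>" "x = single A a 0"
      | a where "a \<in> anti_part A \<theta>" "x = single A a (- 1)" unfolding cgens_def by blast
    then show "x \<in> S"
    proof cases
      case 2
      then have "fst (dC a) = x" "a \<in> carrier A" using ev_fixed by (auto simp: fixed_part_def dC_def)
      then show ?thesis using d by blast
    next
      case 3
      then have "snd (dC a) = x" "a \<in> carrier A" using od_anti by (auto simp: anti_part_def dC_def)
      then show ?thesis using d by blast
    qed (use str in blast)
  qed
  then show "carrier CA \<subseteq> S" unfolding carrier_CA
    by (rule LA.generate_ring_min_subring1[OF cgens_closed S'])
qed

text \<open>Substituting the unit \<open>s\<close> of L for \<surd>t turns the point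
  \<open>w\<close> into a homomorphism from A to L, which extends to \<open>laurent A\<close>. The
  middle claims say that on the generators of the contraction the extension gives back the
  components of \<open>w\<close>.\<close>

lemma laurent_ehom_lift:
  assumes C: "ring_hom_cring R C \<psi>" and w: "w \<in> ehom C \<psi>" and L: "cring L" and i: "\<iota> \<in> ring_hom C L"
    and s: "s \<in> Units L" "s \<otimes>\<^bsub>L\<^esub> s = \<iota> (\<psi> t)"
  obtains \<Lambda> where "\<Lambda> \<in> ring_hom LA L" "\<And>a. a \<in> carrier A \<Longrightarrow> \<Lambda> (fst (dC a)) = \<iota> (fst (w a))"
    "\<And>a. a \<in> carrier A \<Longrightarrow> \<Lambda> (snd (dC a)) = \<iota> (snd (w a))" "\<And>r. r \<in> carrier R \<Longrightarrow> \<Lambda> (str r) = \<iota> (\<psi> r)"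
    "\<And>a n. a \<in> carrier A \<Longrightarrow> \<Lambda> (single A a n) = (\<iota> (fst (w a)) \<oplus>\<^bsub>L\<^esub> s \<otimes>\<^bsub>L\<^esub> \<iota> (snd (w a))) \<otimes>\<^bsub>L\<^esub> unit_pow L s n"
proof -
  note C' = ring_hom_cringD[OF C]
  interpret L: cring L by fact
  have tC: "\<psi> t \<in> carrier C" by (rule ring_hom_closed[OF C'(3) t_closed])
  have sc: "s \<in> carrier L" using s by (simp add: L.Units_closed)
  have f: "(\<lambda>a. \<iota> (fst (w a)) \<oplus>\<^bsub>L\<^esub> s \<otimes>\<^bsub>L\<^esub> \<iota> (snd (w a))) \<in> ring_hom A L"
    by (rule ring_hom_comp[OF ehom_hom[OF w] dbl_eval_hom[OF C'(2) tC L i sc s(2)]])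
  obtain \<Lambda> where Lam: "\<Lambda> \<in> ring_hom (laurent A) L"
    and eq: "\<And>a n. a \<in> carrier A \<Longrightarrow> \<Lambda> (single A a n) = (\<iota> (fst (w a)) \<oplus>\<^bsub>L\<^esub> s \<otimes>\<^bsub>L\<^esub> \<iota> (snd (w a))) \<otimes>\<^bsub>L\<^esub> unit_pow L s n"
    using laurent_lift[OF A.is_cring L f s(1)] by metis
  have i0: "\<iota> \<zero>\<^bsub>C\<^esub> = \<zero>\<^bsub>L\<^esub>" by (rule ring_hom_zero[OF i C'(5) L.ring_axioms])
  have ic: "\<iota> (fst (w a)) \<in> carrier L" "\<iota> (snd (w a)) \<in> carrier L" if "a \<in> carrier A" for a
    using ehom_closed[OF w that] by (auto intro: ring_hom_closed[OF i])
  note up = unit_pow[OF L s(1)]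
  have 1: "\<Lambda> (fst (dC a)) = \<iota> (fst (w a))" if "a \<in> carrier A" for a
    using ehom_ev_od(1)[OF C w that] ic[OF that] sc that by (simp add: dC_def eq up i0)
  \<comment> \<open>The odd coordinate carries the exponent -1, so \<open>unit_pow L s (-1)\<close>
    cancels the factor \<open>s\<close> in front of the second component.\<close>
  have 2: "\<Lambda> (snd (dC a)) = \<iota> (snd (w a))" if a: "a \<in> carrier A" for a
  proof -
    have "\<Lambda> (snd (dC a)) = (s \<otimes>\<^bsub>L\<^esub> \<iota> (snd (w a))) \<otimes>\<^bsub>L\<^esub> unit_pow L s (-1)"
      using ehom_ev_od(2)[OF C w a] ic[OF a] sc a by (simp add: dC_def eq i0)
    also have "\<dots> = \<iota> (snd (w a)) \<otimes>\<^bsub>L\<^esub> (s \<otimes>\<^bsub>L\<^esub> unit_pow L s (-1))"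
      using ic[OF a] sc up(1) by (simp add: L.m_ac)
    finally show ?thesis using up(6) ic[OF a] by simp
  qed
  have 3: "\<Lambda> (str r) = \<iota> (\<psi> r)" if "r \<in> carrier R" for r
  proof (rule UP_hom_eqI[OF k.is_cring L ring_hom_comp[OF str_LA Lam] ring_hom_comp[OF C'(3) i] _ _ that])
    fix c assume c: "c \<in> carrier k"
    then show "\<Lambda> (str (cn c)) = \<iota> (\<psi> (cn c))"
      using ehom_phi[OF w c] ic[of "\<phi> c"] sc by (simp add: str_cn eq up i0)
  next
    have "w \<one>\<^bsub>A\<^esub> = (\<one>\<^bsub>C\<^esub>, \<zero>\<^bsub>C\<^esub>)" using ring_hom_one[OF ehom_hom[OF w]] by simp
    then show "\<Lambda> (str t) = \<iota> (\<psi> t)"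
      using sc s(2) ring_hom_one[OF i] ring_hom_closed[OF i tC] by (simp add: str_t eq up i0)
  qed
  show thesis by (rule that[OF Lam 1 2 3 eq])
qed

end

locale smooth_inv = inv_alg k A \<phi> \<theta> + SP: smooth_presentation k A \<phi> n F \<pi> \<sigma>
  for k :: "('k, 'm) ring_scheme" and A :: "('a, 'n) ring_scheme" and \<phi> \<theta> n F \<pi> \<sigma>
begin

text \<open>The pair (B, \<delta>) is kept abstract because the lemma serves twice: for the
  presented algebra, where smoothness is the means to exclude torsion, and for the contraction,
  where it is the goal. A premise cannot range over all types, so \<open>univ\<close> is asked for
  at the test algebra C.\<close>

lemma universal_lifting:
  assumes B: "ring_hom_cring R B \<beta>" and d: "\<delta> \<in> ehom B \<beta>" and gen: "egen B \<beta> \<delta>"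
    and univ: "\<And>w. w \<in> ehom C \<psi> \<Longrightarrow> \<exists>h\<in>alg_hom R B \<beta> C \<psi>. \<forall>a\<in>carrier A. map_prod h h (\<delta> a) = w a"
    and C: "ring_hom_cring R C \<psi>" and D: "cring D" and q: "q \<in> ring_hom C D" and q_surj: "q ` carrier C = carrier D"
    and sq: "\<And>x y. x \<in> carrier C \<Longrightarrow> y \<in> carrier C \<Longrightarrow> q x = \<zero>\<^bsub>D\<^esub> \<Longrightarrow> q y = \<zero>\<^bsub>D\<^esub> \<Longrightarrow> x \<otimes>\<^bsub>C\<^esub> y = \<zero>\<^bsub>C\<^esub>"
    and u: "u \<in> alg_hom R B \<beta> D (\<lambda>r. q (\<psi> r))"
  shows "\<exists>v\<in>alg_hom R B \<beta> C \<psi>. \<forall>b\<in>carrier B. q (v b) = u b"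
proof -
  note B' = ring_hom_cringD[OF B] and C' = ring_hom_cringD[OF C]
  interpret D: cring D by fact
  have tC: "\<psi> t \<in> carrier C" by (rule ring_hom_closed[OF C'(3) t_closed])
  have D': "ring_hom_cring R D (\<lambda>r. q (\<psi> r))"
    by (rule ring_hom_cringI[OF R_cring D ring_hom_comp[OF C'(3) q]])
  let ?E = "dbl C (\<psi> t)" and ?F = "dbl D (q (\<psi> t))" and ?Q = "map_prod q q"
  define w where "w a = map_prod u u (\<delta> a)" for a
  have w: "w \<in> ehom D (\<lambda>r. q (\<psi> r))" unfolding w_def by (rule ehom_comp[OF B D' d u])
  have E: "cring ?E" by (rule dbl_cring[OF C'(2) tC])
  have F: "cring ?F" by (rule dbl_cring[OF D ring_hom_closed[OF q tC]])
  have Q: "?Q \<in> ring_hom ?E ?F" by (rule dbl_map_hom[OF q refl C'(5) D.ring_axioms tC])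
  have q0: "q \<zero>\<^bsub>C\<^esub> = \<zero>\<^bsub>D\<^esub>" by (rule ring_hom_zero[OF q C'(5) D.ring_axioms])
  have chi: "(\<lambda>c. (\<psi> (cn c), \<zero>\<^bsub>C\<^esub>)) \<in> ring_hom k ?E"
    by (rule ring_hom_comp[OF ring_hom_comp[OF cn_hom C'(3)] dbl_const_hom[OF C'(2) tC]])
  have wa: "w \<in> alg_hom k A \<phi> ?F (\<lambda>c. ?Q (\<psi> (cn c), \<zero>\<^bsub>C\<^esub>))"
    using ehom_alg[OF w] by (simp add: q0)
  have surj: "?Q ` carrier ?E = carrier ?F"
    using q_surj by (simp add: map_prod_surj_on)
  have sqE: "x \<otimes>\<^bsub>?E\<^esub> y = \<zero>\<^bsub>?E\<^esub>" if "x \<in> carrier ?E" "y \<in> carrier ?E" "?Q x = \<zero>\<^bsub>?F\<^esub>" "?Q y = \<zero>\<^bsub>?F\<^esub>" for x y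
  proof -
    interpret C: cring C by (rule C')
    show ?thesis using that sq tC by (cases x; cases y) simp
  qed
  have "\<exists>v. v \<in> alg_hom k A \<phi> ?E (\<lambda>c. (\<psi> (cn c), \<zero>\<^bsub>C\<^esub>)) \<and> (\<forall>a\<in>carrier A. ?Q (v a) = w a)"
    by (rule SP.lifting[OF E F chi Q surj sqE wa]) blast+
  then obtain v where v: "v \<in> alg_hom k A \<phi> ?E (\<lambda>c. (\<psi> (cn c), \<zero>\<^bsub>C\<^esub>))" and qv: "\<And>a. a \<in> carrier A \<Longrightarrow> ?Q (v a) = w a"
    by blast
  have "?Q (v (\<theta> a)) = (q (fst (v a)), \<ominus>\<^bsub>D\<^esub> q (snd (v a)))" if a: "a \<in> carrier A" for a
    using ehom_theta[OF w a] qv[OF a] qv[OF theta_closed[OF a]] by (metis fst_map_prod snd_map_prod)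
  then obtain w' where w': "w' \<in> ehom C \<psi>" and qw': "\<And>a. a \<in> carrier A \<Longrightarrow> ?Q (w' a) = ?Q (v a)"
    using ehom_average[OF C v D q sq] by blast
  obtain h where h: "h \<in> alg_hom R B \<beta> C \<psi>" and hd: "\<And>a. a \<in> carrier A \<Longrightarrow> map_prod h h (\<delta> a) = w' a"
    using univ[OF w'] by blast
  have qh: "(\<lambda>b. q (h b)) \<in> alg_hom R B \<beta> D (\<lambda>r. q (\<psi> r))"
    by (rule alg_homI[OF ring_hom_comp[OF alg_hom_ring_hom[OF h] q]]) (simp add: alg_hom_str[OF h])
  have "q (h b) = u b" if "b \<in> carrier B" for b
  proof (rule egen_hom_eqI[OF gen B d D.ring_axioms qh u _ that])
    fix a assume a: "a \<in> carrier A"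
    have "map_prod (\<lambda>b. q (h b)) (\<lambda>b. q (h b)) (\<delta> a) = ?Q (map_prod h h (\<delta> a))"
      by (simp add: map_prod_def split_beta)
    also have "\<dots> = map_prod u u (\<delta> a)" using hd[OF a] qw'[OF a] qv[OF a] by (simp add: w_def)
    finally show "map_prod (\<lambda>b. q (h b)) (\<lambda>b. q (h b)) (\<delta> a) = map_prod u u (\<delta> a)" .
  qed
  then show ?thesis using h by blast
qed

subsection \<open>A finite presentation of the universal algebra\<close>

abbreviation "CP \<equiv> mpoly_ring R (2 * n)"
abbreviation "cc r \<equiv> single R r {#}"
abbreviation "cv j \<equiv> single R \<one>\<^bsub>R\<^esub> {#j::nat#}"

sublocale CP: cring CP by (rule mpoly_ring_cring[OF R_cring])

lemma cc_hom: "cc \<in> ring_hom R CP" by (rule mpoly_const_hom[OF R_cring])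
lemma cc_closed: "r \<in> carrier R \<Longrightarrow> cc r \<in> carrier CP" using cc_hom by (rule ring_hom_closed)
lemma cv_closed: "j < 2 * n \<Longrightarrow> cv j \<in> carrier CP" by (rule mpoly_var_closed[OF R_cring])
abbreviation "DP \<equiv> dbl CP (cc t)"

lemma DP_cring: "cring DP" by (rule dbl_cring[OF CP.is_cring cc_closed[OF t_closed]])

text \<open>The generic substitution: variable i becomes y_i + y_(n+i) s in 2 n new variables, the
  first n for the even and the last n for the odd coordinates.\<close>

definition "dP = (SOME e. e \<in> alg_hom k SP.Pn SP.cst DP (\<lambda>c. (cc (cn c), \<zero>\<^bsub>CP\<^esub>)) \<and> (\<forall>i<n. e (SP.vr i) = (cv i, cv (n + i))))"

lemma dP: "dP \<in> alg_hom k SP.Pn SP.cst DP (\<lambda>c. (cc (cn c), \<zero>\<^bsub>CP\<^esub>))"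
  and dP_var: "i < n \<Longrightarrow> dP (SP.vr i) = (cv i, cv (n + i))"
proof -
  have chi: "(\<lambda>c. (cc (cn c), \<zero>\<^bsub>CP\<^esub>)) \<in> ring_hom k DP"
    by (rule ring_hom_comp[OF ring_hom_comp[OF cn_hom cc_hom] dbl_const_hom[OF CP.is_cring cc_closed[OF t_closed]]])
  have "\<exists>e. e \<in> alg_hom k SP.Pn SP.cst DP (\<lambda>c. (cc (cn c), \<zero>\<^bsub>CP\<^esub>)) \<and> (\<forall>i<n. e (SP.vr i) = (cv i, cv (n + i)))"
    by (rule mpoly_lift[OF k.is_cring DP_cring chi, of n "\<lambda>i. (cv i, cv (n + i))"]) (use cv_closed in auto)
  then have *: "dP \<in> alg_hom k SP.Pn SP.cst DP (\<lambda>c. (cc (cn c), \<zero>\<^bsub>CP\<^esub>)) \<and> (\<forall>i<n. dP (SP.vr i) = (cv i, cv (n + i)))"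
    unfolding dP_def by (rule someI_ex)
  then show "dP \<in> alg_hom k SP.Pn SP.cst DP (\<lambda>c. (cc (cn c), \<zero>\<^bsub>CP\<^esub>))" by blast
  from * show "i < n \<Longrightarrow> dP (SP.vr i) = (cv i, cv (n + i))" by blast
qed

lemma dP_closed: "p \<in> carrier SP.Pn \<Longrightarrow> fst (dP p) \<in> carrier CP \<and> snd (dP p) \<in> carrier CP"
  using alg_hom_closed[OF dP, of p] by auto

definition "evp i = (SOME p. p \<in> carrier SP.Pn \<and> \<pi> p = ev (\<pi> (SP.vr i)))"

lemma evp: assumes "i < n" shows "evp i \<in> carrier SP.Pn" "\<pi> (evp i) = ev (\<pi> (SP.vr i))"
proof -
  have "ev (\<pi> (SP.vr i)) \<in> carrier A"
    using ring_hom_closed[OF SP.pi_hom SP.var_closed[OF assms]] by simp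
  then have "\<exists>p. p \<in> carrier SP.Pn \<and> \<pi> p = ev (\<pi> (SP.vr i))" using SP.preimage by metis
  then have "evp i \<in> carrier SP.Pn \<and> \<pi> (evp i) = ev (\<pi> (SP.vr i))" unfolding evp_def by (rule someI_ex)
  then show "evp i \<in> carrier SP.Pn" "\<pi> (evp i) = ev (\<pi> (SP.vr i))" by auto
qed

text \<open>The first two families make the generic point respect the relations \<open>F\<close> of
  A. The last two encode equivariance: the even part of generator i, represented by
  \<open>evp i\<close>, has to go to (y_i, 0). Generators suffice because both sides of the
  equivariance law are homomorphisms, and so the list is finite.\<close>

definition "G1 = (\<lambda>f. fst (dP f)) ` F \<union> (\<lambda>f. snd (dP f)) ` F \<union>
  (\<lambda>i. fst (dP (evp i)) \<ominus>\<^bsub>CP\<^esub> cv i) ` {..<n} \<union> (\<lambda>i. snd (dP (evp i))) ` {..<n}"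

lemma G1_closed: "G1 \<subseteq> carrier CP"
  unfolding G1_def using dP_closed SP.F evp(1) cv_closed by (auto simp: subset_iff)

lemma G1_finite: "finite G1"
  unfolding G1_def using SP.fin by simp

definition "K1 = Idl\<^bsub>CP\<^esub> G1"
definition "B1 = CP Quot K1"
abbreviation "q1 x \<equiv> K1 +>\<^bsub>CP\<^esub> x"
abbreviation "b1 r \<equiv> q1 (cc r)"

lemma K1_ideal: "ideal K1 CP" unfolding K1_def by (rule CP.genideal_ideal[OF G1_closed])

lemma q1_hom: "q1 \<in> ring_hom CP B1" unfolding B1_def by (rule quot_hom[OF K1_ideal])

lemma B1_cring: "cring B1" unfolding B1_def by (rule quot_cring[OF K1_ideal CP.is_cring])
lemma B1_ring: "ring B1" using B1_cring by (rule cring.axioms)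

lemma B1_alg: "ring_hom_cring R B1 b1"
  by (rule ring_hom_cringI[OF R_cring B1_cring ring_hom_comp[OF cc_hom q1_hom]])

lemma q1_surj: "q1 ` carrier CP = carrier B1" by (simp add: B1_def carrier_Quot)

lemma q1_zero: "x \<in> carrier CP \<Longrightarrow> q1 x = \<zero>\<^bsub>B1\<^esub> \<longleftrightarrow> x \<in> K1"
  unfolding B1_def zero_Quot by (rule coset_zero_iff[OF K1_ideal])

lemma q1_G1: "g \<in> G1 \<Longrightarrow> q1 g = \<zero>\<^bsub>B1\<^esub>"
  using q1_zero[of g] G1_closed CP.genideal_self[OF G1_closed] unfolding K1_def by blast

lemma B1_presentation: "alg_presentation R B1 b1 (2 * n) G1 q1"
proof (rule alg_presentation.intro[OF B1_alg _ q1_surj G1_finite G1_closed])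
  show "q1 \<in> alg_hom R CP cc B1 b1" by (rule alg_homI[OF q1_hom]) simp
  show "a_kernel CP B1 q1 = Idl\<^bsub>CP\<^esub> G1"
    using q1_zero ideal.Icarr[OF K1_ideal] unfolding a_kernel_def' K1_def[symmetric] by blast
qed

abbreviation "DB \<equiv> dbl B1 (b1 t)"

lemma b1_closed: "r \<in> carrier R \<Longrightarrow> b1 r \<in> carrier B1"
  by (rule ring_hom_closed[OF q1_hom cc_closed])

lemma DB_cring: "cring DB" by (rule dbl_cring[OF B1_cring b1_closed[OF t_closed]])

lemma dq_hom: "map_prod q1 q1 \<in> ring_hom DP DB"
  by (rule dbl_map_hom[OF q1_hom refl CP.ring_axioms B1_ring cc_closed[OF t_closed]])

definition "d1 = (SOME g. g \<in> ring_hom A DB \<and> (\<forall>p\<in>carrier SP.Pn. g (\<pi> p) = map_prod q1 q1 (dP p)))"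

lemma d1: "d1 \<in> ring_hom A DB" and d1_pi: "p \<in> carrier SP.Pn \<Longrightarrow> d1 (\<pi> p) = map_prod q1 q1 (dP p)"
proof -
  have DBr: "ring DB" using DB_cring by (rule cring.axioms)
  have h: "(\<lambda>p. map_prod q1 q1 (dP p)) \<in> ring_hom SP.Pn DB"
    by (rule ring_hom_comp[OF alg_hom_ring_hom[OF dP] dq_hom])
  have "map_prod q1 q1 (dP p) = \<zero>\<^bsub>DB\<^esub>" if "p \<in> carrier SP.Pn" "\<pi> p = \<zero>\<^bsub>A\<^esub>" for p
  proof (rule genideal_kernel[OF h SP.Pn_ring DBr SP.F])
    show "p \<in> Idl\<^bsub>SP.Pn\<^esub> F" using that SP.mem_J_iff unfolding SP.J_def by blast
    fix f assume "f \<in> F"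
    then have "fst (dP f) \<in> G1" "snd (dP f) \<in> G1" unfolding G1_def by auto
    then show "map_prod q1 q1 (dP f) = \<zero>\<^bsub>DB\<^esub>" using q1_G1 by (simp add: map_prod_def split_beta)
  qed
  then have "\<exists>g. g \<in> ring_hom A DB \<and> (\<forall>p\<in>carrier SP.Pn. g (\<pi> p) = map_prod q1 q1 (dP p))"
    using hom_factor[OF SP.pi_hom SP.surj h _ SP.Pn_ring A.ring_axioms DBr] by metis
  then have "d1 \<in> ring_hom A DB \<and> (\<forall>p\<in>carrier SP.Pn. d1 (\<pi> p) = map_prod q1 q1 (dP p))"
    unfolding d1_def by (rule someI_ex)
  then show "d1 \<in> ring_hom A DB" "p \<in> carrier SP.Pn \<Longrightarrow> d1 (\<pi> p) = map_prod q1 q1 (dP p)" by auto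
qed

lemma d1_phi: "c \<in> carrier k \<Longrightarrow> d1 (\<phi> c) = (b1 (cn c), \<zero>\<^bsub>B1\<^esub>)"
  using d1_pi[OF SP.cst_closed, of c] alg_hom_str[OF SP.pi, of c] alg_hom_str[OF dP, of c]
    ring_hom_zero[OF q1_hom CP.ring_axioms B1_ring] by simp

lemma d1_gen: "i < n \<Longrightarrow> d1 (\<pi> (SP.vr i)) = (q1 (cv i), q1 (cv (n + i)))"
  using d1_pi[OF SP.var_closed, of i] dP_var by simp

lemma d1_ev_gen: assumes i: "i < n" shows "d1 (ev (\<pi> (SP.vr i))) = (q1 (cv i), \<zero>\<^bsub>B1\<^esub>)"
proof -
  have cl: "fst (dP (evp i)) \<in> carrier CP" "cv i \<in> carrier CP"
    using dP_closed[OF evp(1)[OF i]] cv_closed i by auto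
  have "fst (dP (evp i)) \<ominus>\<^bsub>CP\<^esub> cv i \<in> G1" "snd (dP (evp i)) \<in> G1" unfolding G1_def using i by auto
  then have "q1 (fst (dP (evp i))) = q1 (cv i)" "q1 (snd (dP (evp i))) = \<zero>\<^bsub>B1\<^esub>"
    using q1_G1 ring_hom_eq_iff_minus[OF q1_hom CP.ring_axioms B1_ring cl] by auto
  then show ?thesis using d1_pi[OF evp(1)[OF i]] evp(2)[OF i] by (simp add: map_prod_def split_beta)
qed

lemma d1_ehom: "d1 \<in> ehom B1 b1"
proof -
  interpret B: cring B1 by (rule B1_cring)
  interpret D: cring DB by (rule DB_cring)
  let ?c = "\<lambda>x. (fst x, \<ominus>\<^bsub>B1\<^esub> snd x)"
  have c: "?c \<in> ring_hom DB DB" by (rule dbl_conj_hom[OF B1_cring b1_closed[OF t_closed]])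
  have "d1 (\<theta> (\<pi> p)) = ?c (d1 (\<pi> p))" if "p \<in> carrier SP.Pn" for p
  proof (rule mpoly_hom_eqI[OF k.is_cring D.ring_axioms
        ring_hom_comp[OF ring_hom_comp[OF SP.pi_hom theta_hom] d1] ring_hom_comp[OF ring_hom_comp[OF SP.pi_hom d1] c] _ _ that])
    fix r assume "r \<in> carrier k"
    then show "d1 (\<theta> (\<pi> (SP.cst r))) = ?c (d1 (\<pi> (SP.cst r)))"
      by (simp add: alg_hom_str[OF SP.pi] d1_phi)
  next
    fix i assume i: "i < n"
    let ?g = "\<pi> (SP.vr i)"
    have g: "?g \<in> carrier A" by (rule ring_hom_closed[OF SP.pi_hom SP.var_closed[OF i]])
    have cl: "q1 (cv i) \<in> carrier B1" "q1 (cv (n + i)) \<in> carrier B1"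
      using i cv_closed by (auto intro!: ring_hom_closed[OF q1_hom])
    \<comment> \<open>The formula \<theta>(g) = 2 ev(g) - g expresses the involution through the
      even part, whose image is prescribed by \<open>G1\<close>; the result is the pair (y_i,
      -y_(n+i)).\<close>
    have e: "\<theta> ?g = (ev ?g \<oplus>\<^bsub>A\<^esub> ev ?g) \<ominus>\<^bsub>A\<^esub> ?g"
    proof -
      have "\<theta> ?g = \<theta> (ev ?g \<oplus>\<^bsub>A\<^esub> od ?g)" using ev_add_od[OF g] by simp
      also have "\<dots> = ev ?g \<oplus>\<^bsub>A\<^esub> \<ominus>\<^bsub>A\<^esub> od ?g" using g by (simp add: theta_simps)
      also have "\<dots> = (ev ?g \<oplus>\<^bsub>A\<^esub> ev ?g) \<ominus>\<^bsub>A\<^esub> (ev ?g \<oplus>\<^bsub>A\<^esub> od ?g)"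
        using g by (simp add: a_minus_def A.minus_add A.a_assoc A.r_neg1 A.r_neg2)
      finally show ?thesis using ev_add_od[OF g] by simp
    qed
    have "d1 (\<theta> ?g) = (d1 (ev ?g) \<oplus>\<^bsub>DB\<^esub> d1 (ev ?g)) \<ominus>\<^bsub>DB\<^esub> d1 ?g"
      unfolding e using g by (simp only: ring_hom_minus[OF d1 A.ring_axioms D.ring_axioms] ring_hom_add[OF d1] ev_closed A.a_closed)
    also have "\<dots> = (q1 (cv i), \<ominus>\<^bsub>B1\<^esub> q1 (cv (n + i)))"
      using cl b1_closed[OF t_closed]
      by (simp add: d1_ev_gen[OF i] d1_gen[OF i] a_minus_def dbl_a_inv[OF B1_cring] B.a_assoc B.r_neg)
    finally show "d1 (\<theta> ?g) = ?c (d1 ?g)" using d1_gen[OF i] by simp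
  qed
  then have "d1 (\<theta> a) = ?c (d1 a)" if "a \<in> carrier A" for a using SP.preimage[OF that] by metis
  then show ?thesis unfolding ehom_def using d1 d1_phi by (simp add: alg_hom_def)
qed

lemma B1_egen: "egen B1 b1 d1"
  unfolding egen_def
proof (intro allI impI, elim conjE)
  fix S assume S: "subring S B1" and str: "b1 ` carrier R \<subseteq> S" and d: "\<forall>a\<in>carrier A. fst (d1 a) \<in> S \<and> snd (d1 a) \<in> S"
  let ?S = "{x \<in> carrier CP. q1 x \<in> S}"
  have sub: "subring ?S CP"
    by (rule CP.subringI)
      (use subringE[OF S] in \<open>auto simp: ring_hom_add[OF q1_hom] ring_hom_mult[OF q1_hom] ring_hom_one[OF q1_hom]
        ring_hom_a_inv[OF q1_hom CP.ring_axioms B1_ring]\<close>)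
  have v: "cv j \<in> ?S" if j: "j \<in> {..<2 * n}" for j
  proof -
    have g: "\<pi> (SP.vr i) \<in> carrier A" if "i < n" for i by (rule ring_hom_closed[OF SP.pi_hom SP.var_closed[OF that]])
    have "q1 (cv j) \<in> S"
    proof (cases "j < n")
      case True
      then show ?thesis using d g[OF True] d1_gen[OF True] by fastforce
    next
      case False
      then have i: "j - n < n" "n + (j - n) = j" using j by auto
      then show ?thesis using d g[OF i(1)] d1_gen[OF i(1)] by fastforce
    qed
    then show ?thesis using cv_closed j by simp
  qed
  have c: "cc r \<in> ?S" if "r \<in> carrier R" for r using str that cc_closed by auto
  have "carrier CP \<subseteq> ?S"
    using free_generating_subring[OF R_cring sub[unfolded mpoly_ring_def]] c v by (simp add: mpoly_ring_def)
  then show "carrier B1 \<subseteq> S" unfolding q1_surj[symmetric] by blast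
qed

text \<open>The variables take the components of \<open>w\<close> on the generators of A as values.
  The relations die because \<open>w\<close> is a homomorphism on A and, by
  \<open>ehom_ev_od\<close>, separates even and odd parts.\<close>

lemma B1_universal:
  assumes C: "ring_hom_cring R C \<psi>" and w: "w \<in> ehom C \<psi>"
  shows "\<exists>h\<in>alg_hom R B1 b1 C \<psi>. \<forall>a\<in>carrier A. map_prod h h (d1 a) = w a"
proof -
  note C' = ring_hom_cringD[OF C]
  interpret C: cring C by (rule C')
  have tC: "\<psi> t \<in> carrier C" by (rule ring_hom_closed[OF C'(3) t_closed])
  interpret D: cring "dbl C (\<psi> t)" by (rule dbl_cring[OF C'(2) tC])
  have g: "\<pi> (SP.vr i) \<in> carrier A" if "i < n" for i by (rule ring_hom_closed[OF SP.pi_hom SP.var_closed[OF that]])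
  define c where "c j = (if j < n then fst (w (\<pi> (SP.vr j))) else snd (w (\<pi> (SP.vr (j - n)))))" for j
  have cc: "c j \<in> carrier C" if "j < 2 * n" for j
    using ehom_closed[OF w g, of j] ehom_closed[OF w g, of "j - n"] that by (auto simp: c_def)
  have "\<exists>h. h \<in> alg_hom R CP cc C \<psi> \<and> (\<forall>j<2 * n. h (cv j) = c j)"
    by (rule mpoly_lift[OF R_cring C'(2,3) cc]) blast+
  then obtain h where h: "h \<in> alg_hom R CP cc C \<psi>" and h_var: "\<And>j. j < 2 * n \<Longrightarrow> h (cv j) = c j"
    by blast
  note hr = alg_hom_ring_hom[OF h]
  have hC: "map_prod h h \<in> ring_hom DP (dbl C (\<psi> t))"
    by (rule dbl_map_hom[OF hr alg_hom_str[OF h t_closed] CP.ring_axioms C.ring_axioms cc_closed[OF t_closed]])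
  have h0: "h \<zero>\<^bsub>CP\<^esub> = \<zero>\<^bsub>C\<^esub>" by (rule ring_hom_zero[OF hr CP.ring_axioms C.ring_axioms])
  have hd: "map_prod h h (dP p) = w (\<pi> p)" if "p \<in> carrier SP.Pn" for p
  proof (rule mpoly_hom_eqI[OF k.is_cring D.ring_axioms ring_hom_comp[OF alg_hom_ring_hom[OF dP] hC]
        ring_hom_comp[OF SP.pi_hom ehom_hom[OF w]] _ _ that])
    fix r assume "r \<in> carrier k"
    then show "map_prod h h (dP (SP.cst r)) = w (\<pi> (SP.cst r))"
      by (simp add: alg_hom_str[OF dP] alg_hom_str[OF SP.pi] alg_hom_str[OF h] ehom_phi[OF w] h0)
  next
    fix i assume i: "i < n"
    then show "map_prod h h (dP (SP.vr i)) = w (\<pi> (SP.vr i))"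
      by (simp add: dP_var h_var c_def)
  qed
  have hd': "h (fst (dP p)) = fst (w (\<pi> p))" "h (snd (dP p)) = snd (w (\<pi> p))" if "p \<in> carrier SP.Pn" for p
    using hd[OF that] by (metis fst_map_prod, metis snd_map_prod)
  have w0: "w \<zero>\<^bsub>A\<^esub> = (\<zero>\<^bsub>C\<^esub>, \<zero>\<^bsub>C\<^esub>)" using ring_hom_zero[OF ehom_hom[OF w] A.ring_axioms D.ring_axioms] by simp
  have hG: "h x = \<zero>\<^bsub>C\<^esub>" if xG: "x \<in> G1" for x
  proof -
    consider f where "f \<in> F" "x = fst (dP f) \<or> x = snd (dP f)"
      | i where "i < n" "x = fst (dP (evp i)) \<ominus>\<^bsub>CP\<^esub> cv i" | i where "i < n" "x = snd (dP (evp i))"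
      using xG unfolding G1_def by blast
    then show ?thesis
    proof cases
      case 1
      then have "f \<in> SP.J" using ring.genideal_self[OF SP.Pn_ring SP.F] unfolding SP.J_def by blast
      then show ?thesis using 1 SP.mem_J_iff hd'[of f] w0 by auto
    next
      case 2
      have cl: "fst (dP (evp i)) \<in> carrier CP" "cv i \<in> carrier CP" using dP_closed[OF evp(1)[OF 2(1)]] cv_closed 2(1) by auto
      have "h (fst (dP (evp i))) = h (cv i)"
        using hd'(1)[OF evp(1)[OF 2(1)]] evp(2)[OF 2(1)] ehom_ev_od(1)[OF C w g[OF 2(1)]] 2(1)
        by (simp add: h_var c_def)
      then show ?thesis
        unfolding 2(2) using ring_hom_eq_iff_minus[OF hr CP.ring_axioms C.ring_axioms cl] by simp
    next
      case 3
      then show ?thesis using hd'(2)[OF evp(1)[OF 3(1)]] evp(2)[OF 3(1)] ehom_ev_od(1)[OF C w g[OF 3(1)]] by simp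
    qed
  qed
  have hK: "h x = \<zero>\<^bsub>C\<^esub>" if "x \<in> carrier CP" "q1 x = \<zero>\<^bsub>B1\<^esub>" for x
    using genideal_kernel[OF hr CP.ring_axioms C.ring_axioms G1_closed hG] that q1_zero unfolding K1_def by blast
  obtain h' where h': "h' \<in> ring_hom B1 C" and h'_eq: "\<And>x. x \<in> carrier CP \<Longrightarrow> h' (q1 x) = h x"
    using hom_factor[OF q1_hom q1_surj hr hK CP.ring_axioms B1_ring C.ring_axioms] by metis
  have "h' \<in> alg_hom R B1 b1 C \<psi>"
    using h' by (rule alg_homI) (simp add: h'_eq cc_closed alg_hom_str[OF h])
  moreover have "map_prod h' h' (d1 a) = w a" if aA: "a \<in> carrier A" for a
  proof -
    obtain p where p: "p \<in> carrier SP.Pn" "\<pi> p = a" using aA by (rule SP.preimage)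
    have "map_prod h' h' (d1 a) = map_prod h h (dP p)"
      using d1_pi[OF p(1)] p(2) dP_closed[OF p(1)] by (simp add: map_prod_def split_beta h'_eq)
    then show ?thesis using hd[OF p(1)] p(2) by simp
  qed
  ultimately show ?thesis by blast
qed

lemma B1_smooth: "smooth TYPE('c) R B1 b1"
  unfolding smooth_def
proof (intro conjI B1_alg)
  show "finitely_presented R B1 b1" by (rule alg_presentation.finitely_presented[OF B1_presentation])
  show "formally_smooth TYPE('c) R B1 b1"
  proof (rule formally_smoothI)
    fix C :: "'c ring" and D :: "'c set ring" and \<chi> q u
    assume C: "cring C" and D: "cring D" and chi: "\<chi> \<in> ring_hom R C" and q: "q \<in> ring_hom C D" "q ` carrier C = carrier D"
      and sq: "\<And>x y. x \<in> carrier C \<Longrightarrow> y \<in> carrier C \<Longrightarrow> q x = \<zero>\<^bsub>D\<^esub> \<Longrightarrow> q y = \<zero>\<^bsub>D\<^esub> \<Longrightarrow> x \<otimes>\<^bsub>C\<^esub> y = \<zero>\<^bsub>C\<^esub>"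
      and u: "u \<in> alg_hom R B1 b1 D (\<lambda>r. q (\<chi> r))"
    have C': "ring_hom_cring R C \<chi>" by (rule ring_hom_cringI[OF R_cring C chi])
    show "\<exists>v\<in>alg_hom R B1 b1 C \<chi>. \<forall>a\<in>carrier B1. q (v a) = u a"
      by (rule universal_lifting[OF B1_alg d1_ehom B1_egen B1_universal[OF C'] C' D q sq u])
  qed
qed

text \<open>\<open>B1_smooth\<close> holds at every type of test rings, in particular at the one
  that \<open>smoothE\<close> asks for.\<close>

lemma B1_nonzerodivisor:
  assumes "b \<in> carrier B1" "b1 t \<otimes>\<^bsub>B1\<^esub> b = \<zero>\<^bsub>B1\<^esub>"
  shows "b = \<zero>\<^bsub>B1\<^esub>"
proof -
  obtain n' F' \<pi>' \<sigma>' where "smooth_presentation R B1 b1 n' F' \<pi>' \<sigma>'"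
    using smoothE[OF B1_smooth] by metis
  then interpret B: smooth_presentation R B1 b1 n' F' \<pi>' \<sigma>' .
  show ?thesis
    by (rule B.nonzerodivisor[OF t_closed tvar_nonzerodivisor[OF k.is_cring] assms])
qed

subsection \<open>The contraction algebra is universal\<close>

text \<open>Surjectivity is generation. For injectivity, \<open>L\<close> is B1 with an invertible
  square root of t adjoined, and \<open>\<iota>\<close> is injective since t is a nonzerodivisor on
  B1. The universal point extends to \<open>M\<close> on \<open>laurent A\<close>, and M h = \<iota>
  holds on generators.\<close>

lemma B1_CA_iso:
  obtains \<Lambda> where "\<Lambda> \<in> alg_hom R B1 b1 CA str" "\<And>a. a \<in> carrier A \<Longrightarrow> map_prod \<Lambda> \<Lambda> (d1 a) = dC a"
    "\<Lambda> ` carrier B1 = carrier CA" "\<And>b. b \<in> carrier B1 \<Longrightarrow> \<Lambda> b = \<zero>\<^bsub>CA\<^esub> \<Longrightarrow> b = \<zero>\<^bsub>B1\<^esub>"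
proof -
  have CAr: "ring CA" using CA_cring by (rule cring.axioms)
  obtain h where h: "h \<in> alg_hom R B1 b1 CA str" and hd: "\<And>a. a \<in> carrier A \<Longrightarrow> map_prod h h (d1 a) = dC a"
    using B1_universal[OF CA_alg dC_ehom] by blast
  note hr = alg_hom_ring_hom[OF h]
  have hd': "h (fst (d1 a)) = fst (dC a)" "h (snd (d1 a)) = snd (dC a)" if "a \<in> carrier A" for a
    using hd[OF that] by (metis fst_map_prod, metis snd_map_prod)
  have dcl: "fst (d1 a) \<in> carrier B1" "snd (d1 a) \<in> carrier B1" if "a \<in> carrier A" for a
    using ehom_closed[OF d1_ehom that] by auto
  have "carrier CA \<subseteq> h ` carrier B1"
  proof (rule egenD[OF CA_egen ring_hom_image_subring[OF hr B1_ring CAr]])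
    fix r assume "r \<in> carrier R"
    then show "str r \<in> h ` carrier B1"
      using alg_hom_str[OF h] b1_closed by (intro image_eqI[of _ _ "b1 r"]) auto
  next
    fix a assume a: "a \<in> carrier A"
    show "fst (dC a) \<in> h ` carrier B1" using hd'(1)[OF a] dcl(1)[OF a] by (metis imageI)
    show "snd (dC a) \<in> h ` carrier B1" using hd'(2)[OF a] dcl(2)[OF a] by (metis imageI)
  qed
  then have surj: "h ` carrier B1 = carrier CA" using ring_hom_closed[OF hr] by blast
  obtain L :: "(int \<Rightarrow> (nat multiset \<Rightarrow> nat \<Rightarrow> 'k) set) set ring" and \<iota> s where L: "cring L" and i: "\<iota> \<in> ring_hom B1 L"
    and i_inj: "\<And>c. c \<in> carrier B1 \<Longrightarrow> \<iota> c = \<zero>\<^bsub>L\<^esub> \<Longrightarrow> c = \<zero>\<^bsub>B1\<^esub>" and s: "s \<in> Units L" "s \<otimes>\<^bsub>L\<^esub> s = \<iota> (b1 t)"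
    by (rule invert_square_root[OF B1_cring b1_closed[OF t_closed] B1_nonzerodivisor]) blast+
  obtain M where M: "M \<in> ring_hom LA L" "\<And>a. a \<in> carrier A \<Longrightarrow> M (fst (dC a)) = \<iota> (fst (d1 a))"
    "\<And>a. a \<in> carrier A \<Longrightarrow> M (snd (dC a)) = \<iota> (snd (d1 a))" "\<And>r. r \<in> carrier R \<Longrightarrow> M (str r) = \<iota> (b1 r)"
    by (rule laurent_ehom_lift[OF B1_alg d1_ehom L i s]) blast
  have Lr: "ring L" using L by (rule cring.axioms)
  have Mh: "(\<lambda>b. M (h b)) \<in> ring_hom B1 L"
    by (rule ring_hom_comp[OF ring_hom_comp[OF hr id_CA_LA] M(1)])
  have eq: "M (h b) = \<iota> b" if "b \<in> carrier B1" for b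
    by (rule egen_eqI[OF B1_egen B1_alg d1_ehom Lr Mh i _ _ _ that])
      (simp_all add: alg_hom_str[OF h] M(2-4) hd')
  have inj: "b = \<zero>\<^bsub>B1\<^esub>" if "b \<in> carrier B1" "h b = \<zero>\<^bsub>CA\<^esub>" for b
  proof (rule i_inj[OF that(1)])
    have "\<iota> b = M (h b)" using eq[OF that(1)] by simp
    also have "\<dots> = \<zero>\<^bsub>L\<^esub>" using that(2) ring_hom_zero[OF M(1) LA.ring_axioms Lr] by simp
    finally show "\<iota> b = \<zero>\<^bsub>L\<^esub>" .
  qed
  show thesis by (rule that[OF h hd surj inj])
qed

theorem CA_universal:
  assumes C: "ring_hom_cring R C \<psi>" and w: "w \<in> ehom C \<psi>"
  obtains h where "h \<in> alg_hom R CA str C \<psi>" "\<And>a. a \<in> carrier A \<Longrightarrow> h (fst (dC a)) = fst (w a)"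
    "\<And>a. a \<in> carrier A \<Longrightarrow> h (snd (dC a)) = snd (w a)"
proof -
  note C' = ring_hom_cringD[OF C]
  obtain \<Lambda> where Lam: "\<Lambda> \<in> alg_hom R B1 b1 CA str" and Ld: "\<And>a. a \<in> carrier A \<Longrightarrow> map_prod \<Lambda> \<Lambda> (d1 a) = dC a"
    and surj: "\<Lambda> ` carrier B1 = carrier CA" and inj: "\<And>b. b \<in> carrier B1 \<Longrightarrow> \<Lambda> b = \<zero>\<^bsub>CA\<^esub> \<Longrightarrow> b = \<zero>\<^bsub>B1\<^esub>"
    by (rule B1_CA_iso) blast
  obtain g where g: "g \<in> alg_hom R B1 b1 C \<psi>" and gd: "\<And>a. a \<in> carrier A \<Longrightarrow> map_prod g g (d1 a) = w a"
    using B1_universal[OF C w] by blast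
  have CAr: "ring CA" using CA_cring by (rule cring.axioms)
  have ker: "g b = \<zero>\<^bsub>C\<^esub>" if "b \<in> carrier B1" "\<Lambda> b = \<zero>\<^bsub>CA\<^esub>" for b
    using inj[OF that] ring_hom_zero[OF alg_hom_ring_hom[OF g] B1_ring C'(5)] by simp
  obtain h where h: "h \<in> ring_hom CA C" and hL: "\<And>b. b \<in> carrier B1 \<Longrightarrow> h (\<Lambda> b) = g b"
    using hom_factor[OF alg_hom_ring_hom[OF Lam] surj alg_hom_ring_hom[OF g] ker B1_ring CAr C'(5)] by metis
  have "h \<in> alg_hom R CA str C \<psi>"
    using h by (rule alg_homI) (simp add: alg_hom_str[OF Lam, symmetric] hL b1_closed alg_hom_str[OF g])
  moreover have "h (fst (dC a)) = fst (w a)" "h (snd (dC a)) = snd (w a)" if a: "a \<in> carrier A" for a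
  proof -
    have "fst (dC a) = \<Lambda> (fst (d1 a))" "snd (dC a) = \<Lambda> (snd (d1 a))"
      "fst (w a) = g (fst (d1 a))" "snd (w a) = g (snd (d1 a))"
      using Ld[OF a] gd[OF a] by (metis fst_map_prod, metis snd_map_prod, metis fst_map_prod, metis snd_map_prod)
    then show "h (fst (dC a)) = fst (w a)" "h (snd (dC a)) = snd (w a)"
      using ehom_closed[OF d1_ehom a] by (simp_all add: hL)
  qed
  ultimately show thesis by (rule that)
qed

corollary CA_represents:
  assumes "ring_hom_cring R C \<psi>" "w \<in> ehom C \<psi>"
  shows "\<exists>h\<in>alg_hom R CA str C \<psi>. \<forall>a\<in>carrier A. map_prod h h (dC a) = w a"
  using CA_universal[OF assms] by (metis prod.collapse map_prod_simp)

lemma CA_finitely_presented: "finitely_presented R CA str"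
proof -
  obtain \<Lambda> where Lam: "\<Lambda> \<in> alg_hom R B1 b1 CA str"
    and surj: "\<Lambda> ` carrier B1 = carrier CA" and inj: "\<And>b. b \<in> carrier B1 \<Longrightarrow> \<Lambda> b = \<zero>\<^bsub>CA\<^esub> \<Longrightarrow> b = \<zero>\<^bsub>B1\<^esub>"
    by (rule B1_CA_iso) blast
  note Lr = alg_hom_ring_hom[OF Lam]
  have CAr: "ring CA" using CA_cring by (rule cring.axioms)
  have "alg_presentation R CA str (2 * n) G1 (\<lambda>x. \<Lambda> (q1 x))"
  proof (rule alg_presentation.intro[OF CA_alg _ _ G1_finite G1_closed])
    show "(\<lambda>x. \<Lambda> (q1 x)) \<in> alg_hom R CP cc CA str"
      by (rule alg_homI[OF ring_hom_comp[OF q1_hom Lr]]) (simp add: alg_hom_str[OF Lam])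
    show "(\<lambda>x. \<Lambda> (q1 x)) ` carrier CP = carrier CA"
      unfolding surj[symmetric] q1_surj[symmetric] by (simp add: image_image)
    have "\<Lambda> (q1 x) = \<zero>\<^bsub>CA\<^esub> \<longleftrightarrow> x \<in> K1" if x: "x \<in> carrier CP" for x
      using inj[OF ring_hom_closed[OF q1_hom x]] q1_zero[OF x] ring_hom_zero[OF Lr B1_ring CAr] by metis
    then show "a_kernel CP CA (\<lambda>x. \<Lambda> (q1 x)) = Idl\<^bsub>CP\<^esub> G1"
      using ideal.Icarr[OF K1_ideal] unfolding a_kernel_def' K1_def[symmetric] by blast
  qed
  then show ?thesis by (rule alg_presentation.finitely_presented)
qed

theorem CA_smooth: "smooth TYPE('c) R CA str"
  unfolding smooth_def
proof (intro conjI CA_alg CA_finitely_presented)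
  show "formally_smooth TYPE('c) R CA str"
  proof (rule formally_smoothI)
    fix C :: "'c ring" and D :: "'c set ring" and \<chi> q u
    assume C: "cring C" and D: "cring D" and chi: "\<chi> \<in> ring_hom R C" and q: "q \<in> ring_hom C D" "q ` carrier C = carrier D"
      and sq: "\<And>x y. x \<in> carrier C \<Longrightarrow> y \<in> carrier C \<Longrightarrow> q x = \<zero>\<^bsub>D\<^esub> \<Longrightarrow> q y = \<zero>\<^bsub>D\<^esub> \<Longrightarrow> x \<otimes>\<^bsub>C\<^esub> y = \<zero>\<^bsub>C\<^esub>"
      and u: "u \<in> alg_hom R CA str D (\<lambda>r. q (\<chi> r))"
    have C': "ring_hom_cring R C \<chi>" by (rule ring_hom_cringI[OF R_cring C chi])
    show "\<exists>v\<in>alg_hom R CA str C \<chi>. \<forall>a\<in>carrier CA. q (v a) = u a"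
      by (rule universal_lifting[OF CA_alg dC_ehom CA_egen CA_represents[OF C'] C' D q sq u])
  qed
qed

end

section \<open>Symmetric algebras\<close>

text \<open>Closure of \<open>M\<close> under its two operations keeps the defining relations of
  \<open>sym_alg\<close> inside the free algebra.\<close>

locale sym_setup =
  fixes Q :: "('q, 'm) ring_scheme" and M :: "('q, 'x, 'n) module_scheme"
  assumes Q: "cring Q"
    and add_closed: "\<And>x y. x \<in> carrier M \<Longrightarrow> y \<in> carrier M \<Longrightarrow> x \<oplus>\<^bsub>M\<^esub> y \<in> carrier M"
    and smult_closed: "\<And>r x. r \<in> carrier Q \<Longrightarrow> x \<in> carrier M \<Longrightarrow> r \<odot>\<^bsub>M\<^esub> x \<in> carrier M"
begin

abbreviation "SF \<equiv> sym_free Q M"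
abbreviation "SI \<equiv> sym_ideal Q M"
abbreviation "Sy \<equiv> sym_alg Q M"
abbreviation "Ss \<equiv> sym_str Q M"
definition "si x = SI +>\<^bsub>SF\<^esub> single Q \<one>\<^bsub>Q\<^esub> {#x#}"

sublocale Q: cring Q by (rule Q)

interpretation MA: mon_alg Q "free_cmonoid (carrier M)" using Q by (rule mon_alg_free)

lemma SF_eq: "SF = MA.P" by (simp add: sym_free_def)

sublocale SF: cring SF unfolding SF_eq by (rule MA.P_cring)

definition "srels = {single Q \<one>\<^bsub>Q\<^esub> {#x \<oplus>\<^bsub>M\<^esub> y#} \<ominus>\<^bsub>SF\<^esub>
        (single Q \<one>\<^bsub>Q\<^esub> {#x#} \<oplus>\<^bsub>SF\<^esub> single Q \<one>\<^bsub>Q\<^esub> {#y#}) | x y.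
        x \<in> carrier M \<and> y \<in> carrier M} \<union>
     {single Q \<one>\<^bsub>Q\<^esub> {#r \<odot>\<^bsub>M\<^esub> x#} \<ominus>\<^bsub>SF\<^esub> single Q r {#x#} | r x.
        r \<in> carrier Q \<and> x \<in> carrier M}"

lemma SI_eq: "SI = Idl\<^bsub>SF\<^esub> srels" by (simp add: sym_ideal_def srels_def)

lemma single_SF: "r \<in> carrier Q \<Longrightarrow> set_mset N \<subseteq> carrier M \<Longrightarrow> single Q r N \<in> carrier SF"
  unfolding SF_eq by (rule MA.single_closed) auto

lemma srels_closed: "srels \<subseteq> carrier SF"
  unfolding srels_def using add_closed smult_closed
  by (auto intro!: SF.minus_closed SF.a_closed single_SF)

lemma SI_ideal: "ideal SI SF" unfolding SI_eq by (rule SF.genideal_ideal[OF srels_closed])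

lemma Sy_cring: "cring Sy" unfolding sym_alg_def by (rule quot_cring[OF SI_ideal SF.is_cring])

sublocale Sy: cring Sy by (rule Sy_cring)

lemma sq_hom: "(\<lambda>x. SI +>\<^bsub>SF\<^esub> x) \<in> ring_hom SF Sy" unfolding sym_alg_def by (rule quot_hom[OF SI_ideal])

lemma Ss_hom: "Ss \<in> ring_hom Q Sy"
proof -
  have "(\<lambda>r. single Q r {#}) \<in> ring_hom Q SF" using MA.const_hom by (simp add: SF_eq)
  from ring_hom_comp[OF this sq_hom] show ?thesis by (simp add: sym_str_def[abs_def])
qed

lemma si_closed: "x \<in> carrier M \<Longrightarrow> si x \<in> carrier Sy"
  unfolding si_def by (intro ring_hom_closed[OF sq_hom] single_SF) auto

lemma srel_eq: "x \<ominus>\<^bsub>SF\<^esub> y \<in> srels \<Longrightarrow> x \<in> carrier SF \<Longrightarrow> y \<in> carrier SF \<Longrightarrow> SI +>\<^bsub>SF\<^esub> x = SI +>\<^bsub>SF\<^esub> y"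
  using coset_eq_iff[OF SI_ideal] SF.genideal_self[OF srels_closed] unfolding SI_eq by blast

lemma si_add:
  assumes "x \<in> carrier M" "y \<in> carrier M"
  shows "si (x \<oplus>\<^bsub>M\<^esub> y) = si x \<oplus>\<^bsub>Sy\<^esub> si y"
proof -
  have cl: "single Q \<one>\<^bsub>Q\<^esub> {#x#} \<in> carrier SF" "single Q \<one>\<^bsub>Q\<^esub> {#y#} \<in> carrier SF" "single Q \<one>\<^bsub>Q\<^esub> {#x \<oplus>\<^bsub>M\<^esub> y#} \<in> carrier SF"
    using assms add_closed by (auto intro!: single_SF)
  have "si (x \<oplus>\<^bsub>M\<^esub> y) = SI +>\<^bsub>SF\<^esub> (single Q \<one>\<^bsub>Q\<^esub> {#x#} \<oplus>\<^bsub>SF\<^esub> single Q \<one>\<^bsub>Q\<^esub> {#y#})"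
    unfolding si_def by (rule srel_eq) (use assms cl in \<open>auto simp: srels_def intro!: SF.a_closed\<close>)
  then show ?thesis unfolding si_def using ring_hom_add[OF sq_hom cl(1,2)] by simp
qed

lemma si_smult:
  assumes "r \<in> carrier Q" "x \<in> carrier M"
  shows "si (r \<odot>\<^bsub>M\<^esub> x) = Ss r \<otimes>\<^bsub>Sy\<^esub> si x"
proof -
  have cl: "single Q \<one>\<^bsub>Q\<^esub> {#x#} \<in> carrier SF" "single Q r {#} \<in> carrier SF" "single Q r {#x#} \<in> carrier SF"
    "single Q \<one>\<^bsub>Q\<^esub> {#r \<odot>\<^bsub>M\<^esub> x#} \<in> carrier SF"
    using assms smult_closed by (auto intro!: single_SF)
  have "si (r \<odot>\<^bsub>M\<^esub> x) = SI +>\<^bsub>SF\<^esub> single Q r {#x#}"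
    unfolding si_def by (rule srel_eq) (use assms cl in \<open>auto simp: srels_def\<close>)
  also have "single Q r {#x#} = single Q r {#} \<otimes>\<^bsub>SF\<^esub> single Q \<one>\<^bsub>Q\<^esub> {#x#}"
    using assms unfolding SF_eq by (subst MA.single_mult) auto
  finally show ?thesis unfolding si_def sym_str_def using ring_hom_mult[OF sq_hom cl(2,1)] by simp
qed

lemma Sy_generating_subring:
  assumes S: "subring S Sy" and 1: "\<And>r. r \<in> carrier Q \<Longrightarrow> Ss r \<in> S" and 2: "\<And>x. x \<in> carrier M \<Longrightarrow> si x \<in> S"
  shows "carrier Sy \<subseteq> S"
proof -
  let ?S = "{x \<in> carrier SF. SI +>\<^bsub>SF\<^esub> x \<in> S}"
  have sub: "subring ?S SF"
    by (rule SF.subringI)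
      (use subringE[OF S] in \<open>auto simp: ring_hom_add[OF sq_hom] ring_hom_mult[OF sq_hom] ring_hom_one[OF sq_hom]
        ring_hom_a_inv[OF sq_hom SF.ring_axioms Sy.ring_axioms]\<close>)
  have c: "single Q r {#} \<in> ?S" if "r \<in> carrier Q" for r
    using 1[OF that] single_SF[OF that, of "{#}"] by (simp add: sym_str_def)
  have v: "single Q \<one>\<^bsub>Q\<^esub> {#x#} \<in> ?S" if "x \<in> carrier M" for x
    using 2[OF that] single_SF[OF Q.one_closed, of "{#x#}"] that by (simp add: si_def)
  have "carrier SF \<subseteq> ?S"
    unfolding sym_free_def
    by (rule free_generating_subring[OF Q sub[unfolded sym_free_def]]) (use c v in \<open>simp_all add: sym_free_def\<close>)
  then show ?thesis unfolding sym_alg_def carrier_Quot by blast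
qed

lemma Sy_universal:
  assumes D: "cring D" and f: "f \<in> ring_hom Q D" and gc: "\<And>x. x \<in> carrier M \<Longrightarrow> g x \<in> carrier D"
    and ga: "\<And>x y. x \<in> carrier M \<Longrightarrow> y \<in> carrier M \<Longrightarrow> g (x \<oplus>\<^bsub>M\<^esub> y) = g x \<oplus>\<^bsub>D\<^esub> g y"
    and gs: "\<And>r x. r \<in> carrier Q \<Longrightarrow> x \<in> carrier M \<Longrightarrow> g (r \<odot>\<^bsub>M\<^esub> x) = f r \<otimes>\<^bsub>D\<^esub> g x"
  shows "\<exists>h\<in>ring_hom Sy D. (\<forall>r\<in>carrier Q. h (Ss r) = f r) \<and> (\<forall>x\<in>carrier M. h (si x) = g x)"
proof -
  interpret D: cring D by fact
  have "\<exists>e. e \<in> ring_hom SF D \<and> (\<forall>r\<in>carrier Q. e (single Q r {#}) = f r) \<and> (\<forall>x\<in>carrier M. e (single Q \<one>\<^bsub>Q\<^esub> {#x#}) = g x)"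
    unfolding sym_free_def by (rule free_lift[OF Q D f gc]) blast+
  then obtain e where e: "e \<in> ring_hom SF D" and ec: "\<And>r. r \<in> carrier Q \<Longrightarrow> e (single Q r {#}) = f r"
    and ex: "\<And>x. x \<in> carrier M \<Longrightarrow> e (single Q \<one>\<^bsub>Q\<^esub> {#x#}) = g x" by blast
  have es: "e (single Q r {#x#}) = f r \<otimes>\<^bsub>D\<^esub> g x" if "r \<in> carrier Q" "x \<in> carrier M" for r x
  proof -
    have "single Q r {#x#} = single Q r {#} \<otimes>\<^bsub>SF\<^esub> single Q \<one>\<^bsub>Q\<^esub> {#x#}"
      using that unfolding SF_eq by (subst MA.single_mult) auto
    then show ?thesis using ring_hom_mult[OF e single_SF single_SF, of r "{#}" "\<one>\<^bsub>Q\<^esub>" "{#x#}"] that by (simp add: ec ex)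
  qed
  have kill: "e z = \<zero>\<^bsub>D\<^esub>" if z: "z \<in> srels" for z
  proof -
    have *: "e (a \<ominus>\<^bsub>SF\<^esub> b) = \<zero>\<^bsub>D\<^esub>" if "e a = e b" "a \<in> carrier SF" "b \<in> carrier SF" for a b
      using that ring_hom_eq_iff_minus[OF e SF.ring_axioms D.ring_axioms] by blast
    have s1: "single Q \<one>\<^bsub>Q\<^esub> {#x#} \<in> carrier SF" if "x \<in> carrier M" for x using that by (auto intro!: single_SF)
    consider x y where "x \<in> carrier M" "y \<in> carrier M" "z = single Q \<one>\<^bsub>Q\<^esub> {#x \<oplus>\<^bsub>M\<^esub> y#} \<ominus>\<^bsub>SF\<^esub>
        (single Q \<one>\<^bsub>Q\<^esub> {#x#} \<oplus>\<^bsub>SF\<^esub> single Q \<one>\<^bsub>Q\<^esub> {#y#})"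
      | r x where "r \<in> carrier Q" "x \<in> carrier M" "z = single Q \<one>\<^bsub>Q\<^esub> {#r \<odot>\<^bsub>M\<^esub> x#} \<ominus>\<^bsub>SF\<^esub> single Q r {#x#}"
      using z unfolding srels_def by blast
    then show ?thesis
    proof cases
      case 1
      show ?thesis unfolding 1(3)
        by (rule *) (use 1(1,2) s1 add_closed in \<open>auto simp: ring_hom_add[OF e] ex ga intro!: SF.a_closed\<close>)
    next
      case 2
      have "single Q r {#x#} \<in> carrier SF" using 2 by (auto intro!: single_SF)
      then show ?thesis unfolding 2(3)
        by (intro *) (use 2(1,2) s1 smult_closed es[OF 2(1,2)] in \<open>simp_all add: ex gs\<close>)
    qed
  qed
  have kill': "e z = \<zero>\<^bsub>D\<^esub>" if "z \<in> SI" for z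
    using genideal_kernel[OF e SF.ring_axioms D.ring_axioms srels_closed kill] that unfolding SI_eq by blast
  let ?h = "\<lambda>Z. the_elem (e ` Z)"
  have h1: "?h \<in> ring_hom Sy D" unfolding sym_alg_def
    by (rule quot_lift_hom[OF SI_ideal SF.ring_axioms D.ring_axioms e kill'])
  have h2: "?h (Ss r) = f r" if "r \<in> carrier Q" for r
    unfolding sym_str_def using quot_lift_eq[OF SI_ideal SF.ring_axioms D.ring_axioms e kill', of "single Q r {#}"] that
    by (simp add: ec single_SF)
  have h3: "?h (si x) = g x" if "x \<in> carrier M" for x
    unfolding si_def using quot_lift_eq[OF SI_ideal SF.ring_axioms D.ring_axioms e kill', of "single Q \<one>\<^bsub>Q\<^esub> {#x#}"] that
    by (simp add: ex single_SF)
  show ?thesis by (intro bexI[OF _ h1] conjI ballI h2 h3)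
qed

end

section \<open>The special fibre\<close>

context inv_alg
begin

definition "I = Idl\<^bsub>A\<^esub> (anti_part A \<theta>)"
definition "I2 = I \<cdot>\<^bsub>A\<^esub> I"

lemma anti_sub: "anti_part A \<theta> \<subseteq> carrier A" by (auto simp: anti_part_def)

lemma I_ideal: "ideal I A" unfolding I_def by (rule A.genideal_ideal[OF anti_sub])
lemma I2_ideal: "ideal I2 A" unfolding I2_def by (rule A.ideal_prod_is_ideal[OF I_ideal I_ideal])
lemma I2_sub: "I2 \<subseteq> I" unfolding I2_def using A.ideal_prod_inter[OF I_ideal I_ideal] by blast

lemmas I_closed = ideal.Icarr[OF I_ideal] and I2_closed = ideal.Icarr[OF I2_ideal]
lemmas I_add = additive_subgroup.a_closed[OF ideal.axioms(1)[OF I_ideal]]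
  and I2_add = additive_subgroup.a_closed[OF ideal.axioms(1)[OF I2_ideal]]
lemmas I_zero = additive_subgroup.zero_closed[OF ideal.axioms(1)[OF I_ideal]]
  and I2_zero = additive_subgroup.zero_closed[OF ideal.axioms(1)[OF I2_ideal]]
lemmas I_neg = additive_subgroup.a_inv_closed[OF ideal.axioms(1)[OF I_ideal]]

lemma I2_prod: "x \<in> I \<Longrightarrow> y \<in> I \<Longrightarrow> x \<otimes>\<^bsub>A\<^esub> y \<in> I2" unfolding I2_def by (rule ideal_prod.prod)

lemma od_I: "a \<in> carrier A \<Longrightarrow> od a \<in> I"
  unfolding I_def using A.genideal_self[OF anti_sub] od_anti_part by blast

text \<open>The elements with even part in I^2 form an ideal by the product rule: the extra term
  od(s) od(a) is a product of two elements of I. The ideal contains the odd elements, whose even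
  part is zero. So modulo I^2 every element of I agrees with its odd part.\<close>

lemma ev_I: assumes "x \<in> I" shows "ev x \<in> I2"
proof -
  define W where "W = {x \<in> carrier A. ev x \<in> I2}"
  have "sub_ideal A (carrier A) W"
    unfolding sub_ideal_def
  proof (intro conjI ballI)
    show "W \<subseteq> carrier A" by (auto simp: W_def)
    show "\<zero>\<^bsub>A\<^esub> \<in> W" using ev_fixed[of "\<zero>\<^bsub>A\<^esub>"] I2_zero by (simp add: W_def theta_simps)
    show "a \<oplus>\<^bsub>A\<^esub> b \<in> W" if "a \<in> W" "b \<in> W" for a b using that I2_add by (simp add: W_def ev_add)
    fix s a assume s: "s \<in> carrier A" and a: "a \<in> W"
    then have "ev s \<otimes>\<^bsub>A\<^esub> ev a \<in> I2" "od s \<otimes>\<^bsub>A\<^esub> od a \<in> I2"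
      using ideal.I_l_closed[OF I2_ideal] I2_prod od_I by (auto simp: W_def)
    then show "s \<otimes>\<^bsub>A\<^esub> a \<in> W" using s a I2_add by (simp add: W_def ev_od_mult)
  qed
  then have "ideal W A" by (rule A.sub_ideal_ideal)
  moreover have "anti_part A \<theta> \<subseteq> W" using od_anti I2_zero by (auto simp: W_def anti_part_def)
  ultimately have "I \<subseteq> W" unfolding I_def by (rule A.genideal_minimal)
  then show ?thesis using assms by (auto simp: W_def)
qed

abbreviation "AI \<equiv> A Quot I"
abbreviation "cM \<equiv> conormal_module A I"
abbreviation "qI a \<equiv> I +>\<^bsub>A\<^esub> a"
abbreviation "q2 a \<equiv> I2 +>\<^bsub>A\<^esub> a"

lemma carrier_cM: "carrier cM = q2 ` I" by (simp add: conormal_module_def I2_def)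

lemma qI_hom: "qI \<in> ring_hom A AI" by (rule quot_hom[OF I_ideal])

lemma qI_eq: "a \<in> carrier A \<Longrightarrow> b \<in> carrier A \<Longrightarrow> qI a = qI b \<longleftrightarrow> a \<ominus>\<^bsub>A\<^esub> b \<in> I" by (rule coset_eq_iff[OF I_ideal])
lemma q2_eq: "a \<in> carrier A \<Longrightarrow> b \<in> carrier A \<Longrightarrow> q2 a = q2 b \<longleftrightarrow> a \<ominus>\<^bsub>A\<^esub> b \<in> I2" by (rule coset_eq_iff[OF I2_ideal])

lemma cM_add: "x \<in> carrier A \<Longrightarrow> y \<in> carrier A \<Longrightarrow> q2 x \<oplus>\<^bsub>cM\<^esub> q2 y = q2 (x \<oplus>\<^bsub>A\<^esub> y)"
  using ring_hom_add[OF quot_hom[OF I2_ideal], of x y] by (simp add: conormal_module_def FactRing_def)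

text \<open>The scalar product is a union of cosets over all representatives. They coincide because
  a' x' - a x = (a' - a) x' + a (x' - x) is a product of two elements of I plus a multiple of an
  element of I^2.\<close>

lemma cM_smult:
  assumes a: "a \<in> carrier A" and x: "x \<in> I"
  shows "qI a \<odot>\<^bsub>cM\<^esub> q2 x = q2 (a \<otimes>\<^bsub>A\<^esub> x)"
proof -
  have xc: "x \<in> carrier A" using I_closed[OF x] .
  have eq: "q2 (a' \<otimes>\<^bsub>A\<^esub> x') = q2 (a \<otimes>\<^bsub>A\<^esub> x)" if "a' \<in> qI a" "x' \<in> q2 x" for a' x'
  proof -
    have a': "a' \<in> carrier A" "a' \<ominus>\<^bsub>A\<^esub> a \<in> I" using that(1) mem_coset_iff[OF I_ideal a] by auto
    have x': "x' \<in> carrier A" "x' \<ominus>\<^bsub>A\<^esub> x \<in> I2" using that(2) mem_coset_iff[OF I2_ideal xc] by auto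
    have "x' = x \<oplus>\<^bsub>A\<^esub> (x' \<ominus>\<^bsub>A\<^esub> x)" using x' xc by (simp add: A.add_minus_cancel)
    moreover have "x \<oplus>\<^bsub>A\<^esub> (x' \<ominus>\<^bsub>A\<^esub> x) \<in> I" using I_add[OF x] x'(2) I2_sub by blast
    ultimately have x'I: "x' \<in> I" by metis
    have "a' \<otimes>\<^bsub>A\<^esub> x' \<ominus>\<^bsub>A\<^esub> a \<otimes>\<^bsub>A\<^esub> x = (a' \<ominus>\<^bsub>A\<^esub> a) \<otimes>\<^bsub>A\<^esub> x' \<oplus>\<^bsub>A\<^esub> a \<otimes>\<^bsub>A\<^esub> (x' \<ominus>\<^bsub>A\<^esub> x)"
      using a a'(1) x'(1) xc
      by (simp add: a_minus_def A.l_distr A.r_distr A.l_minus A.r_minus A.a_assoc A.r_neg1)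
    also have "\<dots> \<in> I2"
      using I2_prod[OF a'(2) x'I] ideal.I_l_closed[OF I2_ideal x'(2) a] by (rule I2_add)
    finally show ?thesis using q2_eq a a' x' xc by simp
  qed
  have "qI a \<odot>\<^bsub>cM\<^esub> q2 x = (\<Union>a'\<in>qI a. \<Union>x'\<in>q2 x. q2 (a' \<otimes>\<^bsub>A\<^esub> x'))"
    by (simp add: conormal_module_def rcoset_mult_def I2_def)
  also have "\<dots> = (\<Union>a'\<in>qI a. \<Union>x'\<in>q2 x. q2 (a \<otimes>\<^bsub>A\<^esub> x))" using eq by (intro SUP_cong refl) auto
  also have "\<dots> = q2 (a \<otimes>\<^bsub>A\<^esub> x)"
    using self_mem_coset[OF I_ideal a] self_mem_coset[OF I2_ideal xc] by auto
  finally show ?thesis .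
qed

lemma sym_setup_conormal: "sym_setup AI cM"
proof (rule sym_setup.intro)
  show "cring AI" by (rule quot_cring[OF I_ideal A.is_cring])
  show "x \<oplus>\<^bsub>cM\<^esub> y \<in> carrier cM" if "x \<in> carrier cM" "y \<in> carrier cM" for x y
    using that I_closed I_add cM_add unfolding carrier_cM by auto
  show "r \<odot>\<^bsub>cM\<^esub> x \<in> carrier cM" if r: "r \<in> carrier AI" and x: "x \<in> carrier cM" for r x
  proof -
    obtain a y where "a \<in> carrier A" "r = qI a" "y \<in> I" "x = q2 y" using r x unfolding carrier_cM carrier_Quot by blast
    then show ?thesis using cM_smult ideal.I_l_closed[OF I_ideal] unfolding carrier_cM by auto
  qed
qed

end

context smooth_inv
begin

interpretation SY: sym_setup AI cM by (rule sym_setup_conormal)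

abbreviation "Sym \<equiv> sym_alg AI cM"
abbreviation "sy a \<equiv> sym_str AI cM (qI a)"
abbreviation "sx a \<equiv> SY.si (q2 a)"

lemma sy_hom: "sy \<in> ring_hom A Sym" by (rule ring_hom_comp[OF qI_hom SY.Ss_hom])

lemma cM_mem: "x \<in> I \<Longrightarrow> q2 x \<in> carrier cM" by (simp add: carrier_cM)

lemma sx_closed: "x \<in> I \<Longrightarrow> sx x \<in> carrier Sym" by (intro SY.si_closed cM_mem)

lemma sx_add: "x \<in> I \<Longrightarrow> y \<in> I \<Longrightarrow> sx (x \<oplus>\<^bsub>A\<^esub> y) = sx x \<oplus>\<^bsub>Sym\<^esub> sx y"
  using SY.si_add[OF cM_mem cM_mem, of x y] by (simp add: cM_add I_closed)

lemma sx_mult: "a \<in> carrier A \<Longrightarrow> x \<in> I \<Longrightarrow> sx (a \<otimes>\<^bsub>A\<^esub> x) = sy a \<otimes>\<^bsub>Sym\<^esub> sx x"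
  using SY.si_smult[OF ring_hom_closed[OF qI_hom] cM_mem, of a x] by (simp add: cM_smult)

lemma sx_zero: "sx \<zero>\<^bsub>A\<^esub> = \<zero>\<^bsub>Sym\<^esub>"
proof -
  have "sx \<zero>\<^bsub>A\<^esub> \<oplus>\<^bsub>Sym\<^esub> sx \<zero>\<^bsub>A\<^esub> = sx \<zero>\<^bsub>A\<^esub>" using sx_add[OF I_zero I_zero] by simp
  then show ?thesis using sx_closed[OF I_zero] SY.Sy.add.r_cancel_one' by metis
qed

lemma sx_neg: assumes x: "x \<in> I" shows "sx (\<ominus>\<^bsub>A\<^esub> x) = \<ominus>\<^bsub>Sym\<^esub> sx x"
proof -
  have "sx (\<ominus>\<^bsub>A\<^esub> x) \<oplus>\<^bsub>Sym\<^esub> sx x = \<zero>\<^bsub>Sym\<^esub>"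
    using sx_add[OF I_neg[OF x] x] sx_zero I_closed[OF x] by (simp add: A.l_neg)
  then show ?thesis using sx_closed[OF x] sx_closed[OF I_neg[OF x]] SY.Sy.minus_equality by metis
qed

lemma qI_ev: "a \<in> carrier A \<Longrightarrow> qI (ev a) = qI a"
proof -
  assume a: "a \<in> carrier A"
  have "a \<ominus>\<^bsub>A\<^esub> ev a = od a"
    using ev_add_od[OF a] a by (metis A.add_minus_cancel A.add.l_cancel A.minus_closed ev_closed od_closed)
  then show ?thesis using qI_eq[of a "ev a"] od_I[OF a] a by simp
qed

lemma q2_od: assumes x: "x \<in> I" shows "q2 (od x) = q2 x"
proof -
  have xc: "x \<in> carrier A" using I_closed[OF x] .
  have "x \<ominus>\<^bsub>A\<^esub> od x = ev x"
    using ev_add_od[OF xc] xc by (metis A.add_minus_cancel A.add.l_cancel A.a_comm A.minus_closed ev_closed od_closed)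
  then show ?thesis using q2_eq[of x "od x"] ev_I[OF x] xc by simp
qed

definition "symR = UnivPoly.eval k Sym (\<lambda>c. sy (\<phi> c)) \<zero>\<^bsub>Sym\<^esub>"

lemma symR: "symR \<in> ring_hom R Sym" "\<And>c. c \<in> carrier k \<Longrightarrow> symR (cn c) = sy (\<phi> c)" "symR t = \<zero>\<^bsub>Sym\<^esub>"
  unfolding symR_def
  using UP_eval[OF k.is_cring SY.Sy_cring ring_hom_comp[OF algD(3) sy_hom] SY.Sy.zero_closed] by auto

lemma symR_alg: "ring_hom_cring R Sym symR" by (rule ring_hom_cringI[OF R_cring SY.Sy_cring symR(1)])

text \<open>For t = 0 the ring \<open>dbl\<close> is that of dual numbers, so the second component
  has to be a derivation along the first. The odd part gives one, because ev(a) and a agree modulo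
  I.\<close>

lemma sym_ehom: "(\<lambda>a. (sy a, sx (od a))) \<in> ehom Sym symR"
proof -
  let ?w = "\<lambda>a. (sy a, sx (od a))"
  have syc: "sy a \<in> carrier Sym" if "a \<in> carrier A" for a using sy_hom that by (rule ring_hom_closed)
  have "?w \<in> ring_hom A (dbl Sym (symR t))"
    unfolding symR(3)
  proof (rule ring_hom_memI)
    fix a assume "a \<in> carrier A"
    then show "?w a \<in> carrier (dbl Sym \<zero>\<^bsub>Sym\<^esub>)" using syc sx_closed od_I by simp
  next
    fix a b assume ab: "a \<in> carrier A" "b \<in> carrier A"
    have "od (a \<otimes>\<^bsub>A\<^esub> b) = ev a \<otimes>\<^bsub>A\<^esub> od b \<oplus>\<^bsub>A\<^esub> ev b \<otimes>\<^bsub>A\<^esub> od a"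
      using ev_od_mult(2)[OF ab] ab by (simp add: A.m_comm)
    then have "sx (od (a \<otimes>\<^bsub>A\<^esub> b)) = sy (ev a) \<otimes>\<^bsub>Sym\<^esub> sx (od b) \<oplus>\<^bsub>Sym\<^esub> sy (ev b) \<otimes>\<^bsub>Sym\<^esub> sx (od a)"
      using ab od_I ideal.I_l_closed[OF I_ideal] by (simp add: sx_add sx_mult)
    then show "?w (a \<otimes>\<^bsub>A\<^esub> b) = ?w a \<otimes>\<^bsub>dbl Sym \<zero>\<^bsub>Sym\<^esub>\<^esub> ?w b"
      using ab syc sx_closed od_I by (simp add: qI_ev ring_hom_mult[OF sy_hom] SY.Sy.m_comm)
    show "?w (a \<oplus>\<^bsub>A\<^esub> b) = ?w a \<oplus>\<^bsub>dbl Sym \<zero>\<^bsub>Sym\<^esub>\<^esub> ?w b"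
      using ab od_I by (simp add: ring_hom_add[OF sy_hom] od_add sx_add)
  next
    show "?w \<one>\<^bsub>A\<^esub> = \<one>\<^bsub>dbl Sym \<zero>\<^bsub>Sym\<^esub>\<^esub>"
      using ev_fixed[of "\<one>\<^bsub>A\<^esub>"] by (simp add: theta_simps ring_hom_one[OF sy_hom] sx_zero)
  qed
  moreover have "?w (\<phi> c) = (symR (cn c), \<zero>\<^bsub>Sym\<^esub>)" if "c \<in> carrier k" for c
    using ev_fixed[of "\<phi> c"] that by (simp add: symR(2) sx_zero)
  moreover have "?w (\<theta> a) = (fst (?w a), \<ominus>\<^bsub>Sym\<^esub> snd (?w a))" if "a \<in> carrier A" for a
  proof -
    have "qI (\<theta> a) = qI a" using qI_ev[OF that] qI_ev[OF theta_closed[OF that]] theta_ev_od[OF that] by simp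
    then show ?thesis using that theta_ev_od[OF that] od_I[OF that] by (simp add: sx_neg)
  qed
  ultimately show ?thesis unfolding ehom_def alg_hom_def by blast
qed

abbreviation "tI \<equiv> Idl\<^bsub>CA\<^esub> {laurent_t A}"

lemma laurent_t_eq: "laurent_t A = str t" by (simp add: laurent_t_def str_t)

text \<open>Reduced modulo t, the point \<open>dC\<close> is a homomorphism \<open>f0\<close>
  together with a derivation \<open>g0\<close> along it. Since \<open>f0\<close> kills I, the
  restriction of \<open>g0\<close> to I is linear and kills I^2, so the pair factors through A/I and
  I/I^2.\<close>

lemma special_fibre_retraction:
  "\<exists>g\<in>ring_hom Sym (CA Quot tI). (\<forall>a\<in>carrier A. g (sy a) = tI +>\<^bsub>CA\<^esub> fst (dC a)) \<and>
    (\<forall>a\<in>carrier A. g (sx (od a)) = tI +>\<^bsub>CA\<^esub> snd (dC a))"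
proof -
  interpret C: cring CA by (rule CA_cring)
  have tc: "laurent_t A \<in> carrier CA" unfolding laurent_t_eq by (rule ring_hom_closed[OF str_CA t_closed])
  have tI: "ideal tI CA" by (rule C.genideal_ideal) (use tc in simp)
  let ?T = "CA Quot tI"
  define p where "p x = tI +>\<^bsub>CA\<^esub> x" for x
  interpret T: cring ?T by (rule quot_cring[OF tI CA_cring])
  have p: "p \<in> ring_hom CA ?T" unfolding p_def by (rule quot_hom[OF tI])
  have pt: "p (str t) = \<zero>\<^bsub>?T\<^esub>"
    unfolding p_def zero_Quot using coset_zero_iff[OF tI tc] C.genideal_self'[OF tc] laurent_t_eq by metis
  have str_tc: "str t \<in> carrier CA" using tc laurent_t_eq by simp
  have fst_hom: "fst \<in> ring_hom (dbl ?T \<zero>\<^bsub>?T\<^esub>) ?T"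
    by (rule ring_hom_memI) auto
  define d where "d a = map_prod p p (dC a)" for a
  have d: "d \<in> ring_hom A (dbl ?T \<zero>\<^bsub>?T\<^esub>)"
    unfolding d_def by (rule ring_hom_comp[OF ehom_hom[OF dC_ehom]
      dbl_map_hom[OF p pt C.ring_axioms T.ring_axioms str_tc]])
  define f0 where "f0 a = fst (d a)" for a
  define g0 where "g0 a = snd (d a)" for a
  have f0: "f0 \<in> ring_hom A ?T" unfolding f0_def by (rule ring_hom_comp[OF d fst_hom])
  have d_eq: "d a = (f0 a, g0 a)" for a by (simp add: f0_def g0_def)
  have dcl: "f0 a \<in> carrier ?T" "g0 a \<in> carrier ?T" if "a \<in> carrier A" for a
    using ring_hom_closed[OF d that] by (auto simp: d_eq)
  have g0_add: "g0 (a \<oplus>\<^bsub>A\<^esub> b) = g0 a \<oplus>\<^bsub>?T\<^esub> g0 b" if "a \<in> carrier A" "b \<in> carrier A" for a b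
    using ring_hom_add[OF d that] by (simp add: d_eq)
  have g0_mult: "g0 (a \<otimes>\<^bsub>A\<^esub> b) = f0 a \<otimes>\<^bsub>?T\<^esub> g0 b \<oplus>\<^bsub>?T\<^esub> g0 a \<otimes>\<^bsub>?T\<^esub> f0 b" if "a \<in> carrier A" "b \<in> carrier A" for a b
    using ring_hom_mult[OF d that] by (simp add: d_eq)
  have f0_I: "f0 x = \<zero>\<^bsub>?T\<^esub>" if "x \<in> I" for x
  proof (rule genideal_kernel[OF f0 A.ring_axioms T.ring_axioms anti_sub _ that[unfolded I_def]])
    fix b assume "b \<in> anti_part A \<theta>"
    then have "ev b = \<zero>\<^bsub>A\<^esub>" using od_anti by (auto simp: anti_part_def)
    then have "fst (dC b) = \<zero>\<^bsub>CA\<^esub>" by (simp add: dC_def laurent_zero[OF A.is_cring])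
    then show "f0 b = \<zero>\<^bsub>?T\<^esub>" using ring_hom_zero[OF p C.ring_axioms T.ring_axioms] by (simp add: f0_def d_def map_prod_def split_beta)
  qed
  have g0_I2: "g0 x = \<zero>\<^bsub>?T\<^esub>" if "x \<in> I2" for x
    using that unfolding I2_def
  proof (induction x rule: ideal_prod.induct)
    case (prod i j)
    then show ?case using g0_mult[of i j] f0_I dcl(2) I_closed by simp
  next
    case (sum x y)
    then have "x \<in> carrier A" "y \<in> carrier A" using I2_closed unfolding I2_def by auto
    then show ?case using g0_add sum.IH by simp
  qed
  have g0_cong: "g0 x = g0 y" if "x \<in> carrier A" "y \<in> carrier A" "x \<ominus>\<^bsub>A\<^esub> y \<in> I2" for x y
  proof -
    have "x = y \<oplus>\<^bsub>A\<^esub> (x \<ominus>\<^bsub>A\<^esub> y)" using that by (simp add: A.add_minus_cancel)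
    then have "g0 x = g0 y \<oplus>\<^bsub>?T\<^esub> g0 (x \<ominus>\<^bsub>A\<^esub> y)" using g0_add[of y "x \<ominus>\<^bsub>A\<^esub> y"] that by simp
    then show ?thesis using g0_I2[OF that(3)] dcl(2)[OF that(2)] by simp
  qed
  define f where "f = (\<lambda>Z. the_elem (f0 ` Z))"
  have f: "f \<in> ring_hom AI ?T" unfolding f_def by (rule quot_lift_hom[OF I_ideal A.ring_axioms T.ring_axioms f0 f0_I])
  have f_eq: "f (qI a) = f0 a" if "a \<in> carrier A" for a
    unfolding f_def by (rule quot_lift_eq[OF I_ideal A.ring_axioms T.ring_axioms f0 f0_I that])
  \<comment> \<open>A representative of the class is chosen; \<open>g0_cong\<close> makes the value
    independent of the choice.\<close>
  define g where "g Z = g0 (SOME x. x \<in> I \<and> Z = q2 x)" for Z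
  have g_eq: "g (q2 x) = g0 x" if "x \<in> I" for x
  proof -
    have "(SOME y. y \<in> I \<and> q2 x = q2 y) \<in> I \<and> q2 x = q2 (SOME y. y \<in> I \<and> q2 x = q2 y)"
      by (rule someI[of _ x]) (use that in simp)
    then show ?thesis unfolding g_def using g0_cong[OF I_closed[OF that] I_closed] q2_eq[OF I_closed[OF that] I_closed] by metis
  qed
  have "\<exists>h\<in>ring_hom Sym ?T. (\<forall>r\<in>carrier AI. h (sym_str AI cM r) = f r) \<and> (\<forall>x\<in>carrier cM. h (SY.si x) = g x)"
  proof (rule SY.Sy_universal[OF T.is_cring f])
    show "g x \<in> carrier ?T" if "x \<in> carrier cM" for x
      using that dcl(2) I_closed by (auto simp: carrier_cM g_eq)
    show "g (x \<oplus>\<^bsub>cM\<^esub> y) = g x \<oplus>\<^bsub>?T\<^esub> g y" if "x \<in> carrier cM" "y \<in> carrier cM" for x y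
      using that I_closed I_add by (auto simp: carrier_cM cM_add g_eq g0_add)
    show "g (r \<odot>\<^bsub>cM\<^esub> x) = f r \<otimes>\<^bsub>?T\<^esub> g x" if r: "r \<in> carrier AI" and x: "x \<in> carrier cM" for r x
    proof -
      obtain a y where ay: "a \<in> carrier A" "r = qI a" "y \<in> I" "x = q2 y" using r x unfolding carrier_cM carrier_Quot by blast
      have "g (r \<odot>\<^bsub>cM\<^esub> x) = g0 (a \<otimes>\<^bsub>A\<^esub> y)"
        using ay cM_smult g_eq ideal.I_l_closed[OF I_ideal] by simp
      also have "\<dots> = f0 a \<otimes>\<^bsub>?T\<^esub> g0 y"
        using g0_mult[OF ay(1) I_closed[OF ay(3)]] f0_I[OF ay(3)] dcl ay(1) I_closed[OF ay(3)] by simp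
      finally show ?thesis using ay f_eq g_eq by simp
    qed
  qed
  then obtain h where h: "h \<in> ring_hom Sym ?T" "\<And>r. r \<in> carrier AI \<Longrightarrow> h (sym_str AI cM r) = f r"
    "\<And>x. x \<in> carrier cM \<Longrightarrow> h (SY.si x) = g x" by blast
  have "h (sy a) = p (fst (dC a))" if "a \<in> carrier A" for a
    using h(2)[OF ring_hom_closed[OF qI_hom that]] f_eq[OF that] by (simp add: f0_def d_def map_prod_def split_beta)
  moreover have "h (sx (od a)) = p (snd (dC a))" if "a \<in> carrier A" for a
  proof -
    have "od (od a) = od a" using od_anti[of "od a"] that by simp
    then have "dC (od a) = (fst (dC (od a)), snd (dC a))" by (simp add: dC_def)
    then have "g0 (od a) = p (snd (dC a))" unfolding g0_def d_def by (metis snd_conv snd_map_prod)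
    then show ?thesis using h(3)[OF cM_mem[OF od_I[OF that]]] g_eq[OF od_I[OF that]] by simp
  qed
  ultimately show ?thesis using h(1) unfolding p_def by blast
qed

text \<open>The map \<open>h\<close> classifies the point of \<open>sym_ehom\<close>. Followed by
  the map of \<open>special_fibre_retraction\<close> it is reduction modulo t, so its kernel is no
  larger than (t); and t goes to zero, so the kernel is no smaller.\<close>

theorem special_fibre_iso:
  "\<exists>h. h \<in> alg_iso k (CA Quot tI) (\<lambda>c. tI +>\<^bsub>CA\<^esub> str (cn c)) Sym (\<lambda>c. sy (\<phi> c))"
proof -
  interpret C: cring CA by (rule CA_cring)
  have tc: "laurent_t A \<in> carrier CA" unfolding laurent_t_eq by (rule ring_hom_closed[OF str_CA t_closed])
  have tI: "ideal tI CA" by (rule C.genideal_ideal) (use tc in simp)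
  interpret T: cring "CA Quot tI" by (rule quot_cring[OF tI CA_cring])
  obtain h where h: "h \<in> alg_hom R CA str Sym symR" and h1: "\<And>a. a \<in> carrier A \<Longrightarrow> h (fst (dC a)) = sy a"
    and h2: "\<And>a. a \<in> carrier A \<Longrightarrow> h (snd (dC a)) = sx (od a)"
    by (rule CA_universal[OF symR_alg sym_ehom, unfolded fst_conv snd_conv]) blast
  note hr = alg_hom_ring_hom[OF h]
  obtain g where g: "g \<in> ring_hom Sym (CA Quot tI)" and g1: "\<And>a. a \<in> carrier A \<Longrightarrow> g (sy a) = tI +>\<^bsub>CA\<^esub> fst (dC a)"
    and g2: "\<And>a. a \<in> carrier A \<Longrightarrow> g (sx (od a)) = tI +>\<^bsub>CA\<^esub> snd (dC a)"
    using special_fibre_retraction by blast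
  have p: "(\<lambda>x. tI +>\<^bsub>CA\<^esub> x) \<in> ring_hom CA (CA Quot tI)" by (rule quot_hom[OF tI])
  have ht: "h (laurent_t A) = \<zero>\<^bsub>Sym\<^esub>" unfolding laurent_t_eq using alg_hom_str[OF h t_closed] symR(3) by simp
  have gstr: "g (h (str r)) = tI +>\<^bsub>CA\<^esub> str r" if "r \<in> carrier R" for r
  proof (rule UP_hom_eqI[OF k.is_cring T.is_cring ring_hom_comp[OF ring_hom_comp[OF str_CA hr] g] ring_hom_comp[OF str_CA p] _ _ that])
    fix c assume c: "c \<in> carrier k"
    have "fst (dC (\<phi> c)) = str (cn c)" using ev_fixed[of "\<phi> c"] c by (simp add: dC_def str_cn)
    then show "g (h (str (cn c))) = tI +>\<^bsub>CA\<^esub> str (cn c)" using h1[of "\<phi> c"] g1[of "\<phi> c"] c by simp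
  next
    have "tI +>\<^bsub>CA\<^esub> str t = \<zero>\<^bsub>CA Quot tI\<^esub>"
      unfolding zero_Quot using coset_zero_iff[OF tI tc] C.genideal_self'[OF tc] laurent_t_eq by metis
    then show "g (h (str t)) = tI +>\<^bsub>CA\<^esub> str t"
      using ht laurent_t_eq ring_hom_zero[OF g SY.Sy.ring_axioms T.ring_axioms] by simp
  qed
  have gh: "g (h x) = tI +>\<^bsub>CA\<^esub> x" if "x \<in> carrier CA" for x
    by (rule egen_eqI[OF CA_egen CA_alg dC_ehom T.ring_axioms ring_hom_comp[OF hr g] p gstr _ _ that])
      (simp_all add: h1 h2 g1 g2)
  have ker: "a_kernel CA Sym h = tI"
  proof
    show "a_kernel CA Sym h \<subseteq> tI"
    proof
      fix x assume "x \<in> a_kernel CA Sym h"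
      then have x: "x \<in> carrier CA" "h x = \<zero>\<^bsub>Sym\<^esub>" unfolding a_kernel_def' by auto
      then have "tI +>\<^bsub>CA\<^esub> x = tI"
        using gh[OF x(1)] ring_hom_zero[OF g SY.Sy.ring_axioms T.ring_axioms] by (simp add: zero_Quot)
      then show "x \<in> tI" using coset_zero_iff[OF tI x(1)] by simp
    qed
    show "tI \<subseteq> a_kernel CA Sym h"
      unfolding a_kernel_def'
      by (rule C.genideal_minimal[OF ideal_kernel[OF hr C.ring_axioms SY.Sy.ring_axioms]]) (use tc ht in auto)
  qed
  have surj: "h ` carrier CA = carrier Sym"
  proof
    show "h ` carrier CA \<subseteq> carrier Sym" using ring_hom_closed[OF hr] by blast
    show "carrier Sym \<subseteq> h ` carrier CA"
    proof (rule SY.Sy_generating_subring[OF ring_hom_image_subring[OF hr C.ring_axioms SY.Sy.ring_axioms]])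
      fix r assume "r \<in> carrier AI"
      then obtain a where "a \<in> carrier A" "r = qI a" unfolding carrier_Quot by blast
      then show "sym_str AI cM r \<in> h ` carrier CA"
        using h1[of a] dC_closed[of a] by (intro image_eqI[of _ _ "fst (dC a)"]) auto
    next
      fix x assume "x \<in> carrier cM"
      then obtain y where y: "y \<in> I" "x = q2 y" unfolding carrier_cM by blast
      \<comment> \<open>By \<open>q2_od\<close> every class in I/I^2 has an odd representative, so
        the linear generators of the symmetric algebra are values of \<open>h\<close>.\<close>
      then have "SY.si x = h (snd (dC y))" using h2[OF I_closed[OF y(1)]] q2_od[OF y(1)] by simp
      then show "SY.si x \<in> h ` carrier CA"
        using dC_closed[OF I_closed[OF y(1)]] by (intro image_eqI[of _ _ "snd (dC y)"]) auto
    qed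
  qed
  interpret H: ring_hom_ring CA Sym h
    using hr C.ring_axioms SY.Sy.ring_axioms by (simp add: ring_hom_ring.intro ring_hom_ring_axioms.intro)
  let ?i = "\<lambda>Z. the_elem (h ` Z)"
  have iso: "?i \<in> ring_iso (CA Quot tI) Sym" using H.FactRing_iso_set[OF surj] unfolding ker .
  have kill: "h x = \<zero>\<^bsub>Sym\<^esub>" if "x \<in> tI" for x using that unfolding ker[symmetric] a_kernel_def' by blast
  have "?i (tI +>\<^bsub>CA\<^esub> str (cn c)) = sy (\<phi> c)" if c: "c \<in> carrier k" for c
  proof -
    have "?i (tI +>\<^bsub>CA\<^esub> str (cn c)) = h (str (cn c))"
      by (rule quot_lift_eq[OF tI C.ring_axioms SY.Sy.ring_axioms hr kill ring_hom_closed[OF str_CA cn_closed[OF c]]])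
    then show ?thesis using alg_hom_str[OF h cn_closed[OF c]] symR(2)[OF c] by simp
  qed
  then have "?i \<in> alg_iso k (CA Quot tI) (\<lambda>c. tI +>\<^bsub>CA\<^esub> str (cn c)) Sym (\<lambda>c. sy (\<phi> c))"
    using iso by (auto simp: alg_iso_def alg_hom_def ring_iso_def)
  then show ?thesis by blast
qed

end

section \<open>Group structure on equivariant homomorphisms\<close>

context inv_alg
begin

text \<open>From here on the contraction is a ring in its own right, used through its universal
  property; its operations should not be rewritten into those of \<open>LA\<close>.\<close>

declare CA_simps [simp del]

sublocale TA: tensor_alg k A \<phi> A \<phi> by (rule tensor_alg.intro[OF alg alg])
sublocale TC: tensor_alg R CA str CA str by (rule tensor_alg.intro[OF CA_alg CA_alg])

abbreviation "wj1 \<equiv> \<lambda>a. map_prod TC.j1 TC.j1 (dC a)"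
abbreviation "wj2 \<equiv> \<lambda>a. map_prod TC.j2 TC.j2 (dC a)"

lemma dbl_alg:
  assumes "ring_hom_cring R C \<psi>"
  shows "cring (dbl C (\<psi> t))" "(\<lambda>c. (\<psi> (cn c), \<zero>\<^bsub>C\<^esub>)) \<in> ring_hom k (dbl C (\<psi> t))"
proof -
  note C = ring_hom_cringD[OF assms]
  have t: "\<psi> t \<in> carrier C" by (rule ring_hom_closed[OF C(3) t_closed])
  show "cring (dbl C (\<psi> t))" by (rule dbl_cring[OF C(2) t])
  show "(\<lambda>c. (\<psi> (cn c), \<zero>\<^bsub>C\<^esub>)) \<in> ring_hom k (dbl C (\<psi> t))"
    by (rule ring_hom_comp[OF ring_hom_comp[OF cn_hom C(3)] dbl_const_hom[OF C(2) t]])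
qed

text \<open>Two points of A define one homomorphism on the tensor square, the product of the two in
  the commutative ring \<open>dbl\<close>.\<close>

definition ehom_lift :: "('c, 'p) ring_scheme \<Rightarrow> ((nat \<Rightarrow> 'k) \<Rightarrow> 'c) \<Rightarrow> ('a \<Rightarrow> 'c \<times> 'c) \<Rightarrow> ('a \<Rightarrow> 'c \<times> 'c) \<Rightarrow>
    ('a \<times> 'a \<Rightarrow> 'k) set \<Rightarrow> 'c \<times> 'c"
  where "ehom_lift C \<psi> = tensor_lift k (dbl C (\<psi> t)) (\<lambda>c. (\<psi> (cn c), \<zero>\<^bsub>C\<^esub>))"

lemma
  assumes C: "ring_hom_cring R C \<psi>" and w: "w1 \<in> ehom C \<psi>" "w2 \<in> ehom C \<psi>"
  shows ehom_lift_alg: "ehom_lift C \<psi> w1 w2 \<in> alg_hom k TA.T TA.\<tau> (dbl C (\<psi> t)) (\<lambda>c. (\<psi> (cn c), \<zero>\<^bsub>C\<^esub>))"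
    and ehom_lift_hom: "ehom_lift C \<psi> w1 w2 \<in> ring_hom TA.T (dbl C (\<psi> t))"
    and ehom_lift_j1: "\<And>a. a \<in> carrier A \<Longrightarrow> ehom_lift C \<psi> w1 w2 (TA.j1 a) = w1 a"
    and ehom_lift_j2: "\<And>a. a \<in> carrier A \<Longrightarrow> ehom_lift C \<psi> w1 w2 (TA.j2 a) = w2 a"
  unfolding ehom_lift_def
  using TA.tensor_lift_alg[OF dbl_alg[OF C] ehom_alg[OF w(1)] ehom_alg[OF w(2)]]
    TA.tensor_lift_hom[OF dbl_alg[OF C] ehom_alg[OF w(1)] ehom_alg[OF w(2)]]
    TA.tensor_lift_j1[OF dbl_alg[OF C] ehom_alg[OF w(1)] ehom_alg[OF w(2)]]
    TA.tensor_lift_j2[OF dbl_alg[OF C] ehom_alg[OF w(1)] ehom_alg[OF w(2)]]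
  by blast+

lemma dbl_alg_map_hom:
  assumes C: "ring_hom_cring R C \<psi>" and D: "ring_hom_cring R D \<chi>" and h: "h \<in> alg_hom R C \<psi> D \<chi>"
  shows "map_prod h h \<in> ring_hom (dbl C (\<psi> t)) (dbl D (\<chi> t))"
  by (rule dbl_map_hom[OF alg_hom_ring_hom[OF h] alg_hom_str[OF h t_closed] ring_hom_cringD(5)[OF C]
      ring_hom_cringD(5)[OF D] ring_hom_closed[OF ring_hom_cringD(3)[OF C] t_closed]])

lemma ehom_lift_comp:
  assumes C: "ring_hom_cring R C \<psi>" and D: "ring_hom_cring R D \<chi>" and w: "w1 \<in> ehom C \<psi>" "w2 \<in> ehom C \<psi>"
    and h: "h \<in> alg_hom R C \<psi> D \<chi>" and z: "z \<in> carrier TA.T"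
  shows "map_prod h h (ehom_lift C \<psi> w1 w2 z) =
    ehom_lift D \<chi> (\<lambda>a. map_prod h h (w1 a)) (\<lambda>a. map_prod h h (w2 a)) z"
proof -
  note w' = ehom_comp[OF C D w(1) h] ehom_comp[OF C D w(2) h]
  show ?thesis
    by (rule TA.T_hom_eqI[OF ring_hom_comp[OF ehom_lift_hom[OF C w] dbl_alg_map_hom[OF C D h]]
          ehom_lift_hom[OF D w'] cring.axioms(1)[OF dbl_alg(1)[where \<psi> = \<chi>, OF D]] _ _ z])
      (simp_all only: ehom_lift_j1[OF C w] ehom_lift_j2[OF C w] ehom_lift_j1[OF D w'] ehom_lift_j2[OF D w'])
qed

lemma ehom_pullback:
  assumes w: "w \<in> ehom C \<psi>" and f: "f \<in> alg_hom k A \<phi> A \<phi>"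
    and th: "\<And>a. a \<in> carrier A \<Longrightarrow> f (\<theta> a) = \<theta> (f a)"
  shows "(\<lambda>a. w (f a)) \<in> ehom C \<psi>"
  using alg_hom_comp[OF f ehom_alg[OF w]] ehom_theta[OF w] alg_hom_closed[OF f] th by (simp add: ehom_def)

text \<open>When both points are pulled back from one point \<open>w\<close>, the pair factors
  through a homomorphism from the tensor square to A. Identities between convolutions of such points
  become Hopf identities of A, pushed forward along \<open>w\<close>.\<close>

lemma ehom_lift_pullback:
  assumes C: "ring_hom_cring R C \<psi>" and w: "w \<in> ehom C \<psi>" and f: "f \<in> alg_hom k A \<phi> A \<phi>" and g: "g \<in> alg_hom k A \<phi> A \<phi>"
    and w': "w1 \<in> ehom C \<psi>" "w2 \<in> ehom C \<psi>"
    and eq: "\<And>a. a \<in> carrier A \<Longrightarrow> w1 a = w (f a)" "\<And>a. a \<in> carrier A \<Longrightarrow> w2 a = w (g a)"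
    and z: "z \<in> carrier TA.T"
  shows "ehom_lift C \<psi> w1 w2 z = w (tensor_lift k A \<phi> f g z)"
  by (rule TA.T_hom_eqI[OF ehom_lift_hom[OF C w'] ring_hom_comp[OF TA.tensor_lift_hom[OF A.is_cring algD(3) f g] ehom_hom[OF w]]
        cring.axioms(1)[OF dbl_alg(1)[OF C]] _ _ z])
    (simp_all only: ehom_lift_j1[OF C w'] ehom_lift_j2[OF C w'] eq TA.tensor_lift_j1[OF A.is_cring algD(3) f g]
      TA.tensor_lift_j2[OF A.is_cring algD(3) f g])

end

locale hopf_inv = smooth_inv k A \<phi> \<theta> n F \<pi> \<sigma>
  for k :: "('k, 'm) ring_scheme" and A :: "('a, 'n) ring_scheme" and \<phi> \<theta> n F \<pi> \<sigma> +
  fixes \<Delta> \<epsilon> S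
  assumes hopf: "hopf_algebra k A \<phi> \<Delta> \<epsilon> S" and hopf_inv: "hopf_involution k A \<phi> \<Delta> \<epsilon> S \<theta>"
begin

lemma Delta_alg: "\<Delta> \<in> alg_hom k A \<phi> TA.T TA.\<tau>" and eps_alg: "\<epsilon> \<in> alg_hom k A \<phi> k id" and S_alg: "S \<in> alg_hom k A \<phi> A \<phi>"
  using hopf by (auto simp: hopf_algebra_def Let_def)

lemma coassoc: "b \<in> carrier A \<Longrightarrow> tensor_assoc k A \<phi> (tensor_map k TA.T TA.\<tau> A \<phi> \<Delta> id (\<Delta> b)) =
    tensor_map k A \<phi> TA.T TA.\<tau> id \<Delta> (\<Delta> b)"
  and counit: "b \<in> carrier A \<Longrightarrow> tensor_lift k A \<phi> (\<phi> \<circ> \<epsilon>) id (\<Delta> b) = b"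
    "b \<in> carrier A \<Longrightarrow> tensor_lift k A \<phi> id (\<phi> \<circ> \<epsilon>) (\<Delta> b) = b"
  and antipode: "b \<in> carrier A \<Longrightarrow> tensor_lift k A \<phi> S id (\<Delta> b) = \<phi> (\<epsilon> b)"
    "b \<in> carrier A \<Longrightarrow> tensor_lift k A \<phi> id S (\<Delta> b) = \<phi> (\<epsilon> b)"
  using hopf by (auto simp: hopf_algebra_def Let_def)

lemma Delta_theta: "b \<in> carrier A \<Longrightarrow> \<Delta> (\<theta> b) = tensor_map k A \<phi> A \<phi> \<theta> \<theta> (\<Delta> b)"
  and eps_theta: "b \<in> carrier A \<Longrightarrow> \<epsilon> (\<theta> b) = \<epsilon> b" and S_theta: "b \<in> carrier A \<Longrightarrow> S (\<theta> b) = \<theta> (S b)"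
  using hopf_inv by (auto simp: hopf_involution_def)

lemmas Delta_closed = alg_hom_closed[OF Delta_alg] and eps_closed = alg_hom_closed[OF eps_alg]
  and S_closed = alg_hom_closed[OF S_alg]

lemma unit_counit_alg: "\<phi> \<circ> \<epsilon> \<in> alg_hom k A \<phi> A \<phi>"
  unfolding comp_def
  by (rule alg_homI[OF ring_hom_comp[OF alg_hom_ring_hom[OF eps_alg] algD(3)]]) (simp add: alg_hom_str[OF eps_alg])

text \<open>Yoneda: the contraction is a Hopf algebra because its points \<open>ehom C \<psi>\<close> form a group under \<open>conv\<close>.\<close>

definition conv :: "('c, 'p) ring_scheme \<Rightarrow> ((nat \<Rightarrow> 'k) \<Rightarrow> 'c) \<Rightarrow> ('a \<Rightarrow> 'c \<times> 'c) \<Rightarrow> ('a \<Rightarrow> 'c \<times> 'c) \<Rightarrow> 'a \<Rightarrow> 'c \<times> 'c"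
  where "conv C \<psi> w1 w2 a = ehom_lift C \<psi> w1 w2 (\<Delta> a)"

text \<open>Equivariance of the product comes from the compatibility of \<open>\<Delta>\<close> with
  \<open>\<theta>\<close>: precomposing the pair with \<open>\<theta>\<close> on both factors
  conjugates its value.\<close>

lemma conv_ehom:
  assumes C: "ring_hom_cring R C \<psi>" and w: "w1 \<in> ehom C \<psi>" "w2 \<in> ehom C \<psi>"
  shows "conv C \<psi> w1 w2 \<in> ehom C \<psi>"
proof -
  note C' = ring_hom_cringD[OF C]
  have tC: "\<psi> t \<in> carrier C" by (rule ring_hom_closed[OF C'(3) t_closed])
  let ?E = "dbl C (\<psi> t)" and ?c = "\<lambda>x. (fst x, \<ominus>\<^bsub>C\<^esub> snd x)"
  note LA = ehom_lift_alg[OF C w] and Lh = ehom_lift_hom[OF C w]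
  have 1: "conv C \<psi> w1 w2 \<in> alg_hom k A \<phi> ?E (\<lambda>c. (\<psi> (cn c), \<zero>\<^bsub>C\<^esub>))"
    unfolding conv_def by (rule alg_hom_comp[OF Delta_alg LA])
  note th1 = alg_hom_comp[OF theta_alg TA.j1_alg] and th2 = alg_hom_comp[OF theta_alg TA.j2_alg]
  note tl = TA.T_cring TA.str_hom th1 th2
  have 2: "ehom_lift C \<psi> w1 w2 (tensor_map k A \<phi> A \<phi> \<theta> \<theta> z) = ?c (ehom_lift C \<psi> w1 w2 z)" if z: "z \<in> carrier TA.T" for z
    unfolding tensor_map_def
    by (rule TA.T_hom_eqI[OF ring_hom_comp[OF TA.tensor_lift_hom[OF tl] Lh]
          ring_hom_comp[OF Lh dbl_conj_hom[OF C'(2) tC]] cring.axioms(1)[OF dbl_alg(1)[OF C]] _ _ z])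
      (simp_all only: TA.tensor_lift_j1[OF tl] TA.tensor_lift_j2[OF tl] ehom_lift_j1[OF C w] ehom_lift_j2[OF C w]
        theta_closed ehom_theta[OF w(1)] ehom_theta[OF w(2)])
  show ?thesis
    unfolding ehom_def using 1 by (simp add: conv_def Delta_theta 2 Delta_closed)
qed

lemma conv_comp:
  assumes C: "ring_hom_cring R C \<psi>" and D: "ring_hom_cring R D \<chi>" and w: "w1 \<in> ehom C \<psi>" "w2 \<in> ehom C \<psi>"
    and h: "h \<in> alg_hom R C \<psi> D \<chi>" and a: "a \<in> carrier A"
  shows "map_prod h h (conv C \<psi> w1 w2 a) = conv D \<chi> (\<lambda>a. map_prod h h (w1 a)) (\<lambda>a. map_prod h h (w2 a)) a"
  unfolding conv_def by (rule ehom_lift_comp[OF C D w h Delta_closed[OF a]])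

lemma conv_counit:
  assumes C: "ring_hom_cring R C \<psi>" and w: "w \<in> ehom C \<psi>" and a: "a \<in> carrier A"
  shows "conv C \<psi> (\<lambda>a. w (\<phi> (\<epsilon> a))) w a = w a" "conv C \<psi> w (\<lambda>a. w (\<phi> (\<epsilon> a))) a = w a"
    and unit_ehom: "(\<lambda>a. w (\<phi> (\<epsilon> a))) \<in> ehom C \<psi>"
proof -
  have "\<phi> (\<epsilon> (\<theta> a)) = \<theta> (\<phi> (\<epsilon> a))" if "a \<in> carrier A" for a using that eps_theta eps_closed by simp
  then show u: "(\<lambda>a. w (\<phi> (\<epsilon> a))) \<in> ehom C \<psi>"
    using ehom_pullback[OF w unit_counit_alg] by simp
  show "conv C \<psi> (\<lambda>a. w (\<phi> (\<epsilon> a))) w a = w a"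
    unfolding conv_def by (subst ehom_lift_pullback[OF C w unit_counit_alg alg_hom_id u w _ _ Delta_closed[OF a]])
      (simp_all add: counit a)
  show "conv C \<psi> w (\<lambda>a. w (\<phi> (\<epsilon> a))) a = w a"
    unfolding conv_def by (subst ehom_lift_pullback[OF C w alg_hom_id unit_counit_alg w u _ _ Delta_closed[OF a]])
      (simp_all add: counit a)
qed

lemma conv_antipode:
  assumes C: "ring_hom_cring R C \<psi>" and w: "w \<in> ehom C \<psi>" and a: "a \<in> carrier A"
  shows "conv C \<psi> (\<lambda>a. w (S a)) w a = w (\<phi> (\<epsilon> a))" "conv C \<psi> w (\<lambda>a. w (S a)) a = w (\<phi> (\<epsilon> a))"
    and antipode_ehom: "(\<lambda>a. w (S a)) \<in> ehom C \<psi>"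
proof -
  show u: "(\<lambda>a. w (S a)) \<in> ehom C \<psi>" by (rule ehom_pullback[OF w S_alg S_theta])
  show "conv C \<psi> (\<lambda>a. w (S a)) w a = w (\<phi> (\<epsilon> a))"
    unfolding conv_def by (subst ehom_lift_pullback[OF C w S_alg alg_hom_id u w _ _ Delta_closed[OF a]])
      (simp_all add: antipode a)
  show "conv C \<psi> w (\<lambda>a. w (S a)) a = w (\<phi> (\<epsilon> a))"
    unfolding conv_def by (subst ehom_lift_pullback[OF C w alg_hom_id S_alg w u _ _ Delta_closed[OF a]])
      (simp_all add: antipode a)
qed

sublocale T3: tensor_alg k A \<phi> TA.T TA.\<tau> by (rule tensor_alg.intro[OF alg TA.T_alg])
sublocale T3': tensor_alg k TA.T TA.\<tau> A \<phi> by (rule tensor_alg.intro[OF TA.T_alg alg])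

text \<open>Both sides are values of the homomorphism \<open>M\<close> that three points define on
  the threefold tensor product. \<open>R\<close> and \<open>L\<close> express the bracketings as
  \<open>M\<close> after id \<otimes> \<Delta> and after \<Delta> \<otimes> id followed by the
  associator; coassociativity of A identifies them.\<close>

lemma conv_assoc:
  assumes C: "ring_hom_cring R C \<psi>" and w: "w1 \<in> ehom C \<psi>" "w2 \<in> ehom C \<psi>" "w3 \<in> ehom C \<psi>" and a: "a \<in> carrier A"
  shows "conv C \<psi> (conv C \<psi> w1 w2) w3 a = conv C \<psi> w1 (conv C \<psi> w2 w3) a"
proof -
  let ?E = "dbl C (\<psi> t)" and ?\<gamma> = "\<lambda>c. (\<psi> (cn c), \<zero>\<^bsub>C\<^esub>)"
  note E = dbl_alg[OF C] and Er = cring.axioms(1)[OF dbl_alg(1)[OF C]]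
  note L12 = ehom_lift_alg[OF C w(1,2)] and L23 = ehom_lift_alg[OF C w(2,3)]
  note mm = E ehom_alg[OF w(1)] L23
  define M where "M = tensor_lift k ?E ?\<gamma> w1 (ehom_lift C \<psi> w2 w3)"
  have M: "M \<in> ring_hom T3.T ?E" unfolding M_def by (rule T3.tensor_lift_hom[OF mm])
  have M1: "M (T3.j1 b) = w1 b" if "b \<in> carrier A" for b unfolding M_def using that by (rule T3.tensor_lift_j1[OF mm])
  have M2: "M (T3.j2 z) = ehom_lift C \<psi> w2 w3 z" if "z \<in> carrier TA.T" for z unfolding M_def using that by (rule T3.tensor_lift_j2[OF mm])
  note c12 = conv_ehom[OF C w(1,2)] and c23 = conv_ehom[OF C w(2,3)]
  note tr = T3.T_cring T3.str_hom T3.j1_alg alg_hom_comp[OF Delta_alg T3.j2_alg]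
  have R: "M (tensor_map k A \<phi> TA.T TA.\<tau> id \<Delta> z) = ehom_lift C \<psi> w1 (conv C \<psi> w2 w3) z" if z: "z \<in> carrier TA.T" for z
    unfolding tensor_map_def id_apply
    by (rule TA.T_hom_eqI[OF ring_hom_comp[OF TA.tensor_lift_hom[OF tr] M] ehom_lift_hom[OF C w(1) c23] Er _ _ z])
      (simp_all add: TA.tensor_lift_j1[OF tr] TA.tensor_lift_j2[OF tr] ehom_lift_j1[OF C w(1) c23] ehom_lift_j2[OF C w(1) c23]
        M1 M2 Delta_closed conv_def)
  note i1 = T3.T_cring T3.str_hom T3.j1_alg alg_hom_comp[OF TA.j1_alg T3.j2_alg]
  note as = T3.T_cring T3.str_hom TA.tensor_lift_alg[OF i1] alg_hom_comp[OF TA.j2_alg T3.j2_alg]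
  have ash: "tensor_assoc k A \<phi> \<in> ring_hom T3'.T T3.T"
    unfolding tensor_assoc_def Let_def by (rule T3'.tensor_lift_hom[OF as])
  have as1: "tensor_assoc k A \<phi> (T3'.j1 z) = tensor_lift k T3.T T3.\<tau> T3.j1 (\<lambda>b. T3.j2 (TA.j1 b)) z" if "z \<in> carrier TA.T" for z
    unfolding tensor_assoc_def Let_def using that by (rule T3'.tensor_lift_j1[OF as])
  have as2: "tensor_assoc k A \<phi> (T3'.j2 b) = T3.j2 (TA.j2 b)" if "b \<in> carrier A" for b
    unfolding tensor_assoc_def Let_def using that by (rule T3'.tensor_lift_j2[OF as])
  have Mas: "M (tensor_lift k T3.T T3.\<tau> T3.j1 (\<lambda>b. T3.j2 (TA.j1 b)) z) = ehom_lift C \<psi> w1 w2 z" if z: "z \<in> carrier TA.T" for z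
    by (rule TA.T_hom_eqI[OF ring_hom_comp[OF TA.tensor_lift_hom[OF i1] M] ehom_lift_hom[OF C w(1,2)] Er _ _ z])
      (simp_all add: TA.tensor_lift_j1[OF i1] TA.tensor_lift_j2[OF i1] ehom_lift_j1[OF C w(1,2)] ehom_lift_j2[OF C w(1,2)]
        ehom_lift_j1[OF C w(2,3)] M1 M2 ring_hom_closed[OF TA.j1_hom])
  note tl = T3'.T_cring T3'.str_hom alg_hom_comp[OF Delta_alg T3'.j1_alg] T3'.j2_alg
  have L: "M (tensor_assoc k A \<phi> (tensor_map k TA.T TA.\<tau> A \<phi> \<Delta> id z)) = ehom_lift C \<psi> (conv C \<psi> w1 w2) w3 z"
    if z: "z \<in> carrier TA.T" for z
    unfolding tensor_map_def id_apply
    by (rule TA.T_hom_eqI[OF ring_hom_comp[OF ring_hom_comp[OF TA.tensor_lift_hom[OF tl] ash] M] ehom_lift_hom[OF C c12 w(3)] Er _ _ z])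
      (simp_all add: TA.tensor_lift_j1[OF tl] TA.tensor_lift_j2[OF tl] ehom_lift_j1[OF C c12 w(3)] ehom_lift_j2[OF C c12 w(3)]
        as1 as2 Mas M2 Delta_closed conv_def ehom_lift_j2[OF C w(2,3)] ring_hom_closed[OF TA.j2_hom])
  have "conv C \<psi> (conv C \<psi> w1 w2) w3 a = M (tensor_assoc k A \<phi> (tensor_map k TA.T TA.\<tau> A \<phi> \<Delta> id (\<Delta> a)))"
    using L[OF Delta_closed[OF a]] by (simp add: conv_def[of _ _ "conv C \<psi> w1 w2"])
  also have "\<dots> = conv C \<psi> w1 (conv C \<psi> w2 w3) a"
    unfolding coassoc[OF a] using R[OF Delta_closed[OF a]] by (simp add: conv_def[of _ _ w1 "conv C \<psi> w2 w3"])
  finally show ?thesis .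
qed

end

section \<open>The Hopf algebra structure of the contraction\<close>

lemma map_prod_comp: "map_prod f f (map_prod g g x) = map_prod (\<lambda>y. f (g y)) (\<lambda>y. f (g y)) x"
  by (cases x) simp

lemma map_prod_id_id: "map_prod id id x = x"
  by (cases x) simp

context hopf_inv
begin

text \<open>Points are functions on a whole type and may differ outside \<open>carrier A\<close>, so
  equal points are exchanged by this lemma and not by rewriting.\<close>

lemma conv_cong:
  assumes C: "ring_hom_cring R C \<psi>" and w: "w1 \<in> ehom C \<psi>" "w2 \<in> ehom C \<psi>" and v: "v1 \<in> ehom C \<psi>" "v2 \<in> ehom C \<psi>"
    and eq: "\<And>a. a \<in> carrier A \<Longrightarrow> w1 a = v1 a" "\<And>a. a \<in> carrier A \<Longrightarrow> w2 a = v2 a" and a: "a \<in> carrier A"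
  shows "conv C \<psi> w1 w2 a = conv C \<psi> v1 v2 a"
  unfolding conv_def
  by (rule TA.T_hom_eqI[OF ehom_lift_hom[OF C w] ehom_lift_hom[OF C v] cring.axioms(1)[OF dbl_alg(1)[OF C]] _ _ Delta_closed[OF a]])
    (simp_all only: ehom_lift_j1[OF C w] ehom_lift_j2[OF C w] ehom_lift_j1[OF C v] ehom_lift_j2[OF C v] eq)

lemma R_alg: "ring_hom_cring R R id"
  by (rule ring_hom_cringI[OF R_cring R_cring id_ring_hom])

lemma counit_ehom: "(\<lambda>a. (cn (\<epsilon> a), \<zero>\<^bsub>R\<^esub>)) \<in> ehom R id"
proof -
  have "(\<lambda>a. (cn (\<epsilon> a), \<zero>\<^bsub>R\<^esub>)) \<in> ring_hom A (dbl R (id t))"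
    using ring_hom_comp[OF alg_hom_ring_hom[OF eps_alg] dbl_alg(2)[OF R_alg]] by simp
  then show ?thesis
    unfolding ehom_def by (auto intro!: alg_homI simp: alg_hom_str[OF eps_alg] eps_theta)
qed

lemma incl_ehom:
  assumes "ring_hom_cring R D \<chi>" "h \<in> alg_hom R CA str D \<chi>"
  shows "(\<lambda>a. map_prod h h (dC a)) \<in> ehom D \<chi>"
  by (rule ehom_comp[OF CA_alg assms(1) dC_ehom assms(2)])

lemmas wj_ehom = incl_ehom[OF TC.T_alg TC.j1_alg] incl_ehom[OF TC.T_alg TC.j2_alg]

sublocale TC3: tensor_alg R CA str TC.T TC.\<tau> by (rule tensor_alg.intro[OF CA_alg TC.T_alg])
sublocale TC3': tensor_alg R TC.T TC.\<tau> CA str by (rule tensor_alg.intro[OF TC.T_alg CA_alg])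

context
  fixes \<Delta>' \<epsilon>' S'
  assumes D': "\<Delta>' \<in> alg_hom R CA str TC.T TC.\<tau>" and D'_dC: "\<And>a. a \<in> carrier A \<Longrightarrow> map_prod \<Delta>' \<Delta>' (dC a) = conv TC.T TC.\<tau> wj1 wj2 a"
    and e': "\<epsilon>' \<in> alg_hom R CA str R id" and e'_dC: "\<And>a. a \<in> carrier A \<Longrightarrow> map_prod \<epsilon>' \<epsilon>' (dC a) = (cn (\<epsilon> a), \<zero>\<^bsub>R\<^esub>)"
    and S': "S' \<in> alg_hom R CA str CA str" and S'_dC: "\<And>a. a \<in> carrier A \<Longrightarrow> map_prod S' S' (dC a) = dC (S a)"
begin

text \<open>Under the correspondence of homomorphisms and points, composition with
  \<open>\<Delta>'\<close> is convolution. The premises \<open>eq\<close> are pointwise, so the two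
  points may be given in whatever form a particular axiom produces.\<close>

lemma comult_dC:
  assumes D: "ring_hom_cring R D \<chi>" and G: "G \<in> alg_hom R TC.T TC.\<tau> D \<chi>" and w: "w1 \<in> ehom D \<chi>" "w2 \<in> ehom D \<chi>"
    and eq: "\<And>a. a \<in> carrier A \<Longrightarrow> map_prod (\<lambda>x. G (TC.j1 x)) (\<lambda>x. G (TC.j1 x)) (dC a) = w1 a"
      "\<And>a. a \<in> carrier A \<Longrightarrow> map_prod (\<lambda>x. G (TC.j2 x)) (\<lambda>x. G (TC.j2 x)) (dC a) = w2 a"
    and a: "a \<in> carrier A"
  shows "map_prod (\<lambda>x. G (\<Delta>' x)) (\<lambda>x. G (\<Delta>' x)) (dC a) = conv D \<chi> w1 w2 a"
proof -
  have "map_prod (\<lambda>x. G (\<Delta>' x)) (\<lambda>x. G (\<Delta>' x)) (dC a) = map_prod G G (conv TC.T TC.\<tau> wj1 wj2 a)"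
    using D'_dC[OF a] by (simp add: map_prod_comp[symmetric])
  also have "\<dots> = conv D \<chi> (\<lambda>a. map_prod G G (wj1 a)) (\<lambda>a. map_prod G G (wj2 a)) a"
    by (rule conv_comp[OF TC.T_alg D wj_ehom G a])
  also have "\<dots> = conv D \<chi> w1 w2 a"
    by (rule conv_cong[OF D ehom_comp[OF TC.T_alg D wj_ehom(1) G] ehom_comp[OF TC.T_alg D wj_ehom(2) G] w _ _ a])
      (simp_all add: map_prod_comp eq)
  finally show ?thesis .
qed

lemma CA_eqI:
  assumes "ring_hom_cring R D \<chi>" "f \<in> alg_hom R CA str D \<chi>" "g \<in> alg_hom R CA str D \<chi>"
    "\<And>a. a \<in> carrier A \<Longrightarrow> map_prod f f (dC a) = map_prod g g (dC a)" "b \<in> carrier CA"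
  shows "f b = g b"
  by (rule egen_hom_eqI[OF CA_egen CA_alg dC_ehom ring_hom_cringD(5)[OF assms(1)] assms(2-5)])

text \<open>The counit and antipode axioms all have this shape. The uniqueness half of
  representability reduces them to an identity of convolutions at the tautological point.\<close>

lemma lift_comult_eq:
  assumes f: "f \<in> alg_hom R CA str CA str" and g: "g \<in> alg_hom R CA str CA str" and u: "u \<in> alg_hom R CA str CA str"
    and eq: "\<And>a. a \<in> carrier A \<Longrightarrow> conv CA str (\<lambda>a. map_prod f f (dC a)) (\<lambda>a. map_prod g g (dC a)) a = map_prod u u (dC a)"
    and b: "b \<in> carrier CA"
  shows "tensor_lift R CA str f g (\<Delta>' b) = u b"
proof -
  note lf = CA_cring str_CA f g
  note G = TC.tensor_lift_alg[OF lf]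
  have cl: "fst (dC a) \<in> carrier CA" "snd (dC a) \<in> carrier CA" if "a \<in> carrier A" for a using dC_closed[OF that] by auto
  show ?thesis
  proof (rule CA_eqI[OF CA_alg alg_hom_comp[OF D' G] u _ b])
    fix a assume a: "a \<in> carrier A"
    show "map_prod (\<lambda>x. tensor_lift R CA str f g (\<Delta>' x)) (\<lambda>x. tensor_lift R CA str f g (\<Delta>' x)) (dC a) = map_prod u u (dC a)"
      unfolding eq[OF a, symmetric]
      by (rule comult_dC[OF CA_alg G incl_ehom[OF CA_alg f] incl_ehom[OF CA_alg g] _ _ a])
        (simp_all add: map_prod_def split_beta cl TC.tensor_lift_j1[OF lf] TC.tensor_lift_j2[OF lf])
  qed
qed

lemma unit_alg: "(\<lambda>x. str (\<epsilon>' x)) \<in> alg_hom R CA str CA str"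
  by (rule alg_homI[OF ring_hom_comp[OF alg_hom_ring_hom[OF e'] str_CA]]) (simp add: alg_hom_str[OF e'])

lemma unit_dC: "a \<in> carrier A \<Longrightarrow> map_prod (\<lambda>x. str (\<epsilon>' x)) (\<lambda>x. str (\<epsilon>' x)) (dC a) = dC (\<phi> (\<epsilon> a))"
  using e'_dC[of a] ehom_phi[OF dC_ehom eps_closed[of a]] ring_hom_zero[OF str_CA R.ring_axioms ring_hom_cringD(5)[OF CA_alg]]
  by (simp add: map_prod_comp[symmetric, of str \<epsilon>'])

lemma CA_counit:
  assumes b: "b \<in> carrier CA"
  shows "tensor_lift R CA str (str \<circ> \<epsilon>') id (\<Delta>' b) = b" "tensor_lift R CA str id (str \<circ> \<epsilon>') (\<Delta>' b) = b"
proof -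
  note u = unit_ehom[OF CA_alg dC_ehom] and c = conv_counit[OF CA_alg dC_ehom]
  note i = incl_ehom[OF CA_alg unit_alg] incl_ehom[OF CA_alg alg_hom_id]
  have "tensor_lift R CA str (\<lambda>x. str (\<epsilon>' x)) id (\<Delta>' b) = id b"
    by (rule lift_comult_eq[OF unit_alg alg_hom_id alg_hom_id _ b])
      (subst conv_cong[OF CA_alg i u dC_ehom], simp_all add: unit_dC c map_prod_id_id)
  moreover have "tensor_lift R CA str id (\<lambda>x. str (\<epsilon>' x)) (\<Delta>' b) = id b"
    by (rule lift_comult_eq[OF alg_hom_id unit_alg alg_hom_id _ b])
      (subst conv_cong[OF CA_alg i(2,1) dC_ehom u], simp_all add: unit_dC c map_prod_id_id)
  ultimately show "tensor_lift R CA str (str \<circ> \<epsilon>') id (\<Delta>' b) = b" "tensor_lift R CA str id (str \<circ> \<epsilon>') (\<Delta>' b) = b"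
    by (simp_all add: comp_def)
qed

lemma CA_antipode:
  assumes b: "b \<in> carrier CA"
  shows "tensor_lift R CA str S' id (\<Delta>' b) = str (\<epsilon>' b)" "tensor_lift R CA str id S' (\<Delta>' b) = str (\<epsilon>' b)"
proof -
  note u = antipode_ehom[OF CA_alg dC_ehom] and c = conv_antipode[OF CA_alg dC_ehom]
  note i = incl_ehom[OF CA_alg S'] incl_ehom[OF CA_alg alg_hom_id]
  show "tensor_lift R CA str S' id (\<Delta>' b) = str (\<epsilon>' b)"
    by (rule lift_comult_eq[OF S' alg_hom_id unit_alg _ b])
      (subst conv_cong[OF CA_alg i u dC_ehom], simp_all add: unit_dC S'_dC c map_prod_id_id)
  show "tensor_lift R CA str id S' (\<Delta>' b) = str (\<epsilon>' b)"
    by (rule lift_comult_eq[OF alg_hom_id S' unit_alg _ b])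
      (subst conv_cong[OF CA_alg i(2,1) dC_ehom u], simp_all add: unit_dC S'_dC c map_prod_id_id)
qed

lemma CA_coassoc:
  assumes b: "b \<in> carrier CA"
  shows "tensor_assoc R CA str (tensor_map R TC.T TC.\<tau> CA str \<Delta>' id (\<Delta>' b)) = tensor_map R CA str TC.T TC.\<tau> id \<Delta>' (\<Delta>' b)"
proof -
  note T3 = TC3.T_alg
  have cl: "fst (dC a) \<in> carrier CA" "snd (dC a) \<in> carrier CA" if "a \<in> carrier A" for a using dC_closed[OF that] by auto
  note Dc = alg_hom_closed[OF D']
  \<comment> \<open>The three tautological points of the threefold tensor product. Each side of
    coassociativity becomes their product, with one bracketing or the other.\<close>
  define w1 where "w1 a = map_prod TC3.j1 TC3.j1 (dC a)" for a
  define w2 where "w2 a = map_prod (\<lambda>x. TC3.j2 (TC.j1 x)) (\<lambda>x. TC3.j2 (TC.j1 x)) (dC a)" for a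
  define w3 where "w3 a = map_prod (\<lambda>x. TC3.j2 (TC.j2 x)) (\<lambda>x. TC3.j2 (TC.j2 x)) (dC a)" for a
  have w: "w1 \<in> ehom TC3.T TC3.\<tau>" "w2 \<in> ehom TC3.T TC3.\<tau>" "w3 \<in> ehom TC3.T TC3.\<tau>"
    unfolding w1_def w2_def w3_def
    by (intro incl_ehom T3 TC3.j1_alg alg_hom_comp[OF TC.j1_alg TC3.j2_alg] alg_hom_comp[OF TC.j2_alg TC3.j2_alg])+
  note i1 = TC3.T_cring TC3.str_hom TC3.j1_alg alg_hom_comp[OF TC.j1_alg TC3.j2_alg]
  define H where "H = tensor_lift R TC3.T TC3.\<tau> TC3.j1 (\<lambda>b. TC3.j2 (TC.j1 b))"
  have H: "H \<in> alg_hom R TC.T TC.\<tau> TC3.T TC3.\<tau>" unfolding H_def by (rule TC.tensor_lift_alg[OF i1])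
  note as = TC3.T_cring TC3.str_hom H[unfolded H_def] alg_hom_comp[OF TC.j2_alg TC3.j2_alg]
  have ash: "tensor_assoc R CA str \<in> alg_hom R TC3'.T TC3'.\<tau> TC3.T TC3.\<tau>"
    unfolding tensor_assoc_def Let_def by (rule TC3'.tensor_lift_alg[OF as])
  have as1: "tensor_assoc R CA str (TC3'.j1 z) = H z" if "z \<in> carrier TC.T" for z
    unfolding tensor_assoc_def Let_def H_def using that by (rule TC3'.tensor_lift_j1[OF as])
  have as2: "tensor_assoc R CA str (TC3'.j2 b) = TC3.j2 (TC.j2 b)" if "b \<in> carrier CA" for b
    unfolding tensor_assoc_def Let_def using that by (rule TC3'.tensor_lift_j2[OF as])
  note tl = TC3'.T_cring TC3'.str_hom alg_hom_comp[OF D' TC3'.j1_alg] TC3'.j2_alg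
  note tr = TC3.T_cring TC3.str_hom TC3.j1_alg alg_hom_comp[OF D' TC3.j2_alg]
  define l where "l = tensor_map R TC.T TC.\<tau> CA str \<Delta>' id"
  define r where "r = tensor_map R CA str TC.T TC.\<tau> id \<Delta>'"
  have l: "l \<in> alg_hom R TC.T TC.\<tau> TC3'.T TC3'.\<tau>" "\<And>x. x \<in> carrier CA \<Longrightarrow> l (TC.j1 x) = TC3'.j1 (\<Delta>' x)"
    "\<And>x. x \<in> carrier CA \<Longrightarrow> l (TC.j2 x) = TC3'.j2 x"
    unfolding l_def tensor_map_def id_apply
    by (rule TC.tensor_lift_alg[OF tl], rule TC.tensor_lift_j1[OF tl], assumption, rule TC.tensor_lift_j2[OF tl], assumption)
  have r: "r \<in> alg_hom R TC.T TC.\<tau> TC3.T TC3.\<tau>" "\<And>x. x \<in> carrier CA \<Longrightarrow> r (TC.j1 x) = TC3.j1 x"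
    "\<And>x. x \<in> carrier CA \<Longrightarrow> r (TC.j2 x) = TC3.j2 (\<Delta>' x)"
    unfolding r_def tensor_map_def id_apply
    by (rule TC.tensor_lift_alg[OF tr], rule TC.tensor_lift_j1[OF tr], assumption, rule TC.tensor_lift_j2[OF tr], assumption)
  note al = alg_hom_comp[OF l(1) ash]
  have 1: "map_prod (\<lambda>x. H (\<Delta>' x)) (\<lambda>x. H (\<Delta>' x)) (dC a) = conv TC3.T TC3.\<tau> w1 w2 a" if "a \<in> carrier A" for a
    by (rule comult_dC[OF T3 H w(1,2) _ _ that])
      (simp_all add: w1_def w2_def map_prod_def split_beta cl H_def TC.tensor_lift_j1[OF i1] TC.tensor_lift_j2[OF i1])
  have 2: "map_prod (\<lambda>x. TC3.j2 (\<Delta>' x)) (\<lambda>x. TC3.j2 (\<Delta>' x)) (dC a) = conv TC3.T TC3.\<tau> w2 w3 a" if "a \<in> carrier A" for a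
    by (rule comult_dC[OF T3 TC3.j2_alg w(2,3) _ _ that]) (simp_all add: w2_def w3_def)
  have L: "map_prod (\<lambda>x. tensor_assoc R CA str (l (\<Delta>' x))) (\<lambda>x. tensor_assoc R CA str (l (\<Delta>' x))) (dC a) =
      conv TC3.T TC3.\<tau> (conv TC3.T TC3.\<tau> w1 w2) w3 a" if "a \<in> carrier A" for a
    by (rule comult_dC[OF T3 al conv_ehom[OF T3 w(1,2)] w(3) _ _ that], unfold 1[symmetric] w3_def)
      (simp_all add: map_prod_def split_beta cl l as1 as2 Dc)
  have R: "map_prod (\<lambda>x. r (\<Delta>' x)) (\<lambda>x. r (\<Delta>' x)) (dC a) =
      conv TC3.T TC3.\<tau> w1 (conv TC3.T TC3.\<tau> w2 w3) a" if "a \<in> carrier A" for a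
    by (rule comult_dC[OF T3 r(1) w(1) conv_ehom[OF T3 w(2,3)] _ _ that], unfold 2[symmetric] w1_def)
      (simp_all add: map_prod_def split_beta cl r)
  have "tensor_assoc R CA str (l (\<Delta>' b)) = r (\<Delta>' b)"
    by (rule CA_eqI[OF T3 alg_hom_comp[OF D' al] alg_hom_comp[OF D' r(1)] _ b])
      (simp only: L R conv_assoc[OF T3 w])
  then show ?thesis unfolding l_def r_def .
qed

theorem CA_hopf: "hopf_algebra R CA str \<Delta>' \<epsilon>' S'"
  unfolding hopf_algebra_def Let_def
  using CA_alg D' e' S' CA_counit CA_antipode CA_coassoc by blast

end

end

section \<open>Comparison with the Laurent polynomial ring\<close>

lemma laurent_ma_lift:
  assumes A: "cring A" and L: "cring L" and f: "f \<in> ring_hom A L" and c: "\<And>n. \<chi> n \<in> carrier L"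
    and m: "\<And>m n. \<chi> (m + n) = \<chi> m \<otimes>\<^bsub>L\<^esub> \<chi> n" and o: "\<chi> 0 = \<one>\<^bsub>L\<^esub>"
  shows "ma_lift A L f \<chi> \<in> ring_hom (laurent A) L"
    and "a \<in> carrier A \<Longrightarrow> ma_lift A L f \<chi> (single A a (n::int)) = f a \<otimes>\<^bsub>L\<^esub> \<chi> n"
proof -
  interpret mon_alg A integer_group using A by (rule mon_alg_laurent)
  show "ma_lift A L f \<chi> \<in> ring_hom (laurent A) L"
    unfolding laurent_def by (rule lift_hom[OF L f]) (simp_all add: c m o)
  show "ma_lift A L f \<chi> (single A a n) = f a \<otimes>\<^bsub>L\<^esub> \<chi> n" if "a \<in> carrier A"
    by (rule lift_single[OF L f]) (simp_all add: c m o that)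
qed

lemma laurent_map_single:
  assumes "f \<zero>\<^bsub>A\<^esub> = \<zero>\<^bsub>B\<^esub>" shows "laurent_map f (single A a n) = single B (f a) n"
  using assms by (auto simp: laurent_map_def single_def fun_eq_iff)

text \<open>Coefficientwise application coincides with the lift that fixes \<surd>t, which is
  multiplicative by the universal property.\<close>

lemma laurent_map_hom:
  assumes A: "cring A" and B: "cring B" and f: "f \<in> ring_hom A B"
  shows "laurent_map f \<in> ring_hom (laurent A) (laurent B)"
proof -
  interpret A: cring A by fact
  interpret B: cring B by fact
  interpret LB: cring "laurent B" using B by (rule laurent_cring)
  interpret MA: mon_alg A integer_group using A by (rule mon_alg_laurent)
  interpret MB: mon_alg B integer_group using B by (rule mon_alg_laurent)
  note sc = laurent_single_closed[OF B] and sm = laurent_single_mult[OF B]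
  have f0: "f \<zero>\<^bsub>A\<^esub> = \<zero>\<^bsub>B\<^esub>" by (rule ring_hom_zero[OF f A.ring_axioms B.ring_axioms])
  let ?L = "ma_lift A (laurent B) (\<lambda>a. single B (f a) 0) (single B \<one>\<^bsub>B\<^esub>)"
  have c: "single B \<one>\<^bsub>B\<^esub> n \<in> carrier (laurent B)"
    and m: "single B \<one>\<^bsub>B\<^esub> (m + n) = single B \<one>\<^bsub>B\<^esub> m \<otimes>\<^bsub>laurent B\<^esub> single B \<one>\<^bsub>B\<^esub> n"
    and o: "single B \<one>\<^bsub>B\<^esub> 0 = \<one>\<^bsub>laurent B\<^esub>" for m n :: int
    using sc sm by (simp_all add: laurent_one[OF B])
  note L = laurent_ma_lift[OF A LB.is_cring ring_hom_comp[OF f laurent_const_hom[OF B]], of "single B \<one>\<^bsub>B\<^esub>", OF c m o]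
  have eq: "laurent_map f x = ?L x" if "x \<in> carrier (laurent A)" for x
    using that unfolding laurent_def[of A]
  proof (induction x rule: MA.P_induct)
    case (single a n)
    then show ?case using ring_hom_closed[OF f] by (simp add: L(2) laurent_map_single[of f A B, OF f0] sm)
  next
    case (add p q)
    have pq: "p \<in> carrier (laurent A)" "q \<in> carrier (laurent A)" using add(1,2) by (simp_all add: laurent_def)
    have "laurent_map f (p \<oplus>\<^bsub>MA.P\<^esub> q) = (\<lambda>n. f (p n) \<oplus>\<^bsub>B\<^esub> f (q n))"
      using MA.coeff_closed[OF add(1)] MA.coeff_closed[OF add(2)]
      by (simp add: laurent_map_def MA.add_P ring_hom_add[OF f])
    also have "\<dots> = laurent_map f p \<oplus>\<^bsub>laurent B\<^esub> laurent_map f q"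
      unfolding laurent_map_def by (simp add: laurent_def MB.add_P)
    also have "\<dots> = ?L (p \<oplus>\<^bsub>laurent A\<^esub> q)"
      using ring_hom_add[OF L(1) pq] add by simp
    finally show ?case by (simp add: laurent_def[of A])
  qed
  show ?thesis
    by (rule ring_hom_cong[OF L(1)]) (simp_all add: eq laurent_cring A cring.axioms(1))
qed

context inv_alg
begin

abbreviation "LK \<equiv> laurent k"
abbreviation "l\<phi> \<equiv> laurent_map \<phi>"
abbreviation "lstr \<equiv> laurent_str k k id"
abbreviation "can \<equiv> contraction_tensor_can k A \<phi>"

lemma LK_cring: "cring LK" by (rule laurent_cring[OF k.is_cring])

lemmas lstr = laurent_str_hom[OF k.is_cring k.is_cring id_ring_hom, simplified]

lemma phi_zero: "\<phi> \<zero>\<^bsub>k\<^esub> = \<zero>\<^bsub>A\<^esub>" by (rule ring_hom_zero[OF algD(3) k.ring_axioms A.ring_axioms])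

lemma lphi_hom: "l\<phi> \<in> ring_hom LK LA" by (rule laurent_map_hom[OF k.is_cring A.is_cring algD(3)])

lemma lphi_single: "l\<phi> (single k c n) = single A (\<phi> c) n" by (rule laurent_map_single[of \<phi> k A, OF phi_zero])

lemma lphi_one: "l\<phi> (single k \<one>\<^bsub>k\<^esub> n) = single A \<one>\<^bsub>A\<^esub> n" using ring_hom_one[OF algD(3)] by (simp add: lphi_single)

text \<open>The two routes from k[t] into \<open>laurent A\<close> agree, so structures over the
  Laurent ring of k restrict to the given ones over k[t].\<close>

lemma lphi_lstr: "r \<in> carrier R \<Longrightarrow> l\<phi> (lstr r) = str r"
  by (rule UP_hom_eqI[OF k.is_cring LA.is_cring ring_hom_comp[OF lstr(1) lphi_hom] str_LA])
    (simp_all add: lstr(2,3) lphi_single str_cn str_t ring_hom_one[OF algD(3)])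

sublocale TL: tensor_alg LK LA l\<phi> LA l\<phi>
  by (intro tensor_alg.intro ring_hom_cringI LK_cring LA.is_cring lphi_hom)

sublocale TLr: cring TL.T by (rule TL.T_cring)

lemma laurent_tensor_simps: "laurent_tensor k A \<phi> = TL.T" "laurent_tensor_str k A \<phi> = TL.\<tau>" "laurent_pure_tensor k A \<phi> = TL.pt"
  by (simp_all add: laurent_tensor_def laurent_tensor_str_def laurent_pure_tensor_def)

definition "ltstr r = TL.\<tau> (lstr r)"

lemma ltstr_alg: "ring_hom_cring R TL.T ltstr"
  unfolding ltstr_def by (rule ring_hom_cringI[OF R_cring TL.T_cring ring_hom_comp[OF lstr(1) TL.str_hom]])

lemma can_eq: "can = tensor_lift R TL.T ltstr TL.j1 TL.j2"
  by (simp add: contraction_tensor_can_def laurent_tensor_simps ltstr_def[abs_def])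

lemma lstr_closed: "r \<in> carrier R \<Longrightarrow> lstr r \<in> carrier LK" by (rule ring_hom_closed[OF lstr(1)])

lemma TL_j_alg: "TL.j1 \<in> alg_hom R CA str TL.T ltstr" "TL.j2 \<in> alg_hom R CA str TL.T ltstr"
  by (rule alg_homI[OF ring_hom_comp[OF id_CA_LA TL.j1_hom]], use lstr_closed in \<open>simp add: ltstr_def lphi_lstr[symmetric] TL.j1_str\<close>,
      rule alg_homI[OF ring_hom_comp[OF id_CA_LA TL.j2_hom]], use lstr_closed in \<open>simp add: ltstr_def lphi_lstr[symmetric] TL.j2_str\<close>)

lemmas can_lift = TL.T_cring ring_hom_cringD(3)[OF ltstr_alg] TL_j_alg

lemma can_alg: "can \<in> alg_hom R TC.T TC.\<tau> TL.T ltstr"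
  and can_j1: "x \<in> carrier CA \<Longrightarrow> can (TC.j1 x) = TL.j1 x" and can_j2: "x \<in> carrier CA \<Longrightarrow> can (TC.j2 x) = TL.j2 x"
  unfolding can_eq
  by (rule TC.tensor_lift_alg[OF can_lift], rule TC.tensor_lift_j1[OF can_lift], assumption,
      rule TC.tensor_lift_j2[OF can_lift], assumption)

text \<open>In the ambient Laurent ring t is a unit, with inverse at exponent -2.\<close>

lemma CA_t_nonzerodivisor:
  assumes b: "b \<in> carrier CA" and z: "str t \<otimes>\<^bsub>CA\<^esub> b = \<zero>\<^bsub>CA\<^esub>"
  shows "b = \<zero>\<^bsub>CA\<^esub>"
proof -
  note s = laurent_single_closed[OF A.is_cring A.one_closed]
  have "b = (single A \<one>\<^bsub>A\<^esub> (-2) \<otimes>\<^bsub>LA\<^esub> single A \<one>\<^bsub>A\<^esub> 2) \<otimes>\<^bsub>LA\<^esub> b"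
    using CA_LA[OF b] by (simp add: laurent_single_mult[OF A.is_cring] laurent_one[OF A.is_cring, symmetric])
  also have "\<dots> = single A \<one>\<^bsub>A\<^esub> (-2) \<otimes>\<^bsub>LA\<^esub> (single A \<one>\<^bsub>A\<^esub> 2 \<otimes>\<^bsub>LA\<^esub> b)"
    using CA_LA[OF b] s by (intro LA.m_assoc)
  also have "single A \<one>\<^bsub>A\<^esub> 2 \<otimes>\<^bsub>LA\<^esub> b = \<zero>\<^bsub>LA\<^esub>" using z by (simp add: CA_simps str_t)
  finally show ?thesis using s by (simp add: CA_simps)
qed

end

context smooth_inv
begin

text \<open>The contraction is smooth over k[t] and t is a nonzerodivisor on it, so by
  \<open>nonzerodivisor_tensor\<close> t is one on the tensor square. The latter therefore embeds
  into a ring \<open>L\<close> with an invertible square root of t. There the points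
  \<open>wj1\<close> and \<open>wj2\<close> extend to \<open>laurent A\<close>, and the extensions
  \<open>M1\<close> and \<open>M2\<close> combine to a homomorphism \<open>N\<close> with N can =
  \<iota>.\<close>

theorem contraction_tensor_can_inj: "inj_on can (carrier TC.T)"
proof -
  interpret C2: cring TC.T by (rule TC.T_cring)
  obtain n' F' \<pi>' \<sigma>' where "smooth_presentation R CA str n' F' \<pi>' \<sigma>'"
    using smoothE[OF CA_smooth] by metis
  then interpret SC: smooth_presentation R CA str n' F' \<pi>' \<sigma>' .
  have tC: "TC.\<tau> t \<in> carrier TC.T" by (rule ring_hom_closed[OF TC.str_hom t_closed])
  have nzd: "b = \<zero>\<^bsub>TC.T\<^esub>" if "b \<in> carrier TC.T" "TC.\<tau> t \<otimes>\<^bsub>TC.T\<^esub> b = \<zero>\<^bsub>TC.T\<^esub>" for b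
    by (rule SC.nonzerodivisor_tensor[OF CA_alg ring_hom_closed[OF str_CA t_closed] CA_t_nonzerodivisor that(1)])
      (simp_all add: TC.j2_str that(2))
  obtain L :: "(int \<Rightarrow> ((int \<Rightarrow> 'a) \<times> (int \<Rightarrow> 'a) \<Rightarrow> nat \<Rightarrow> 'k) set) set ring" and \<iota> s where L: "cring L"
    and i: "\<iota> \<in> ring_hom TC.T L" and i_inj: "\<And>c. c \<in> carrier TC.T \<Longrightarrow> \<iota> c = \<zero>\<^bsub>L\<^esub> \<Longrightarrow> c = \<zero>\<^bsub>TC.T\<^esub>"
    and s: "s \<in> Units L" "s \<otimes>\<^bsub>L\<^esub> s = \<iota> (TC.\<tau> t)"
    by (rule invert_square_root[OF TC.T_cring tC nzd]) blast+
  interpret L: cring L by (rule L)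
  have w1: "wj1 \<in> ehom TC.T TC.\<tau>" by (rule ehom_comp[OF CA_alg TC.T_alg dC_ehom TC.j1_alg])
  have w2: "wj2 \<in> ehom TC.T TC.\<tau>" by (rule ehom_comp[OF CA_alg TC.T_alg dC_ehom TC.j2_alg])
  obtain M1 where M1: "M1 \<in> ring_hom LA L" "\<And>a. a \<in> carrier A \<Longrightarrow> M1 (fst (dC a)) = \<iota> (fst (wj1 a))"
    "\<And>a. a \<in> carrier A \<Longrightarrow> M1 (snd (dC a)) = \<iota> (snd (wj1 a))" "\<And>r. r \<in> carrier R \<Longrightarrow> M1 (str r) = \<iota> (TC.\<tau> r)"
    "\<And>a n. a \<in> carrier A \<Longrightarrow> M1 (single A a n) = (\<iota> (fst (wj1 a)) \<oplus>\<^bsub>L\<^esub> s \<otimes>\<^bsub>L\<^esub> \<iota> (snd (wj1 a))) \<otimes>\<^bsub>L\<^esub> unit_pow L s n"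
    by (rule laurent_ehom_lift[OF TC.T_alg w1 L i s]) blast
  obtain M2 where M2: "M2 \<in> ring_hom LA L" "\<And>a. a \<in> carrier A \<Longrightarrow> M2 (fst (dC a)) = \<iota> (fst (wj2 a))"
    "\<And>a. a \<in> carrier A \<Longrightarrow> M2 (snd (dC a)) = \<iota> (snd (wj2 a))" "\<And>r. r \<in> carrier R \<Longrightarrow> M2 (str r) = \<iota> (TC.\<tau> r)"
    "\<And>a n. a \<in> carrier A \<Longrightarrow> M2 (single A a n) = (\<iota> (fst (wj2 a)) \<oplus>\<^bsub>L\<^esub> s \<otimes>\<^bsub>L\<^esub> \<iota> (snd (wj2 a))) \<otimes>\<^bsub>L\<^esub> unit_pow L s n"
    by (rule laurent_ehom_lift[OF TC.T_alg w2 L i s]) blast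
  have M_phi: "M1 (single A (\<phi> c) n) = M2 (single A (\<phi> c) n)" if "c \<in> carrier k" for c n
    using M1(5)[of "\<phi> c" n] M2(5)[of "\<phi> c" n] ehom_phi[OF w1 that] ehom_phi[OF w2 that] that by simp
  \<comment> \<open>The Laurent tensor product is taken over the Laurent ring of k, so the two
    extensions have to agree on its elements; they do, as both use the same root
    \<open>s\<close>.\<close>
  have M12: "M2 (l\<phi> y) = M1 (l\<phi> y)" if "y \<in> carrier LK" for y
    by (rule laurent_hom_eqI[OF k.is_cring L.ring_axioms ring_hom_comp[OF lphi_hom M2(1)] ring_hom_comp[OF lphi_hom M1(1)] _ _ that])
      (simp_all add: lphi_single M_phi)
  let ?\<chi> = "\<lambda>y. M1 (l\<phi> y)"
  have Ma: "M1 \<in> alg_hom LK LA l\<phi> L ?\<chi>" "M2 \<in> alg_hom LK LA l\<phi> L ?\<chi>"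
    using M1(1) M2(1) M12 by (simp_all add: alg_hom_def)
  note lm = L ring_hom_comp[OF lphi_hom M1(1)] Ma
  define N where "N = tensor_lift LK L (\<lambda>y. M1 (l\<phi> y)) M1 M2"
  have N: "N \<in> ring_hom TL.T L" unfolding N_def by (rule TL.tensor_lift_hom[OF lm])
  have N1: "N (TL.j1 x) = M1 x" if "x \<in> carrier LA" for x unfolding N_def using that by (rule TL.tensor_lift_j1[OF lm])
  have N2: "N (TL.j2 x) = M2 x" if "x \<in> carrier LA" for x unfolding N_def using that by (rule TL.tensor_lift_j2[OF lm])
  have e1: "M1 x = \<iota> (TC.j1 x)" if "x \<in> carrier CA" for x
    by (rule egen_eqI[OF CA_egen CA_alg dC_ehom L.ring_axioms ring_hom_comp[OF id_CA_LA M1(1)] ring_hom_comp[OF TC.j1_hom i] _ _ _ that])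
      (simp_all add: M1(2-4) TC.j1_str)
  have e2: "M2 x = \<iota> (TC.j2 x)" if "x \<in> carrier CA" for x
    by (rule egen_eqI[OF CA_egen CA_alg dC_ehom L.ring_axioms ring_hom_comp[OF id_CA_LA M2(1)] ring_hom_comp[OF TC.j2_hom i] _ _ _ that])
      (simp_all add: M2(2-4) TC.j2_str)
  have retr: "N (can z) = \<iota> z" if "z \<in> carrier TC.T" for z
    by (rule TC.T_hom_eqI[OF ring_hom_comp[OF alg_hom_ring_hom[OF can_alg] N] i L.ring_axioms _ _ that])
      (simp_all add: can_j1 can_j2 N1 N2 CA_LA e1 e2)
  show ?thesis
  proof (rule inj_onI)
    fix x y assume xy: "x \<in> carrier TC.T" "y \<in> carrier TC.T" "can x = can y"
    then have "\<iota> x = \<iota> y" using retr by metis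
    then have "\<iota> (x \<ominus>\<^bsub>TC.T\<^esub> y) = \<zero>\<^bsub>L\<^esub>"
      using ring_hom_eq_iff_minus[OF i C2.ring_axioms L.ring_axioms xy(1,2)] by blast
    then have "x \<ominus>\<^bsub>TC.T\<^esub> y = \<zero>\<^bsub>TC.T\<^esub>" using i_inj xy(1,2) by simp
    then show "x = y" using xy(1,2) by simp
  qed
qed

end

context hopf_inv
begin

section \<open>Structure maps of the Laurent Hopf algebra\<close>

abbreviation "canA \<equiv> tensor_lift k TL.T (\<lambda>c. TL.\<tau> (single k c 0)) (\<lambda>a. TL.j1 (single A a 0)) (\<lambda>a. TL.j2 (single A a 0))"
abbreviation "sqt j \<equiv> TL.\<tau> (single k \<one>\<^bsub>k\<^esub> (j::int))"
abbreviation "lcom \<equiv> laurent_comult k A \<phi> \<Delta>"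

lemma single_LK: "c \<in> carrier k \<Longrightarrow> single k c (j::int) \<in> carrier LK"
  by (rule laurent_single_closed[OF k.is_cring])

lemma sqt_pow: "sqt j \<in> carrier TL.T" "sqt (m + j) = sqt m \<otimes>\<^bsub>TL.T\<^esub> sqt j" "sqt 0 = \<one>\<^bsub>TL.T\<^esub>"
proof -
  show "sqt j \<in> carrier TL.T" for j by (rule ring_hom_closed[OF TL.str_hom single_LK[OF k.one_closed]])
  have "single k \<one>\<^bsub>k\<^esub> (m + j) = single k \<one>\<^bsub>k\<^esub> m \<otimes>\<^bsub>LK\<^esub> single k \<one>\<^bsub>k\<^esub> j"
    by (simp add: laurent_single_mult[OF k.is_cring])
  then show "sqt (m + j) = sqt m \<otimes>\<^bsub>TL.T\<^esub> sqt j"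
    using ring_hom_mult[OF TL.str_hom single_LK[OF k.one_closed] single_LK[OF k.one_closed], of m j] by simp
  show "sqt 0 = \<one>\<^bsub>TL.T\<^esub>" using ring_hom_one[OF TL.str_hom] by (simp add: laurent_one[OF k.is_cring])
qed

lemma sqt_j: "sqt j = TL.j1 (single A \<one>\<^bsub>A\<^esub> j)" "sqt j = TL.j2 (single A \<one>\<^bsub>A\<^esub> j)"
  using TL.j1_str[OF single_LK[OF k.one_closed], of j] TL.j2_str[OF single_LK[OF k.one_closed], of j] by (simp_all add: lphi_one)

lemma canA_lift:
  "(\<lambda>c. TL.\<tau> (single k c 0)) \<in> ring_hom k TL.T"
  "(\<lambda>a. TL.j1 (single A a 0)) \<in> alg_hom k A \<phi> TL.T (\<lambda>c. TL.\<tau> (single k c 0))"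
  "(\<lambda>a. TL.j2 (single A a 0)) \<in> alg_hom k A \<phi> TL.T (\<lambda>c. TL.\<tau> (single k c 0))"
proof -
  show "(\<lambda>c. TL.\<tau> (single k c 0)) \<in> ring_hom k TL.T"
    by (rule ring_hom_comp[OF laurent_const_hom[OF k.is_cring] TL.str_hom])
  have "TL.j1 (single A (\<phi> c) 0) = TL.\<tau> (single k c 0)" "TL.j2 (single A (\<phi> c) 0) = TL.\<tau> (single k c 0)" if "c \<in> carrier k" for c
    using TL.j1_str[OF single_LK[OF that], of 0] TL.j2_str[OF single_LK[OF that], of 0] by (simp_all add: lphi_single)
  then show "(\<lambda>a. TL.j1 (single A a 0)) \<in> alg_hom k A \<phi> TL.T (\<lambda>c. TL.\<tau> (single k c 0))"
    "(\<lambda>a. TL.j2 (single A a 0)) \<in> alg_hom k A \<phi> TL.T (\<lambda>c. TL.\<tau> (single k c 0))"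
    by (auto intro!: alg_homI ring_hom_comp[OF laurent_const_hom[OF A.is_cring] TL.j1_hom]
        ring_hom_comp[OF laurent_const_hom[OF A.is_cring] TL.j2_hom])
qed

lemmas canA = TA.tensor_lift_alg[OF TL.T_cring canA_lift] TA.tensor_lift_j1[OF TL.T_cring canA_lift]
  TA.tensor_lift_j2[OF TL.T_cring canA_lift]

lemma canA_Delta: "(\<lambda>a. canA (\<Delta> a)) \<in> alg_hom k A \<phi> TL.T (\<lambda>c. TL.\<tau> (single k c 0))"
  by (rule alg_hom_comp[OF Delta_alg canA(1)])

lemma lcom_hom: "lcom \<in> ring_hom LA TL.T"
  and lcom_single: "a \<in> carrier A \<Longrightarrow> lcom (single A a j) = canA (\<Delta> a) \<otimes>\<^bsub>TL.T\<^esub> sqt j"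
proof -
  interpret MA: mon_alg A integer_group by (rule mon_alg_laurent[OF A.is_cring])
  note L = laurent_ma_lift[OF A.is_cring TL.T_cring alg_hom_ring_hom[OF canA_Delta], of sqt, OF sqt_pow]
  \<comment> \<open>\<open>laurent_comult\<close> is \<open>ma_lift\<close> for \<open>canA\<close>
    after \<open>\<Delta>\<close>, with the factors exchanged, so its multiplicativity comes from
    the universal property of the Laurent ring.\<close>
  have eq: "lcom x = ma_lift A TL.T (\<lambda>a. canA (\<Delta> a)) sqt x" if "x \<in> carrier LA" for x
  proof -
    have "x j \<in> carrier A" for j using MA.coeff_closed that unfolding laurent_def by blast
    then have c: "canA (\<Delta> (x j)) \<in> carrier TL.T" for j by (intro alg_hom_closed[OF canA_Delta])
    show ?thesis
      unfolding laurent_comult_def laurent_tensor_simps Let_def ma_lift_def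
      by (rule TLr.finsum_cong') (use c sqt_pow(1) in \<open>auto simp: TLr.m_comm\<close>)
  qed
  show "lcom \<in> ring_hom LA TL.T" by (rule ring_hom_cong[OF L(1)]) (simp_all add: eq LA.ring_axioms)
  show "lcom (single A a j) = canA (\<Delta> a) \<otimes>\<^bsub>TL.T\<^esub> sqt j" if "a \<in> carrier A"
    using L(2)[OF that] eq[OF laurent_single_closed[OF A.is_cring that]] by simp
qed

lemma ltstr_cn: "c \<in> carrier k \<Longrightarrow> ltstr (cn c) = TL.\<tau> (single k c 0)" and ltstr_t: "ltstr t = sqt 2"
  by (simp_all add: ltstr_def lstr(2,3))

lemma lcom_str: "r \<in> carrier R \<Longrightarrow> lcom (str r) = ltstr r"
proof (rule UP_hom_eqI[OF k.is_cring TL.T_cring ring_hom_comp[OF str_LA lcom_hom] ring_hom_cringD(3)[OF ltstr_alg]])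
  fix c assume c: "c \<in> carrier k"
  then show "lcom (str (cn c)) = ltstr (cn c)"
    using alg_hom_str[OF canA_Delta c] ring_hom_closed[OF canA_lift(1) c]
    by (simp add: str_cn lcom_single sqt_pow(3) ltstr_cn)
next
  show "lcom (str t) = ltstr t"
    using ring_hom_one[OF alg_hom_ring_hom[OF canA_Delta]] sqt_pow(1) by (simp add: str_t lcom_single ltstr_t)
qed

abbreviation "u1 \<equiv> \<lambda>a. map_prod TL.j1 TL.j1 (dC a)"
abbreviation "u2 \<equiv> \<lambda>a. map_prod TL.j2 TL.j2 (dC a)"

lemmas u_ehom = incl_ehom[OF ltstr_alg TL_j_alg(1)] incl_ehom[OF ltstr_alg TL_j_alg(2)]

text \<open>Substituting \<surd>t for s turns the points \<open>u1\<close> and \<open>u2\<close>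
  into the two embeddings of A, since ev a + \<surd>t (od a / \<surd>t) = a. Their product therefore
  turns into \<open>canA\<close> after \<open>\<Delta>\<close>.\<close>

lemma conv_u:
  assumes a: "a \<in> carrier A"
  shows "fst (conv TL.T ltstr u1 u2 a) \<oplus>\<^bsub>TL.T\<^esub> sqt 1 \<otimes>\<^bsub>TL.T\<^esub> snd (conv TL.T ltstr u1 u2 a) = canA (\<Delta> a)"
proof -
  let ?E = "\<lambda>x. id (fst x) \<oplus>\<^bsub>TL.T\<^esub> sqt 1 \<otimes>\<^bsub>TL.T\<^esub> id (snd x)"
  have s11: "sqt 1 \<otimes>\<^bsub>TL.T\<^esub> sqt 1 = id (ltstr t)" using sqt_pow(2)[of 1 1] by (simp add: ltstr_t)
  have E: "?E \<in> ring_hom (dbl TL.T (ltstr t)) TL.T"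
    by (rule dbl_eval_hom[OF TL.T_cring ring_hom_closed[OF ring_hom_cringD(3)[OF ltstr_alg] t_closed] TL.T_cring id_ring_hom sqt_pow(1) s11])
  note sc = laurent_single_closed[OF A.is_cring] and sm = laurent_single_mult[OF A.is_cring] and sa = laurent_single_add[OF A.is_cring]
  have *: "single A a 0 = single A (ev a) 0 \<oplus>\<^bsub>LA\<^esub> single A \<one>\<^bsub>A\<^esub> 1 \<otimes>\<^bsub>LA\<^esub> single A (od a) (-1)" if "a \<in> carrier A" for a
    using that by (simp add: sm sa ev_add_od)
  have e1: "?E (u1 a) = TL.j1 (single A a 0)" and e2: "?E (u2 a) = TL.j2 (single A a 0)" if "a \<in> carrier A" for a
    unfolding *[OF that] using that sc
    by (simp_all add: dC_def ring_hom_add[OF TL.j1_hom] ring_hom_mult[OF TL.j1_hom] sqt_j(1)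
        ring_hom_add[OF TL.j2_hom] ring_hom_mult[OF TL.j2_hom] sqt_j(2)[of 1, unfolded sqt_j(1)[of 1]])
  have "?E (ehom_lift TL.T ltstr u1 u2 z) = canA z" if "z \<in> carrier TA.T" for z
    by (rule TA.T_hom_eqI[OF ring_hom_comp[OF ehom_lift_hom[OF ltstr_alg u_ehom] E] alg_hom_ring_hom[OF canA(1)] TLr.ring_axioms _ _ that])
      (simp_all only: ehom_lift_j1[OF ltstr_alg u_ehom] ehom_lift_j2[OF ltstr_alg u_ehom] canA(2,3) e1 e2)
  then show ?thesis using Delta_closed[OF a] by (simp add: conv_def)
qed

text \<open>The identity of \<open>conv_u\<close> mixes the two components. Applied to ev a and to
  od a, where by \<open>ehom_ev_od\<close> only one component is left, it determines both; the
  second is divided by \<surd>t, as in \<open>dC\<close>.\<close>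

lemma conv_u_dC:
  assumes a: "a \<in> carrier A"
  shows "conv TL.T ltstr u1 u2 a = map_prod lcom lcom (dC a)"
proof -
  define w where "w = conv TL.T ltstr u1 u2"
  have w: "w \<in> ehom TL.T ltstr" unfolding w_def by (rule conv_ehom[OF ltstr_alg u_ehom])
  note eo = ehom_ev_od[OF ltstr_alg w a]
  have cl: "fst (w a) \<in> carrier TL.T" "snd (w a) \<in> carrier TL.T" using ehom_closed[OF w a] by auto
  have 1: "canA (\<Delta> (ev a)) = fst (w a)" using conv_u[of "ev a"] eo(1) a cl sqt_pow(1) by (simp add: w_def[symmetric])
  have 2: "canA (\<Delta> (od a)) = sqt 1 \<otimes>\<^bsub>TL.T\<^esub> snd (w a)" using conv_u[of "od a"] eo(2) a cl sqt_pow(1) by (simp add: w_def[symmetric])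
  have "lcom (fst (dC a)) = fst (w a)" using a cl by (simp add: dC_def lcom_single 1 sqt_pow(3))
  moreover have "lcom (snd (dC a)) = snd (w a)"
  proof -
    have "lcom (snd (dC a)) = (sqt 1 \<otimes>\<^bsub>TL.T\<^esub> snd (w a)) \<otimes>\<^bsub>TL.T\<^esub> sqt (-1)"
      using a by (simp add: dC_def lcom_single 2)
    also have "\<dots> = (sqt 1 \<otimes>\<^bsub>TL.T\<^esub> sqt (-1)) \<otimes>\<^bsub>TL.T\<^esub> snd (w a)" using cl sqt_pow(1) by (simp add: TLr.m_ac)
    also have "sqt 1 \<otimes>\<^bsub>TL.T\<^esub> sqt (-1) = \<one>\<^bsub>TL.T\<^esub>" using sqt_pow(2)[of 1 "-1"] sqt_pow(3) by simp
    finally show ?thesis using cl by simp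
  qed
  ultimately have "w a = map_prod lcom lcom (dC a)" by (simp add: map_prod_def split_beta)
  then show ?thesis by (simp only: w_def)
qed

lemma eps_ev_od:
  assumes "a \<in> carrier A" shows "\<epsilon> (ev a) = \<epsilon> a" "\<epsilon> (od a) = \<zero>\<^bsub>k\<^esub>"
proof -
  note e = alg_hom_ring_hom[OF eps_alg]
  have "half \<otimes>\<^bsub>k\<^esub> (\<epsilon> a \<oplus>\<^bsub>k\<^esub> \<epsilon> a) = \<epsilon> a"
    using half_double eps_closed[OF assms] k.l_distr[of half half "\<epsilon> a"] by (simp add: k.r_distr)
  then show "\<epsilon> (ev a) = \<epsilon> a"
    using assms by (simp add: ev_def ring_hom_mult[OF e] ring_hom_add[OF e] eps_theta alg_hom_str[OF eps_alg])
  have "\<epsilon> a \<ominus>\<^bsub>k\<^esub> \<epsilon> a = \<zero>\<^bsub>k\<^esub>" using eps_closed[OF assms] by (simp add: a_minus_def k.r_neg)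
  then show "\<epsilon> (od a) = \<zero>\<^bsub>k\<^esub>"
    using assms by (simp add: od_def ring_hom_mult[OF e] ring_hom_minus[OF e A.ring_axioms k.ring_axioms] eps_theta alg_hom_str[OF eps_alg])
qed

lemma S_ev_od:
  assumes "a \<in> carrier A" shows "S (ev a) = ev (S a)" "S (od a) = od (S a)"
proof -
  note e = alg_hom_ring_hom[OF S_alg]
  show "S (ev a) = ev (S a)" "S (od a) = od (S a)"
    using assms by (simp_all add: ev_def od_def ring_hom_mult[OF e] ring_hom_add[OF e]
        ring_hom_minus[OF e A.ring_axioms A.ring_axioms] S_theta alg_hom_str[OF S_alg])
qed

lemma laurent_coeff: "y \<in> carrier LK \<Longrightarrow> y j \<in> carrier k"
  using mon_alg.coeff_closed[OF mon_alg_laurent[OF k.is_cring]] unfolding laurent_def by blast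

text \<open>Universality supplies the three maps: \<open>\<Delta>'\<close> classifies the product of
  the two tautological points, \<open>\<epsilon>'\<close> the counit point and \<open>S'\<close> the
  inverse of the tautological point. By generation, the comparison with the Laurent structure maps
  takes place on scalars and on the components of \<open>dC\<close>.\<close>

theorem hopf_contraction:
  "\<exists>\<Delta>' \<epsilon>' S'. hopf_algebra R CA str \<Delta>' \<epsilon>' S' \<and>
    (\<forall>x\<in>carrier CA. can (\<Delta>' x) = lcom x \<and> lstr (\<epsilon>' x) = laurent_map \<epsilon> x \<and> S' x = laurent_map S x)"
proof -
  obtain \<Delta>' where D': "\<Delta>' \<in> alg_hom R CA str TC.T TC.\<tau>"
    and D'_dC: "\<And>a. a \<in> carrier A \<Longrightarrow> map_prod \<Delta>' \<Delta>' (dC a) = conv TC.T TC.\<tau> wj1 wj2 a"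
    using CA_represents[OF TC.T_alg conv_ehom[OF TC.T_alg wj_ehom]] by blast
  obtain \<epsilon>' where e': "\<epsilon>' \<in> alg_hom R CA str R id"
    and e'_dC: "\<And>a. a \<in> carrier A \<Longrightarrow> map_prod \<epsilon>' \<epsilon>' (dC a) = (cn (\<epsilon> a), \<zero>\<^bsub>R\<^esub>)"
    using CA_represents[OF R_alg counit_ehom] by blast
  obtain S' where S': "S' \<in> alg_hom R CA str CA str" and S'_dC: "\<And>a. a \<in> carrier A \<Longrightarrow> map_prod S' S' (dC a) = dC (S a)"
    using CA_represents[OF CA_alg antipode_ehom(1)[OF CA_alg dC_ehom]] by blast
  note H = D' D'_dC e' e'_dC S' S'_dC
  have cl: "fst (dC a) \<in> carrier CA" "snd (dC a) \<in> carrier CA" if "a \<in> carrier A" for a using dC_closed[OF that] by auto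
  have LKr: "ring LK" using LK_cring by (rule cring.axioms)
  have 1: "can (\<Delta>' x) = lcom x" if x: "x \<in> carrier CA" for x
  proof (rule CA_eqI[OF H ltstr_alg alg_hom_comp[OF D' can_alg] _ _ x])
    show "lcom \<in> alg_hom R CA str TL.T ltstr"
      using ring_hom_comp[OF id_CA_LA lcom_hom] by (rule alg_homI) (rule lcom_str)
    show "map_prod (\<lambda>x. can (\<Delta>' x)) (\<lambda>x. can (\<Delta>' x)) (dC a) = map_prod lcom lcom (dC a)" if a: "a \<in> carrier A" for a
      unfolding conv_u_dC[OF a, symmetric]
      by (rule comult_dC[OF H ltstr_alg can_alg u_ehom _ _ a]) (simp_all add: map_prod_def split_beta cl can_j1 can_j2)
  qed
  have "lstr (\<epsilon>' x) = laurent_map \<epsilon> x" if x: "x \<in> carrier CA" for x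
  proof (rule egen_eqI[OF CA_egen CA_alg dC_ehom LKr ring_hom_comp[OF alg_hom_ring_hom[OF e'] lstr(1)] _ _ _ _ x])
    note e = alg_hom_ring_hom[OF eps_alg]
    show "laurent_map \<epsilon> \<in> ring_hom CA LK"
      by (rule ring_hom_comp[OF id_CA_LA laurent_map_hom[OF A.is_cring k.is_cring e]])
    note ls = laurent_map_single[of \<epsilon> A k, OF ring_hom_zero[OF e A.ring_axioms k.ring_axioms]]
    show "lstr (\<epsilon>' (str r)) = laurent_map \<epsilon> (str r)" if r: "r \<in> carrier R" for r
      using laurent_coeff[OF lstr_closed[OF r]] alg_hom_str[OF e' r]
      by (simp add: lphi_lstr[OF r, symmetric] laurent_map_def alg_hom_str[OF eps_alg])
    fix a assume a: "a \<in> carrier A"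
    have "\<epsilon>' (fst (dC a)) = cn (\<epsilon> a)" "\<epsilon>' (snd (dC a)) = \<zero>\<^bsub>R\<^esub>"
      using e'_dC[OF a] by (simp_all add: map_prod_def split_beta)
    then show "lstr (\<epsilon>' (fst (dC a))) = laurent_map \<epsilon> (fst (dC a))" "lstr (\<epsilon>' (snd (dC a))) = laurent_map \<epsilon> (snd (dC a))"
      using a eps_closed[OF a] ring_hom_zero[OF lstr(1) R.ring_axioms LKr]
      by (simp_all add: dC_def ls eps_ev_od lstr(2) laurent_zero[OF k.is_cring])
  qed
  moreover have "S' x = laurent_map S x" if x: "x \<in> carrier CA" for x
  proof (rule egen_eqI[OF CA_egen CA_alg dC_ehom LA.ring_axioms ring_hom_comp[OF alg_hom_ring_hom[OF S'] id_CA_LA] _ _ _ _ x])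
    note e = alg_hom_ring_hom[OF S_alg]
    show "laurent_map S \<in> ring_hom CA LA"
      by (rule ring_hom_comp[OF id_CA_LA laurent_map_hom[OF A.is_cring A.is_cring e]])
    note ls = laurent_map_single[of S A A, OF ring_hom_zero[OF e A.ring_axioms A.ring_axioms]]
    show "S' (str r) = laurent_map S (str r)" if r: "r \<in> carrier R" for r
      using laurent_coeff[OF lstr_closed[OF r]] alg_hom_str[OF S' r]
      by (simp add: lphi_lstr[OF r, symmetric] laurent_map_def alg_hom_str[OF S_alg])
    fix a assume a: "a \<in> carrier A"
    have "S' (fst (dC a)) = fst (dC (S a))" "S' (snd (dC a)) = snd (dC (S a))"
      using S'_dC[OF a] by (metis fst_map_prod, metis snd_map_prod)
    then show "S' (fst (dC a)) = laurent_map S (fst (dC a))" "S' (snd (dC a)) = laurent_map S (snd (dC a))"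
      using a by (simp_all add: dC_def ls S_ev_od)
  qed
  ultimately show ?thesis using CA_hopf[OF H] 1 by blast
qed

end

text \<open>The hypothesis tests smoothness of A at a single type of rings, whereas the conclusion
  holds at the arbitrary type \<open>'c\<close>; \<open>lifting\<close> bridges the two. Injectivity
  of \<open>contraction_tensor_can\<close> is part of the claim because it makes the tensor square a
  subalgebra, so that the restricted comultiplication has a unique meaning.\<close>

theorem theorem1p2:
  fixes k :: "'k ring" and A :: "'a ring" and \<phi> :: "'k \<Rightarrow> 'a" and \<theta> :: "'a \<Rightarrow> 'a"
  assumes two: "\<one>\<^bsub>k\<^esub> \<oplus>\<^bsub>k\<^esub> \<one>\<^bsub>k\<^esub> \<in> Units k"
    and smooth: "smooth TYPE((nat multiset \<Rightarrow> 'k) set) k A \<phi>"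
    and involution: "alg_involution k A \<phi> \<theta>"
  shows
    "(let CA = contraction k A \<phi> \<theta>; str = laurent_str k A \<phi>;
          I = Idl\<^bsub>A\<^esub> (anti_part A \<theta>); t = Idl\<^bsub>CA\<^esub> {laurent_t A}
      in
       (\<exists>h. h \<in> alg_iso k
               (CA Quot t) (\<lambda>c. t +>\<^bsub>CA\<^esub> str (up_ring.monom (UP k) c 0))
               (sym_alg (A Quot I) (conormal_module A I))
               (\<lambda>c. sym_str (A Quot I) (conormal_module A I) (I +>\<^bsub>A\<^esub> \<phi> c))) \<and>
       smooth TYPE('c) (UP k) CA str \<and>
       (\<forall>\<Delta> \<epsilon> S. hopf_algebra k A \<phi> \<Delta> \<epsilon> S \<and> hopf_involution k A \<phi> \<Delta> \<epsilon> S \<theta> \<longrightarrow>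
          inj_on (contraction_tensor_can k A \<phi>) (carrier (tensor (UP k) CA str CA str)) \<and>
          (\<exists>\<Delta>' \<epsilon>' S'. hopf_algebra (UP k) CA str \<Delta>' \<epsilon>' S' \<and>
             (\<forall>x \<in> carrier CA.
                contraction_tensor_can k A \<phi> (\<Delta>' x) = laurent_comult k A \<phi> \<Delta> x \<and>
                laurent_str k k id (\<epsilon>' x) = laurent_map \<epsilon> x \<and>
                S' x = laurent_map S x))))"
proof -
  have "ring_hom_cring k A \<phi>" using smooth by (simp add: smooth_def)
  then interpret IA: inv_alg k A \<phi> \<theta> using two involution by (rule inv_alg.intro)
  obtain n F \<pi> \<sigma> where "smooth_presentation k A \<phi> n F \<pi> \<sigma>" using smoothE[OF smooth] by metis
  then interpret SI: smooth_inv k A \<phi> \<theta> n F \<pi> \<sigma> using IA.inv_alg_axioms by (simp add: smooth_inv_def)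
  have "hopf_inv k A \<phi> \<theta> n F \<pi> \<sigma> \<Delta> \<epsilon> S" if "hopf_algebra k A \<phi> \<Delta> \<epsilon> S" "hopf_involution k A \<phi> \<Delta> \<epsilon> S \<theta>" for \<Delta> \<epsilon> S
    using that SI.smooth_inv_axioms by (simp add: hopf_inv_def hopf_inv_axioms_def)
  note hopf = hopf_inv.hopf_contraction[OF this]
  show ?thesis
    unfolding Let_def
  proof (intro conjI allI impI)
    show "\<exists>h. h \<in> alg_iso k (IA.CA Quot SI.tI) (\<lambda>c. SI.tI +>\<^bsub>IA.CA\<^esub> IA.str (IA.cn c))
       (sym_alg (A Quot Idl\<^bsub>A\<^esub> (anti_part A \<theta>)) (conormal_module A (Idl\<^bsub>A\<^esub> (anti_part A \<theta>))))
       (\<lambda>c. sym_str (A Quot Idl\<^bsub>A\<^esub> (anti_part A \<theta>)) (conormal_module A (Idl\<^bsub>A\<^esub> (anti_part A \<theta>))) (Idl\<^bsub>A\<^esub> (anti_part A \<theta>) +>\<^bsub>A\<^esub> \<phi> c))"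
      using SI.special_fibre_iso unfolding IA.I_def .
    show "smooth TYPE('c) IA.R IA.CA IA.str" by (rule SI.CA_smooth)
  next
    fix \<Delta> \<epsilon> S assume "hopf_algebra k A \<phi> \<Delta> \<epsilon> S \<and> hopf_involution k A \<phi> \<Delta> \<epsilon> S \<theta>"
    then show "inj_on IA.can (carrier (tensor IA.R IA.CA IA.str IA.CA IA.str))"
      "\<exists>\<Delta>' \<epsilon>' S'. hopf_algebra IA.R IA.CA IA.str \<Delta>' \<epsilon>' S' \<and>
        (\<forall>x\<in>carrier IA.CA. IA.can (\<Delta>' x) = laurent_comult k A \<phi> \<Delta> x \<and> IA.lstr (\<epsilon>' x) = laurent_map \<epsilon> x \<and> S' x = laurent_map S x)"
      using SI.contraction_tensor_can_inj hopf by blast+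
  qed
qed

end
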